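(* Let $\mathbb M^n$ be a complete noncompact model manifold with pole $o$ and suppose there exists $\hat o\in\mathbb M^n$ with $S(\hat o)>S(o)$, where $S$ is the scalar curvature. Then $\mathbb M^n$ does not support the Pólya–Szegő inequality.
   Context: Model manifold: metric $dr\otimes dr+\psi(r)^2g_{\mathbb S^{n-1}}$ about the pole $o$, $\psi\in C^\infty([0,\infty))$, $\psi>0$ on $(0,\infty)$, $\psi'(0)=1$, $\psi^{(2k)}(0)=0$. Its scalar curvature is $S(r)=-(n-1)\big[2\psi''/\psi+(n-2)((\psi')^2-1)/\psi^2\big]$. $B_r$ = geodesic ball centered at $o$. $\dot H^1$: $v\in L^2_{loc}$, $|\nabla v|\in L^2$, approximable by $\varphi_k\in C^\infty_c$ with $\nabla\varphi_k\to\nabla v$ in $L^2$ and $\varphi_k\to v$ in $L^2_{loc}$. $\mathcal L_0$: measurable $f$ with $V(\{|f|>t\})<\infty$ for $t>0$; Schwarz rearrangement $f^\star(x)=f^*(V(B_{\mathrm d(x,o)}))$, $f^*(s)=\sup\{t\ge0:V(\{|f|>t\})>s\}$. Pólya–Szegő inequality: for all $v\in\dot H^1\cap\mathcal L_0$, $v^\star\in\dot H^1\cap\mathcal L_0$ and $\int|\nabla v^\star|^2\le\int|\nabla v|^2$. *)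

theory Defs
  imports "HOL-Analysis.Analysis"
begin

text \<open>The model manifold with pole o is realised on a Euclidean space 'a (dimension
n = DIM('a)), the pole being 0 and r = norm x the geodesic distance to the pole.
In these coordinates the metric dr^2 + psi(r)^2 g_S equals dr^2 + (psi r / r)^2 times
the tangential part of the Euclidean metric.\<close>

coinductive smoothf :: "('a::euclidean_space \<Rightarrow> real) \<Rightarrow> bool" where
  "(\<forall>x. f differentiable (at x)) \<Longrightarrow>
   (\<forall>b\<in>Basis. smoothf (\<lambda>x. frechet_derivative f (at x) b)) \<Longrightarrow> smoothf f"

definition smooth_real :: "(real \<Rightarrow> real) \<Rightarrow> bool" where
  "smooth_real p \<longleftrightarrow> (\<forall>k x. ((deriv ^^ k) p) differentiable (at x))"

text \<open>Admissible warping function: psi smooth (on [0,oo), extended smoothly to the real line),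
psi > 0 on (0,oo), psi'(0) = 1, all even derivatives vanish at 0.\<close>
definition admissible_warp :: "(real \<Rightarrow> real) \<Rightarrow> bool" where
  "admissible_warp p \<longleftrightarrow> smooth_real p \<and> (\<forall>r>0. p r > 0) \<and> deriv p 0 = 1 \<and>
     (\<forall>k. (deriv ^^ (2*k)) p 0 = 0)"

definition scal :: "nat \<Rightarrow> (real \<Rightarrow> real) \<Rightarrow> real \<Rightarrow> real" where
  "scal n p r = - (real n - 1) * (2 * deriv (deriv p) r / p r
      + (real n - 2) * ((deriv p r)^2 - 1) / (p r)^2)"

definition model_weight :: "(real \<Rightarrow> real) \<Rightarrow> 'a::euclidean_space \<Rightarrow> real" where
  "model_weight p x = (if x = 0 then 1 else (p (norm x) / norm x) ^ (DIM('a) - 1))"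

definition model_vol :: "(real \<Rightarrow> real) \<Rightarrow> 'a::euclidean_space measure" where
  "model_vol p = density lebesgue (\<lambda>x. ennreal (model_weight p x))"

text \<open>Squared Riemannian norm |D|_g^2 at the point x of the differential whose Euclidean
representative (Euclidean gradient) is D.\<close>
definition gnorm2 :: "(real \<Rightarrow> real) \<Rightarrow> 'a::euclidean_space \<Rightarrow> 'a \<Rightarrow> real" where
  "gnorm2 p x D = (if x = 0 then (norm D)^2 else
     (let r = norm x; a = (D \<bullet> x) / r in a^2 + (r / p r)^2 * ((norm D)^2 - a^2)))"

definition egrad :: "('a::euclidean_space \<Rightarrow> real) \<Rightarrow> 'a \<Rightarrow> 'a" where
  "egrad f x = (\<Sum>b\<in>Basis. frechet_derivative f (at x) b *\<^sub>R b)"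

definition test_fun :: "('a::euclidean_space \<Rightarrow> real) \<Rightarrow> bool" where
  "test_fun f \<longleftrightarrow> smoothf f \<and> compact (closure {x. f x \<noteq> 0})"

definition L2loc :: "(real \<Rightarrow> real) \<Rightarrow> ('a::euclidean_space \<Rightarrow> real) \<Rightarrow> bool" where
  "L2loc p v \<longleftrightarrow> v \<in> borel_measurable (model_vol p) \<and>
     (\<forall>K. compact K \<longrightarrow> (\<integral>\<^sup>+ x\<in>K. ennreal ((v x)^2) \<partial>model_vol p) < \<infinity>)"

text \<open>Hdot1 p v G: v belongs to the homogeneous Sobolev space, G being (the Euclidean
representative of) its weak gradient: v in L2_loc, |G| in L2, and there are test functions
phi_k with grad phi_k \<rightarrow> G in L2 and phi_k \<rightarrow> v in L2_loc.
The Dirichlet energy of v is then the integral of gnorm2 p x (G x).\<close>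
definition Hdot1 :: "(real \<Rightarrow> real) \<Rightarrow> ('a::euclidean_space \<Rightarrow> real) \<Rightarrow> ('a \<Rightarrow> 'a) \<Rightarrow> bool" where
  "Hdot1 p v G \<longleftrightarrow> L2loc p v \<and> G \<in> borel_measurable lebesgue \<and>
     (\<integral>\<^sup>+ x. ennreal (gnorm2 p x (G x)) \<partial>model_vol p) < \<infinity> \<and>
     (\<exists>\<phi>::nat \<Rightarrow> 'a \<Rightarrow> real. (\<forall>k. test_fun (\<phi> k)) \<and>
        ((\<lambda>k. \<integral>\<^sup>+ x. ennreal (gnorm2 p x (egrad (\<phi> k) x - G x)) \<partial>model_vol p) \<longlonglongrightarrow> 0) \<and>
        (\<forall>K. compact K \<longrightarrow>
           ((\<lambda>k. \<integral>\<^sup>+ x\<in>K. ennreal ((\<phi> k x - v x)^2) \<partial>model_vol p) \<longlonglongrightarrow> 0)))"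

definition energy :: "(real \<Rightarrow> real) \<Rightarrow> ('a::euclidean_space \<Rightarrow> 'a) \<Rightarrow> ennreal" where
  "energy p G = (\<integral>\<^sup>+ x. ennreal (gnorm2 p x (G x)) \<partial>model_vol p)"

definition L0 :: "(real \<Rightarrow> real) \<Rightarrow> ('a::euclidean_space \<Rightarrow> real) \<Rightarrow> bool" where
  "L0 p f \<longleftrightarrow> f \<in> borel_measurable (model_vol p) \<and>
     (\<forall>t>0. emeasure (model_vol p) {x. \<bar>f x\<bar> > t} < \<infinity>)"

text \<open>Decreasing rearrangement f^*(s) = sup{t >= 0 : V(|f| > t) > s} (sup of empty set = 0).\<close>
definition drearr :: "(real \<Rightarrow> real) \<Rightarrow> ('a::euclidean_space \<Rightarrow> real) \<Rightarrow> real \<Rightarrow> real" where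
  "drearr p f s = real_of_ereal (Sup {ereal t | t. t \<ge> 0 \<and>
       emeasure (model_vol p) {x. \<bar>f x\<bar> > t} > ennreal s})"

definition schwarz :: "(real \<Rightarrow> real) \<Rightarrow> ('a::euclidean_space \<Rightarrow> real) \<Rightarrow> 'a \<Rightarrow> real" where
  "schwarz p f x = drearr p f (measure (model_vol p) (ball (0::'a) (norm x)))"

definition polya_szego :: "(real \<Rightarrow> real) \<Rightarrow> 'a::euclidean_space itself \<Rightarrow> bool" where
  "polya_szego p _ \<longleftrightarrow> (\<forall>(v::'a \<Rightarrow> real) G. Hdot1 p v G \<and> L0 p v \<longrightarrow>
      L0 p (schwarz p v) \<and> (\<exists>G'. Hdot1 p (schwarz p v) G' \<and> energy p G' \<le> energy p G))"

end

theory Submission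
  imports Defs
begin

text \<open>
If the inequality holds, then every smooth \<open>v \<ge> 0\<close> with compact support satisfies
\<open>(\<integral>v)\<^sup>2 \<le> T(R) \<integral>|\<nabla>v|\<^sup>2\<close>, where \<open>B\<^sub>R\<close> is the ball about the pole with the volume of
\<open>{v \<noteq> 0}\<close> and \<open>T(R)\<close> bounds its torsional rigidity: the symmetrized function satisfies this bound by
duality, after integrating by parts against an explicit radial field with divergence at least 1.

This is tested with \<open>v = (D - q)\<^sub>+\<close>, where \<open>q\<close> agrees with half the squared distance from the
point \<open>x0\<close> at radius \<open>r0\<close> up to higher order terms, and \<open>D \<rightarrow> 0\<close>. With
\<open>W = \<integral>v\<close>, \<open>m = V({q < D})\<close> and \<open>E = \<integral>|\<nabla>v|\<^sup>2\<close>, integrating by parts against two fields close to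
\<open>\<nabla>q\<close> gives the first curvature corrections in \<open>E \<le> W(n - \<beta>\<^sub>1 D + \<dots>)\<close> and
\<open>2(Dm - W) \<le> W(n - \<beta>\<^sub>2 D + \<dots>)\<close>. Since \<open>m = W'\<close>, the second one also bounds \<open>W\<close> itself.
The combination \<open>(n + 4)(\<beta>\<^sub>1 + 2\<beta>\<^sub>2)\<close> is \<open>2 S(x0)\<close>, the expansion of \<open>T(R)\<close> and \<open>V(B\<^sub>R)\<close> at the pole
involves \<open>S(o)\<close> in the same way, and comparing the logarithms to first order in \<open>D\<close> yields
\<open>S(x0) \<le> S(o)\<close>.
\<close>

section \<open>Smooth functions on open sets\<close>

text \<open>The inequality provides the symmetrized function only as an element of a completion, so
  nothing pointwise is known about its gradient. A linear functional of it, paired with one fixed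
  field, passes to the limit along the approximating test functions; hence duality. On the other
  side \<open>(D - q)_+\<close> may be crude: the squared integral over the energy, at prescribed
  volume, is stationary at the torsion function of a flat ball. Relative errors of order
  \<open>D\<close> in \<open>q\<close> therefore change it only at order \<open>D^2\<close>, one
  order beyond the curvature term, and an explicit function of the polar coordinates can stand for
  half the squared distance. The price is that \<open>\<kappa>1\<close> and \<open>\<kappa>2\<close>
  depend on this choice and are not multiples of the scalar curvature; only the combination of the
  two is. The two fields contain free parameters, tuned so that the divergence is a function of
  \<open>q\<close> alone up to negligible terms. What remains are moments of \<open>q\<close> over
  its own sublevel sets, and these are again related by integration by parts.\<close>

coinductive smooth_within :: "'a::euclidean_space set \<Rightarrow> ('a \<Rightarrow> real) \<Rightarrow> bool" for S where
  "(\<forall>x\<in>S. f differentiable (at x)) \<Longrightarrow>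
   (\<forall>b\<in>Basis. smooth_within S (\<lambda>x. frechet_derivative f (at x) b)) \<Longrightarrow> smooth_within S f"

lemma smooth_within_differentiable: "smooth_within S f \<Longrightarrow> x \<in> S \<Longrightarrow> f differentiable (at x)"
  by (erule smooth_within.cases) blast

lemma smooth_within_partial:
  "smooth_within S f \<Longrightarrow> b \<in> Basis \<Longrightarrow> smooth_within S (\<lambda>x. frechet_derivative f (at x) b)"
  by (erule smooth_within.cases) blast

lemma smooth_within_has_derivative:
  "smooth_within S f \<Longrightarrow> x \<in> S \<Longrightarrow> (f has_derivative frechet_derivative f (at x)) (at x)"
  using frechet_derivative_works smooth_within_differentiable by blast

lemma smooth_within_continuous_on: "smooth_within S f \<Longrightarrow> continuous_on S f"
  by (meson continuous_at_imp_continuous_on differentiable_imp_continuous_within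
      smooth_within_differentiable)

text \<open>Closing a family of generators under algebra operations gives an up-to principle for coinduction:
it is enough that the partial derivatives of the generators lie in this closure.\<close>
inductive gen_alg :: "'a::euclidean_space set \<Rightarrow> (('a \<Rightarrow> real) \<Rightarrow> bool) \<Rightarrow> ('a \<Rightarrow> real) \<Rightarrow> bool"
  for S G where
  gen: "G f \<Longrightarrow> gen_alg S G f"
| const: "gen_alg S G (\<lambda>_. c)"
| add: "gen_alg S G f \<Longrightarrow> gen_alg S G g \<Longrightarrow> gen_alg S G (\<lambda>x. f x + g x)"
| mult: "gen_alg S G f \<Longrightarrow> gen_alg S G g \<Longrightarrow> gen_alg S G (\<lambda>x. f x * g x)"
| cong: "gen_alg S G f \<Longrightarrow> (\<And>x. x \<in> S \<Longrightarrow> g x = f x) \<Longrightarrow> gen_alg S G g"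

lemma has_derivative_cong_open:
  assumes "open S" "x \<in> S" "\<And>x. x \<in> S \<Longrightarrow> g x = f x" "(f has_derivative f') (at x)"
  shows "(g has_derivative f') (at x)"
  using assms has_derivative_transform_within_open[of f f' x UNIV S g] by auto

text \<open>The sum and product rules keep the closure stable under partial derivatives once those
  of the generators stay in it; \<open>cong\<close> is harmless because a derivative on an open set
  depends only on the values there. So the closure is an invariant for the coinduction in
  \<open>gen_alg_smooth_within\<close>.\<close>

lemma gen_alg_partial:
  assumes S: "open S"
    and G: "\<And>g x. G g \<Longrightarrow> x \<in> S \<Longrightarrow> g differentiable (at x)"
    and G': "\<And>g b. G g \<Longrightarrow> b \<in> Basis \<Longrightarrow> gen_alg S G (\<lambda>x. frechet_derivative g (at x) b)"
  shows "gen_alg S G f \<Longrightarrow> (\<forall>x\<in>S. f differentiable (at x)) \<and>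
    (\<forall>b\<in>Basis. gen_alg S G (\<lambda>x. frechet_derivative f (at x) b))"
proof (induction rule: gen_alg.induct)
  case (gen f)
  then show ?case using G G' by blast
next
  case (const c)
  then show ?case by (auto intro: gen_alg.const)
next
  case (add f g)
  have 1: "((\<lambda>x. f x + g x) has_derivative (\<lambda>h. frechet_derivative f (at x) h + frechet_derivative g (at x) h)) (at x)"
    if "x \<in> S" for x
    using add that by (intro has_derivative_add) (auto simp: frechet_derivative_works[symmetric])
  have 2: "gen_alg S G (\<lambda>x. frechet_derivative (\<lambda>x. f x + g x) (at x) b)" if "b \<in> Basis" for b
  proof (rule gen_alg.cong)
    show "gen_alg S G (\<lambda>x. frechet_derivative f (at x) b + frechet_derivative g (at x) b)"
      using add that by (intro gen_alg.add) auto
    show "frechet_derivative (\<lambda>x. f x + g x) (at x) b = frechet_derivative f (at x) b + frechet_derivative g (at x) b"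
      if "x \<in> S" for x
      using frechet_derivative_at[OF 1[OF that]] by metis
  qed
  show ?case using 1 2 by (auto simp: differentiable_def)
next
  case (mult f g)
  have 1: "((\<lambda>x. f x * g x) has_derivative (\<lambda>h. f x * frechet_derivative g (at x) h + frechet_derivative f (at x) h * g x)) (at x)"
    if "x \<in> S" for x
    using mult that by (intro has_derivative_mult) (auto simp: frechet_derivative_works[symmetric])
  have 2: "gen_alg S G (\<lambda>x. frechet_derivative (\<lambda>x. f x * g x) (at x) b)" if "b \<in> Basis" for b
  proof (rule gen_alg.cong)
    show "gen_alg S G (\<lambda>x. f x * frechet_derivative g (at x) b + frechet_derivative f (at x) b * g x)"
      using mult that by (intro gen_alg.add gen_alg.mult) auto
    show "frechet_derivative (\<lambda>x. f x * g x) (at x) b = f x * frechet_derivative g (at x) b + frechet_derivative f (at x) b * g x"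
      if "x \<in> S" for x
      using frechet_derivative_at[OF 1[OF that]] by metis
  qed
  show ?case using 1 2 by (auto simp: differentiable_def)
next
  case (cong f g)
  have 1: "(g has_derivative frechet_derivative f (at x)) (at x)" if "x \<in> S" for x
    by (rule has_derivative_cong_open[OF S that cong(2)])
      (use cong that in \<open>auto simp: frechet_derivative_works[symmetric]\<close>)
  have 2: "gen_alg S G (\<lambda>x. frechet_derivative g (at x) b)" if "b \<in> Basis" for b
  proof (rule gen_alg.cong)
    show "gen_alg S G (\<lambda>x. frechet_derivative f (at x) b)" using cong that by auto
    show "frechet_derivative g (at x) b = frechet_derivative f (at x) b" if "x \<in> S" for x
      using frechet_derivative_at[OF 1[OF that]] by metis
  qed
  show ?case using 1 2 by (auto simp: differentiable_def)
qed

lemma gen_alg_smooth_within: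
  assumes "open S"
    and "\<And>g x. G g \<Longrightarrow> x \<in> S \<Longrightarrow> g differentiable (at x)"
    and "\<And>g b. G g \<Longrightarrow> b \<in> Basis \<Longrightarrow> gen_alg S G (\<lambda>x. frechet_derivative g (at x) b)"
    and "gen_alg S G f"
  shows "smooth_within S f"
  using assms(4)
proof (coinduction arbitrary: f)
  case smooth_within
  then show ?case using gen_alg_partial[OF assms(1-3)] by blast
qed

context
  fixes S :: "'a::euclidean_space set"
  assumes S: "open S"
begin

lemma smooth_within_of_alg: "gen_alg S (smooth_within S) f \<Longrightarrow> smooth_within S f"
  by (rule gen_alg_smooth_within[OF S])
    (auto intro: smooth_within_differentiable gen_alg.gen smooth_within_partial)

lemma smooth_within_const: "smooth_within S (\<lambda>_. c)"
  by (rule smooth_within_of_alg, rule gen_alg.const)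

lemma smooth_within_add:
  "smooth_within S f \<Longrightarrow> smooth_within S g \<Longrightarrow> smooth_within S (\<lambda>x. f x + g x)"
  by (rule smooth_within_of_alg, rule gen_alg.add; rule gen_alg.gen)

lemma smooth_within_mult:
  "smooth_within S f \<Longrightarrow> smooth_within S g \<Longrightarrow> smooth_within S (\<lambda>x. f x * g x)"
  by (rule smooth_within_of_alg, rule gen_alg.mult; rule gen_alg.gen)

lemma smooth_within_cong:
  "smooth_within S f \<Longrightarrow> (\<And>x. x \<in> S \<Longrightarrow> g x = f x) \<Longrightarrow> smooth_within S g"
  by (rule smooth_within_of_alg, rule gen_alg.cong[OF gen_alg.gen])

lemma smooth_within_minus: "smooth_within S f \<Longrightarrow> smooth_within S (\<lambda>x. - f x)"
  using smooth_within_mult[OF smooth_within_const[of "-1"]] by simp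

lemma smooth_within_diff:
  "smooth_within S f \<Longrightarrow> smooth_within S g \<Longrightarrow> smooth_within S (\<lambda>x. f x - g x)"
  using smooth_within_add[OF _ smooth_within_minus] by simp

lemma smooth_within_power: "smooth_within S f \<Longrightarrow> smooth_within S (\<lambda>x. f x ^ k)"
  by (induction k) (simp_all add: smooth_within_const smooth_within_mult)

lemma smooth_within_inner: "smooth_within S (\<lambda>x. x \<bullet> e)"
proof (rule gen_alg_smooth_within[OF S, where G = "\<lambda>f. f = (\<lambda>x. x \<bullet> e)"])
  fix g :: "'a \<Rightarrow> real" and b :: 'a and x :: 'a
  assume g: "g = (\<lambda>x. x \<bullet> e)"
  have d: "(g has_derivative (\<lambda>h. h \<bullet> e)) (at x)" for x
    unfolding g by (auto intro!: derivative_eq_intros)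
  show "g differentiable at x" using d differentiable_def by blast
  show "gen_alg S (\<lambda>f. f = (\<lambda>x. x \<bullet> e)) (\<lambda>x. frechet_derivative g (at x) b)"
    by (simp add: frechet_derivative_at[OF d, symmetric] gen_alg.const)
qed (rule gen_alg.gen, simp)

text \<open>The generators are the smooth functions on \<open>S\<close> together with all
  compositions with \<open>h\<close>: the chain rule writes a partial derivative of a composition as
  a product of one generator of each kind.\<close>

lemma smooth_within_compose:
  assumes T: "open T" and g: "smooth_within T g" and h: "smooth_within S h" and hT: "h ` S \<subseteq> T"
  shows "smooth_within S (\<lambda>x. g (h x :: real))"
proof (rule gen_alg_smooth_within[OF S,
      where G = "\<lambda>f. smooth_within S f \<or> (\<exists>g. smooth_within T g \<and> f = (\<lambda>x. g (h x)))"])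
  let ?G = "\<lambda>f. smooth_within S f \<or> (\<exists>g. smooth_within T g \<and> f = (\<lambda>x. g (h x)))"
  have chain: "((\<lambda>x. g (h x)) has_derivative (\<lambda>k. frechet_derivative g (at (h x)) (frechet_derivative h (at x) k))) (at x)"
    if "smooth_within T g" "x \<in> S" for g x
    using has_derivative_compose[OF smooth_within_has_derivative[OF h that(2)]
      smooth_within_has_derivative[OF that(1)]] that hT by blast
  show "f differentiable at x" if "?G f" "x \<in> S" for f x
    using that smooth_within_differentiable chain differentiable_def by blast
  show "gen_alg S ?G (\<lambda>x. frechet_derivative f (at x) b)" if Gb: "?G f" "b \<in> Basis" for f b
  proof (cases "smooth_within S f")
    case True
    then show ?thesis using Gb by (auto intro!: gen_alg.gen smooth_within_partial)
  next
    case False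
    then obtain g where g: "smooth_within T g" "f = (\<lambda>x. g (h x))" using Gb by blast
    show ?thesis
    proof (rule gen_alg.cong)
      show "gen_alg S ?G (\<lambda>x. frechet_derivative g (at (h x)) 1 * frechet_derivative h (at x) b)"
      proof (rule gen_alg.mult; rule gen_alg.gen)
        have "smooth_within T (\<lambda>y. frechet_derivative g (at y) 1)"
          by (intro smooth_within_partial g) auto
        then show "?G (\<lambda>x. frechet_derivative g (at (h x)) 1)"
          by (intro disjI2 exI[of _ "\<lambda>y. frechet_derivative g (at y) 1"]) auto
        show "?G (\<lambda>x. frechet_derivative h (at x) b)"
          using h Gb by (auto intro: smooth_within_partial)
      qed
      show "frechet_derivative f (at x) b = frechet_derivative g (at (h x)) 1 * frechet_derivative h (at x) b"
        if x: "x \<in> S" for x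
      proof -
        have "linear (frechet_derivative g (at (h x)))"
          using g x hT smooth_within_has_derivative has_derivative_linear by blast
        then have "frechet_derivative g (at (h x)) (frechet_derivative h (at x) b * 1)
          = frechet_derivative h (at x) b * frechet_derivative g (at (h x)) 1"
          by (metis linear_cmul real_scaleR_def)
        then show ?thesis
          using frechet_derivative_at[OF chain[OF g(1) x]] g(2) by (metis mult.commute mult.right_neutral)
      qed
    qed
  qed
  show "gen_alg S ?G (\<lambda>x. g (h x))" using g by (intro gen_alg.gen) blast
qed

end

text \<open>Smoothness within \<open>N\<close> and vanishing off the closed set \<open>K\<close> are
  both inherited by partial derivatives, so the pair is the coinduction invariant. This leads from
  functions that are smooth only away from the pole to test functions on the whole space.\<close>

lemma smoothf_of_smooth_within:
  assumes "open N" "smooth_within N f" "closed K" "K \<subseteq> N" "\<And>x. x \<notin> K \<Longrightarrow> f x = 0"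
  shows "smoothf f"
  using assms(2,5)
proof (coinduction arbitrary: f)
  case (smoothf f)
  have 0: "(f has_derivative (\<lambda>_. 0)) (at x)" if "x \<notin> K" for x
    by (rule has_derivative_cong_open[where S = "-K" and f = "\<lambda>_. 0"]) (use assms smoothf that in auto)
  have "f differentiable at x" for x
    using 0 smooth_within_differentiable[OF smoothf(1)] assms(4) differentiable_def by blast
  moreover have "frechet_derivative f (at x) b = 0" if "x \<notin> K" for x b
    using frechet_derivative_at[OF 0[OF that]] by metis
  ultimately show ?case using smooth_within_partial[OF smoothf(1)] by blast
qed

lemma smoothf_imp_smooth_within: "smoothf f \<Longrightarrow> smooth_within UNIV f"
proof (coinduction arbitrary: f)
  case (smooth_within f)
  then show ?case by (cases rule: smoothf.cases) blast
qed

lemma frechet_derivative_real: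
  assumes "(f has_real_derivative d) (at x)"
  shows "frechet_derivative f (at x) h = d * h"
  using frechet_derivative_at[of f "(*) d" x] assms by (simp add: has_field_derivative_def)

lemma smooth_real_imp_smooth_within: "smooth_real p \<Longrightarrow> smooth_within UNIV p"
proof -
  assume p: "smooth_real p"
  have "smooth_within UNIV ((deriv ^^ k) p)" for k
  proof (coinduction arbitrary: k)
    case smooth_within
    have d: "((deriv ^^ k) p has_real_derivative (deriv ^^ Suc k) p x) (at x)" for x
      using p by (simp add: smooth_real_def DERIV_deriv_iff_real_differentiable)
    then show ?case using p
      by (auto simp: smooth_real_def frechet_derivative_real[OF d] intro: exI[of _ "Suc k"])
  qed
  from this[of 0] show ?thesis by simp
qed

section \<open>Explicit generators: reciprocals, inverse roots and flat exponentials\<close>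

lemma smooth_within_inverse_real: "smooth_within {0<..} (inverse :: real \<Rightarrow> real)"
proof (rule gen_alg_smooth_within[where G = "\<lambda>f. f = inverse"])
  have d: "(inverse has_real_derivative - (inverse x * inverse x)) (at x)" if "x \<in> {0<..}" for x :: real
    using that by (auto intro!: derivative_eq_intros simp: power2_eq_square)
  fix g :: "real \<Rightarrow> real" assume g: "g = inverse"
  show "g differentiable at x" if "x \<in> {0<..}" for x
    using d[OF that] g real_differentiable_def by blast
  show "gen_alg {0<..} (\<lambda>f. f = inverse) (\<lambda>x. frechet_derivative g (at x) b)" if "b \<in> Basis" for b
  proof (rule gen_alg.cong)
    show "gen_alg {0<..} (\<lambda>f. f = inverse) (\<lambda>x. (-1) * (inverse x * inverse x :: real))"
      by (intro gen_alg.mult gen_alg.const) (auto intro: gen_alg.gen)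
    show "frechet_derivative g (at x) b = (-1) * (inverse x * inverse x)" if "x \<in> {0<..}" for x
      using frechet_derivative_real[OF d[OF that], of b] g \<open>b \<in> Basis\<close> by simp
  qed
qed (simp, rule gen_alg.gen, blast)

text \<open>The inverse root is treated in place of the root because its derivative is
  \<open>- 1/2\<close> times its own cube, so a single generator is closed under
  differentiation.\<close>

lemma smooth_within_inverse_sqrt: "smooth_within {0<..} (\<lambda>y. inverse (sqrt y))"
proof (rule gen_alg_smooth_within[where G = "\<lambda>f. f = (\<lambda>y. inverse (sqrt y))"])
  let ?f = "\<lambda>y. inverse (sqrt y)"
  have d: "(?f has_real_derivative - (1/2) * (?f x * ?f x * ?f x)) (at x)" if "x \<in> {0<..}" for x :: real
    using that by (auto intro!: derivative_eq_intros simp: field_simps power2_eq_square)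
  fix g :: "real \<Rightarrow> real" assume g: "g = ?f"
  show "g differentiable at x" if "x \<in> {0<..}" for x
    using d[OF that] g real_differentiable_def by blast
  show "gen_alg {0<..} (\<lambda>f. f = ?f) (\<lambda>x. frechet_derivative g (at x) b)" if "b \<in> Basis" for b
  proof (rule gen_alg.cong)
    show "gen_alg {0<..} (\<lambda>f. f = ?f) (\<lambda>x. - (1/2) * (?f x * ?f x * ?f x))"
      by (intro gen_alg.mult gen_alg.const) (auto intro: gen_alg.gen)
    show "frechet_derivative g (at x) b = - (1/2) * (?f x * ?f x * ?f x)" if "x \<in> {0<..}" for x
      using frechet_derivative_real[OF d[OF that], of b] g \<open>b \<in> Basis\<close> by simp
  qed
qed (simp, rule gen_alg.gen, blast)

text \<open>For \<open>k = 0\<close> this is the standard flat function. The negative powers in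
  front make the family closed under differentiation.\<close>

definition flat_exp :: "real \<Rightarrow> nat \<Rightarrow> real \<Rightarrow> real" where
  "flat_exp \<delta> k y = (if y > 0 then (1/y)^k * exp (- (\<delta> / y)) else 0)"

lemma flat_exp_tendsto_0:
  assumes "\<delta> > 0"
  shows "(flat_exp \<delta> k \<longlongrightarrow> 0) (at 0)"
proof -
  have "((\<lambda>z. (z / \<delta>)^k / exp z) \<longlongrightarrow> 0) at_top"
    using tendsto_mult[OF tendsto_const[of "(1/\<delta>)^k"] tendsto_power_div_exp_0[of k]]
    by (simp add: power_divide)
  moreover have "filterlim (\<lambda>y. \<delta> / y) at_top (at_right 0)"
    using assms filterlim_tendsto_pos_mult_at_top[OF tendsto_const assms filterlim_inverse_at_top_right]
    by (simp add: divide_inverse)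
  ultimately have "((\<lambda>y. ((\<delta> / y) / \<delta>)^k / exp (\<delta> / y)) \<longlongrightarrow> 0) (at_right 0)"
    using filterlim_compose by blast
  then have "(flat_exp \<delta> k \<longlongrightarrow> 0) (at_right 0)"
    by (rule Lim_transform_eventually)
      (use assms in \<open>auto simp: flat_exp_def eventually_at_filter exp_minus field_simps\<close>)
  moreover have "(flat_exp \<delta> k \<longlongrightarrow> 0) (at_left 0)"
    by (rule Lim_transform_eventually[OF tendsto_const])
      (auto simp: flat_exp_def eventually_at_filter)
  ultimately show ?thesis by (simp add: filterlim_split_at)
qed

lemma flat_exp_has_derivative:
  assumes "\<delta> > 0"
  shows "(flat_exp \<delta> k has_real_derivative (\<delta> * flat_exp \<delta> (k+2) y - k * flat_exp \<delta> (k+1) y)) (at y)"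
proof (cases y "0::real" rule: linorder_cases)
  case less
  have "((\<lambda>_. 0) has_real_derivative (\<delta> * flat_exp \<delta> (k+2) y - k * flat_exp \<delta> (k+1) y)) (at y)"
    using less by (simp add: flat_exp_def)
  then show ?thesis
    by (rule has_field_derivative_transform_within_open[where S="{..<0}"])
      (use less in \<open>auto simp: flat_exp_def\<close>)
next
  case greater
  have "((\<lambda>y. (1/y)^k * exp (- (\<delta> / y))) has_real_derivative (\<delta> * flat_exp \<delta> (k+2) y - k * flat_exp \<delta> (k+1) y)) (at y)"
  proof -
    have 1: "((\<lambda>y. 1 / y) has_real_derivative - ((1/y)^2)) (at y)"
      using greater by (auto intro!: derivative_eq_intros simp: power2_eq_square)
    have 2: "((\<lambda>y. exp (- (\<delta> * (1 / y)))) has_real_derivative exp (- (\<delta> * (1/y))) * (\<delta> * (1/y)^2)) (at y)"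
      by (rule derivative_eq_intros 1 | simp)+
    have 3: "real k * (1/y)^(k - 1) * (1/y)^2 = real k * (1/y)^(k+1)"
      by (cases k) (auto simp: power2_eq_square)
    have "((\<lambda>y. (1/y)^k * exp (- (\<delta> * (1/y)))) has_real_derivative
      (- (real k * (1/y)^(k - 1) * (1/y)^2)) * exp (- (\<delta> * (1/y))) + exp (- (\<delta> * (1/y))) * (\<delta> * (1/y)^2) * (1/y)^k) (at y)"
      by (rule DERIV_mult[OF DERIV_cong[OF DERIV_power[OF 1, of k]] 2]) simp
    then show ?thesis
      unfolding 3 using greater by (simp add: flat_exp_def power_add power2_eq_square mult.commute mult.left_commute)
  qed
  then show ?thesis
    by (rule has_field_derivative_transform_within_open[where S="{0<..}"])
      (use greater in \<open>auto simp: flat_exp_def\<close>)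
next
  case equal
  have "((\<lambda>h. (flat_exp \<delta> k (0 + h) - flat_exp \<delta> k 0) / h) \<longlongrightarrow> 0) (at 0)"
  proof -
    \<comment> \<open>Dividing by \<open>h\<close> raises the index by one, so the difference
      quotient at 0 is again a member of the family.\<close>
    have "(\<lambda>h. (flat_exp \<delta> k (0 + h) - flat_exp \<delta> k 0) / h) = flat_exp \<delta> (Suc k)"
      by (rule ext) (simp add: flat_exp_def)
    then show ?thesis using flat_exp_tendsto_0[OF assms, of "Suc k"] by simp
  qed
  then show ?thesis using equal by (simp add: DERIV_def flat_exp_def)
qed

lemma smooth_within_flat_exp: assumes "\<delta> > 0" shows "smooth_within UNIV (flat_exp \<delta> k)"
proof (rule gen_alg_smooth_within[where G = "\<lambda>f. \<exists>k. f = flat_exp \<delta> k"])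
  fix g assume "\<exists>k. g = flat_exp \<delta> k"
  then obtain k where g: "g = flat_exp \<delta> k" by blast
  note d = flat_exp_has_derivative[OF assms, of k, folded g]
  show "g differentiable at x" for x using d real_differentiable_def by blast
  show "gen_alg UNIV (\<lambda>f. \<exists>k. f = flat_exp \<delta> k) (\<lambda>x. frechet_derivative g (at x) b)" if "b \<in> Basis" for b
  proof (rule gen_alg.cong)
    show "gen_alg UNIV (\<lambda>f. \<exists>k. f = flat_exp \<delta> k)
       (\<lambda>y. \<delta> * flat_exp \<delta> (k+2) y + (- real k) * flat_exp \<delta> (k+1) y)"
      by (intro gen_alg.mult gen_alg.const gen_alg.add) (auto intro: gen_alg.gen)
    show "frechet_derivative g (at x) b = \<delta> * flat_exp \<delta> (k+2) x + (- real k) * flat_exp \<delta> (k+1) x" for x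
      using frechet_derivative_real[OF d, of x b] that by simp
  qed
qed (simp, rule gen_alg.gen, blast)

lemma smooth_within_inner_self:
  fixes S :: "'a::euclidean_space set"
  assumes "open S" shows "smooth_within S (\<lambda>x. x \<bullet> x)"
proof (rule smooth_within_cong[OF assms])
  have "smooth_within S (\<lambda>x. \<Sum>b\<in>B. (x \<bullet> b) * (x \<bullet> b))" if "finite B" for B
    using that
  proof (induction B)
    case (insert b B)
    then show ?case
      using smooth_within_add[OF assms smooth_within_mult[OF assms smooth_within_inner[OF assms, of b]
          smooth_within_inner[OF assms, of b]] insert.IH] by simp
  qed (simp add: smooth_within_const[OF assms])
  then show "smooth_within S (\<lambda>x. \<Sum>b\<in>Basis. (x \<bullet> b) * (x \<bullet> b))" by simp
  show "x \<bullet> x = (\<Sum>b\<in>Basis. (x \<bullet> b) * (x \<bullet> b))" for x :: 'a by (rule euclidean_inner)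
qed

lemma smooth_within_inverse_norm:
  fixes S :: "'a::euclidean_space set"
  assumes "open S" "0 \<notin> S"
  shows "smooth_within S (\<lambda>x. inverse (norm x))" "smooth_within S norm"
proof -
  have q: "smooth_within S (\<lambda>x. x \<bullet> x)" by (rule smooth_within_inner_self[OF assms(1)])
  have "smooth_within S (\<lambda>x. inverse (sqrt (x \<bullet> x)))"
    by (rule smooth_within_compose[OF assms(1) _ smooth_within_inverse_sqrt q])
      (use assms in auto)
  then show 1: "smooth_within S (\<lambda>x. inverse (norm x))" by (simp add: norm_eq_sqrt_inner)
  show "smooth_within S norm"
    by (rule smooth_within_cong[OF assms(1) smooth_within_mult[OF assms(1) q 1]])
      (use assms in \<open>auto simp: power2_norm_eq_inner[symmetric] power2_eq_square field_simps\<close>)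
qed

section \<open>Integration by parts on sublevel sets\<close>

lemma has_derivative_outside_support:
  fixes f :: "'a::euclidean_space \<Rightarrow> real"
  assumes "closed K" "\<And>x. x \<notin> K \<Longrightarrow> f x = 0" "x \<notin> K"
  shows "(f has_derivative (\<lambda>_. 0)) (at x)"
  by (rule has_derivative_cong_open[where S = "-K" and f = "\<lambda>_. 0"]) (use assms in auto)

lemma integrable_compact_support:
  fixes f :: "'a::euclidean_space \<Rightarrow> real"
  assumes "compact K" "continuous_on UNIV f" "\<And>x. x \<notin> K \<Longrightarrow> f x = 0"
  shows "integrable lborel f"
proof -
  have "integrable lborel (\<lambda>x. indicator K x *\<^sub>R f x)"
    by (rule borel_integrable_compact[OF assms(1) continuous_on_subset[OF assms(2)]]) simp
  moreover have "(\<lambda>x. indicator K x *\<^sub>R f x) = f"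
    using assms(3) by (auto simp: fun_eq_iff indicator_def)
  ultimately show ?thesis by simp
qed

text \<open>By translation invariance of Lebesgue measure every difference quotient of
  \<open>f\<close> has integral zero. The mean value theorem bounds the quotients uniformly, and
  dominated convergence carries the value zero over to the derivative.\<close>

lemma integral_directional_derivative:
  fixes f :: "'a::euclidean_space \<Rightarrow> real"
  assumes d: "\<And>x. (f has_derivative f' x) (at x)"
    and c: "continuous_on UNIV (\<lambda>x. f' x b)"
    and K: "compact K" and z: "\<And>x. x \<notin> K \<Longrightarrow> f x = 0"
  shows "integrable lborel (\<lambda>x. f' x b)" "(\<integral>x. f' x b \<partial>lborel) = 0"
proof -
  have z': "f' x b = 0" if "x \<notin> K" for x
    using fun_cong[OF has_derivative_unique[OF d[of x]
        has_derivative_outside_support[OF compact_imp_closed[OF K] z that]], of b] .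
  show int: "integrable lborel (\<lambda>x. f' x b)"
    using integrable_compact_support[OF K c] z' by blast
  have cf: "continuous_on UNIV f"
    using d has_derivative_continuous continuous_at_imp_continuous_on by blast
  have intf: "integrable lborel f"
    using integrable_compact_support[OF K cf] z by blast
  obtain M where M: "\<And>x. x \<in> K \<Longrightarrow> norm x \<le> M"
    using compact_imp_bounded[OF K] bounded_iff by blast
  obtain B where B: "\<And>x. x \<in> K \<Longrightarrow> \<bar>f' x b\<bar> \<le> B"
  proof -
    have "compact ((\<lambda>x. f' x b) ` K)"
      using K c continuous_on_subset compact_continuous_image by blast
    then obtain B where "\<forall>y\<in>(\<lambda>x. f' x b) ` K. norm y \<le> B" using compact_imp_bounded bounded_iff by blast
    then show ?thesis by (intro that[of B]) auto
  qed
  define B' where "B' = max B 0"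
  have B': "\<bar>f' x b\<bar> \<le> B'" for x using B[of x] z'[of x] unfolding B'_def by (cases "x \<in> K") auto
  \<comment> \<open>Steps of length at most 1 keep the supports of all difference quotients in one
    ball of radius \<open>M + norm b\<close>.\<close>
  define t where "t k = inverse (real (Suc k))" for k
  have t: "0 < t k" "t k \<le> 1" for k by (auto simp: t_def field_simps)
  define g where "g k x = (f (x + t k *\<^sub>R b) - f x) / t k" for k x
  have line: "((\<lambda>s. f (x + s *\<^sub>R b)) has_real_derivative f' (x + s *\<^sub>R b) b) (at s)" for x s
  proof -
    have "((\<lambda>s. f (x + s *\<^sub>R b)) has_derivative (\<lambda>h. f' (x + s *\<^sub>R b) (h *\<^sub>R b))) (at s)"
      by (rule has_derivative_compose[OF _ d]) (auto intro!: derivative_eq_intros)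
    moreover have "f' (x + s *\<^sub>R b) (h *\<^sub>R b) = f' (x + s *\<^sub>R b) b * h" for h
      using has_derivative_linear[OF d] by (simp add: linear_cmul)
    ultimately show ?thesis by (simp add: has_field_derivative_def)
  qed
  have lim: "(\<lambda>k. g k x) \<longlonglongrightarrow> f' x b" for x
  proof -
    have "((\<lambda>h. (f (x + h *\<^sub>R b) - f x) / h) \<longlongrightarrow> f' x b) (at 0)"
      using line[of x 0] by (simp add: DERIV_def)
    moreover have "filterlim t (at 0) sequentially"
      unfolding filterlim_at t_def using LIMSEQ_inverse_real_of_nat by (auto simp: eventually_sequentially)
    ultimately show ?thesis unfolding g_def using filterlim_compose by blast
  qed
  have bnd: "\<bar>g k x\<bar> \<le> B' * indicator (cball 0 (M + norm b)) x" for k x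
  proof (cases "norm x \<le> M + norm b")
    case True
    obtain s where "f (x + t k *\<^sub>R b) - f (x + 0 *\<^sub>R b) = (t k - 0) * f' (x + s *\<^sub>R b) b"
      using MVT2[OF t(1)[of k], of "\<lambda>s. f (x + s *\<^sub>R b)" "\<lambda>s. f' (x + s *\<^sub>R b) b"] line by blast
    then have "g k x = f' (x + s *\<^sub>R b) b" using t(1)[of k] by (simp add: g_def)
    then show ?thesis using B' True by simp
  next
    case False
    have "norm x \<le> norm (x + t k *\<^sub>R b) + norm (t k *\<^sub>R b)"
      using norm_triangle_ineq4[of "x + t k *\<^sub>R b" "t k *\<^sub>R b"] by simp
    also have "norm (t k *\<^sub>R b) \<le> norm b" using t[of k] by (simp add: mult_left_le_one_le)
    finally have "norm (x + t k *\<^sub>R b) > M" using False by simp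
    then have "f (x + t k *\<^sub>R b) = 0" using M z by force
    moreover have "f x = 0" using M[of x] z[of x] False by (metis add_increasing2 norm_ge_zero)
    ultimately show ?thesis by (simp add: g_def B'_def)
  qed
  have "(\<integral>x. g k x \<partial>lborel) = 0" for k
  proof -
    have "integrable (distr lborel borel (\<lambda>x. t k *\<^sub>R b + x)) f" using intf by (simp add: lborel_distr_plus)
    then have i: "integrable lborel (\<lambda>x. f (t k *\<^sub>R b + x))"
      by (rule integrable_distr[rotated]) simp
    have "(\<integral>x. f x \<partial>lborel) = (\<integral>x. f x \<partial>distr lborel borel (\<lambda>x. t k *\<^sub>R b + x))"
      by (simp add: lborel_distr_plus)
    also have "\<dots> = (\<integral>x. f (t k *\<^sub>R b + x) \<partial>lborel)"
      using borel_measurable_integrable[OF intf] by (intro integral_distr) auto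
    finally show ?thesis using i intf by (simp add: g_def add.commute)
  qed
  moreover have "(\<lambda>k. \<integral>x. g k x \<partial>lborel) \<longlonglongrightarrow> (\<integral>x. f' x b \<partial>lborel)"
  proof (rule integral_dominated_convergence[where w = "\<lambda>x. B' * indicator (cball 0 (M + norm b)) x"])
    have "f \<in> borel_measurable borel" using cf borel_measurable_continuous_onI by blast
    then show "g k \<in> borel_measurable lborel" for k unfolding g_def by measurable
    show "integrable lborel (\<lambda>x. B' * indicat_real (cball 0 (M + norm b)) x)"
      using emeasure_compact_finite[OF compact_cball, of 0 "M + norm b"]
      by (intro integrable_mult_right integrable_real_indicator) auto
  qed (use int lim bnd in auto)
  ultimately show "(\<integral>x. f' x b \<partial>lborel) = 0" by (simp add: LIMSEQ_const_iff)
qed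

text \<open>The divergence theorem for the field \<open>x\<close> multiplied by \<open>f\<close>:
  \<open>integral_directional_derivative\<close> is applied to \<open>f x * (x \<bullet> b)\<close>
  in direction \<open>b\<close> and summed over the basis.\<close>

lemma integral_euler_derivative:
  fixes f :: "'a::euclidean_space \<Rightarrow> real"
  assumes d: "\<And>x. (f has_derivative f' x) (at x)"
    and c: "\<And>b. b \<in> Basis \<Longrightarrow> continuous_on UNIV (\<lambda>x. f' x b)"
    and K: "compact K" and z: "\<And>x. x \<notin> K \<Longrightarrow> f x = 0"
  shows "integrable lborel (\<lambda>x. DIM('a) * f x + f' x x)" "(\<integral>x. DIM('a) * f x + f' x x \<partial>lborel) = 0"
proof -
  have cf: "continuous_on UNIV f"
    using d has_derivative_continuous continuous_at_imp_continuous_on by blast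
  have D: "((\<lambda>x. f x * (x \<bullet> b)) has_derivative (\<lambda>h. f x * (h \<bullet> b) + f' x h * (x \<bullet> b))) (at x)" for b x
    by (intro has_derivative_mult d) (auto intro!: derivative_eq_intros)
  have I: "integrable lborel (\<lambda>x. f x * (b \<bullet> b) + f' x b * (x \<bullet> b)) \<and> (\<integral>x. f x * (b \<bullet> b) + f' x b * (x \<bullet> b) \<partial>lborel) = 0"
    if "b \<in> Basis" for b
  proof -
    have "continuous_on UNIV (\<lambda>x. f x * (b \<bullet> b) + f' x b * (x \<bullet> b))"
      by (intro continuous_intros cf c that)
    from integral_directional_derivative[OF D[of b] this K] show ?thesis using z by simp
  qed
  have e: "DIM('a) * f x + f' x x = (\<Sum>b\<in>Basis. f x * (b \<bullet> b) + f' x b * (x \<bullet> b))" for x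
  proof -
    have "f' x x = f' x (\<Sum>b\<in>Basis. (x \<bullet> b) *\<^sub>R b)" by (simp add: euclidean_representation)
    also have "\<dots> = (\<Sum>b\<in>Basis. f' x b * (x \<bullet> b))"
      using has_derivative_linear[OF d[of x]] by (simp add: linear_sum linear_cmul mult.commute)
    finally show ?thesis by (simp add: sum.distrib)
  qed
  show "integrable lborel (\<lambda>x. DIM('a) * f x + f' x x)" "(\<integral>x. DIM('a) * f x + f' x x \<partial>lborel) = 0"
    unfolding e using I by (auto simp: Bochner_Integration.integral_sum)
qed

text \<open>A smooth substitute for the positive part of \<open>y ^ j\<close>, recovered as \<open>\<delta> \<rightarrow> 0\<close>.\<close>
definition profile :: "real \<Rightarrow> nat \<Rightarrow> real \<Rightarrow> real" where
  "profile \<delta> j y = y ^ j * flat_exp \<delta> 0 y"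

definition profile' :: "real \<Rightarrow> nat \<Rightarrow> real \<Rightarrow> real" where
  "profile' \<delta> j y = j * y ^ (j - 1) * flat_exp \<delta> 0 y + \<delta> * (y ^ j * flat_exp \<delta> 2 y)"

lemma profile_nonpos: "y \<le> 0 \<Longrightarrow> profile \<delta> j y = 0" "y \<le> 0 \<Longrightarrow> profile' \<delta> j y = 0"
  by (auto simp: profile_def profile'_def flat_exp_def)

lemma profile_has_derivative:
  assumes "\<delta> > 0" shows "(profile \<delta> j has_real_derivative profile' \<delta> j y) (at y)"
  unfolding profile_def[abs_def] profile'_def
  using flat_exp_has_derivative[OF assms, of 0 y]
  by (auto intro!: derivative_eq_intros simp: algebra_simps numeral_2_eq_2)

lemma smooth_within_profile: "\<delta> > 0 \<Longrightarrow> smooth_within UNIV (profile \<delta> j)"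
  unfolding profile_def[abs_def]
  using smooth_within_mult[OF open_UNIV smooth_within_power[OF open_UNIV smooth_within_inner[OF open_UNIV, of "1::real"]]
      smooth_within_flat_exp[of \<delta> 0]] by simp

lemma profile_pos:
  "y > 0 \<Longrightarrow> profile \<delta> j y = y ^ j * exp (- (\<delta> / y))"
  "y > 0 \<Longrightarrow> j \<ge> 1 \<Longrightarrow> profile' \<delta> j y = y ^ (j - 1) * ((j + \<delta> / y) * exp (- (\<delta> / y)))"
  by (cases j; force simp: profile_def profile'_def flat_exp_def field_simps power2_eq_square)+

text \<open>Uniformly in \<open>\<delta>\<close>, the smoothed power and its slope stay below those
  of \<open>y ^ j\<close>, by \<open>1 + s \<le> exp s\<close>. This supplies dominating functions,
  and for \<open>j = 1\<close> it shows that smoothing does not increase the Dirichlet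
  energy.\<close>

lemma profile_bounds:
  assumes "\<delta> > 0" "y > 0"
  shows "0 \<le> profile \<delta> j y" "profile \<delta> j y \<le> y ^ j"
    "j \<ge> 1 \<Longrightarrow> 0 \<le> profile' \<delta> j y" "j \<ge> 1 \<Longrightarrow> profile' \<delta> j y \<le> j * y ^ (j - 1)"
proof -
  show "0 \<le> profile \<delta> j y" "profile \<delta> j y \<le> y ^ j"
    using assms by (auto simp: profile_pos mult_left_le)
  assume j: "j \<ge> 1"
  show "0 \<le> profile' \<delta> j y" using assms j by (auto simp: profile_pos)
  have "1 + \<delta> / y \<le> exp (\<delta> / y)" by simp
  then have "real j + \<delta> / y \<le> j * exp (\<delta> / y)"
  proof -
    have "real j + \<delta> / y \<le> real j * (1 + \<delta> / y)"
      using mult_right_mono[of 1 "real j" "\<delta> / y"] j assms by (simp add: distrib_left)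
    also have "\<dots> \<le> j * exp (\<delta> / y)" by (intro mult_left_mono) auto
    finally show ?thesis .
  qed
  then have "(real j + \<delta> / y) * exp (- (\<delta> / y)) \<le> j * exp (\<delta> / y) * exp (- (\<delta> / y))"
    by (intro mult_right_mono) auto
  also have "\<dots> = j" by (simp add: exp_minus_inverse mult.assoc)
  finally have "y ^ (j - 1) * ((real j + \<delta> / y) * exp (- (\<delta> / y))) \<le> y ^ (j - 1) * j"
    using assms by (intro mult_left_mono) auto
  then show "profile' \<delta> j y \<le> j * y ^ (j - 1)" using assms j by (simp add: profile_pos mult.commute)
qed

lemma profile_tendsto:
  assumes "\<And>k::nat. \<delta> k > 0" "\<delta> \<longlonglongrightarrow> 0" "y > 0"
  shows "(\<lambda>k. profile (\<delta> k) j y) \<longlonglongrightarrow> y ^ j"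
    "j \<ge> 1 \<Longrightarrow> (\<lambda>k. profile' (\<delta> k) j y) \<longlonglongrightarrow> j * y ^ (j - 1)"
proof -
  have 1: "(\<lambda>k. exp (- (\<delta> k / y))) \<longlonglongrightarrow> exp (- (0 / y))" by (intro tendsto_intros assms) (use assms in auto)
  show "(\<lambda>k. profile (\<delta> k) j y) \<longlonglongrightarrow> y ^ j"
    using tendsto_mult[OF tendsto_const[of "y^j"] 1] assms by (simp add: profile_pos)
  assume "j \<ge> 1"
  moreover have "(\<lambda>k. real j + \<delta> k / y) \<longlonglongrightarrow> real j + 0 / y"
    by (intro tendsto_intros assms) (use assms in auto)
  note tendsto_mult[OF tendsto_const[of "y^(j-1)"] tendsto_mult[OF this 1]]
  ultimately show "(\<lambda>k. profile' (\<delta> k) j y) \<longlonglongrightarrow> j * y ^ (j - 1)"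
    using assms by (simp add: profile_pos mult.commute)
qed

text \<open>The profile is flat at 0, so cutting off at \<open>q = D\<close> is smooth across the
  level set whether or not \<open>D\<close> is a regular value. Compactness of the sublevel set
  keeps the support away from the boundary of \<open>N\<close>, and extension by zero is
  smooth.\<close>

lemma sublevel_cutoff:
  fixes q :: "'a::euclidean_space \<Rightarrow> real" and j :: nat and q' P' :: "'a \<Rightarrow> 'a \<Rightarrow> real"
  assumes N: "open N" and q: "smooth_within N q" and P: "smooth_within N P"
    and K: "compact {x \<in> N. q x \<le> D}" and \<delta>: "\<delta> > 0"
    and q': "\<forall>x\<in>N. (q has_derivative q' x) (at x)"
    and P': "\<forall>x\<in>N. (P has_derivative P' x) (at x)"
  defines "f \<equiv> (\<lambda>x. if x \<in> N then profile \<delta> j (D - q x) * P x else 0)"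
    and "f' \<equiv> (\<lambda>x h. indicator {x \<in> N. q x < D} x * (profile \<delta> j (D - q x) * P' x h - profile' \<delta> j (D - q x) * q' x h * P x))"
  shows "smoothf f" "\<And>x. x \<notin> {x \<in> N. q x \<le> D} \<Longrightarrow> f x = 0"
    "\<And>x. (f has_derivative f' x) (at x)" "\<And>b. b \<in> Basis \<Longrightarrow> continuous_on UNIV (\<lambda>x. f' x b)"
proof -
  show z: "f x = 0" if "x \<notin> {x \<in> N. q x \<le> D}" for x
    using that by (auto simp: f_def profile_nonpos)
  have s1: "smooth_within N (\<lambda>x. profile \<delta> j (D - q x))"
    by (rule smooth_within_compose[OF N open_UNIV smooth_within_profile[OF \<delta>]])
      (auto intro!: smooth_within_diff N smooth_within_const q)
  have "smooth_within N f"
    by (rule smooth_within_cong[OF N smooth_within_mult[OF N s1 P]]) (simp add: f_def)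
  then show sf: "smoothf f"
    by (rule smoothf_of_smooth_within[OF N _ compact_imp_closed[OF K] _ z]) auto
  show d: "(f has_derivative f' x) (at x)" for x
  proof (cases "x \<in> N")
    case True
    have pd: "((\<lambda>x. profile \<delta> j (D - q x)) has_derivative (\<lambda>h. profile' \<delta> j (D - q x) * (- q' x h))) (at x)"
    proof -
      have "((\<lambda>x. D - q x) has_derivative (\<lambda>h. - q' x h)) (at x)"
        using has_derivative_diff[OF has_derivative_const[of D] bspec[OF q' True]] by simp
      from has_derivative_compose[OF this profile_has_derivative[OF \<delta>, unfolded has_field_derivative_def]]
      show ?thesis by simp
    qed
    have "(f has_derivative (\<lambda>h. profile \<delta> j (D - q x) * P' x h + profile' \<delta> j (D - q x) * (- q' x h) * P x)) (at x)"
      by (rule has_derivative_cong_open[OF N True _ has_derivative_mult[OF pd bspec[OF P' True]]])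
        (simp add: f_def)
    moreover have "f' x = (\<lambda>h. profile \<delta> j (D - q x) * P' x h + profile' \<delta> j (D - q x) * (- q' x h) * P x)"
      using True by (auto simp: f'_def fun_eq_iff indicator_def profile_nonpos)
    ultimately show ?thesis by simp
  next
    case False
    then have "f' x = (\<lambda>_. 0)" by (auto simp: f'_def)
    then show ?thesis using has_derivative_outside_support[OF compact_imp_closed[OF K] z, where x = x] False by simp
  qed
  show "continuous_on UNIV (\<lambda>x. f' x b)" if "b \<in> Basis" for b
  proof -
    have "f' x = frechet_derivative f (at x)" for x using frechet_derivative_at[OF d] .
    then show ?thesis
      using smooth_within_continuous_on[OF smooth_within_partial[OF smoothf_imp_smooth_within[OF sf] that]] by simp
  qed
qed

text \<open>The divergence theorem for \<open>(D - q) ^ j\<close> times the field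
  \<open>P x *\<^sub>R x - Q x *\<^sub>R e\<close>; there is no boundary term because the power
  vanishes on the level set. Two directions suffice since the fields of interest are symmetric about
  the axis \<open>e\<close>. For \<open>j = 1\<close> the cut off power is only Lipschitz, which is
  why the identity is proved for the smooth profile and then passed to the limit.\<close>

lemma sublevel_integration_by_parts:
  fixes q P Q :: "'a::euclidean_space \<Rightarrow> real"
  assumes N: "open N" and q: "smooth_within N q" and P: "smooth_within N P" and Q: "smooth_within N Q"
    and K: "compact {x \<in> N. q x \<le> D}" and e: "e \<in> Basis" and j: "j \<ge> 1"
    and q': "\<And>x. x \<in> N \<Longrightarrow> (q has_derivative q' x) (at x)"
    and P': "\<And>x. x \<in> N \<Longrightarrow> (P has_derivative P' x) (at x)"
    and Q': "\<And>x. x \<in> N \<Longrightarrow> (Q has_derivative Q' x) (at x)"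
  shows "(LINT x:{x \<in> N. q x < D}|lborel. j * (D - q x) ^ (j - 1) * (q' x x * P x - q' x e * Q x))
    = (LINT x:{x \<in> N. q x < D}|lborel. (D - q x) ^ j * (DIM('a) * P x + P' x x - Q' x e))"
proof -
  define B where "B = {x \<in> N. q x < D}"
  define K' where "K' = {x \<in> N. q x \<le> D}"
  have cq: "continuous_on N q" using q smooth_within_continuous_on by blast
  have "open B" unfolding B_def
    using continuous_open_preimage[OF cq N, of "{..<D}"] by (simp add: vimage_def Int_def)
  have BK: "B \<subseteq> K'" "K' \<subseteq> N" by (auto simp: B_def K'_def)
  have Kc: "compact K'" using K by (simp add: K'_def)
  define F where "F x = q' x x * P x - q' x e * Q x" for x
  define A where "A x = DIM('a) * P x + P' x x - Q' x e" for x
  have dirx: "continuous_on N (\<lambda>x. g' x x)"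
    if "smooth_within N g" "\<And>x. x \<in> N \<Longrightarrow> (g has_derivative g' x) (at x)" for g :: "'a \<Rightarrow> real" and g'
  proof -
    have "continuous_on N (\<lambda>x. \<Sum>b\<in>Basis. (x \<bullet> b) * frechet_derivative g (at x) b)"
      by (intro continuous_intros smooth_within_continuous_on smooth_within_partial that)
    moreover have "(\<Sum>b\<in>Basis. (x \<bullet> b) * frechet_derivative g (at x) b) = g' x x" if x: "x \<in> N" for x
    proof -
      have 1: "g' x = frechet_derivative g (at x)"
        using frechet_derivative_at[OF \<open>\<And>x. x \<in> N \<Longrightarrow> (g has_derivative g' x) (at x)\<close>[OF x]] .
      have "g' x x = g' x (\<Sum>b\<in>Basis. (x \<bullet> b) *\<^sub>R b)" by (simp add: euclidean_representation)
      also have "\<dots> = (\<Sum>b\<in>Basis. (x \<bullet> b) * g' x b)"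
        using has_derivative_linear[OF \<open>\<And>x. x \<in> N \<Longrightarrow> (g has_derivative g' x) (at x)\<close>[OF x]]
        by (simp add: linear_sum linear_cmul)
      finally show ?thesis using 1 by simp
    qed
    ultimately show ?thesis by (simp cong: continuous_on_cong)
  qed
  have dire: "continuous_on N (\<lambda>x. g' x e)"
    if "smooth_within N g" "\<And>x. x \<in> N \<Longrightarrow> (g has_derivative g' x) (at x)" for g :: "'a \<Rightarrow> real" and g'
  proof -
    have "g' x e = frechet_derivative g (at x) e" if "x \<in> N" for x
      using frechet_derivative_at[OF \<open>\<And>x. x \<in> N \<Longrightarrow> (g has_derivative g' x) (at x)\<close>[OF that]] by simp
    then show ?thesis
      using smooth_within_continuous_on[OF smooth_within_partial[OF that(1) e]] by (simp cong: continuous_on_cong)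
  qed
  note cont = smooth_within_continuous_on
  have cF: "continuous_on N F" unfolding F_def
    by (intro continuous_intros dirx[OF q q'] dire[OF q q'] cont P Q)
  have cA: "continuous_on N A" unfolding A_def
    by (intro continuous_intros dirx[OF P P'] dire[OF Q Q'] cont P Q)
  have bdd: "\<exists>M\<ge>0. \<forall>x\<in>K'. \<bar>g x\<bar> \<le> M" if "continuous_on N g" for g :: "'a \<Rightarrow> real"
  proof -
    have "compact (g ` K')" using that Kc BK continuous_on_subset compact_continuous_image by blast
    then obtain M where "\<forall>y\<in>g ` K'. norm y \<le> M" using compact_imp_bounded bounded_iff by blast
    then have "\<forall>x\<in>K'. \<bar>g x\<bar> \<le> max M 0" by fastforce
    then show ?thesis by (intro exI[of _ "max M 0"]) auto
  qed
  obtain MF where MF: "MF \<ge> 0" "\<And>x. x \<in> K' \<Longrightarrow> \<bar>F x\<bar> \<le> MF" using bdd[OF cF] by blast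
  obtain MA where MA: "MA \<ge> 0" "\<And>x. x \<in> K' \<Longrightarrow> \<bar>A x\<bar> \<le> MA" using bdd[OF cA] by blast
  obtain MD where MD: "MD \<ge> 0" "\<And>x. x \<in> K' \<Longrightarrow> \<bar>D - q x\<bar> \<le> MD"
    using bdd[OF continuous_on_diff[OF continuous_on_const[of N D] cq]] by blast
  define \<delta> where "\<delta> k = inverse (real (Suc k))" for k
  have \<delta>: "\<And>k. \<delta> k > 0" "\<delta> \<longlonglongrightarrow> 0" unfolding \<delta>_def using LIMSEQ_inverse_real_of_nat by auto
  \<comment> \<open>The smoothed power has compact support in \<open>N\<close>, so both total
    derivatives integrate to zero.\<close>
  have zero: "(\<integral>x. indicator B x * (profile (\<delta> k) j (D - q x) * A x - profile' (\<delta> k) j (D - q x) * F x) \<partial>lborel) = 0"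
    (is "?L = 0") for k
  proof -
    have q2: "\<forall>x\<in>N. (q has_derivative q' x) (at x)" using q' by blast
    have P2: "\<forall>x\<in>N. (P has_derivative P' x) (at x)" using P' by blast
    have Q2: "\<forall>x\<in>N. (Q has_derivative Q' x) (at x)" using Q' by blast
    note cP = sublevel_cutoff[OF N q P K \<delta>(1)[of k] q2 P2, where j = j]
    note cQ = sublevel_cutoff[OF N q Q K \<delta>(1)[of k] q2 Q2, where j = j]
    note IP = integral_euler_derivative[OF cP(3,4) K cP(2)]
    note IQ = integral_directional_derivative[OF cQ(3) cQ(4)[OF e] K cQ(2)]
    have "?L = (\<integral>x. (DIM('a) * (if x \<in> N then profile (\<delta> k) j (D - q x) * P x else 0) +
        indicator {x \<in> N. q x < D} x * (profile (\<delta> k) j (D - q x) * P' x x - profile' (\<delta> k) j (D - q x) * q' x x * P x)) -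
        indicator {x \<in> N. q x < D} x * (profile (\<delta> k) j (D - q x) * Q' x e - profile' (\<delta> k) j (D - q x) * q' x e * Q x) \<partial>lborel)"
      by (rule Bochner_Integration.integral_cong)
        (auto simp: B_def A_def F_def indicator_def profile_nonpos algebra_simps)
    also have "\<dots> = 0"
      using Bochner_Integration.integral_diff[OF IP(1) IQ(1)] IP(2) IQ(2) by simp
    finally show ?thesis .
  qed
  have meas: "(\<lambda>x. indicator B x * g x) \<in> borel_measurable borel" if "continuous_on N g" for g :: "'a \<Rightarrow> real"
  proof -
    have "(\<lambda>x. indicator B x *\<^sub>R g x) \<in> borel_measurable borel"
      using BK \<open>open B\<close> by (intro borel_measurable_continuous_on_indicator continuous_on_subset[OF that]) auto
    then show ?thesis by simp
  qed
  have cprof: "continuous_on N (\<lambda>x. profile d j (D - q x))" "continuous_on N (\<lambda>x. profile' d j (D - q x))" if "d > 0" for d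
  proof -
    have "continuous_on UNIV (profile d j)" using smooth_within_profile[OF that] cont by blast
    then show "continuous_on N (\<lambda>x. profile d j (D - q x))"
      by (rule continuous_on_compose2) (auto intro!: continuous_on_diff cq)
    have "smooth_within UNIV (\<lambda>y. frechet_derivative (profile d j) (at y) 1)"
      using smooth_within_partial[OF smooth_within_profile[OF that], of 1] by simp
    moreover have "(\<lambda>y. frechet_derivative (profile d j) (at y) 1) = profile' d j"
      using frechet_derivative_real[OF profile_has_derivative[OF that]] by (auto simp: fun_eq_iff)
    ultimately have "continuous_on UNIV (profile' d j)" using cont by metis
    then show "continuous_on N (\<lambda>x. profile' d j (D - q x))"
      by (rule continuous_on_compose2) (auto intro!: continuous_on_diff cq)
  qed
  have "(\<lambda>k. \<integral>x. indicator B x * (profile (\<delta> k) j (D - q x) * A x - profile' (\<delta> k) j (D - q x) * F x) \<partial>lborel)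
    \<longlonglongrightarrow> (\<integral>x. indicator B x * ((D - q x) ^ j * A x - j * (D - q x) ^ (j - 1) * F x) \<partial>lborel)"
  proof (rule integral_dominated_convergence[where w = "\<lambda>x. (MD ^ j * MA + j * MD ^ (j - 1) * MF) * indicator K' x"])
    show "(\<lambda>x. indicator B x * ((D - q x) ^ j * A x - j * (D - q x) ^ (j - 1) * F x)) \<in> borel_measurable lborel"
    proof -
      have "continuous_on N (\<lambda>x. (D - q x) ^ j * A x - j * (D - q x) ^ (j - 1) * F x)"
        by (intro continuous_intros cq cA cF)
      from meas[OF this] show ?thesis by simp
    qed
    show "(\<lambda>x. indicator B x * (profile (\<delta> k) j (D - q x) * A x - profile' (\<delta> k) j (D - q x) * F x)) \<in> borel_measurable lborel" for k
    proof -
      have "continuous_on N (\<lambda>x. profile (\<delta> k) j (D - q x) * A x - profile' (\<delta> k) j (D - q x) * F x)"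
        by (intro continuous_intros cprof[OF \<delta>(1)] cA cF)
      from meas[OF this] show ?thesis by simp
    qed
    have "K' \<in> sets borel" using borel_closed[OF compact_imp_closed[OF Kc]] .
    then show "integrable lborel (\<lambda>x. (MD ^ j * MA + j * MD ^ (j - 1) * MF) * indicator K' x)"
      using emeasure_compact_finite[OF Kc] by (intro integrable_mult_right integrable_real_indicator) auto
    show "AE x in lborel. (\<lambda>k. indicator B x * (profile (\<delta> k) j (D - q x) * A x - profile' (\<delta> k) j (D - q x) * F x))
      \<longlonglongrightarrow> indicator B x * ((D - q x) ^ j * A x - j * (D - q x) ^ (j - 1) * F x)"
    proof (rule AE_I2)
      fix x :: 'a
      show "(\<lambda>k. indicator B x * (profile (\<delta> k) j (D - q x) * A x - profile' (\<delta> k) j (D - q x) * F x))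
        \<longlonglongrightarrow> indicator B x * ((D - q x) ^ j * A x - j * (D - q x) ^ (j - 1) * F x)"
      proof (cases "x \<in> B")
        case True
        then have "D - q x > 0" by (simp add: B_def)
        then show ?thesis using j by (intro tendsto_intros profile_tendsto \<delta>) auto
      qed simp
    qed
    show "AE x in lborel. norm (indicator B x * (profile (\<delta> k) j (D - q x) * A x - profile' (\<delta> k) j (D - q x) * F x))
      \<le> (MD ^ j * MA + j * MD ^ (j - 1) * MF) * indicator K' x" for k
    proof (rule AE_I2)
      fix x :: 'a
      show "norm (indicator B x * (profile (\<delta> k) j (D - q x) * A x - profile' (\<delta> k) j (D - q x) * F x))
        \<le> (MD ^ j * MA + j * MD ^ (j - 1) * MF) * indicator K' x"
      proof (cases "x \<in> B")
        case True
        then have xK: "x \<in> K'" using BK by blast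
        have p: "D - q x > 0" using True by (simp add: B_def)
        have D: "D - q x \<le> MD" using MD(2)[OF xK] by simp
        have 1: "\<bar>profile (\<delta> k) j (D - q x) * A x\<bar> \<le> MD ^ j * MA"
          unfolding abs_mult using profile_bounds(1,2)[OF \<delta>(1)[of k] p, of j] MA(2)[OF xK] MA(1) power_mono[OF D, of j] p
          by (intro mult_mono) auto
        have 2: "\<bar>profile' (\<delta> k) j (D - q x) * F x\<bar> \<le> (j * MD ^ (j - 1)) * MF"
        proof -
          have "j * (D - q x) ^ (j - 1) \<le> j * MD ^ (j - 1)" using power_mono[OF D, of "j - 1"] p by (intro mult_left_mono) auto
          then show ?thesis unfolding abs_mult
            using profile_bounds(3,4)[OF \<delta>(1)[of k] p j] MF(2)[OF xK] MF(1) by (intro mult_mono) auto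
        qed
        show ?thesis using 1 2 True xK by simp
      qed (use MA(1) MF(1) MD(1) in simp)
    qed
  qed
  then have L: "(\<integral>x. indicator B x * ((D - q x) ^ j * A x - j * (D - q x) ^ (j - 1) * F x) \<partial>lborel) = 0"
    unfolding zero by (simp add: LIMSEQ_const_iff)
  have int: "integrable lborel (\<lambda>x. indicator B x * g x)" if c: "continuous_on N g" for g :: "'a \<Rightarrow> real"
  proof -
    obtain M where M: "M \<ge> 0" "\<And>x. x \<in> K' \<Longrightarrow> \<bar>g x\<bar> \<le> M" using bdd[OF c] by blast
    have "K' \<in> sets borel" using borel_closed[OF compact_imp_closed[OF Kc]] .
    then have 1: "integrable lborel (\<lambda>x. M * indicator K' x)"
      using emeasure_compact_finite[OF Kc] by (intro integrable_mult_right integrable_real_indicator) auto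
    show ?thesis
      by (rule Bochner_Integration.integrable_bound[OF 1]) (use meas[OF c] M BK in \<open>auto simp: indicator_def abs_mult\<close>)
  qed
  have "(\<integral>x. indicator B x * ((D - q x) ^ j * A x) \<partial>lborel) - (\<integral>x. indicator B x * (j * (D - q x) ^ (j - 1) * F x) \<partial>lborel)
    = (\<integral>x. indicator B x * ((D - q x) ^ j * A x - j * (D - q x) ^ (j - 1) * F x) \<partial>lborel)"
    by (subst Bochner_Integration.integral_diff[symmetric])
      (auto intro!: int continuous_intros cq cA cF simp: right_diff_distrib)
  then show ?thesis using L by (simp add: set_lebesgue_integral_def B_def A_def F_def)
qed

section \<open>The warping function and the weight of the Riemannian volume\<close>

lemma admissible_warpD:
  assumes "admissible_warp p"
  shows "(p has_real_derivative deriv p x) (at x)"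
    "(deriv p has_real_derivative deriv (deriv p) x) (at x)"
    "(deriv (deriv p) has_real_derivative deriv (deriv (deriv p)) x) (at x)"
    "p 0 = 0" "deriv p 0 = 1" "deriv (deriv p) 0 = 0" "r > 0 \<Longrightarrow> p r > 0"
proof -
  have s: "(deriv ^^ k) p differentiable at x" for k x
    using assms by (simp add: admissible_warp_def smooth_real_def)
  show "(p has_real_derivative deriv p x) (at x)"
    using s[of 0 x] by (simp add: DERIV_deriv_iff_real_differentiable)
  show "(deriv p has_real_derivative deriv (deriv p) x) (at x)"
    using s[of 1 x] by (simp add: DERIV_deriv_iff_real_differentiable)
  show "(deriv (deriv p) has_real_derivative deriv (deriv (deriv p)) x) (at x)"
    using s[of 2 x] by (simp add: DERIV_deriv_iff_real_differentiable numeral_2_eq_2)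
  have "(deriv ^^ (2 * k)) p 0 = 0" for k using assms unfolding admissible_warp_def by blast
  from this[of 0] this[of 1] show "p 0 = 0" "deriv (deriv p) 0 = 0" by (simp_all add: numeral_2_eq_2)
  show "deriv p 0 = 1" "r > 0 \<Longrightarrow> p r > 0" using assms unfolding admissible_warp_def by blast+
qed

text \<open>Continuity at the pole is the condition \<open>deriv p 0 = 1\<close>, read as the limit
  of \<open>p r / r\<close>.\<close>

lemma continuous_model_weight:
  assumes "admissible_warp p"
  shows "continuous_on UNIV (model_weight p :: 'a::euclidean_space \<Rightarrow> real)"
proof -
  note D = admissible_warpD[OF assms]
  define h where "h r = (if r = 0 then 1 else p r / r)" for r
  have "isCont h r" for r
  proof (cases "r = 0")
    case True
    have "((\<lambda>h. (p (0 + h) - p 0) / h) \<longlongrightarrow> 1) (at 0)" using D(1)[of 0] D(5) by (simp add: DERIV_def)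
    then have "(h \<longlongrightarrow> 1) (at 0)"
      by (rule Lim_transform_eventually) (auto simp: h_def D eventually_at_filter)
    then show ?thesis using True by (simp add: isCont_def h_def)
  next
    case False
    have "isCont (\<lambda>r. p r / r) r" using False DERIV_isCont[OF D(1)] by (intro continuous_intros) auto
    moreover have "\<forall>\<^sub>F x in nhds r. h x = p x / x"
      using False t1_space_nhds[of r 0] by (auto simp: h_def elim: eventually_mono)
    ultimately show ?thesis using isCont_cong by metis
  qed
  then have "continuous_on UNIV h" by (simp add: continuous_at_imp_continuous_on)
  then have "continuous_on UNIV (\<lambda>x::'a. h (norm x) ^ (DIM('a) - 1))"
    by (intro continuous_on_power continuous_on_compose2[OF _ continuous_on_norm_id]) auto
  moreover have "model_weight p = (\<lambda>x::'a. h (norm x) ^ (DIM('a) - 1))"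
    by (auto simp: model_weight_def h_def fun_eq_iff)
  ultimately show ?thesis by simp
qed

lemma model_weight_pos:
  assumes "admissible_warp p" shows "model_weight p x > 0"
  using admissible_warpD(7)[OF assms, of "norm x"] by (auto simp: model_weight_def)

lemma model_weight_measurable:
  assumes "admissible_warp p"
  shows "model_weight p \<in> borel_measurable borel" "model_weight p \<in> borel_measurable lebesgue"
    "(\<lambda>x. ennreal (model_weight p x)) \<in> borel_measurable lebesgue"
proof -
  show 1: "model_weight p \<in> borel_measurable borel"
    using borel_measurable_continuous_onI[OF continuous_model_weight[OF assms]] .
  then show 2: "model_weight p \<in> borel_measurable lebesgue" by (intro measurable_completion) simp
  show "(\<lambda>x. ennreal (model_weight p x)) \<in> borel_measurable lebesgue"
    by (rule measurable_compose[OF 2 measurable_ennreal])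
qed

section \<open>Schwarz rearrangement\<close>

lemma model_vol_simps [simp]: "space (model_vol p) = UNIV" "sets (model_vol p) = sets lebesgue"
  "f \<in> borel_measurable (model_vol p) \<longleftrightarrow> f \<in> borel_measurable lebesgue"
  by (auto simp: model_vol_def)

lemma nn_integral_model_vol:
  assumes "admissible_warp p" "f \<in> borel_measurable lebesgue"
  shows "(\<integral>\<^sup>+x. f x \<partial>model_vol p) = (\<integral>\<^sup>+x. ennreal (model_weight p x) * f x \<partial>lebesgue)"
  unfolding model_vol_def using assms(2) model_weight_measurable(3)[OF assms(1)] by (intro nn_integral_density) auto

lemma weight_bounded:
  assumes "admissible_warp p"
  obtains M where "M > 0" "\<And>x::'a::euclidean_space. norm x \<le> R \<Longrightarrow> model_weight p x \<le> M"
proof -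
  have "compact (model_weight p ` cball (0::'a) R)"
    by (intro compact_continuous_image continuous_on_subset[OF continuous_model_weight[OF assms]]) auto
  then obtain M where "\<forall>y\<in>model_weight p ` cball (0::'a) R. norm y \<le> M"
    using compact_imp_bounded bounded_iff by blast
  then have "model_weight p x \<le> max M 1" if "norm x \<le> R" for x :: 'a using that by force
  then show ?thesis by (intro that[of "max M 1"]) auto
qed

lemma emeasure_model_vol_finite:
  fixes A :: "'a::euclidean_space set"
  assumes "admissible_warp p" "bounded A" "A \<in> sets lebesgue"
  shows "emeasure (model_vol p) A < \<infinity>"
proof -
  obtain R where R: "A \<subseteq> cball 0 R" using assms(2) unfolding bounded_iff by (metis mem_cball_0 subsetI)
  obtain M where M: "M > 0" "\<And>x::'a. norm x \<le> R \<Longrightarrow> model_weight p x \<le> M" using weight_bounded[OF assms(1)] by blast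
  have "emeasure (model_vol p) A \<le> emeasure (model_vol p) (cball (0::'a) R)" using R by (intro emeasure_mono) auto
  also have "\<dots> = (\<integral>\<^sup>+x. ennreal (model_weight p x) * indicator (cball (0::'a) R) x \<partial>lebesgue)"
    unfolding model_vol_def using model_weight_measurable(3)[OF assms(1)] by (intro emeasure_density) auto
  also have "\<dots> \<le> (\<integral>\<^sup>+x. ennreal M * indicator (cball (0::'a) R) x \<partial>lebesgue)"
    using M by (intro nn_integral_mono) (auto simp: indicator_def intro: ennreal_leI)
  also have "\<dots> = ennreal M * emeasure lebesgue (cball (0::'a) R)" by (intro nn_integral_cmult_indicator) auto
  also have "\<dots> < \<infinity>"
    using emeasure_compact_finite[OF compact_cball, of "0::'a" R] by (simp add: ennreal_mult_less_top)
  finally show ?thesis .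
qed

text \<open>Fubini for the indicator of the region below the graph of \<open>f\<close>.\<close>

lemma layer_cake:
  fixes f :: "'a \<Rightarrow> real"
  assumes "sigma_finite_measure M" and f: "f \<in> borel_measurable M" and pos: "\<And>x. f x \<ge> 0"
  shows "(\<integral>\<^sup>+x. ennreal (f x) \<partial>M) = (\<integral>\<^sup>+t. emeasure M {x \<in> space M. f x > t} * indicator {0..} t \<partial>lborel)"
proof -
  interpret M: sigma_finite_measure M by fact
  interpret pair_sigma_finite M lborel ..
  note [measurable] = f
  define A where "A x t = (indicator {0..} t * indicator {s. s < f x} t :: ennreal)" for x t
  have Am [measurable]: "(\<lambda>(x, t). A x t) \<in> borel_measurable (M \<Otimes>\<^sub>M lborel)"
    unfolding A_def by measurable
  have "ennreal (f x) = (\<integral>\<^sup>+t. A x t \<partial>lborel)" for x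
  proof -
    have "(\<integral>\<^sup>+t. A x t \<partial>lborel) = (\<integral>\<^sup>+t. indicator {0..<f x} t \<partial>lborel)"
      by (intro nn_integral_cong) (auto simp: A_def indicator_def)
    then show ?thesis using pos[of x] by simp
  qed
  then have "(\<integral>\<^sup>+x. ennreal (f x) \<partial>M) = (\<integral>\<^sup>+x. (\<integral>\<^sup>+t. A x t \<partial>lborel) \<partial>M)" by simp
  also have "\<dots> = (\<integral>\<^sup>+t. (\<integral>\<^sup>+x. A x t \<partial>M) \<partial>lborel)"
    using Fubini'[OF Am] by simp
  also have "\<dots> = (\<integral>\<^sup>+t. emeasure M {x \<in> space M. f x > t} * indicator {0..} t \<partial>lborel)"
  proof (intro nn_integral_cong)
    fix t :: real
    have "(\<integral>\<^sup>+x. A x t \<partial>M) = (\<integral>\<^sup>+x. indicator {0..} t * indicator {x \<in> space M. f x > t} x \<partial>M)"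
      by (intro nn_integral_cong) (auto simp: A_def indicator_def)
    also have "\<dots> = emeasure M {x \<in> space M. f x > t} * indicator {0..} t"
      by (subst nn_integral_cmult_indicator) (auto simp: mult.commute)
    finally show "(\<integral>\<^sup>+x. A x t \<partial>M) = emeasure M {x \<in> space M. f x > t} * indicator {0..} t" .
  qed
  finally show ?thesis .
qed

lemma sigma_finite_model_vol:
  assumes "admissible_warp p" shows "sigma_finite_measure (model_vol p :: 'a::euclidean_space measure)"
proof
  show "\<exists>A. countable A \<and> A \<subseteq> sets (model_vol p) \<and> \<Union> A = space (model_vol p :: 'a measure) \<and> (\<forall>a\<in>A. emeasure (model_vol p) a \<noteq> \<infinity>)"
  proof (intro exI conjI)
    show "countable (range (\<lambda>k::nat. ball (0::'a) (real k)))" by simp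
    show "range (\<lambda>k::nat. ball (0::'a) (real k)) \<subseteq> sets (model_vol p)" by auto
    show "\<Union> (range (\<lambda>k::nat. ball (0::'a) (real k))) = space (model_vol p)"
      using reals_Archimedean2 by auto
    show "\<forall>a\<in>range (\<lambda>k::nat. ball (0::'a) (real k)). emeasure (model_vol p) a \<noteq> \<infinity>"
      using emeasure_model_vol_finite[OF assms, of "ball _ _"] by (auto simp: less_top[symmetric])
  qed
qed

definition ball_vol :: "(real \<Rightarrow> real) \<Rightarrow> 'a::euclidean_space itself \<Rightarrow> real \<Rightarrow> real" where
  "ball_vol p _ r = measure (model_vol p) (ball (0::'a) r)"

lemma emeasure_ball_vol:
  assumes "admissible_warp p"
  shows "emeasure (model_vol p) (ball (0::'a::euclidean_space) r) = ennreal (ball_vol p TYPE('a) r)"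
  unfolding ball_vol_def using emeasure_model_vol_finite[OF assms, of "ball (0::'a) r"]
  by (intro emeasure_eq_ennreal_measure) auto

lemma ball_vol_mono:
  assumes "admissible_warp p" "r \<le> s" shows "ball_vol p TYPE('a::euclidean_space) r \<le> ball_vol p TYPE('a) s"
proof -
  have "emeasure (model_vol p) (ball (0::'a) r) \<le> emeasure (model_vol p) (ball (0::'a) s)"
    using assms by (intro emeasure_mono) auto
  then show ?thesis unfolding emeasure_ball_vol[OF assms(1)]
    by (simp add: ball_vol_def)
qed

text \<open>On bounded sets the weight is bounded, so increments of the volume are controlled by
  increments of \<open>r ^ DIM('a)\<close>. Continuity is what allows balls of prescribed volume,
  both for comparing superlevel sets and for choosing the radius in the final comparison.\<close>

lemma ball_vol_continuous:
  assumes a: "admissible_warp p"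
  shows "continuous_on {0..} (ball_vol p TYPE('a::euclidean_space))"
proof -
  let ?V = "ball_vol p TYPE('a)"
  define \<omega> where "\<omega> = measure lborel (ball (0::'a) 1)"
  have diff: "\<exists>C. \<forall>a b. 0 \<le> a \<longrightarrow> a \<le> b \<longrightarrow> b \<le> R \<longrightarrow> \<bar>?V b - ?V a\<bar> \<le> C * \<bar>b ^ DIM('a) - a ^ DIM('a)\<bar>" for R
  proof -
    obtain M where M: "M > 0" "\<And>x::'a. norm x \<le> R \<Longrightarrow> model_weight p x \<le> M" using weight_bounded[OF a] by blast
    have "\<bar>?V s - ?V r\<bar> \<le> M * \<omega> * \<bar>s ^ DIM('a) - r ^ DIM('a)\<bar>" if rs: "0 \<le> r" "r \<le> s" "s \<le> R" for r s
    proof -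
      let ?A = "ball (0::'a) s - ball 0 r"
      have fin: "emeasure (model_vol p) (ball (0::'a) r) \<noteq> \<infinity>" by (simp add: emeasure_ball_vol[OF a])
      have "ennreal (?V s - ?V r) = emeasure (model_vol p) (ball (0::'a) s) - emeasure (model_vol p) (ball (0::'a) r)"
        unfolding emeasure_ball_vol[OF a] by (simp add: ennreal_minus ball_vol_def)
      also have "\<dots> = emeasure (model_vol p) ?A"
        using rs fin by (intro emeasure_Diff[symmetric]) auto
      also have "\<dots> = (\<integral>\<^sup>+x. ennreal (model_weight p x) * indicator ?A x \<partial>lebesgue)"
        unfolding model_vol_def using model_weight_measurable(3)[OF a] by (intro emeasure_density) auto
      also have "\<dots> \<le> (\<integral>\<^sup>+x. ennreal M * indicator ?A x \<partial>lebesgue)"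
        using M rs by (intro nn_integral_mono) (auto simp: indicator_def intro!: ennreal_leI)
      also have "\<dots> = ennreal M * emeasure lebesgue ?A" by (intro nn_integral_cmult_indicator) auto
      also have "emeasure lebesgue ?A = emeasure lebesgue (ball (0::'a) s) - emeasure lebesgue (ball (0::'a) r)"
        using rs emeasure_lborel_ball_finite[of "0::'a" r] by (intro emeasure_Diff) auto
      also have "\<dots> = ennreal (\<omega> * (s ^ DIM('a) - r ^ DIM('a)))"
      proof -
        have e: "emeasure lebesgue (ball (0::'a) s) = ennreal (s ^ DIM('a) * \<omega>)" if "s \<ge> 0" for s
          using that content_ball_conv_unit_ball[OF that, of "0::'a"] emeasure_lborel_ball_finite[of "0::'a" s]
          unfolding \<omega>_def by (simp add: emeasure_eq_ennreal_measure)
        show ?thesis using rs e[of s] e[of r]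
          by (simp add: ennreal_minus \<omega>_def right_diff_distrib mult.commute)
      qed
      also have "ennreal M * \<dots> = ennreal (M * \<omega> * (s ^ DIM('a) - r ^ DIM('a)))"
        using M by (simp add: ennreal_mult'' mult.assoc ennreal_mult')
      finally have "?V s - ?V r \<le> M * \<omega> * (s ^ DIM('a) - r ^ DIM('a))"
        using M rs by (subst (asm) ennreal_le_iff) (auto intro!: mult_nonneg_nonneg simp: \<omega>_def power_mono)
      then show ?thesis using ball_vol_mono[OF a rs(2), where 'a='a] rs by (simp add: power_mono)
    qed
    then show ?thesis by blast
  qed
  show ?thesis unfolding continuous_on_def
  proof (intro ballI)
    fix x :: real assume x: "x \<in> {0..}"
    obtain C where C: "\<And>a b. 0 \<le> a \<Longrightarrow> a \<le> b \<Longrightarrow> b \<le> x + 1 \<Longrightarrow> \<bar>?V b - ?V a\<bar> \<le> C * \<bar>b ^ DIM('a) - a ^ DIM('a)\<bar>"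
      using diff[of "x + 1"] by blast
    have "((\<lambda>y. C * \<bar>y ^ DIM('a) - x ^ DIM('a)\<bar>) \<longlongrightarrow> C * \<bar>x ^ DIM('a) - x ^ DIM('a)\<bar>) (at x within {0..})"
      by (intro tendsto_intros)
    then have "((\<lambda>y. C * \<bar>y ^ DIM('a) - x ^ DIM('a)\<bar>) \<longlongrightarrow> 0) (at x within {0..})" by simp
    moreover have "\<forall>\<^sub>F y in at x within {0..}. norm (?V y - ?V x) \<le> C * \<bar>y ^ DIM('a) - x ^ DIM('a)\<bar>"
      unfolding eventually_at
    proof (intro exI[of _ 1] conjI ballI impI)
      fix y assume y: "y \<in> {0..}" "y \<noteq> x \<and> dist y x < 1"
      then have "y \<le> x + 1" by (auto simp: dist_real_def)
      then show "norm (?V y - ?V x) \<le> C * \<bar>y ^ DIM('a) - x ^ DIM('a)\<bar>"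
        using C[of x y] C[of y x] x y by (cases "x \<le> y") (auto simp: abs_minus_commute)
    qed simp
    ultimately have "((\<lambda>y. ?V y - ?V x) \<longlongrightarrow> 0) (at x within {0..})"
      by (rule Lim_null_comparison[rotated])
    then show "(?V \<longlongrightarrow> ?V x) (at x within {0..})" by (simp add: LIM_zero_iff)
  qed
qed

text \<open>The bound \<open>M\<close> keeps the supremum in \<open>drearr\<close> from being
  infinite, where its conversion to a real number would give 0. The strict inequality in the second
  claim holds because a superlevel set of volume above \<open>s\<close> still has volume above
  \<open>s\<close> at a slightly higher level.\<close>

lemma schwarz_bounds:
  fixes v :: "'a::euclidean_space \<Rightarrow> real"
  assumes a: "admissible_warp p" and v: "v \<in> borel_measurable lebesgue" and M: "\<And>x. \<bar>v x\<bar> \<le> M"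
  shows "schwarz p v x \<ge> 0"
    and "t \<ge> 0 \<Longrightarrow> ennreal (ball_vol p TYPE('a) (norm x)) < emeasure (model_vol p) {x. \<bar>v x\<bar> > t} \<Longrightarrow> schwarz p v x > t"
    and "emeasure (model_vol p) {x. v x \<noteq> 0} \<le> ennreal (ball_vol p TYPE('a) (norm x)) \<Longrightarrow> schwarz p v x = 0"
proof -
  note [measurable] = v
  define s where "s = ball_vol p TYPE('a) (norm x)"
  define A where "A = {ereal t | t. t \<ge> 0 \<and> emeasure (model_vol p) {x. \<bar>v x\<bar> > t} > ennreal s}"
  have S: "schwarz p v x = real_of_ereal (Sup A)"
    unfolding schwarz_def drearr_def A_def s_def ball_vol_def ..
  have ub: "Sup A \<le> ereal M"
  proof (rule Sup_least)
    fix y assume "y \<in> A"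
    then obtain t where t: "y = ereal t" "emeasure (model_vol p) {x. \<bar>v x\<bar> > t} > ennreal s" by (auto simp: A_def)
    then have "{x. \<bar>v x\<bar> > t} \<noteq> {}" by force
    then show "y \<le> ereal M" using t(1) M by (auto intro: order.trans[of t] less_imp_le)
  qed
  have lb: "A \<noteq> {} \<Longrightarrow> 0 \<le> Sup A"
    by (auto simp: A_def intro!: Sup_upper2)
  show "schwarz p v x \<ge> 0"
  proof (cases "A = {}")
    \<comment> \<open>The supremum of the empty set is minus infinity, whose real value is 0 by
      convention.\<close>
    case True then show ?thesis unfolding S by (simp add: bot_ereal_def)
  next
    case False then show ?thesis unfolding S using lb by (simp add: real_of_ereal_pos)
  qed
  show "schwarz p v x > t" if t: "t \<ge> 0" "ennreal (ball_vol p TYPE('a) (norm x)) < emeasure (model_vol p) {x. \<bar>v x\<bar> > t}"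
  proof -
    \<comment> \<open>Continuity of the measure from below along this union produces a level
      strictly above \<open>t\<close> that still belongs to \<open>A\<close>.\<close>
    have U: "{x. \<bar>v x\<bar> > t} = (\<Union>k. {x. \<bar>v x\<bar> > t + inverse (real (Suc k))})" (is "_ = (\<Union>k. ?B k)")
    proof (intro equalityI subsetI)
      fix y assume "y \<in> {x. \<bar>v x\<bar> > t}"
      then have "\<bar>v y\<bar> - t > 0" by simp
      then obtain k where "inverse (real (Suc k)) < \<bar>v y\<bar> - t" using reals_Archimedean by blast
      then show "y \<in> (\<Union>k. ?B k)" by (auto intro!: exI[of _ k])
    next
      fix y assume "y \<in> (\<Union>k. ?B k)"
      then obtain k where "\<bar>v y\<bar> > t + inverse (real (Suc k))" by blast
      moreover have "inverse (real (Suc k)) > 0" by simp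
      ultimately have "t < \<bar>v y\<bar>" by linarith
      then show "y \<in> {x. \<bar>v x\<bar> > t}" by simp
    qed
    have Bm: "?B k \<in> sets (model_vol p)" for k
    proof -
      have "{x \<in> space lebesgue. \<bar>v x\<bar> > t + inverse (real (Suc k))} \<in> sets lebesgue" by measurable
      then show ?thesis by simp
    qed
    have "incseq ?B"
    proof (rule incseq_SucI, rule subsetI)
      fix k y assume y: "y \<in> ?B k"
      have "inverse (real (Suc (Suc k))) \<le> inverse (real (Suc k))" by (intro le_imp_inverse_le) auto
      then show "y \<in> ?B (Suc k)" using y by (simp only: mem_Collect_eq)
    qed
    then have "(SUP k. emeasure (model_vol p) (?B k)) = emeasure (model_vol p) {x. \<bar>v x\<bar> > t}"
      unfolding U using Bm by (intro SUP_emeasure_incseq) auto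
    then obtain k where k: "ennreal s < emeasure (model_vol p) (?B k)"
    proof -
      have "ennreal s < (SUP k. emeasure (model_vol p) (?B k))"
        using t(2) \<open>(SUP k. emeasure (model_vol p) (?B k)) = _\<close> by (simp add: s_def)
      then show ?thesis using that unfolding less_SUP_iff by blast
    qed
    then have "ereal (t + inverse (real (Suc k))) \<in> A" using t(1) unfolding A_def by (auto intro!: exI[of _ "t + inverse (real (Suc k))"])
    then have le: "ereal (t + inverse (real (Suc k))) \<le> Sup A" by (rule Sup_upper)
    then obtain y where y: "Sup A = ereal y" using ub by (cases "Sup A") auto
    have "inverse (real (Suc k)) > 0" by simp
    moreover have "t + inverse (real (Suc k)) \<le> y" using le unfolding y by (simp only: ereal_less_eq)
    ultimately have "t < y" by linarith
    then show ?thesis unfolding S y by simp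
  qed
  assume z: "emeasure (model_vol p) {x. v x \<noteq> 0} \<le> ennreal (ball_vol p TYPE('a) (norm x))"
  have "A = {}"
  proof (rule ccontr)
    assume "A \<noteq> {}"
    then obtain t where t: "t \<ge> 0" "emeasure (model_vol p) {x. \<bar>v x\<bar> > t} > ennreal s" by (auto simp: A_def)
    have "{x \<in> space lebesgue. v x \<noteq> 0} \<in> sets lebesgue" by measurable
    then have "emeasure (model_vol p) {x. \<bar>v x\<bar> > t} \<le> emeasure (model_vol p) {x. v x \<noteq> 0}"
      using t(1) by (intro emeasure_mono) auto
    then show False using t(2) z by (simp add: s_def)
  qed
  then show "schwarz p v x = 0" unfolding S by (simp add: bot_ereal_def)
qed

text \<open>Symmetrization loses no mass: each superlevel set of the rearrangement contains a ball
  at least as large as the superlevel set of \<open>v\<close>, and the layer cake formula integrates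
  this over the levels.\<close>

lemma schwarz_nn_integral_ge:
  fixes v :: "'a::euclidean_space \<Rightarrow> real"
  assumes a: "admissible_warp p" and v: "v \<in> borel_measurable lebesgue" and M: "\<And>x. \<bar>v x\<bar> \<le> M"
    and supp: "\<And>x. norm x \<ge> R \<Longrightarrow> v x = 0" and pos: "\<And>x. v x \<ge> 0"
    and sm: "schwarz p v \<in> borel_measurable lebesgue"
  shows "(\<integral>\<^sup>+x. ennreal (v x) \<partial>model_vol p) \<le> (\<integral>\<^sup>+x. ennreal (schwarz p v x) \<partial>model_vol p)"
proof -
  note [measurable] = v
  let ?V = "ball_vol p TYPE('a)" and ?\<nu> = "model_vol p :: 'a measure"
  define R' where "R' = max R 0"
  have le: "emeasure ?\<nu> {x. v x > t} \<le> emeasure ?\<nu> {x. schwarz p v x > t}" if t: "t \<ge> 0" for t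
  proof -
    have sub: "{x. v x > t} \<subseteq> ball 0 R'" 
    proof
      fix y assume "y \<in> {x. v x > t}"
      then have "v y \<noteq> 0" using t by auto
      then have "norm y < R" using supp[of y] by force
      then show "y \<in> ball 0 R'" by (simp add: R'_def)
    qed
    have ms: "{x. v x > t} \<in> sets lebesgue"
    proof -
      have "{x \<in> space lebesgue. v x > t} \<in> sets lebesgue" by measurable
      then show ?thesis by simp
    qed
    define m where "m = measure ?\<nu> {x. v x > t}"
    have em: "emeasure ?\<nu> {x. v x > t} = ennreal m"
      unfolding m_def using emeasure_model_vol_finite[OF a bounded_subset[OF bounded_ball sub] ms]
      by (intro emeasure_eq_ennreal_measure) auto
    have mV: "m \<le> ?V R'"
    proof -
      have "ennreal m \<le> ennreal (?V R')" unfolding em[symmetric] emeasure_ball_vol[OF a, symmetric]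
        using sub by (intro emeasure_mono) auto
      then show ?thesis by (simp add: ball_vol_def)
    qed
    \<comment> \<open>The least radius whose ball has volume at least \<open>m\<close>. Continuity
      puts it into \<open>Z\<close>, while every smaller ball has volume below \<open>m\<close>, so
      the rearrangement exceeds \<open>t\<close> throughout the open ball.\<close>
    define Z where "Z = {r \<in> {0..}. ?V r \<in> {m..}}"
    have "closed ({0..} \<inter> ?V -` {m..})"
      by (rule continuous_closed_preimage[OF ball_vol_continuous[OF a]]) auto
    moreover have "Z = {0..} \<inter> ?V -` {m..}" by (auto simp: Z_def)
    ultimately have "closed Z" by simp
    have Z: "Z \<noteq> {}" "bdd_below Z" using mV by (auto simp: Z_def R'_def intro!: exI[of _ "max R 0"] bdd_belowI[of _ 0])
    define r where "r = Inf Z"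
    have rZ: "r \<in> Z" unfolding r_def using closed_contains_Inf[OF Z \<open>closed Z\<close>] .
    have "ball 0 r \<subseteq> {x. schwarz p v x > t}"
    proof
      fix x :: 'a assume x: "x \<in> ball 0 r"
      have "norm x \<notin> Z" using x cInf_lower[OF _ Z(2)] by (force simp: r_def)
      then have "?V (norm x) < m" by (auto simp: Z_def)
      then have "ennreal (?V (norm x)) < ennreal m" by (simp add: ball_vol_def ennreal_less_iff)
      also have "ennreal m = emeasure ?\<nu> {x. \<bar>v x\<bar> > t}" using em pos by simp
      finally show "x \<in> {x. schwarz p v x > t}" using schwarz_bounds(2)[OF a v M t] by blast
    qed
    moreover have "{x. schwarz p v x > t} \<in> sets lebesgue"
    proof -
      note [measurable] = sm
      have "{x \<in> space lebesgue. schwarz p v x > t} \<in> sets lebesgue" by measurable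
      then show ?thesis by simp
    qed
    ultimately have "emeasure ?\<nu> (ball 0 r) \<le> emeasure ?\<nu> {x. schwarz p v x > t}" by (intro emeasure_mono) auto
    moreover have "ennreal m \<le> ennreal (?V r)" using rZ by (auto simp: Z_def intro: ennreal_leI)
    ultimately show ?thesis unfolding em emeasure_ball_vol[OF a] by simp
  qed
  have lc: "(\<integral>\<^sup>+x. ennreal (f x) \<partial>?\<nu>) = (\<integral>\<^sup>+t. emeasure ?\<nu> {x. f x > t} * indicator {0..} t \<partial>lborel)"
    if "f \<in> borel_measurable lebesgue" "\<And>x. f x \<ge> 0" for f
    using layer_cake[OF sigma_finite_model_vol[OF a], of f] that by simp
  show ?thesis
    unfolding lc[OF v pos] lc[OF sm schwarz_bounds(1)[OF a v M]]
    by (intro nn_integral_mono) (auto simp: indicator_def le)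
qed

lemma weighted_Cauchy_Schwarz:
  fixes f g w :: "'a \<Rightarrow> real"
  assumes [measurable]: "f \<in> borel_measurable M" "g \<in> borel_measurable M" "w \<in> borel_measurable M"
    and w: "\<And>x. w x > 0"
  shows "(\<integral>\<^sup>+x. ennreal \<bar>f x * g x\<bar> \<partial>M)\<^sup>2
    \<le> (\<integral>\<^sup>+x. ennreal (w x) * ennreal ((f x)\<^sup>2) \<partial>M) * (\<integral>\<^sup>+x. ennreal ((g x)\<^sup>2 / w x) \<partial>M)"
proof -
  have w0: "w x \<ge> 0" for x using w[of x] by simp
  have 1: "ennreal \<bar>f x * g x\<bar> = ennreal (\<bar>f x\<bar> * sqrt (w x)) * ennreal (\<bar>g x\<bar> / sqrt (w x))" for x
    using w[of x] by (simp add: ennreal_mult[symmetric] abs_mult)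
  have 2: "ennreal (w x) * ennreal ((f x)\<^sup>2) = (ennreal (\<bar>f x\<bar> * sqrt (w x)))\<^sup>2" for x
    using w0[of x] by (simp add: ennreal_power ennreal_mult[symmetric] power_mult_distrib mult.commute)
  have 3: "ennreal ((g x)\<^sup>2 / w x) = (ennreal (\<bar>g x\<bar> / sqrt (w x)))\<^sup>2" for x
    using w0[of x] by (simp add: ennreal_power power_divide)
  show ?thesis unfolding 1 2 3 by (rule Cauchy_Schwarz_nn_integral) measurable
qed

text \<open>The metric is Euclidean in the radial direction, and a radial field pairs only with this
  component of a gradient.\<close>

lemma radial_part_le_gnorm2: "((D \<bullet> x) / norm x)\<^sup>2 \<le> gnorm2 p x D"
proof (cases "x = 0")
  case False
  have "((D \<bullet> x) / norm x)\<^sup>2 \<le> (norm D)\<^sup>2"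
    using Cauchy_Schwarz_ineq2[of D x] False by (simp add: abs_le_square_iff[symmetric] divide_le_eq)
  then show ?thesis using False by (simp add: gnorm2_def Let_def)
qed (simp add: gnorm2_def)

lemma ennreal_tendsto_0_of_square:
  fixes X :: "nat \<Rightarrow> ennreal"
  assumes "(\<lambda>k. (X k)\<^sup>2) \<longlonglongrightarrow> 0" shows "X \<longlonglongrightarrow> 0"
proof (rule order_tendstoI)
  fix a :: ennreal assume "0 < a"
  then have "0 < a\<^sup>2" by (simp add: power2_eq_square ennreal_zero_less_mult_iff)
  then have "\<forall>\<^sub>F k in sequentially. (X k)\<^sup>2 < a\<^sup>2" using assms order_tendstoD(2) by blast
  then show "\<forall>\<^sub>F k in sequentially. X k < a"
    by (rule eventually_mono) (metis linorder_not_le mult_mono power2_eq_square zero_le)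
qed simp

section \<open>Duality bound for the torsion functional\<close>

definition ramp2 :: "real \<Rightarrow> real" where "ramp2 y = (max 0 y)\<^sup>2"

lemma ramp2_has_derivative: "(ramp2 has_real_derivative 2 * max 0 y) (at y)"
proof (cases y "0::real" rule: linorder_cases)
  case less
  have "((\<lambda>_. 0) has_real_derivative 2 * max 0 y) (at y)" using less by simp
  then show ?thesis
    by (rule has_field_derivative_transform_within_open[where S = "{..<0}"])
      (use less in \<open>auto simp: ramp2_def\<close>)
next
  case greater
  have "((\<lambda>y. y\<^sup>2) has_real_derivative 2 * max 0 y) (at y)" using greater
    by (auto intro!: derivative_eq_intros)
  then show ?thesis
    by (rule has_field_derivative_transform_within_open[where S = "{0<..}"])
      (use greater in \<open>auto simp: ramp2_def\<close>)
next
  case equal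
  have "((\<lambda>h. ramp2 h / h) \<longlongrightarrow> 0) (at 0)"
  proof (rule Lim_null_comparison)
    show "\<forall>\<^sub>F h in at 0. norm (ramp2 h / h) \<le> \<bar>h\<bar>"
      by (rule always_eventually) (auto simp: ramp2_def max_def power2_eq_square)
    show "((\<lambda>h::real. \<bar>h\<bar>) \<longlongrightarrow> 0) (at 0)" by (auto intro!: tendsto_eq_intros)
  qed
  then show ?thesis using equal by (simp add: DERIV_def ramp2_def)
qed

text \<open>The cutoff is 1 for \<open>s \<le> A\<close>, 0 for \<open>s \<ge> A + \<delta>\<close>, and continuously differentiable.\<close>
definition cutoff :: "real \<Rightarrow> real \<Rightarrow> real \<Rightarrow> real" where
  "cutoff A \<delta> s = ramp2 (1 - ramp2 ((s - A) / \<delta>))"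

definition cutoff' :: "real \<Rightarrow> real \<Rightarrow> real \<Rightarrow> real" where
  "cutoff' A \<delta> s = - (2 * max 0 (1 - ramp2 ((s - A) / \<delta>)) * (2 * max 0 ((s - A) / \<delta>) / \<delta>))"

lemma cutoff_has_derivative:
  assumes "\<delta> > 0" shows "(cutoff A \<delta> has_real_derivative cutoff' A \<delta> s) (at s)"
proof -
  have "((\<lambda>s. (s - A) / \<delta>) has_real_derivative 1 / \<delta>) (at s)"
    using assms by (auto intro!: derivative_eq_intros)
  from DERIV_chain2[OF ramp2_has_derivative this]
  have "((\<lambda>s. 1 - ramp2 ((s - A) / \<delta>)) has_real_derivative - (2 * max 0 ((s - A) / \<delta>) * (1 / \<delta>))) (at s)"
    by (auto intro!: derivative_eq_intros)
  from DERIV_chain2[OF ramp2_has_derivative this] show ?thesis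
    by (simp add: cutoff_def[abs_def] cutoff'_def)
qed

lemma cutoff_simps:
  assumes "\<delta> > 0"
  shows "s \<le> A \<Longrightarrow> cutoff A \<delta> s = 1" "s \<le> A \<Longrightarrow> cutoff' A \<delta> s = 0"
    "s \<ge> A + \<delta> \<Longrightarrow> cutoff A \<delta> s = 0" "s \<ge> A + \<delta> \<Longrightarrow> cutoff' A \<delta> s = 0" "\<bar>cutoff A \<delta> s\<bar> \<le> 1"
proof -
  show "s \<le> A \<Longrightarrow> cutoff A \<delta> s = 1" "s \<le> A \<Longrightarrow> cutoff' A \<delta> s = 0"
    using assms by (auto simp: cutoff_def cutoff'_def ramp2_def max_def divide_le_0_iff zero_le_divide_iff)
  assume s: "s \<ge> A + \<delta>"
  then have "(s - A) / \<delta> \<ge> 1" using assms by (simp add: field_simps)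
  then have "ramp2 ((s - A) / \<delta>) \<ge> 1" by (simp add: ramp2_def)
  then show "cutoff A \<delta> s = 0" "cutoff' A \<delta> s = 0" by (auto simp: cutoff_def cutoff'_def ramp2_def)
next
  have "0 \<le> max 0 (1 - ramp2 ((s - A) / \<delta>))" "max 0 (1 - ramp2 ((s - A) / \<delta>)) \<le> 1" by (auto simp: ramp2_def)
  then show "\<bar>cutoff A \<delta> s\<bar> \<le> 1" unfolding cutoff_def[of A] ramp2_def[of "1 - _"] by (simp add: power_le_one)
qed

lemma continuous_cutoff:
  assumes "\<delta> > 0" shows "continuous_on S (cutoff A \<delta>)" "continuous_on S (cutoff' A \<delta>)"
proof -
  show "continuous_on S (cutoff A \<delta>)"
    using DERIV_isCont[OF cutoff_has_derivative[OF assms]] continuous_at_imp_continuous_on by blast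
  have r: "continuous_on T ramp2" for T
    using DERIV_isCont[OF ramp2_has_derivative] continuous_at_imp_continuous_on by blast
  show "continuous_on S (cutoff' A \<delta>)" unfolding cutoff'_def[abs_def]
    using assms by (intro continuous_intros continuous_on_compose2[OF r[of UNIV]]) auto
qed

lemma egrad_inner:
  assumes "f differentiable at x" shows "egrad f x \<bullet> h = frechet_derivative f (at x) h"
proof -
  have l: "linear (frechet_derivative f (at x))"
    using assms frechet_derivative_works has_derivative_linear by blast
  have "frechet_derivative f (at x) h = frechet_derivative f (at x) (\<Sum>b\<in>Basis. (h \<bullet> b) *\<^sub>R b)"
    by (simp add: euclidean_representation)
  also have "\<dots> = (\<Sum>b\<in>Basis. (h \<bullet> b) * frechet_derivative f (at x) b)"
    using l by (simp add: linear_sum linear_cmul)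
  also have "\<dots> = egrad f x \<bullet> h"
    by (simp add: egrad_def inner_sum_left mult.commute inner_commute[of h])
  finally show ?thesis by simp
qed

lemma test_fun_continuous:
  assumes "test_fun f"
  shows "\<And>x. f differentiable at x" "continuous_on UNIV f" "continuous_on UNIV (egrad f)"
    "\<And>b. b \<in> Basis \<Longrightarrow> continuous_on UNIV (\<lambda>x. frechet_derivative f (at x) b)"
proof -
  have s: "smooth_within UNIV f" using assms smoothf_imp_smooth_within test_fun_def by blast
  show "\<And>x. f differentiable at x" using s smooth_within_differentiable by blast
  show "continuous_on UNIV f" using s smooth_within_continuous_on by blast
  show c: "continuous_on UNIV (\<lambda>x. frechet_derivative f (at x) b)" if "b \<in> Basis" for b
    using s that smooth_within_continuous_on smooth_within_partial by blast
  show "continuous_on UNIV (egrad f)" unfolding egrad_def[abs_def]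
    by (intro continuous_intros c)
qed

lemma borel_lebesgue_measurable:
  "f \<in> borel_measurable borel \<Longrightarrow> f \<in> borel_measurable lebesgue"
  by (intro measurable_completion) simp

lemma nn_integral_compact_support_finite:
  fixes f :: "'a::euclidean_space \<Rightarrow> real"
  assumes "compact K" "continuous_on K f" "\<And>x. x \<notin> K \<Longrightarrow> f x = 0"
  shows "(\<integral>\<^sup>+x. ennreal (f x) \<partial>lebesgue) < \<infinity>"
proof -
  have "compact (f ` K)" using assms compact_continuous_image by blast
  then obtain M where M: "\<forall>y\<in>f ` K. norm y \<le> M" using compact_imp_bounded bounded_iff by blast
  have "(\<integral>\<^sup>+x. ennreal (f x) \<partial>lebesgue) \<le> (\<integral>\<^sup>+x. ennreal M * indicator K x \<partial>lebesgue)"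
    using M assms(3) by (intro nn_integral_mono) (fastforce simp: indicator_def intro: ennreal_leI)
  also have "\<dots> = ennreal M * emeasure lebesgue K"
    using compact_imp_closed[OF assms(1)] by (intro nn_integral_cmult_indicator) auto
  also have "\<dots> < \<infinity>"
    using emeasure_compact_finite[OF assms(1)] compact_imp_closed[OF assms(1)] by (simp add: ennreal_mult_less_top)
  finally show ?thesis .
qed

text \<open>The field is \<open>\<kappa> x *\<^sub>R x\<close> with \<open>\<kappa>\<close> equal to
  \<open>(1 + a * (x \<bullet> x)) / DIM('a)\<close> times the cutoff. Its Euclidean divergence on
  the ball is exactly the upper bound assumed for the weight, so the integral of \<open>u\<close>
  against the weight is at most that of \<open>u * dv\<close>. Integration by parts moves the
  derivative to the gradient, and Cauchy-Schwarz with the weight separates energy and field. The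
  cutoff acts only where \<open>u\<close> vanishes; it makes the field compactly supported.\<close>

lemma energy_duality_cutoff:
  fixes u :: "'a::euclidean_space \<Rightarrow> real" and G :: "'a \<Rightarrow> 'a" and a \<delta> R :: real
  assumes ad: "admissible_warp p" and H: "Hdot1 p u G" and u0: "\<And>x. u x \<ge> 0"
    and R: "R > 0" and uR: "\<And>x. norm x \<ge> R \<Longrightarrow> u x = 0"
    and w: "\<And>x::'a. norm x \<le> R \<Longrightarrow> model_weight p x \<le> 1 + a * (DIM('a) + 2) / DIM('a) * (norm x)\<^sup>2"
    and \<delta>: "0 < \<delta>" "\<delta> \<le> 1"
  shows "(\<integral>\<^sup>+x. ennreal (u x) \<partial>model_vol p)\<^sup>2 \<le> energy p G *
    (\<integral>\<^sup>+x. ennreal (((1 + a * ((x::'a) \<bullet> x)) / DIM('a) * cutoff (R\<^sup>2) \<delta> (x \<bullet> x) * norm x)\<^sup>2 / model_weight p x) \<partial>lebesgue)"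
proof -
  let ?w = "model_weight p :: 'a \<Rightarrow> real"
  define n where "n = real DIM('a)"
  have n: "n > 0" by (simp add: n_def)
  define F where "F s = (1 + a * s) / n * cutoff (R\<^sup>2) \<delta> s" for s
  define F' where "F' s = a / n * cutoff (R\<^sup>2) \<delta> s + cutoff' (R\<^sup>2) \<delta> s * ((1 + a * s) / n)" for s
  have dF: "(F has_real_derivative F' s) (at s)" for s
  proof -
    have "((\<lambda>s. (1 + a * s) / n) has_real_derivative a / n) (at s)" using n by (auto intro!: derivative_eq_intros)
    from DERIV_mult[OF this cutoff_has_derivative[OF \<delta>(1)]] show ?thesis by (simp add: F_def[abs_def] F'_def)
  qed
  have cF: "continuous_on UNIV F" "continuous_on UNIV F'"
    unfolding F_def[abs_def] F'_def[abs_def] using n by (intro continuous_intros continuous_cutoff \<delta>; simp)+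
  define \<kappa> where "\<kappa> x = F (x \<bullet> x)" for x :: 'a
  define dv where "dv x = n * F (x \<bullet> x) + 2 * (x \<bullet> x) * F' (x \<bullet> x)" for x :: 'a
  define K where "K = cball (0::'a) (R + 1)"
  have K: "compact K" by (simp add: K_def)
  have out: "x \<bullet> x \<ge> R\<^sup>2 + \<delta>" if "x \<notin> K" for x
  proof -
    have "(R + 1)\<^sup>2 \<le> (norm x)\<^sup>2" using that R by (intro power_mono) (auto simp: K_def)
    then have "(R + 1)\<^sup>2 \<le> x \<bullet> x" by (simp only: power2_norm_eq_inner)
    then show ?thesis using \<delta> R by (simp add: power2_eq_square algebra_simps)
  qed
  have z: "\<kappa> x = 0" "dv x = 0" if "x \<notin> K" for x
    using cutoff_simps[OF \<delta>(1)] out[OF that] by (auto simp: \<kappa>_def dv_def F_def F'_def)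
  have c\<kappa>: "continuous_on UNIV \<kappa>" unfolding \<kappa>_def[abs_def]
    by (intro continuous_on_compose2[OF cF(1)] continuous_intros) auto
  have cF'x: "continuous_on UNIV (\<lambda>x::'a. F' (x \<bullet> x))" 
    by (intro continuous_on_compose2[OF cF(2)] continuous_intros) auto
  have cdv: "continuous_on UNIV dv" unfolding dv_def[abs_def]
    by (intro continuous_intros cF'x c\<kappa>[unfolded \<kappa>_def[abs_def]])
  have d\<kappa>: "(\<kappa> has_derivative (\<lambda>h. F' (x \<bullet> x) * (2 * (x \<bullet> h)))) (at x)" for x
  proof -
    have "((\<lambda>x. x \<bullet> x) has_derivative (\<lambda>h. 2 * (x \<bullet> h))) (at x)"
      by (auto intro!: derivative_eq_intros simp: inner_commute)
    from has_derivative_compose[OF this dF[unfolded has_field_derivative_def]]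
    show ?thesis by (simp add: \<kappa>_def[abs_def])
  qed
  have wm: "?w \<in> borel_measurable lebesgue" using model_weight_measurable[OF ad] by blast
  have w0: "?w x > 0" for x using model_weight_pos[OF ad] .
  have um [measurable]: "u \<in> borel_measurable lebesgue" using H by (simp add: Hdot1_def L2loc_def)
  have Gm [measurable]: "G \<in> borel_measurable lebesgue" using H by (simp add: Hdot1_def)
  have dvm [measurable]: "dv \<in> borel_measurable lebesgue"
    using cdv borel_measurable_continuous_onI borel_lebesgue_measurable by blast
  have \<kappa>m [measurable]: "\<kappa> \<in> borel_measurable lebesgue"
    using c\<kappa> borel_measurable_continuous_onI borel_lebesgue_measurable by blast
  have nm [measurable]: "norm \<in> borel_measurable (lebesgue :: 'a measure)" "(\<lambda>x::'a. x) \<in> borel_measurable lebesgue"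
    by (intro borel_lebesgue_measurable; simp)+
  obtain \<phi> where \<phi>: "\<And>k. test_fun (\<phi> k)"
    and \<phi>G: "(\<lambda>k. \<integral>\<^sup>+ x. ennreal (gnorm2 p x (egrad (\<phi> k) x - G x)) \<partial>model_vol p) \<longlonglongrightarrow> 0"
    and \<phi>u: "\<And>K. compact K \<Longrightarrow> (\<lambda>k. \<integral>\<^sup>+ x\<in>K. ennreal ((\<phi> k x - u x)\<^sup>2) \<partial>model_vol p) \<longlonglongrightarrow> 0"
    using H unfolding Hdot1_def by blast
  have \<phi>m [measurable]: "\<phi> k \<in> borel_measurable lebesgue" for k
    using test_fun_continuous(2)[OF \<phi>] borel_measurable_continuous_onI borel_lebesgue_measurable by blast
  have e\<phi>m [measurable]: "egrad (\<phi> k) \<in> borel_measurable lebesgue" for k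
    using test_fun_continuous(3)[OF \<phi>] borel_measurable_continuous_onI borel_lebesgue_measurable by blast
  define T where "T = (\<integral>\<^sup>+x. ennreal ((\<kappa> x * norm x)\<^sup>2 / ?w x) \<partial>lebesgue)"
  have wK: "continuous_on K ?w" using continuous_model_weight[OF ad] continuous_on_subset by blast
  have fin: "(\<integral>\<^sup>+x. ennreal ((g x)\<^sup>2 / ?w x) \<partial>lebesgue) < \<infinity>"
    if "continuous_on UNIV g" "\<And>x. x \<notin> K \<Longrightarrow> g x = 0" for g
    by (rule nn_integral_compact_support_finite[OF K])
      (auto intro!: continuous_intros wK continuous_on_subset[OF that(1)] simp: that(2) w0[THEN less_imp_neq, symmetric])
  have T: "T < \<infinity>" unfolding T_def
    by (rule fin) (auto intro!: continuous_intros c\<kappa> simp: z)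
  have CS: "(\<integral>\<^sup>+x. ennreal \<bar>\<kappa> x * (D x \<bullet> x)\<bar> \<partial>lebesgue)\<^sup>2 \<le> (\<integral>\<^sup>+ x. ennreal (gnorm2 p x (D x)) \<partial>model_vol p) * T"
    if Dm [measurable]: "D \<in> borel_measurable lebesgue"
      and gm: "(\<lambda>x. ennreal (gnorm2 p x (D x))) \<in> borel_measurable lebesgue" for D
  proof -
    have e: "\<bar>\<kappa> x * (D x \<bullet> x)\<bar> = \<bar>(D x \<bullet> x) / norm x * (\<kappa> x * norm x)\<bar>" for x
      by (cases "x = 0") (auto simp: abs_mult)
    have "(\<integral>\<^sup>+x. ennreal \<bar>\<kappa> x * (D x \<bullet> x)\<bar> \<partial>lebesgue)\<^sup>2
      \<le> (\<integral>\<^sup>+x. ennreal (?w x) * ennreal (((D x \<bullet> x) / norm x)\<^sup>2) \<partial>lebesgue) * T"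
      unfolding e T_def by (rule weighted_Cauchy_Schwarz[OF _ _ wm w0]) measurable
    also have "\<dots> \<le> (\<integral>\<^sup>+x. ennreal (?w x) * ennreal (gnorm2 p x (D x)) \<partial>lebesgue) * T"
      by (intro mult_right_mono nn_integral_mono mult_left_mono ennreal_leI radial_part_le_gnorm2) auto
    also have "\<dots> = (\<integral>\<^sup>+ x. ennreal (gnorm2 p x (D x)) \<partial>model_vol p) * T"
      using nn_integral_model_vol[OF ad gm] by simp
    finally show ?thesis .
  qed
  have gn: "(\<lambda>x. ennreal (gnorm2 p x (D x))) \<in> borel_measurable lebesgue"
    if Dm [measurable]: "D \<in> borel_measurable lebesgue" for D :: "'a \<Rightarrow> 'a"
  proof -
    have "(\<lambda>x::'a. p (norm x)) \<in> borel_measurable borel"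
    proof (rule borel_measurable_continuous_onI)
      have "continuous_on UNIV p"
        using DERIV_isCont[OF admissible_warpD(1)[OF ad]] continuous_at_imp_continuous_on by blast
      then show "continuous_on UNIV (\<lambda>x::'a. p (norm x))"
        by (rule continuous_on_compose2) (auto intro: continuous_intros)
    qed
    then have [measurable]: "(\<lambda>x::'a. p (norm x)) \<in> borel_measurable lebesgue" by (rule borel_lebesgue_measurable)
    have [measurable]: "Measurable.pred (lebesgue :: 'a measure) (\<lambda>x. x = 0)"
      unfolding Measurable.pred_def by simp
    show ?thesis unfolding gnorm2_def Let_def by measurable
  qed
  have parts: "(\<integral>x. \<phi> k x * dv x \<partial>lebesgue) = - (\<integral>x. \<kappa> x * (egrad (\<phi> k) x \<bullet> x) \<partial>lebesgue)"
      "integrable lebesgue (\<lambda>x. \<phi> k x * dv x)" for k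
  proof -
    define f' where "f' x h = \<phi> k x * (F' (x \<bullet> x) * (2 * (x \<bullet> h))) + frechet_derivative (\<phi> k) (at x) h * \<kappa> x" for x h
    have d: "((\<lambda>x. \<phi> k x * \<kappa> x) has_derivative f' x) (at x)" for x
      unfolding f'_def using test_fun_continuous(1)[OF \<phi>[of k], of x]
      by (intro has_derivative_mult d\<kappa>) (simp add: frechet_derivative_works[symmetric])
    have c: "continuous_on UNIV (\<lambda>x. f' x b)" if "b \<in> Basis" for b
      unfolding f'_def using test_fun_continuous(2,4)[OF \<phi>[of k]] that
      by (intro continuous_intros cF'x c\<kappa>) auto
    have E: "(\<integral>x. DIM('a) * (\<phi> k x * \<kappa> x) + f' x x \<partial>lborel) = 0"
      by (rule integral_euler_derivative(2)[OF d c K]) (simp_all add: z)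
    have e: "DIM('a) * (\<phi> k x * \<kappa> x) + f' x x = \<phi> k x * dv x + \<kappa> x * (egrad (\<phi> k) x \<bullet> x)" for x
      unfolding f'_def dv_def egrad_inner[OF test_fun_continuous(1)[OF \<phi>[of k]]] \<kappa>_def n_def by (simp add: algebra_simps)
    have c1: "continuous_on UNIV (\<lambda>x. \<phi> k x * dv x)" "continuous_on UNIV (\<lambda>x. \<kappa> x * (egrad (\<phi> k) x \<bullet> x))"
      using test_fun_continuous(2,3)[OF \<phi>[of k]] by (intro continuous_intros cdv c\<kappa>; simp)+
    have i1: "integrable lborel (\<lambda>x. \<phi> k x * dv x)"
      by (rule integrable_compact_support[OF K c1(1)]) (simp add: z)
    have i2: "integrable lborel (\<lambda>x. \<kappa> x * (egrad (\<phi> k) x \<bullet> x))"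
      by (rule integrable_compact_support[OF K c1(2)]) (simp add: z)
    have m: "(\<lambda>x. \<phi> k x * dv x) \<in> borel_measurable lborel" "(\<lambda>x. \<kappa> x * (egrad (\<phi> k) x \<bullet> x)) \<in> borel_measurable lborel"
      using c1 borel_measurable_continuous_onI by auto
    show "(\<integral>x. \<phi> k x * dv x \<partial>lebesgue) = - (\<integral>x. \<kappa> x * (egrad (\<phi> k) x \<bullet> x) \<partial>lebesgue)"
      using E i1 i2 unfolding e by (simp add: integral_completion[OF m(1)] integral_completion[OF m(2)])
    show "integrable lebesgue (\<lambda>x. \<phi> k x * dv x)" using i1 integrable_completion[OF m(1)] by simp
  qed
  \<comment> \<open>\<open>A\<close> is the pairing of the field with the weak gradient;
    \<open>B k\<close> and \<open>C k\<close> measure the errors from replacing gradient and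
    function by the test function \<open>\<phi> k\<close>. Both tend to 0 by Cauchy-Schwarz on the
    compact set \<open>K\<close>.\<close>
  define A where "A = (\<integral>\<^sup>+x. ennreal \<bar>\<kappa> x * (G x \<bullet> x)\<bar> \<partial>lebesgue)"
  define B where "B k = (\<integral>\<^sup>+x. ennreal \<bar>\<kappa> x * ((egrad (\<phi> k) x - G x) \<bullet> x)\<bar> \<partial>lebesgue)" for k
  define C where "C k = (\<integral>\<^sup>+x. ennreal \<bar>(\<phi> k x - u x) * dv x\<bar> \<partial>lebesgue)" for k
  define Td where "Td = (\<integral>\<^sup>+x. ennreal ((dv x)\<^sup>2 / ?w x) \<partial>lebesgue)"
  have Td: "Td < \<infinity>" unfolding Td_def by (rule fin[OF cdv z(2)])
  have CS2: "(\<integral>\<^sup>+x. ennreal \<bar>g x * dv x\<bar> \<partial>lebesgue)\<^sup>2 \<le> (\<integral>\<^sup>+ x\<in>K. ennreal ((g x)\<^sup>2) \<partial>model_vol p) * Td"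
    if gm [measurable]: "g \<in> borel_measurable lebesgue" for g
  proof -
    have Km [measurable]: "K \<in> sets lebesgue" by (simp add: K_def)
    have e: "\<bar>g x * dv x\<bar> = \<bar>(g x * indicator K x) * dv x\<bar>" for x by (cases "x \<in> K") (auto simp: z)
    have e2: "ennreal ((g x * indicator K x)\<^sup>2) = ennreal ((g x)\<^sup>2) * indicator K x" for x
      by (simp add: indicator_def)
    have "(\<integral>\<^sup>+x. ennreal \<bar>g x * dv x\<bar> \<partial>lebesgue)\<^sup>2
      \<le> (\<integral>\<^sup>+x. ennreal (?w x) * ennreal ((g x * indicator K x)\<^sup>2) \<partial>lebesgue) * Td"
      unfolding e Td_def by (rule weighted_Cauchy_Schwarz[OF _ _ wm w0]) measurable
    also have "\<dots> = (\<integral>\<^sup>+ x\<in>K. ennreal ((g x)\<^sup>2) \<partial>model_vol p) * Td"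
      unfolding e2 by (subst nn_integral_model_vol[OF ad]) measurable
    finally show ?thesis .
  qed
  have sq0: "X \<longlonglongrightarrow> 0" if "Y \<longlonglongrightarrow> 0" "c < \<infinity>" "\<And>k. (X k)\<^sup>2 \<le> Y k * c" for X Y :: "nat \<Rightarrow> ennreal" and c
  proof (rule ennreal_tendsto_0_of_square)
    have "(\<lambda>k. c * Y k) \<longlonglongrightarrow> c * 0" using that by (intro ennreal_tendsto_cmult) auto
    then have lim: "(\<lambda>k. c * Y k) \<longlonglongrightarrow> 0" by simp
    show "(\<lambda>k. (X k)\<^sup>2) \<longlonglongrightarrow> 0"
      by (rule tendsto_sandwich[OF _ _ tendsto_const lim]) (use that(3) in \<open>auto simp: mult.commute\<close>)
  qed
  have B0: "B \<longlonglongrightarrow> 0" by (rule sq0[OF \<phi>G T]) (auto simp: B_def intro!: CS gn)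
  have C0: "C \<longlonglongrightarrow> 0" by (rule sq0[OF \<phi>u[OF K] Td]) (auto simp: C_def intro!: CS2)
  \<comment> \<open>\<open>u\<close> is only locally square integrable, so its integrability against
    \<open>dv\<close> also comes from Cauchy-Schwarz on \<open>K\<close>.\<close>
  have udv: "integrable lebesgue (\<lambda>x. u x * dv x)"
  proof (rule integrableI_bounded)
    have "(\<integral>\<^sup>+ x\<in>K. ennreal ((u x)\<^sup>2) \<partial>model_vol p) < \<infinity>" using H K by (simp add: Hdot1_def L2loc_def)
    then have "(\<integral>\<^sup>+x. ennreal \<bar>u x * dv x\<bar> \<partial>lebesgue)\<^sup>2 < \<infinity>"
      using CS2[OF um] Td by (metis ennreal_mult_less_top infinity_ennreal_def order_le_less_trans)
    then show "(\<integral>\<^sup>+x. ennreal (norm (u x * dv x)) \<partial>lebesgue) < \<infinity>"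
      by (auto simp: power2_eq_square ennreal_mult_less_top less_top)
  qed measurable
  define L where "L = (\<integral>x. u x * dv x \<partial>lebesgue)"
  have Lle: "ennreal \<bar>L\<bar> \<le> A + B k + C k" for k
  proof -
    have "\<bar>L\<bar> \<le> \<bar>\<integral>x. \<phi> k x * dv x \<partial>lebesgue\<bar> + \<bar>\<integral>x. (\<phi> k x - u x) * dv x \<partial>lebesgue\<bar>"
    proof -
      have "(\<integral>x. (\<phi> k x - u x) * dv x \<partial>lebesgue) = (\<integral>x. \<phi> k x * dv x \<partial>lebesgue) - L"
        unfolding L_def using parts(2)[of k] udv by (simp add: left_diff_distrib)
      then show ?thesis by linarith
    qed
    then have "ennreal \<bar>L\<bar> \<le> ennreal \<bar>\<integral>x. \<phi> k x * dv x \<partial>lebesgue\<bar> + ennreal \<bar>\<integral>x. (\<phi> k x - u x) * dv x \<partial>lebesgue\<bar>"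
      by (simp add: ennreal_plus[symmetric] ennreal_leI del: ennreal_plus)
    also have "ennreal \<bar>\<integral>x. (\<phi> k x - u x) * dv x \<partial>lebesgue\<bar> \<le> C k"
      unfolding C_def using integral_norm_bound_ennreal[of lebesgue "\<lambda>x. (\<phi> k x - u x) * dv x"] parts(2)[of k] udv
      by (simp add: left_diff_distrib)
    also have "ennreal \<bar>\<integral>x. \<phi> k x * dv x \<partial>lebesgue\<bar> \<le> A + B k"
    proof -
      have "ennreal \<bar>\<integral>x. \<phi> k x * dv x \<partial>lebesgue\<bar> = ennreal \<bar>\<integral>x. \<kappa> x * (egrad (\<phi> k) x \<bullet> x) \<partial>lebesgue\<bar>"
        by (simp add: parts(1))
      also have "\<dots> \<le> (\<integral>\<^sup>+x. ennreal \<bar>\<kappa> x * (egrad (\<phi> k) x \<bullet> x)\<bar> \<partial>lebesgue)"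
      proof (cases "integrable lebesgue (\<lambda>x. \<kappa> x * (egrad (\<phi> k) x \<bullet> x))")
        case True then show ?thesis using integral_norm_bound_ennreal[OF True] by simp
      qed (simp add: not_integrable_integral_eq)
      also have "\<dots> \<le> (\<integral>\<^sup>+x. ennreal \<bar>\<kappa> x * (G x \<bullet> x)\<bar> + ennreal \<bar>\<kappa> x * ((egrad (\<phi> k) x - G x) \<bullet> x)\<bar> \<partial>lebesgue)"
      proof (intro nn_integral_mono)
        fix x :: 'a
        have "\<kappa> x * (egrad (\<phi> k) x \<bullet> x) = \<kappa> x * (G x \<bullet> x) + \<kappa> x * ((egrad (\<phi> k) x - G x) \<bullet> x)"
          by (simp add: inner_diff_left algebra_simps)
        then have "\<bar>\<kappa> x * (egrad (\<phi> k) x \<bullet> x)\<bar> \<le> \<bar>\<kappa> x * (G x \<bullet> x)\<bar> + \<bar>\<kappa> x * ((egrad (\<phi> k) x - G x) \<bullet> x)\<bar>" by linarith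
        then show "ennreal \<bar>\<kappa> x * (egrad (\<phi> k) x \<bullet> x)\<bar> \<le> ennreal \<bar>\<kappa> x * (G x \<bullet> x)\<bar> + ennreal \<bar>\<kappa> x * ((egrad (\<phi> k) x - G x) \<bullet> x)\<bar>"
          by (simp add: ennreal_plus[symmetric] ennreal_leI del: ennreal_plus)
      qed
      also have "\<dots> = A + B k" unfolding A_def B_def by (rule nn_integral_add) measurable
      finally show ?thesis .
    qed
    finally show ?thesis by (simp add: add_mono)
  qed
  have "(\<lambda>k. A + B k + C k) \<longlonglongrightarrow> A + 0 + 0" by (intro tendsto_intros B0 C0)
  then have LA: "ennreal \<bar>L\<bar> \<le> A" using Lle LIMSEQ_le_const by fastforce
  have "(\<integral>\<^sup>+x. ennreal (u x) \<partial>model_vol p) \<le> ennreal \<bar>L\<bar>"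
  proof -
    \<comment> \<open>Inside the ball the cutoff is 1 and the divergence is an explicit polynomial
      dominating the weight; outside both sides are zero.\<close>
    have pw: "?w x * u x \<le> u x * dv x" for x
    proof (cases "norm x \<ge> R")
      case False
      then have "x \<bullet> x \<le> R\<^sup>2" by (simp add: power2_norm_eq_inner[symmetric] power_mono)
      then have "dv x = 1 + a * (DIM('a) + 2) / DIM('a) * (norm x)\<^sup>2"
        using n unfolding dv_def F_def F'_def
        by (simp add: cutoff_simps[OF \<delta>(1)] power2_norm_eq_inner n_def[symmetric] field_simps)
      then have "?w x \<le> dv x" using w[of x] False by simp
      from mult_left_mono[OF this u0[of x]] show ?thesis by (simp add: mult.commute)
    qed (simp add: uR)
    then have nn: "0 \<le> u x * dv x" for x using u0[of x] w0[of x] by (meson less_imp_le mult_nonneg_nonneg order_trans)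
    have "(\<integral>\<^sup>+x. ennreal (u x) \<partial>model_vol p) = (\<integral>\<^sup>+x. ennreal (?w x) * ennreal (u x) \<partial>lebesgue)"
      by (rule nn_integral_model_vol[OF ad]) measurable
    also have "\<dots> \<le> (\<integral>\<^sup>+x. ennreal (u x * dv x) \<partial>lebesgue)"
      using pw u0 w0[THEN less_imp_le] by (intro nn_integral_mono) (auto simp: ennreal_mult[symmetric] intro: ennreal_leI)
    also have "\<dots> = ennreal L" unfolding L_def by (rule nn_integral_eq_integral[OF udv]) (simp add: nn)
    also have "\<dots> \<le> ennreal \<bar>L\<bar>" by (simp add: ennreal_leI)
    finally show ?thesis .
  qed
  then have "(\<integral>\<^sup>+x. ennreal (u x) \<partial>model_vol p)\<^sup>2 \<le> A\<^sup>2" using LA by (auto simp: power2_eq_square intro!: mult_mono)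
  also have "\<dots> \<le> energy p G * T" unfolding A_def energy_def by (rule CS[OF Gm gn[OF Gm]])
  finally show ?thesis unfolding T_def \<kappa>_def F_def n_def .
qed

text \<open>As the cutoff width shrinks, the squared cutoffs tend to the indicator of the closed
  ball and stay dominated by an integrable function supported on a slightly larger one.\<close>

lemma energy_duality:
  fixes u :: "'a::euclidean_space \<Rightarrow> real" and G :: "'a \<Rightarrow> 'a" and a R :: real
  assumes ad: "admissible_warp p" and H: "Hdot1 p u G" and u0: "\<And>x. u x \<ge> 0"
    and R: "R > 0" and uR: "\<And>x. norm x \<ge> R \<Longrightarrow> u x = 0"
    and w: "\<And>x::'a. norm x \<le> R \<Longrightarrow> model_weight p x \<le> 1 + a * (DIM('a) + 2) / DIM('a) * (norm x)\<^sup>2"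
  shows "(\<integral>\<^sup>+x. ennreal (u x) \<partial>model_vol p)\<^sup>2 \<le> energy p G *
    (\<integral>\<^sup>+x\<in>cball (0::'a) R. ennreal (((1 + a * (norm x)\<^sup>2) / DIM('a) * norm x)\<^sup>2 / model_weight p x) \<partial>lebesgue)"
proof -
  let ?w = "model_weight p :: 'a \<Rightarrow> real"
  define \<delta> where "\<delta> k = inverse (real (Suc k))" for k
  have \<delta>: "\<And>k. \<delta> k > 0" "\<delta> \<longlonglongrightarrow> 0" "\<And>k. \<delta> k \<le> 1"
    unfolding \<delta>_def using LIMSEQ_inverse_real_of_nat by (auto simp: inverse_le_1_iff)
  define h where "h k x = ((1 + a * (x \<bullet> x)) / DIM('a) * cutoff (R\<^sup>2) (\<delta> k) (x \<bullet> x) * norm x)\<^sup>2 / ?w x" for k x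
  define K where "K = cball (0::'a) (R + 1)"
  define g where "g x = ((1 + a * (x \<bullet> x)) / DIM('a) * norm x)\<^sup>2 / ?w x" for x
  define f where "f x = (if norm x \<le> R then g x else 0)" for x
  have w0: "?w x > 0" for x using model_weight_pos[OF ad] .
  have cg: "continuous_on UNIV g" unfolding g_def[abs_def]
    using w0[THEN less_imp_neq, symmetric] by (intro continuous_intros continuous_model_weight[OF ad]) auto
  have hm: "(\<lambda>x. ennreal (h k x)) \<in> borel_measurable lebesgue" for k
  proof -
    have "continuous_on UNIV (\<lambda>x::'a. cutoff (R\<^sup>2) (\<delta> k) (x \<bullet> x))"
      by (rule continuous_on_compose2[OF continuous_cutoff(1)[OF \<delta>(1), of UNIV]]) (auto intro: continuous_intros)
    then have "continuous_on UNIV (h k)" unfolding h_def[abs_def]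
      using w0[THEN less_imp_neq, symmetric] by (intro continuous_intros continuous_model_weight[OF ad]) auto
    then have "h k \<in> borel_measurable lebesgue"
      using borel_measurable_continuous_onI borel_lebesgue_measurable by blast
    then show ?thesis by measurable
  qed
  have gm: "g \<in> borel_measurable lebesgue"
    using cg borel_measurable_continuous_onI borel_lebesgue_measurable by blast
  have Km: "K \<in> sets lebesgue" "cball (0::'a) R \<in> sets lebesgue" by (auto simp: K_def)
  have hg: "h k x = g x * (cutoff (R\<^sup>2) (\<delta> k) (x \<bullet> x))\<^sup>2" for k x
    by (simp add: h_def g_def power_mult_distrib power_divide)
  have g0: "g x \<ge> 0" for x using w0[of x] by (simp add: g_def)
  have lim: "(\<lambda>k. \<integral>\<^sup>+x. ennreal (h k x) \<partial>lebesgue) \<longlonglongrightarrow> (\<integral>\<^sup>+x. ennreal (f x) \<partial>lebesgue)"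
  proof (rule nn_integral_dominated_convergence[where w = "\<lambda>x. ennreal (if x \<in> K then g x else 0)"])
    show "(\<lambda>x. ennreal (h k x)) \<in> borel_measurable lebesgue" for k using hm .
    have "f = (\<lambda>x. g x * indicator (cball 0 R) x)" by (auto simp: f_def fun_eq_iff)
    then have "f \<in> borel_measurable lebesgue"
      using borel_measurable_times[OF gm borel_measurable_indicator[OF Km(2)]] by simp
    then show "(\<lambda>x. ennreal (f x)) \<in> borel_measurable lebesgue" by measurable
    have "(\<lambda>x. if x \<in> K then g x else 0) = (\<lambda>x. g x * indicator K x)" by (auto simp: fun_eq_iff)
    then have "(\<lambda>x. if x \<in> K then g x else 0) \<in> borel_measurable lebesgue"
      using borel_measurable_times[OF gm borel_measurable_indicator[OF Km(1)]] by simp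
    then show "(\<lambda>x. ennreal (if x \<in> K then g x else 0)) \<in> borel_measurable lebesgue" by measurable
    show "(\<integral>\<^sup>+x. ennreal (if x \<in> K then g x else 0) \<partial>lebesgue) < \<infinity>"
    proof (rule nn_integral_compact_support_finite[of K])
      have "continuous_on K g" using cg continuous_on_subset by blast
      then show "continuous_on K (\<lambda>x. if x \<in> K then g x else 0)" by (simp cong: continuous_on_cong)
    qed (auto simp: K_def)
    show "AE x in lebesgue. ennreal (h k x) \<le> ennreal (if x \<in> K then g x else 0)" for k
    proof (intro AE_I2 ennreal_leI)
      fix x :: 'a
      show "h k x \<le> (if x \<in> K then g x else 0)"
      proof (cases "x \<in> K")
        case True
        have "(cutoff (R\<^sup>2) (\<delta> k) (x \<bullet> x))\<^sup>2 \<le> 1"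
          using cutoff_simps(5)[OF \<delta>(1)[of k], of "R\<^sup>2" "x \<bullet> x"] by (simp add: abs_square_le_1)
        then show ?thesis using True g0[of x] by (simp add: hg mult_left_le)
      next
        case False
        have "(R + 1)\<^sup>2 \<le> (norm x)\<^sup>2" using False R by (intro power_mono) (auto simp: K_def)
        then have "(R + 1)\<^sup>2 \<le> x \<bullet> x" by (simp only: power2_norm_eq_inner)
        then have "x \<bullet> x \<ge> R\<^sup>2 + \<delta> k"
          using \<delta>(3)[of k] R by (simp add: power2_eq_square algebra_simps)
        then show ?thesis using False by (simp add: hg cutoff_simps(3)[OF \<delta>(1)])
      qed
    qed
    show "AE x in lebesgue. (\<lambda>k. ennreal (h k x)) \<longlonglongrightarrow> ennreal (f x)"
    proof (intro AE_I2 tendsto_ennrealI)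
      fix x :: 'a
      show "(\<lambda>k. h k x) \<longlonglongrightarrow> f x"
      proof (cases "norm x \<le> R")
        case True
        then have "x \<bullet> x \<le> R\<^sup>2" by (simp add: power2_norm_eq_inner[symmetric] power_mono)
        then show ?thesis using True by (simp add: hg f_def cutoff_simps(1)[OF \<delta>(1)])
      next
        case False
        then have "R\<^sup>2 < (norm x)\<^sup>2" using R by (intro power_strict_mono) auto
        then have "0 < x \<bullet> x - R\<^sup>2" by (simp add: power2_norm_eq_inner)
        then have "\<forall>\<^sub>F k in sequentially. \<delta> k < x \<bullet> x - R\<^sup>2" using \<delta>(2) order_tendstoD(2) by blast
        then have "\<forall>\<^sub>F k in sequentially. h k x = 0"
          by (rule eventually_mono) (simp add: hg cutoff_simps(3)[OF \<delta>(1)])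
        then show ?thesis using False by (simp add: f_def tendsto_eventually)
      qed
    qed
  qed
  have E: "energy p G < \<infinity>" using H by (simp add: Hdot1_def energy_def)
  have "(\<lambda>k. energy p G * (\<integral>\<^sup>+x. ennreal (h k x) \<partial>lebesgue)) \<longlonglongrightarrow> energy p G * (\<integral>\<^sup>+x. ennreal (f x) \<partial>lebesgue)"
    using E by (intro ennreal_tendsto_cmult lim) auto
  moreover have "(\<integral>\<^sup>+x. ennreal (u x) \<partial>model_vol p)\<^sup>2 \<le> energy p G * (\<integral>\<^sup>+x. ennreal (h k x) \<partial>lebesgue)" for k
    unfolding h_def using energy_duality_cutoff[OF ad H u0 R uR w \<delta>(1,3)] .
  ultimately have "(\<integral>\<^sup>+x. ennreal (u x) \<partial>model_vol p)\<^sup>2 \<le> energy p G * (\<integral>\<^sup>+x. ennreal (f x) \<partial>lebesgue)"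
    by (intro LIMSEQ_le_const) auto
  also have "(\<integral>\<^sup>+x. ennreal (f x) \<partial>lebesgue)
    = (\<integral>\<^sup>+x\<in>cball (0::'a) R. ennreal (((1 + a * (norm x)\<^sup>2) / DIM('a) * norm x)\<^sup>2 / model_weight p x) \<partial>lebesgue)"
    by (intro nn_integral_cong) (auto simp: f_def g_def power2_norm_eq_inner indicator_def)
  finally show ?thesis .
qed

section \<open>Expansions at the pole\<close>

lemma set_integrable_bounded_continuous:
  fixes f :: "'a::euclidean_space \<Rightarrow> real"
  assumes "compact K" "continuous_on K f" "A \<subseteq> K" "A \<in> sets borel"
  shows "set_integrable lborel A f"
proof -
  have "set_integrable lborel K f"
    unfolding set_integrable_def using assms by (intro borel_integrable_compact)
  then show ?thesis by (rule set_integrable_subset) (use assms in auto)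
qed

text \<open>A ball is a sublevel set of \<open>x \<bullet> x / 2\<close>, so integration by parts
  with the field \<open>x\<close> and with \<open>x\<close> multiplied by
  \<open>x \<bullet> x\<close> relates each even moment to the one before it.\<close>

lemma ball_moments:
  fixes R :: real
  assumes R: "R > 0"
  defines "\<omega> \<equiv> measure lborel (ball (0::'a::euclidean_space) 1)" and "n \<equiv> real DIM('a)"
  shows "(LINT x:ball (0::'a) R|lborel. 1) = \<omega> * R ^ DIM('a)"
    "(LINT x:ball (0::'a) R|lborel. (norm x)\<^sup>2) = n / (n + 2) * \<omega> * R ^ (DIM('a) + 2)"
    "(LINT x:ball (0::'a) R|lborel. (norm x) ^ 4) = n / (n + 4) * \<omega> * R ^ (DIM('a) + 4)"
proof -
  have n: "n > 0" by (simp add: n_def)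
  have int: "set_integrable lborel (ball (0::'a) R) f" if "continuous_on UNIV f" for f :: "'a \<Rightarrow> real"
    by (rule set_integrable_bounded_continuous[of "cball 0 R"]) (auto intro: continuous_on_subset[OF that])
  define M where "M f = (LINT x:ball (0::'a) R|lborel. f x)" for f :: "'a \<Rightarrow> real"
  have Ml: "M (\<lambda>x. f x - g x) = M f - M g" "M (\<lambda>x. c * f x) = c * M f"
    if "continuous_on UNIV f" "continuous_on UNIV g" for f g and c :: real
    unfolding M_def by (auto intro!: set_integral_diff int that)
  show 0: "(LINT x:ball (0::'a) R|lborel. 1) = \<omega> * R ^ DIM('a)"
    using content_ball_conv_unit_ball[of R "0::'a"] R
    by (simp add: set_lebesgue_integral_def \<omega>_def mult.commute)
  define q :: "'a \<Rightarrow> real" where "q x = x \<bullet> x / 2" for x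
  have sq: "smooth_within UNIV q"
    using smooth_within_mult[OF open_UNIV smooth_within_const[OF open_UNIV, of "1/2"] smooth_within_inner_self[OF open_UNIV]]
    by (simp add: q_def[abs_def])
  have B: "{x \<in> UNIV. q x < R\<^sup>2 / 2} = ball 0 R"
  proof -
    have "(x \<bullet> x < R\<^sup>2) = (norm x < R)" for x :: 'a
    proof -
      have "(R \<le> norm x) = (R\<^sup>2 \<le> x \<bullet> x)"
        using R abs_le_square_iff[of R "norm x"] by (simp add: power2_norm_eq_inner)
      then show ?thesis by linarith
    qed
    then have "(q x < R\<^sup>2 / 2) = (x \<in> ball 0 R)" for x
      unfolding mem_ball_0 q_def by (metis divide_less_cancel zero_less_numeral order_less_asym)
    then show ?thesis by blast
  qed
  have K: "compact {x \<in> UNIV. q x \<le> R\<^sup>2 / 2}"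
  proof -
    have "(q x \<le> R\<^sup>2 / 2) = (x \<in> cball 0 R)" for x :: 'a
      using R abs_le_square_iff[of "norm x" R] by (simp add: power2_norm_eq_inner q_def)
    then have "{x \<in> UNIV. q x \<le> R\<^sup>2 / 2} = cball (0::'a) R" by blast
    then show ?thesis by simp
  qed
  have dq: "(q has_derivative (\<lambda>h. x \<bullet> h)) (at x)" for x
    unfolding q_def by (auto intro!: derivative_eq_intros simp: inner_commute)
  have dqq: "((\<lambda>x. x \<bullet> x) has_derivative (\<lambda>h. 2 * (x \<bullet> h))) (at x)" for x :: 'a
    by (auto intro!: derivative_eq_intros simp: inner_commute)
  obtain e :: 'a where e: "e \<in> Basis" using nonempty_Basis by blast
  note ibp = sublevel_integration_by_parts[OF open_UNIV sq _ smooth_within_const[OF open_UNIV, of 0] K e, of _ 1, unfolded B]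
  \<comment> \<open>The choice \<open>P = 1\<close>, \<open>Q = 0\<close>; the next identity has
    \<open>P\<close> equal to \<open>x \<bullet> x\<close>.\<close>
  have 1: "M (\<lambda>x. x \<bullet> x) = M (\<lambda>x. (R\<^sup>2 / 2 - q x) * n)"
    using ibp[OF smooth_within_const[OF open_UNIV, of 1] _ dq has_derivative_const has_derivative_const]
    by (simp add: M_def n_def)
  have 2: "M (\<lambda>x. (x \<bullet> x) * (x \<bullet> x)) = M (\<lambda>x. (R\<^sup>2 / 2 - q x) * (n * (x \<bullet> x) + 2 * (x \<bullet> x)))"
    using ibp[OF smooth_within_inner_self[OF open_UNIV] _ dq dqq has_derivative_const]
    by (simp add: M_def n_def)
  have c: "continuous_on UNIV (\<lambda>x::'a. x \<bullet> x)" "continuous_on UNIV (\<lambda>x::'a. (x \<bullet> x) * (x \<bullet> x))"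
    by (intro continuous_intros)+
  have "M (\<lambda>x. (R\<^sup>2 / 2 - q x) * n) = M (\<lambda>x. n * R\<^sup>2 / 2 * 1 - n / 2 * (x \<bullet> x))"
    by (simp add: q_def algebra_simps)
  also have "\<dots> = n * R\<^sup>2 / 2 * M (\<lambda>x. 1) - n / 2 * M (\<lambda>x. x \<bullet> x)"
    by (subst Ml(1)) (auto intro!: continuous_intros simp only: Ml(2)[OF continuous_on_const continuous_on_const] Ml(2)[OF c(1) c(1)])
  finally have S2: "(n + 2) * M (\<lambda>x. x \<bullet> x) = n * R\<^sup>2 * (\<omega> * R ^ DIM('a))"
    using 1 0 by (simp add: M_def[of "\<lambda>_. 1"] field_simps)
  then show "(LINT x:ball (0::'a) R|lborel. (norm x)\<^sup>2) = n / (n + 2) * \<omega> * R ^ (DIM('a) + 2)"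
    using n by (simp add: M_def power2_norm_eq_inner field_simps power_add power2_eq_square[of R])
  have "M (\<lambda>x. (R\<^sup>2 / 2 - q x) * (n * (x \<bullet> x) + 2 * (x \<bullet> x)))
     = M (\<lambda>x. (n + 2) * R\<^sup>2 / 2 * (x \<bullet> x) - (n + 2) / 2 * ((x \<bullet> x) * (x \<bullet> x)))"
    by (rule arg_cong[of _ _ M], rule ext) (simp add: q_def field_simps)
  also have "\<dots> = (n + 2) * R\<^sup>2 / 2 * M (\<lambda>x. x \<bullet> x) - (n + 2) / 2 * M (\<lambda>x. (x \<bullet> x) * (x \<bullet> x))"
    by (subst Ml(1)) (auto intro!: continuous_intros simp only: Ml(2)[OF c(1) c(1)] Ml(2)[OF c(2) c(2)])
  finally have "(n + 4) * M (\<lambda>x. (x \<bullet> x) * (x \<bullet> x)) = (n + 2) * M (\<lambda>x. x \<bullet> x) * R\<^sup>2"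
    using 2 by (simp add: field_simps)
  then have "(n + 4) * M (\<lambda>x. (x \<bullet> x) * (x \<bullet> x)) = n * \<omega> * R ^ (DIM('a) + 4)"
    unfolding S2 by (simp add: power_add power2_eq_square[of R] power4_eq_xxxx[of R])
  then show "(LINT x:ball (0::'a) R|lborel. (norm x) ^ 4) = n / (n + 4) * \<omega> * R ^ (DIM('a) + 4)"
  proof -
    have "(norm x) ^ 4 = (x \<bullet> x) * (x \<bullet> x)" for x :: 'a
      by (simp add: power2_norm_eq_inner[symmetric] power4_eq_xxxx power2_eq_square)
    then show ?thesis using n \<open>(n + 4) * M _ = n * \<omega> * R ^ (DIM('a) + 4)\<close> by (simp add: M_def field_simps)
  qed
qed

text \<open>The Taylor expansion \<open>p r = r + c * r ^ 3 / 6 + ...\<close> and its derivatives,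
  by l'Hopital's rule from the vanishing of \<open>p\<close> and of its second derivative at
  0.\<close>

lemma warp_limits:
  assumes "admissible_warp p"
  defines "c \<equiv> deriv (deriv (deriv p)) 0"
  shows "((\<lambda>r. deriv (deriv p) r / r) \<longlongrightarrow> c) (at_right 0)"
    "((\<lambda>r. (deriv p r - 1) / r\<^sup>2) \<longlongrightarrow> c / 2) (at_right 0)"
    "((\<lambda>r. (p r / r - 1) / r\<^sup>2) \<longlongrightarrow> c / 6) (at_right 0)"
    "((\<lambda>r. p r / r) \<longlongrightarrow> 1) (at_right 0)"
proof -
  note D = admissible_warpD[OF assms(1)]
  have "((\<lambda>h. (deriv (deriv p) (0 + h) - deriv (deriv p) 0) / h) \<longlongrightarrow> c) (at 0)"
    using D(3)[of 0] by (simp add: DERIV_def c_def)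
  then have "((\<lambda>r. deriv (deriv p) r / r) \<longlongrightarrow> c) (at 0)" using D(6) by simp
  then show 1: "((\<lambda>r. deriv (deriv p) r / r) \<longlongrightarrow> c) (at_right 0)"
    by (rule tendsto_mono[OF at_le, rotated]) simp
  have cont: "(deriv p \<longlongrightarrow> 1) (at_right 0)" "(p \<longlongrightarrow> 0) (at_right 0)"
    using DERIV_isCont[OF D(2)[of 0]] DERIV_isCont[OF D(1)[of 0]] D(4,5)
    unfolding isCont_def by (auto intro: tendsto_mono[OF at_le, rotated])
  have pos: "\<forall>\<^sub>F r in at_right (0::real). r > 0" by (simp add: eventually_at_filter)
  show 2: "((\<lambda>r. (deriv p r - 1) / r\<^sup>2) \<longlongrightarrow> c / 2) (at_right 0)"
  proof (rule lhopital_right_0)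
    show "((\<lambda>r. deriv p r - 1) \<longlongrightarrow> 0) (at_right 0)" using cont by (auto intro!: tendsto_eq_intros)
    show "((\<lambda>r::real. r\<^sup>2) \<longlongrightarrow> 0) (at_right 0)" by (auto intro!: tendsto_eq_intros)
    show "\<forall>\<^sub>F r in at_right (0::real). r\<^sup>2 \<noteq> 0" using pos by (auto elim: eventually_mono)
    show "\<forall>\<^sub>F r in at_right (0::real). 2 * r \<noteq> 0" using pos by (auto elim: eventually_mono)
    show "\<forall>\<^sub>F r in at_right 0. ((\<lambda>r. deriv p r - 1) has_real_derivative deriv (deriv p) r) (at r)"
      by (rule always_eventually) (auto intro!: derivative_eq_intros D)
    show "\<forall>\<^sub>F r in at_right 0. ((\<lambda>r. r\<^sup>2) has_real_derivative 2 * r) (at r)"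
      by (rule always_eventually) (auto intro!: derivative_eq_intros)
    have "((\<lambda>r. deriv (deriv p) r / r / 2) \<longlongrightarrow> c / 2) (at_right 0)" by (intro tendsto_intros 1) simp
    then show "((\<lambda>r. deriv (deriv p) r / (2 * r)) \<longlongrightarrow> c / 2) (at_right 0)" by (simp add: mult.commute)
  qed
  have "((\<lambda>r. (p r - r) / r ^ 3) \<longlongrightarrow> c / 6) (at_right 0)"
  proof (rule lhopital_right_0)
    show "((\<lambda>r. p r - r) \<longlongrightarrow> 0) (at_right 0)" using cont by (auto intro!: tendsto_eq_intros)
    show "((\<lambda>r::real. r ^ 3) \<longlongrightarrow> 0) (at_right 0)" by (auto intro!: tendsto_eq_intros)
    show "\<forall>\<^sub>F r in at_right (0::real). r ^ 3 \<noteq> 0" using pos by (auto elim: eventually_mono)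
    show "\<forall>\<^sub>F r in at_right (0::real). 3 * r\<^sup>2 \<noteq> 0" using pos by (auto elim: eventually_mono)
    show "\<forall>\<^sub>F r in at_right 0. ((\<lambda>r. p r - r) has_real_derivative deriv p r - 1) (at r)"
      by (rule always_eventually) (auto intro!: derivative_eq_intros D)
    show "\<forall>\<^sub>F r in at_right 0. ((\<lambda>r. r ^ 3) has_real_derivative 3 * r\<^sup>2) (at r)"
      by (rule always_eventually) (auto intro!: derivative_eq_intros)
    have "((\<lambda>r. (deriv p r - 1) / r\<^sup>2 / 3) \<longlongrightarrow> c / 2 / 3) (at_right 0)" by (intro tendsto_intros 2) simp
    then show "((\<lambda>r. (deriv p r - 1) / (3 * r\<^sup>2)) \<longlongrightarrow> c / 6) (at_right 0)" by (simp add: mult.commute)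
  qed
  then show 3: "((\<lambda>r. (p r / r - 1) / r\<^sup>2) \<longlongrightarrow> c / 6) (at_right 0)"
  proof (rule Lim_transform_eventually)
    show "\<forall>\<^sub>F r in at_right 0. (p r - r) / r ^ 3 = (p r / r - 1) / r\<^sup>2"
      using pos by (rule eventually_mono) (simp add: field_simps power2_eq_square power3_eq_cube)
  qed
  have "((\<lambda>r. (p r / r - 1) / r\<^sup>2 * r\<^sup>2 + 1) \<longlongrightarrow> c / 6 * 0\<^sup>2 + 1) (at_right 0)" by (intro tendsto_intros 3)
  then have "((\<lambda>r. (p r / r - 1) / r\<^sup>2 * r\<^sup>2 + 1) \<longlongrightarrow> 1) (at_right 0)" by simp
  then show "((\<lambda>r. p r / r) \<longlongrightarrow> 1) (at_right 0)"
    by (rule Lim_transform_eventually) (use pos in \<open>auto elim: eventually_mono\<close>)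
qed

text \<open>The formula for the scalar curvature is undefined at the pole, so its value there is
  taken as a limit. With \<open>c\<close> the third derivative of \<open>p\<close> at 0 the two
  curvature terms tend to \<open>2 * c\<close> and \<open>(n - 2) * c\<close>.\<close>

lemma scal_limit:
  assumes "admissible_warp p" "(scal n p \<longlongrightarrow> S) (at_right 0)"
  shows "S = - (real n * (real n - 1) * deriv (deriv (deriv p)) 0)"
proof -
  define c where "c = deriv (deriv (deriv p)) 0"
  note L = warp_limits[OF assms(1), folded c_def]
  have L2: "(deriv p \<longlongrightarrow> 1) (at_right 0)"
    using DERIV_isCont[OF admissible_warpD(2)[OF assms(1), of 0]] admissible_warpD(5)[OF assms(1)]
    unfolding isCont_def by (auto intro: tendsto_mono[OF at_le, rotated])
  have "((\<lambda>r. - (real n - 1) * (2 * (deriv (deriv p) r / r) / (p r / r)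
      + (real n - 2) * (((deriv p r - 1) / r\<^sup>2) * (deriv p r + 1)) / (p r / r)\<^sup>2))
    \<longlongrightarrow> - (real n - 1) * (2 * c / 1 + (real n - 2) * ((c / 2) * (1 + 1)) / 1\<^sup>2)) (at_right 0)"
    by (intro tendsto_intros L L2) auto
  moreover have "\<forall>\<^sub>F r in at_right 0. - (real n - 1) * (2 * (deriv (deriv p) r / r) / (p r / r)
      + (real n - 2) * (((deriv p r - 1) / r\<^sup>2) * (deriv p r + 1)) / (p r / r)\<^sup>2) = scal n p r"
  proof -
    have "\<forall>\<^sub>F r in at_right (0::real). r > 0" by (simp add: eventually_at_filter)
    then show ?thesis
    proof (rule eventually_mono)
      fix r :: real assume r: "r > 0"
      then have p: "p r > 0" using admissible_warpD(7)[OF assms(1)] by blast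
      have "(deriv p r - 1) / r\<^sup>2 * (deriv p r + 1) = ((deriv p r)\<^sup>2 - 1) / r\<^sup>2"
        by (simp add: power2_eq_square algebra_simps add_divide_distrib diff_divide_distrib)
      then show "- (real n - 1) * (2 * (deriv (deriv p) r / r) / (p r / r)
      + (real n - 2) * (((deriv p r - 1) / r\<^sup>2) * (deriv p r + 1)) / (p r / r)\<^sup>2) = scal n p r"
        using r p by (simp add: scal_def power_divide)
    qed
  qed
  ultimately have "(scal n p \<longlongrightarrow> - (real n - 1) * (2 * c / 1 + (real n - 2) * ((c / 2) * (1 + 1)) / 1\<^sup>2)) (at_right 0)"
    by (rule Lim_transform_eventually)
  from tendsto_unique[OF _ assms(2) this] show ?thesis
    by (simp add: c_def algebra_simps)
qed

text \<open>By \<open>scal_limit\<close> the coefficient \<open>b\<close> equals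
  \<open>- S / (6 * n)\<close> with \<open>S\<close> the scalar curvature at the pole: the usual
  second order term of the volume density in normal coordinates.\<close>

lemma model_weight_expansion:
  assumes ad: "admissible_warp p" and \<eta>: "\<eta> > 0"
  defines "b \<equiv> (real DIM('a) - 1) * deriv (deriv (deriv p)) 0 / 6"
  obtains \<rho> where "\<rho> > 0"
    "\<And>x::'a::euclidean_space. norm x < \<rho> \<Longrightarrow> \<bar>model_weight p x - (1 + b * (norm x)\<^sup>2)\<bar> \<le> \<eta> * (norm x)\<^sup>2"
proof -
  define c where "c = deriv (deriv (deriv p)) 0"
  define m where "m = DIM('a) - 1"
  have m: "real m = real DIM('a) - 1" by (simp add: m_def of_nat_diff)
  note L = warp_limits[OF ad, folded c_def]
  \<comment> \<open>The difference quotient of \<open>(1 + z) ^ m\<close> at 0, filled in by its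
    limit because \<open>p r / r - 1\<close> may vanish arbitrarily close to the pole.\<close>
  define G where "G z = (if z = 0 then real m else ((1 + z) ^ m - 1) / z)" for z :: real
  have "((\<lambda>z. (1 + z) ^ m) has_real_derivative real m) (at 0)"
    by (auto intro!: derivative_eq_intros)
  then have "((\<lambda>z. ((1 + z) ^ m - 1) / z) \<longlongrightarrow> real m) (at 0)" by (simp add: DERIV_def)
  then have "(G \<longlongrightarrow> real m) (at 0)"
    by (rule Lim_transform_eventually) (auto simp: G_def eventually_at_filter)
  then have "isCont G 0" by (simp add: isCont_def G_def)
  moreover have "((\<lambda>r. p r / r - 1) \<longlongrightarrow> 0) (at_right 0)" using tendsto_diff[OF L(4) tendsto_const[of 1]] by simp
  ultimately have "((\<lambda>r. G (p r / r - 1)) \<longlongrightarrow> real m) (at_right 0)"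
    using isCont_tendsto_compose[of 0 G] by (simp add: G_def[of 0])
  from tendsto_mult[OF this L(3)]
  have "((\<lambda>r. G (p r / r - 1) * ((p r / r - 1) / r\<^sup>2)) \<longlongrightarrow> b) (at_right 0)"
    by (simp add: b_def m c_def)
  moreover have "G (p r / r - 1) * ((p r / r - 1) / r\<^sup>2) = ((p r / r) ^ m - 1) / r\<^sup>2" for r
    by (auto simp: G_def)
  ultimately have "((\<lambda>r. ((p r / r) ^ m - 1) / r\<^sup>2) \<longlongrightarrow> b) (at_right 0)" by (simp only:)
  then have "\<forall>\<^sub>F r in at_right 0. dist (((p r / r) ^ m - 1) / r\<^sup>2) b < \<eta>" using \<eta> tendstoD by blast
  then obtain \<rho> where \<rho>: "\<rho> > 0" "\<And>r. 0 < r \<Longrightarrow> r < \<rho> \<Longrightarrow> dist (((p r / r) ^ m - 1) / r\<^sup>2) b < \<eta>"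
    unfolding eventually_at_right_field by auto
  show ?thesis
  proof (rule that[OF \<rho>(1)])
    fix x :: 'a assume x: "norm x < \<rho>"
    show "\<bar>model_weight p x - (1 + b * (norm x)\<^sup>2)\<bar> \<le> \<eta> * (norm x)\<^sup>2"
    proof (cases "x = 0")
      case False
      define r where "r = norm x"
      have r: "r > 0" "r < \<rho>" using False x by (auto simp: r_def)
      have "\<bar>((p r / r) ^ m - 1) / r\<^sup>2 - b\<bar> \<le> \<eta>" using \<rho>(2)[OF r] by (simp add: dist_real_def)
      then have "\<bar>((p r / r) ^ m - 1) / r\<^sup>2 - b\<bar> * r\<^sup>2 \<le> \<eta> * r\<^sup>2" by (rule mult_right_mono) simp
      also have "\<bar>((p r / r) ^ m - 1) / r\<^sup>2 - b\<bar> * r\<^sup>2 = \<bar>(((p r / r) ^ m - 1) / r\<^sup>2 - b) * r\<^sup>2\<bar>" by (simp add: abs_mult)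
      also have "(((p r / r) ^ m - 1) / r\<^sup>2 - b) * r\<^sup>2 = (p r / r) ^ m - (1 + b * r\<^sup>2)" using r by (simp add: field_simps)
      finally show ?thesis using False by (simp add: model_weight_def r_def m_def)
    qed (simp add: model_weight_def)
  qed
qed

section \<open>The torsion bound on small balls about the pole\<close>

lemma polya_szego_torsion:
  fixes v :: "'a::euclidean_space \<Rightarrow> real" and a R :: real
  assumes ad: "admissible_warp p" and PS: "polya_szego p TYPE('a)"
    and v: "test_fun v" and v0: "\<And>x. v x \<ge> 0" and E: "energy p (egrad v) < \<infinity>"
    and R: "R > 0" and vol: "emeasure (model_vol p) {x. v x \<noteq> 0} \<le> ennreal (ball_vol p TYPE('a) R)"
    and w: "\<And>x::'a. norm x \<le> R \<Longrightarrow> model_weight p x \<le> 1 + a * (DIM('a) + 2) / DIM('a) * (norm x)\<^sup>2"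
  shows "(\<integral>\<^sup>+x. ennreal (v x) \<partial>model_vol p)\<^sup>2 \<le> energy p (egrad v) *
    (\<integral>\<^sup>+x\<in>cball (0::'a) R. ennreal (((1 + a * (norm x)\<^sup>2) / DIM('a) * norm x)\<^sup>2 / model_weight p x) \<partial>lebesgue)"
proof -
  have cv: "continuous_on UNIV v" using test_fun_continuous(2)[OF v] .
  have vm: "v \<in> borel_measurable lebesgue"
    using cv borel_measurable_continuous_onI borel_lebesgue_measurable by blast
  define K where "K = closure {x. v x \<noteq> 0}"
  have K: "compact K" using v by (simp add: test_fun_def K_def)
  have z: "v x = 0" if "x \<notin> K" for x using that closure_subset by (force simp: K_def)
  obtain M where M: "\<And>x. \<bar>v x\<bar> \<le> M"
  proof -
    have "compact (v ` K)" using K cv continuous_on_subset compact_continuous_image by blast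
    then obtain M where M: "\<forall>y\<in>v ` K. norm y \<le> M" using compact_imp_bounded bounded_iff by blast
    have "\<bar>v x\<bar> \<le> max M 0" for x using M z[of x] by (cases "x \<in> K") force+
    then show ?thesis using that by blast
  qed
  obtain B where B: "\<And>x. x \<in> K \<Longrightarrow> norm x \<le> B" using compact_imp_bounded[OF K] bounded_iff by blast
  have supp: "v x = 0" if "norm x \<ge> B + 1" for x using z[of x] B[of x] that by force
  have L2: "L2loc p v"
    unfolding L2loc_def
  proof (intro conjI allI impI)
    show "v \<in> borel_measurable (model_vol p)" using vm by simp
    fix C :: "'a set" assume C: "compact C"
    have Cm: "C \<in> sets lebesgue" using compact_imp_closed[OF C] by simp
    have "(\<integral>\<^sup>+ x\<in>C. ennreal ((v x)\<^sup>2) \<partial>model_vol p) \<le> (\<integral>\<^sup>+ x. ennreal (M\<^sup>2) * indicator C x \<partial>model_vol p)"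
    proof (intro nn_integral_mono mult_right_mono ennreal_leI)
      show "(v x)\<^sup>2 \<le> M\<^sup>2" for x using M[of x] by (metis abs_ge_zero abs_le_square_iff abs_of_nonneg order_trans)
    qed simp
    also have "\<dots> = ennreal (M\<^sup>2) * emeasure (model_vol p) C" using Cm by (intro nn_integral_cmult_indicator) simp
    also have "\<dots> < \<infinity>"
      using emeasure_model_vol_finite[OF ad compact_imp_bounded[OF C] Cm] by (simp add: ennreal_mult_less_top)
    finally show "(\<integral>\<^sup>+ x\<in>C. ennreal ((v x)\<^sup>2) \<partial>model_vol p) < \<infinity>" .
  qed
  have g0: "gnorm2 p x 0 = 0" for x :: 'a by (simp add: gnorm2_def Let_def)
  \<comment> \<open>A test function is approximated by the constant sequence.\<close>
  have H: "Hdot1 p v (egrad v)"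
    unfolding Hdot1_def
  proof (intro conjI exI[of _ "\<lambda>_. v"] allI impI)
    show "egrad v \<in> borel_measurable lebesgue"
      using test_fun_continuous(3)[OF v] borel_measurable_continuous_onI borel_lebesgue_measurable by blast
    show "(\<integral>\<^sup>+ x. ennreal (gnorm2 p x (egrad v x)) \<partial>model_vol p) < \<infinity>" using E by (simp add: energy_def)
  qed (auto simp: L2 v g0)
  have L0: "L0 p v"
    unfolding L0_def
  proof (intro conjI allI impI)
    show "v \<in> borel_measurable (model_vol p)" using vm by simp
    fix t :: real assume t: "t > 0"
    have "{x. \<bar>v x\<bar> > t} \<subseteq> K" using z t by force
    moreover have "{x. \<bar>v x\<bar> > t} \<in> sets lebesgue"
    proof -
      note [measurable] = vm
      have "{x \<in> space lebesgue. \<bar>v x\<bar> > t} \<in> sets lebesgue" by measurable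
      then show ?thesis by simp
    qed
    ultimately show "emeasure (model_vol p) {x. \<bar>v x\<bar> > t} < \<infinity>"
      using emeasure_model_vol_finite[OF ad bounded_subset[OF compact_imp_bounded[OF K]]] by blast
  qed
  have PS': "L0 p (schwarz p v) \<and> (\<exists>G. Hdot1 p (schwarz p v) G \<and> energy p G \<le> energy p (egrad v))"
    using PS H L0 unfolding polya_szego_def by blast
  then have sm: "schwarz p v \<in> borel_measurable lebesgue" by (simp add: L0_def)
  obtain G where G: "Hdot1 p (schwarz p v) G" "energy p G \<le> energy p (egrad v)" using PS' by blast
  have sR: "schwarz p v x = 0" if "norm x \<ge> R" for x
  proof (rule schwarz_bounds(3)[OF ad vm M])
    have "ennreal (ball_vol p TYPE('a) R) \<le> ennreal (ball_vol p TYPE('a) (norm x))"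
      using ball_vol_mono[OF ad that, where 'a='a] by (rule ennreal_leI)
    then show "emeasure (model_vol p) {x. v x \<noteq> 0} \<le> ennreal (ball_vol p TYPE('a) (norm x))" using vol by simp
  qed
  have "(\<integral>\<^sup>+x. ennreal (v x) \<partial>model_vol p)\<^sup>2 \<le> (\<integral>\<^sup>+x. ennreal (schwarz p v x) \<partial>model_vol p)\<^sup>2"
    using schwarz_nn_integral_ge[OF ad vm M supp v0 sm] by (auto simp: power2_eq_square intro!: mult_mono)
  also have "\<dots> \<le> energy p G *
    (\<integral>\<^sup>+x\<in>cball (0::'a) R. ennreal (((1 + a * (norm x)\<^sup>2) / DIM('a) * norm x)\<^sup>2 / model_weight p x) \<partial>lebesgue)"
    by (rule energy_duality[OF ad G(1) schwarz_bounds(1)[OF ad vm M] R sR w])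
  also have "\<dots> \<le> energy p (egrad v) *
    (\<integral>\<^sup>+x\<in>cball (0::'a) R. ennreal (((1 + a * (norm x)\<^sup>2) / DIM('a) * norm x)\<^sup>2 / model_weight p x) \<partial>lebesgue)"
    using G(2) by (intro mult_right_mono) auto
  finally show ?thesis .
qed

lemma set_nn_integral_ball_eq:
  fixes f :: "'a::euclidean_space \<Rightarrow> real"
  assumes c: "continuous_on UNIV f" and f: "\<And>x. f x \<ge> 0" and R: "R > 0"
  shows "(\<integral>\<^sup>+x\<in>cball 0 R. ennreal (f x) \<partial>lebesgue) = ennreal (LINT x:ball 0 R|lborel. f x)"
proof -
  have null: "emeasure lborel (cball (0::'a) R - ball 0 R) = 0"
  proof -
    have "emeasure lborel (cball (0::'a) R - ball 0 R) = emeasure lborel (cball (0::'a) R) - emeasure lborel (ball (0::'a) R)"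
      using emeasure_lborel_ball_finite[of "0::'a" R] by (intro emeasure_Diff) auto
    also have "\<dots> = 0" using R by (simp add: emeasure_cball emeasure_ball)
    finally show ?thesis .
  qed
  have i: "integrable lborel (\<lambda>x. indicator (ball 0 R) x *\<^sub>R f x)"
    using set_integrable_bounded_continuous[of "cball (0::'a) R" f "ball 0 R"] continuous_on_subset[OF c]
    by (auto simp: set_integrable_def)
  have "AE x in lborel. x \<notin> cball (0::'a) R - ball 0 R"
    using null by (intro AE_not_in) (auto simp: null_sets_def)
  then have "(\<integral>\<^sup>+x\<in>cball 0 R. ennreal (f x) \<partial>lborel) = (\<integral>\<^sup>+x. ennreal (indicator (ball 0 R) x *\<^sub>R f x) \<partial>lborel)"
    by (intro nn_integral_cong_AE) (auto simp: indicator_def elim!: eventually_mono)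
  also have "\<dots> = ennreal (LINT x:ball 0 R|lborel. f x)"
    unfolding set_lebesgue_integral_def by (rule nn_integral_eq_integral[OF i]) (auto simp: f indicator_def)
  finally show ?thesis by (simp add: nn_integral_completion)
qed

lemma ball_vol_expansion:
  assumes ad: "admissible_warp p" and \<rho>: "R > 0"
    and w: "\<And>x::'a::euclidean_space. norm x < R \<Longrightarrow> \<bar>model_weight p x - (1 + b * (norm x)\<^sup>2)\<bar> \<le> \<eta> * (norm x)\<^sup>2"
  defines "\<omega> \<equiv> measure lborel (ball (0::'a) 1)" and "n \<equiv> real DIM('a)"
  shows "ball_vol p TYPE('a) R \<ge> \<omega> * R ^ DIM('a) * (1 + (b - \<eta>) * n / (n + 2) * R\<^sup>2)"
    "ball_vol p TYPE('a) R \<le> \<omega> * R ^ DIM('a) * (1 + (b + \<eta>) * n / (n + 2) * R\<^sup>2)"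
proof -
  have int: "set_integrable lborel (ball (0::'a) R) f" if "continuous_on UNIV f" for f :: "'a \<Rightarrow> real"
    by (rule set_integrable_bounded_continuous[of "cball 0 R"]) (auto intro: continuous_on_subset[OF that])
  have cw: "continuous_on UNIV (model_weight p :: 'a \<Rightarrow> real)" using continuous_model_weight[OF ad] .
  have w0: "model_weight p (x::'a) > 0" for x using model_weight_pos[OF ad] .
  have i: "integrable lborel (\<lambda>x::'a. indicator (ball 0 R) x *\<^sub>R model_weight p x)"
    using int[OF cw] by (simp add: set_integrable_def)
  have "ennreal (ball_vol p TYPE('a) R) = emeasure (model_vol p) (ball (0::'a) R)"
    by (simp add: emeasure_ball_vol[OF ad])
  also have "\<dots> = (\<integral>\<^sup>+x. ennreal (model_weight p x) * indicator (ball (0::'a) R) x \<partial>lebesgue)"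
    unfolding model_vol_def using model_weight_measurable(3)[OF ad] by (intro emeasure_density) auto
  also have "\<dots> = (\<integral>\<^sup>+x. ennreal (indicator (ball (0::'a) R) x *\<^sub>R model_weight p x) \<partial>lborel)"
    unfolding nn_integral_completion by (intro nn_integral_cong) (auto simp: indicator_def)
  also have "\<dots> = ennreal (LINT x:ball (0::'a) R|lborel. model_weight p x)"
    unfolding set_lebesgue_integral_def using w0[THEN less_imp_le]
    by (intro nn_integral_eq_integral[OF i]) (auto simp: indicator_def)
  finally have V: "ball_vol p TYPE('a) R = (LINT x:ball (0::'a) R|lborel. model_weight p x)"
    using w0[THEN less_imp_le]
    by (subst (asm) ennreal_inj) (auto simp: ball_vol_def set_lebesgue_integral_def intro!: integral_nonneg_AE)
  have L: "(LINT x:ball (0::'a) R|lborel. 1 + c * (norm x)\<^sup>2) = \<omega> * R ^ DIM('a) * (1 + c * n / (n + 2) * R\<^sup>2)" for c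
  proof -
    have "(LINT x:ball (0::'a) R|lborel. 1 + c * (norm x)\<^sup>2) = (LINT x:ball (0::'a) R|lborel. 1) + c * (LINT x:ball (0::'a) R|lborel. (norm x)\<^sup>2)"
      by (subst set_integral_add) (auto intro!: int continuous_intros)
    then show ?thesis using ball_moments(1,2)[OF \<rho>, where 'a='a]
      by (simp add: \<omega>_def n_def power_add power2_eq_square algebra_simps)
  qed
  have c: "continuous_on UNIV (\<lambda>x::'a. 1 + c * (norm x)\<^sup>2)" for c by (intro continuous_intros)
  show "ball_vol p TYPE('a) R \<ge> \<omega> * R ^ DIM('a) * (1 + (b - \<eta>) * n / (n + 2) * R\<^sup>2)"
    unfolding V L[symmetric]
  proof (rule set_integral_mono[OF int[OF c] int[OF cw]])
    fix x :: 'a assume "x \<in> ball 0 R"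
    then show "1 + (b - \<eta>) * (norm x)\<^sup>2 \<le> model_weight p x" using w[of x] by (simp add: algebra_simps abs_le_iff)
  qed
  show "ball_vol p TYPE('a) R \<le> \<omega> * R ^ DIM('a) * (1 + (b + \<eta>) * n / (n + 2) * R\<^sup>2)"
    unfolding V L[symmetric]
  proof (rule set_integral_mono[OF int[OF cw] int[OF c]])
    fix x :: 'a assume "x \<in> ball 0 R"
    then show "model_weight p x \<le> 1 + (b + \<eta>) * (norm x)\<^sup>2" using w[of x] by (simp add: algebra_simps abs_le_iff)
  qed
qed

text \<open>The last factor is an upper bound for the torsional rigidity of the ball. Its flat part
  \<open>\<omega> / (n * (n + 2)) * R ^ (DIM('a) + 2)\<close> is the Euclidean value, and the
  correction comes from integrating the expansion of the squared field over the weight with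
  \<open>ball_moments\<close>.\<close>

lemma polya_szego_small_balls:
  assumes ad: "admissible_warp p" and PS: "polya_szego p TYPE('a::euclidean_space)" and \<eta>: "\<eta> > 0"
  defines "\<omega> \<equiv> measure lborel (ball (0::'a) 1)" and "n \<equiv> real DIM('a)"
    and "b \<equiv> (real DIM('a) - 1) * deriv (deriv (deriv p)) 0 / 6"
  obtains \<rho> where "\<rho> > 0"
    "\<And>R. 0 < R \<Longrightarrow> R < \<rho> \<Longrightarrow> ball_vol p TYPE('a) R \<ge> \<omega> * R ^ DIM('a) * (1 + (b - \<eta>) * n / (n + 2) * R\<^sup>2)"
    "\<And>R. 0 < R \<Longrightarrow> R < \<rho> \<Longrightarrow> ball_vol p TYPE('a) R \<le> \<omega> * R ^ DIM('a) * (1 + (b + \<eta>) * n / (n + 2) * R\<^sup>2)"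
    "\<And>R (v :: 'a \<Rightarrow> real). 0 < R \<Longrightarrow> R < \<rho> \<Longrightarrow> test_fun v \<Longrightarrow> (\<And>x. v x \<ge> 0) \<Longrightarrow> energy p (egrad v) < \<infinity> \<Longrightarrow>
      emeasure (model_vol p) {x. v x \<noteq> 0} \<le> ennreal (ball_vol p TYPE('a) R) \<Longrightarrow>
      (\<integral>\<^sup>+x. ennreal (v x) \<partial>model_vol p)\<^sup>2 \<le> energy p (egrad v) *
        ennreal (\<omega> / n * R ^ (DIM('a) + 2) * (1 / (n + 2) + (b * (n - 2) / (n + 2) + 4 * \<eta>) / (n + 4) * R\<^sup>2))"
proof -
  have n: "n > 0" by (simp add: n_def)
  obtain \<rho>1 where \<rho>1: "\<rho>1 > 0" "\<And>x::'a. norm x < \<rho>1 \<Longrightarrow> \<bar>model_weight p x - (1 + b * (norm x)\<^sup>2)\<bar> \<le> \<eta> * (norm x)\<^sup>2"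
    using model_weight_expansion[OF ad \<eta>, where 'a='a] unfolding b_def by blast
  \<comment> \<open>Makes the divergence of the field in \<open>energy_duality\<close> equal to
    \<open>1 + (b + \<eta>) * (norm x)\<^sup>2\<close>, an upper bound for the weight.\<close>
  define a where "a = n * (b + \<eta>) / (n + 2)"
  \<comment> \<open>First order coefficient of \<open>(1 + a * s)\<^sup>2\<close> over the weight.
    One \<open>\<eta>\<close> pays for the lower bound on the weight, the other absorbs the terms of
    order \<open>s\<^sup>2\<close>.\<close>
  define \<gamma> where "\<gamma> = 2 * a - b + 2 * \<eta>"
  have \<gamma>: "\<gamma> \<le> b * (n - 2) / (n + 2) + 4 * \<eta>"
  proof -
    have "\<gamma> = b * (n - 2) / (n + 2) + (2 * n / (n + 2) + 2) * \<eta>"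
      using n by (simp add: \<gamma>_def a_def divide_simps) (simp add: algebra_simps)
    also have "(2 * n / (n + 2) + 2) * \<eta> \<le> 4 * \<eta>" using n \<eta> by (intro mult_right_mono) (auto simp: field_simps)
    finally show ?thesis by simp
  qed
  \<comment> \<open>Large enough that \<open>s * C \<le> \<eta>\<close> controls the quadratic
    remainder and \<open>s * C \<le> 1\<close> keeps \<open>1 + \<gamma> * s\<close>
    nonnegative.\<close>
  define C where "C = \<bar>a\<^sup>2 - (b - \<eta>) * \<gamma>\<bar> + \<bar>\<gamma>\<bar> + \<bar>b - \<eta>\<bar> + 1"
  have C: "C > 0" by (simp add: C_def)
  define \<rho> where "\<rho> = min \<rho>1 (min 1 (min (\<eta> / C) (1 / C)))"
  have \<rho>: "\<rho> > 0" "\<rho> \<le> \<rho>1" using \<rho>1(1) \<eta> C by (auto simp: \<rho>_def)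
  show ?thesis
  proof (rule that[OF \<rho>(1)])
    fix R assume R: "0 < R" "R < \<rho>"
    have wR: "\<bar>model_weight p x - (1 + b * (norm x)\<^sup>2)\<bar> \<le> \<eta> * (norm x)\<^sup>2" if "norm x \<le> R" for x :: 'a
      using \<rho>1(2)[of x] that R \<rho> by simp
    show "ball_vol p TYPE('a) R \<ge> \<omega> * R ^ DIM('a) * (1 + (b - \<eta>) * n / (n + 2) * R\<^sup>2)"
      unfolding \<omega>_def n_def by (rule ball_vol_expansion(1)[OF ad R(1)]) (simp add: wR)
    show "ball_vol p TYPE('a) R \<le> \<omega> * R ^ DIM('a) * (1 + (b + \<eta>) * n / (n + 2) * R\<^sup>2)"
      unfolding \<omega>_def n_def by (rule ball_vol_expansion(2)[OF ad R(1)]) (simp add: wR)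
    fix v :: "'a \<Rightarrow> real"
    assume v: "test_fun v" "\<And>x. v x \<ge> 0" "energy p (egrad v) < \<infinity>"
      "emeasure (model_vol p) {x. v x \<noteq> 0} \<le> ennreal (ball_vol p TYPE('a) R)"
    define g where "g x = (norm x)\<^sup>2 / n\<^sup>2 * (1 + \<gamma> * (norm x)\<^sup>2)" for x :: 'a
    define h where "h x = ((1 + a * (norm x)\<^sup>2) / n * norm x)\<^sup>2 / model_weight p x" for x :: 'a
    have w0: "model_weight p (x::'a) > 0" for x using model_weight_pos[OF ad] .
    have hg: "h x \<le> g x" if x: "norm x \<le> R" for x
    proof -
      define s where "s = (norm x)\<^sup>2"
      have s0: "s \<ge> 0" by (simp add: s_def)
      have "s \<le> R\<^sup>2" using x by (simp add: s_def power_mono)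
      also have "R\<^sup>2 \<le> R" using R unfolding \<rho>_def power2_eq_square by (intro mult_left_le) auto
      also have "R \<le> min (\<eta> / C) (1 / C)" using R unfolding \<rho>_def by linarith
      finally have s: "s * C \<le> \<eta>" "s * C \<le> 1" using C by (auto simp: field_simps)
      have "s * \<bar>\<gamma>\<bar> \<le> s * C" using s0 by (intro mult_left_mono) (auto simp: C_def)
      then have g1: "1 + \<gamma> * s \<ge> 0" using s(2) s0 by (cases "\<gamma> \<ge> 0") (auto simp: mult.commute)
      have "(a\<^sup>2 - (b - \<eta>) * \<gamma>) * s \<le> C * s" using s0 by (intro mult_right_mono) (auto simp: C_def)
      then have "(a\<^sup>2 - (b - \<eta>) * \<gamma>) * s \<le> \<eta>" using s(1) by (simp add: mult.commute)
      from mult_right_mono[OF this s0]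
      have "(1 + a * s)\<^sup>2 \<le> (1 + (b - \<eta>) * s) * (1 + \<gamma> * s)"
        by (simp add: \<gamma>_def power2_eq_square algebra_simps)
      also have "\<dots> \<le> model_weight p x * (1 + \<gamma> * s)"
        using wR[OF x] g1 by (intro mult_right_mono) (auto simp: s_def algebra_simps abs_le_iff)
      finally have "(1 + a * s)\<^sup>2 / model_weight p x \<le> 1 + \<gamma> * s" using w0[of x] by (simp add: divide_le_eq mult.commute)
      from mult_left_mono[OF this, of "s / n\<^sup>2"] show ?thesis
        using s0 by (simp add: h_def g_def s_def power_mult_distrib power_divide mult.commute mult.left_commute)
    qed
    have ch: "continuous_on UNIV h" unfolding h_def[abs_def]
      using w0[THEN less_imp_neq, symmetric] n by (intro continuous_intros continuous_model_weight[OF ad]) auto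
    have int: "set_integrable lborel (ball (0::'a) R) f" if "continuous_on UNIV f" for f :: "'a \<Rightarrow> real"
      by (rule set_integrable_bounded_continuous[of "cball 0 R"]) (auto intro: continuous_on_subset[OF that])
    have cg: "continuous_on UNIV g" unfolding g_def[abs_def] using n by (intro continuous_intros) auto
    have "(LINT x:ball (0::'a) R|lborel. h x) \<le> (LINT x:ball (0::'a) R|lborel. g x)"
      by (rule set_integral_mono[OF int[OF ch] int[OF cg]]) (simp add: hg)
    also have "\<dots> = (LINT x:ball (0::'a) R|lborel. 1 / n\<^sup>2 * (norm x)\<^sup>2 + \<gamma> / n\<^sup>2 * (norm x) ^ 4)"
    proof -
      have "g x = 1 / n\<^sup>2 * (norm x)\<^sup>2 + \<gamma> / n\<^sup>2 * (norm x) ^ 4" for x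
        by (simp add: g_def distrib_left power4_eq_xxxx power2_eq_square add_divide_distrib mult_ac)
      then show ?thesis by simp
    qed
    also have "\<dots> = 1 / n\<^sup>2 * (LINT x:ball (0::'a) R|lborel. (norm x)\<^sup>2) + \<gamma> / n\<^sup>2 * (LINT x:ball (0::'a) R|lborel. (norm x) ^ 4)"
      by (subst set_integral_add) (auto intro!: int continuous_intros simp del: times_divide_eq_left)
    also have "\<dots> = \<omega> / n * R ^ (DIM('a) + 2) * (1 / (n + 2) + \<gamma> / (n + 4) * R\<^sup>2)"
      unfolding ball_moments(2,3)[OF R(1), where 'a='a, folded n_def \<omega>_def] using n
      by (simp add: power_add power2_eq_square power4_eq_xxxx divide_simps) (simp add: algebra_simps)
    also have "\<dots> \<le> \<omega> / n * R ^ (DIM('a) + 2) * (1 / (n + 2) + (b * (n - 2) / (n + 2) + 4 * \<eta>) / (n + 4) * R\<^sup>2)"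
      using n \<gamma> R by (intro mult_left_mono add_left_mono mult_right_mono divide_right_mono) (auto simp: \<omega>_def)
    finally have T: "(LINT x:ball (0::'a) R|lborel. h x) \<le> \<omega> / n * R ^ (DIM('a) + 2) * (1 / (n + 2) + (b * (n - 2) / (n + 2) + 4 * \<eta>) / (n + 4) * R\<^sup>2)" .
    have "(\<integral>\<^sup>+x. ennreal (v x) \<partial>model_vol p)\<^sup>2 \<le> energy p (egrad v) *
       (\<integral>\<^sup>+x\<in>cball (0::'a) R. ennreal (((1 + a * (norm x)\<^sup>2) / DIM('a) * norm x)\<^sup>2 / model_weight p x) \<partial>lebesgue)"
    proof (rule polya_szego_torsion[OF ad PS v(1,2,3) R(1) v(4)])
      fix x :: 'a assume x: "norm x \<le> R"
      have "a * (DIM('a) + 2) / DIM('a) = b + \<eta>" using n by (simp add: a_def n_def[symmetric] add.commute[of 2])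
      then show "model_weight p x \<le> 1 + a * (DIM('a) + 2) / DIM('a) * (norm x)\<^sup>2"
        using wR[OF x] by (simp add: algebra_simps abs_le_iff)
    qed
    also have "(\<integral>\<^sup>+x\<in>cball (0::'a) R. ennreal (((1 + a * (norm x)\<^sup>2) / DIM('a) * norm x)\<^sup>2 / model_weight p x) \<partial>lebesgue)
      = ennreal (LINT x:ball (0::'a) R|lborel. h x)"
    proof -
      have "h x \<ge> 0" for x using w0[of x] by (simp add: h_def)
      from set_nn_integral_ball_eq[OF ch this R(1)] show ?thesis by (simp add: h_def n_def)
    qed
    also have "energy p (egrad v) * \<dots> \<le> energy p (egrad v) *
        ennreal (\<omega> / n * R ^ (DIM('a) + 2) * (1 / (n + 2) + (b * (n - 2) / (n + 2) + 4 * \<eta>) / (n + 4) * R\<^sup>2))"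
      using T by (intro mult_left_mono ennreal_leI) auto
    finally show "(\<integral>\<^sup>+x. ennreal (v x) \<partial>model_vol p)\<^sup>2 \<le> energy p (egrad v) *
        ennreal (\<omega> / n * R ^ (DIM('a) + 2) * (1 / (n + 2) + (b * (n - 2) / (n + 2) + 4 * \<eta>) / (n + 4) * R\<^sup>2))" .
  qed
qed

lemma smooth_within_subset:
  assumes "smooth_within T f" "S \<subseteq> T" shows "smooth_within S f"
  using assms(1)
proof (coinduction arbitrary: f)
  case (smooth_within f)
  then show ?case
    using smooth_within_differentiable[of T f] smooth_within_partial[of T f] assms(2) by blast
qed

section \<open>Geometry near a point off the pole\<close>

text \<open>By rotational symmetry the point at distance \<open>r0\<close> may be placed on the axis
  of a basis vector \<open>e\<close>, the direction in which integration by parts is then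
  performed.\<close>

locale off_pole =
  fixes p :: "real \<Rightarrow> real" and r0 :: real and e :: "'a::euclidean_space"
  assumes ad: "admissible_warp p" and r0: "r0 > 0" and e: "e \<in> Basis" and dim: "DIM('a) \<ge> 2"
begin

definition n :: real where "n = real DIM('a)"
text \<open>Functions near the point are written in the coordinates \<open>r = norm x\<close> and \<open>u = ang x\<close>, one minus
the cosine of the angle to \<open>e\<close>. Unlike the angle, \<open>u\<close> is smooth on the axis.\<close>
definition ang :: "'a \<Rightarrow> real" where "ang x = 1 - (x \<bullet> e) / norm x"
definition dang :: "'a \<Rightarrow> 'a \<Rightarrow> real" where
  "dang x h = (x \<bullet> e) * (x \<bullet> h) / norm x ^ 3 - (h \<bullet> e) / norm x"

text \<open>Quadratic polynomials in \<open>ang\<close> with radial coefficients; \<open>q\<close>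
  and the components of the weighted fields all have this form.\<close>

definition polar :: "(real \<Rightarrow> real) \<Rightarrow> (real \<Rightarrow> real) \<Rightarrow> (real \<Rightarrow> real) \<Rightarrow> 'a \<Rightarrow> real" where
  "polar f0 f1 f2 x = f0 (norm x) + f1 (norm x) * ang x + f2 (norm x) * (ang x)\<^sup>2"

definition dpolar :: "(real \<Rightarrow> real) \<Rightarrow> (real \<Rightarrow> real) \<Rightarrow> (real \<Rightarrow> real) \<Rightarrow> (real \<Rightarrow> real) \<Rightarrow> (real \<Rightarrow> real) \<Rightarrow> 'a \<Rightarrow> 'a \<Rightarrow> real" where
  "dpolar f1 f2 f0' f1' f2' x h = (f0' (norm x) + f1' (norm x) * ang x + f2' (norm x) * (ang x)\<^sup>2) * ((x \<bullet> h) / norm x)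
     + (f1 (norm x) + 2 * f2 (norm x) * ang x) * dang x h"

lemma n_ge_2: "n \<ge> 2" using dim by (simp add: n_def)

lemma e_norm: "e \<bullet> e = 1" "norm e = 1" using e by (simp_all add: inner_same_Basis)

lemma norm_has_derivative: "x \<noteq> 0 \<Longrightarrow> (norm has_derivative (\<lambda>h. (x \<bullet> h) / norm x)) (at (x::'a))"
  using has_derivative_norm[of x] by (simp add: sgn_div_norm inner_commute divide_inverse mult.commute)

lemma ang_has_derivative:
  assumes x: "x \<noteq> 0" shows "(ang has_derivative dang x) (at x)"
proof -
  have "((\<lambda>x. x \<bullet> e) has_derivative (\<lambda>h. h \<bullet> e)) (at x)" by (auto intro!: derivative_eq_intros)
  from has_derivative_diff[OF has_derivative_const has_derivative_divide'[OF this norm_has_derivative[OF x]]]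
  show ?thesis unfolding ang_def[abs_def]
    by (rule has_derivative_eq_rhs) (use x in \<open>auto simp: dang_def fun_eq_iff field_simps power3_eq_cube\<close>)
qed

lemma polar_has_derivative:
  assumes x: "x \<noteq> 0" and "(f0 has_real_derivative f0' (norm x)) (at (norm x))"
    "(f1 has_real_derivative f1' (norm x)) (at (norm x))" "(f2 has_real_derivative f2' (norm x)) (at (norm x))"
  shows "(polar f0 f1 f2 has_derivative dpolar f1 f2 f0' f1' f2' x) (at x)"
proof -
  have c: "((\<lambda>x. f (norm x)) has_derivative (\<lambda>h. f' * ((x \<bullet> h) / norm x))) (at x)"
    if "(f has_real_derivative f') (at (norm x))" for f :: "real \<Rightarrow> real" and f'
    using has_derivative_compose[OF norm_has_derivative[OF x] that[unfolded has_field_derivative_def]] .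
  note a = ang_has_derivative[OF x]
  have a2: "((\<lambda>x. (ang x)\<^sup>2) has_derivative (\<lambda>h. 2 * ang x * dang x h)) (at x)"
    using has_derivative_mult[OF a a] by (simp add: power2_eq_square algebra_simps)
  show ?thesis
    unfolding polar_def[abs_def]
    by (rule has_derivative_eq_rhs[OF has_derivative_add[OF has_derivative_add[OF c[OF assms(2)]
          has_derivative_mult[OF c[OF assms(3)] a]] has_derivative_mult[OF c[OF assms(4)] a2]]])
      (simp add: dpolar_def fun_eq_iff algebra_simps)
qed

lemma dang_radial: "x \<noteq> 0 \<Longrightarrow> dang x x = 0"
  by (simp add: dang_def power2_norm_eq_inner[symmetric] power2_eq_square power3_eq_cube)

text \<open>Here \<open>2 * u - u\<^sup>2\<close> is the squared sine of the angle to
  \<open>e\<close>, because \<open>1 - u\<close> is its cosine.\<close>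

lemma dang_e: "x \<noteq> 0 \<Longrightarrow> dang x e = - (2 * ang x - (ang x)\<^sup>2) / norm x"
  by (simp add: dang_def ang_def e_norm field_simps power2_eq_square power3_eq_cube)

lemma cos_ang: "(x \<bullet> e) / norm x = 1 - ang x" by (simp add: ang_def)

lemma dpolar_radial: "x \<noteq> 0 \<Longrightarrow> dpolar f1 f2 f0' f1' f2' x x =
  norm x * (f0' (norm x) + f1' (norm x) * ang x + f2' (norm x) * (ang x)\<^sup>2)"
  by (simp add: dpolar_def dang_radial power2_norm_eq_inner[symmetric] power2_eq_square)

lemma dpolar_e: "x \<noteq> 0 \<Longrightarrow> dpolar f1 f2 f0' f1' f2' x e =
  (1 - ang x) * (f0' (norm x) + f1' (norm x) * ang x + f2' (norm x) * (ang x)\<^sup>2)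
   - (f1 (norm x) + 2 * f2 (norm x) * ang x) * ((2 * ang x - (ang x)\<^sup>2) / norm x)"
  unfolding dpolar_def dang_e cos_ang[symmetric] by (simp add: field_simps)

lemma ang_bounds: "0 \<le> ang x" "ang x \<le> 2"
  using Cauchy_Schwarz_ineq2[of x e] by (auto simp: ang_def e_norm divide_le_eq le_divide_eq abs_le_iff)

lemma smooth_within_polar:
  assumes N: "open N" "0 \<notin> N" and f: "smooth_within {0<..} f0" "smooth_within {0<..} f1" "smooth_within {0<..} f2"
  shows "smooth_within N (polar f0 f1 f2)"
proof -
  have c: "smooth_within N (\<lambda>x. f (norm x))" if "smooth_within {0<..} f" for f
    by (rule smooth_within_compose[OF N(1) _ that smooth_within_inverse_norm(2)[OF N]]) (use N in auto)
  have a: "smooth_within N ang"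
    unfolding ang_def[abs_def] divide_inverse
    by (intro smooth_within_diff smooth_within_const smooth_within_mult smooth_within_inner smooth_within_inverse_norm N)
  show ?thesis unfolding polar_def[abs_def]
    by (intro smooth_within_add smooth_within_mult smooth_within_power c a f N)
qed

definition p0 :: real where "p0 = p r0"
definition p1 :: real where "p1 = deriv p r0"
definition p2 :: real where "p2 = deriv (deriv p) r0"
definition w1 :: "real \<Rightarrow> real" where "w1 r = (p r * inverse r) ^ (DIM('a) - 1)"

text \<open>Half the squared distance to the point, up to terms that do not matter at second order.\<close>
definition q :: "'a \<Rightarrow> real" where "q = polar (\<lambda>r. (r - r0)\<^sup>2 / 2) (\<lambda>r. p0 * p r) (\<lambda>_. 0)"

text \<open>The radial derivative and the squared metric gradient of \<open>q\<close>.\<close>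
definition qr :: "real \<Rightarrow> real \<Rightarrow> real" where "qr r u = (r - r0) + p0 * deriv p r * u"
definition GR :: "real \<Rightarrow> real \<Rightarrow> real" where "GR r u = (qr r u)\<^sup>2 + p0\<^sup>2 * (2 * u - u\<^sup>2)"

text \<open>The vector field is \<open>\<alpha> \<partial>\<^sub>r + \<beta> T\<close>, where \<open>T\<close> is the tangential field with
\<open>T u = 2 u - u\<^sup>2\<close>, \<open>\<alpha> = (r - r0) + fa g r * u\<close> and \<open>\<beta> = fb h r + d * u\<close>.\<close>
definition fa :: "real \<Rightarrow> real \<Rightarrow> real" where "fa g r = p0 * deriv p r + 2 * g * p0\<^sup>2 * (r - r0)"
definition fb :: "real \<Rightarrow> real \<Rightarrow> real" where "fb h r = p0 * inverse (p r) + h * (r - r0)\<^sup>2"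

text \<open>The derivative of \<open>q\<close> along the field and the divergence of the field.\<close>
definition DZ :: "real \<Rightarrow> real \<Rightarrow> real \<Rightarrow> real \<Rightarrow> real \<Rightarrow> real" where
  "DZ g h d r u = qr r u * ((r - r0) + fa g r * u) + p0 * p r * (fb h r + d * u) * (2 * u - u\<^sup>2)"
definition DV :: "real \<Rightarrow> real \<Rightarrow> real \<Rightarrow> real \<Rightarrow> real \<Rightarrow> real" where
  "DV g h d r u = 1 + (p0 * deriv (deriv p) r + 2 * g * p0\<^sup>2) * u
     + (n - 1) * (deriv p r / p r) * ((r - r0) + fa g r * u) + d * (2 * u - u\<^sup>2)
     + (n - 1) * (fb h r + d * u) * (1 - u)"

lemma p0_pos: "p0 > 0" using admissible_warpD(7)[OF ad r0] by (simp add: p0_def)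

lemma model_weight_w1: "x \<noteq> 0 \<Longrightarrow> model_weight p (x::'a) = w1 (norm x)"
  by (simp add: model_weight_def w1_def divide_inverse)

lemma w1_has_derivative:
  assumes "r > 0"
  shows "(w1 has_real_derivative (n - 1) * w1 r * (deriv p r / p r - 1 / r)) (at r)"
proof -
  have pr: "p r > 0" using admissible_warpD(7)[OF ad assms] .
  define k where "k = DIM('a) - 2"
  have k: "DIM('a) - 1 = Suc k" "n - 1 = real (Suc k)" using dim by (auto simp: k_def n_def of_nat_diff)
  have "((\<lambda>r. p r * inverse r) has_real_derivative deriv p r * inverse r - p r * inverse r * inverse r) (at r)"
    using assms admissible_warpD(1)[OF ad, of r] by (auto intro!: derivative_eq_intros simp: power2_eq_square)
  from DERIV_power[OF this, of "Suc k"] show ?thesis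
    unfolding w1_def[abs_def] k
    by (rule DERIV_cong) (use assms pr in \<open>simp add: field_simps\<close>)
qed

lemma smooth_radial:
  "smooth_within {0<..} p" "smooth_within {0<..} (deriv p)" "smooth_within {0<..} w1"
  "smooth_within {0<..} (\<lambda>r. inverse (p r))" "smooth_within {0<..} (\<lambda>r::real. r)" "smooth_within {0<..} (inverse :: real \<Rightarrow> real)"
proof -
  have sp: "smooth_real p" using ad by (simp add: admissible_warp_def)
  then have sp': "smooth_real (deriv p)" unfolding smooth_real_def by (metis funpow_swap1 comp_apply funpow.simps(2))
  show 1: "smooth_within {0<..} p" "smooth_within {0<..} (deriv p)"
    using smooth_real_imp_smooth_within[OF sp] smooth_real_imp_smooth_within[OF sp'] smooth_within_subset by blast+
  show "smooth_within {0<..} (\<lambda>r. inverse (p r))"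
    by (rule smooth_within_compose[OF _ _ smooth_within_inverse_real 1(1)]) (use admissible_warpD(7)[OF ad] in auto)
  show 2: "smooth_within {0<..} (inverse :: real \<Rightarrow> real)" by (rule smooth_within_inverse_real)
  show "smooth_within {0<..} w1" unfolding w1_def[abs_def]
    by (intro smooth_within_power smooth_within_mult 1 2) auto
  show "smooth_within {0<..} (\<lambda>r::real. r)"
    using smooth_within_inner[of "{0<..}::real set" 1] by simp
qed

lemma smooth_fa_fb: "smooth_within {0<..} (fa g)" "smooth_within {0<..} (fb h)"
  unfolding fa_def[abs_def] fb_def[abs_def]
  by (intro smooth_within_add smooth_within_mult smooth_within_const smooth_within_power smooth_within_diff smooth_radial open_greaterThan)+

definition q' :: "'a \<Rightarrow> 'a \<Rightarrow> real" where
  "q' = dpolar (\<lambda>r. p0 * p r) (\<lambda>_. 0) (\<lambda>r. r - r0) (\<lambda>r. p0 * deriv p r) (\<lambda>_. 0)"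

lemma q_has_derivative: "x \<noteq> 0 \<Longrightarrow> (q has_derivative q' x) (at x)"
  unfolding q_def q'_def
  by (rule polar_has_derivative) (auto intro!: derivative_eq_intros admissible_warpD(1)[OF ad])

lemma q'_simps:
  assumes "x \<noteq> 0"
  shows "q' x x = norm x * qr (norm x) (ang x)"
    "q' x e = (1 - ang x) * qr (norm x) (ang x) - p0 * p (norm x) * ((2 * ang x - (ang x)\<^sup>2) / norm x)"
  using assms by (simp_all add: q'_def dpolar_radial dpolar_e qr_def)

lemma smooth_within_q: "open N \<Longrightarrow> 0 \<notin> N \<Longrightarrow> smooth_within N q"
  unfolding q_def divide_inverse
  by (intro smooth_within_polar smooth_within_mult smooth_within_const smooth_within_power smooth_within_diff smooth_radial open_greaterThan)

text \<open>Multiplying a field by the weight turns its Riemannian divergence, times the weight,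
  into a Euclidean divergence. The weighted field is then a combination of \<open>x\<close> and
  \<open>e\<close>, to which \<open>sublevel_integration_by_parts\<close> applies.\<close>

lemma field_integration_by_parts:
  assumes N: "open N" "0 \<notin> N" and K: "compact {x \<in> N. q x \<le> D}" and j: "j \<ge> 1"
  shows "(LINT x:{x \<in> N. q x < D}|lborel. real j * (D - q x) ^ (j - 1) * (model_weight p x * DZ g h d (norm x) (ang x)))
    = (LINT x:{x \<in> N. q x < D}|lborel. (D - q x) ^ j * (model_weight p x * DV g h d (norm x) (ang x)))"
proof -
  let ?t = "\<lambda>r::real. r - r0"
  \<comment> \<open>The tangential field \<open>T\<close> is
    \<open>(1 - u) *\<^sub>R x - r *\<^sub>R e\<close>. Hence the components along \<open>x\<close>
    and \<open>- e\<close> are the weight times \<open>\<alpha> / r + \<beta> * (1 - u)\<close> and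
    the weight times \<open>\<beta> * r\<close>; the radial coefficients below are those of the
    powers of \<open>u\<close>.\<close>
  define A0 where "A0 r = w1 r * (?t r * inverse r + fb h r)" for r
  define A1 where "A1 r = w1 r * (fa g r * inverse r - fb h r + d)" for r
  define A2 where "A2 r = - (w1 r * d)" for r
  define B0 where "B0 r = w1 r * fb h r * r" for r
  define B1 where "B1 r = w1 r * d * r" for r
  define P where "P = polar A0 A1 A2"
  define Q where "Q = polar B0 B1 (\<lambda>_. 0)"
  define w1' where "w1' r = (n - 1) * w1 r * (deriv p r / p r - 1 / r)" for r
  define fa' where "fa' r = p0 * deriv (deriv p) r + 2 * g * p0\<^sup>2" for r
  define fb' where "fb' r = - (p0 * deriv p r / (p r)\<^sup>2) + 2 * h * (r - r0)" for r
  define A0' where "A0' r = w1' r * (?t r * inverse r + fb h r) + w1 r * (inverse r - ?t r * inverse r * inverse r + fb' r)" for r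
  define A1' where "A1' r = w1' r * (fa g r * inverse r - fb h r + d) + w1 r * (fa' r * inverse r - fa g r * inverse r * inverse r - fb' r)" for r
  define A2' where "A2' r = - (w1' r * d)" for r
  define B0' where "B0' r = w1' r * fb h r * r + w1 r * fb' r * r + w1 r * fb h r" for r
  define B1' where "B1' r = w1' r * d * r + w1 r * d" for r
  have dw: "(w1 has_real_derivative w1' r) (at r)" if "r > 0" for r
    using w1_has_derivative[OF that] by (simp add: w1'_def)
  have dfa: "(fa g has_real_derivative fa' r) (at r)" for r
    unfolding fa_def[abs_def] fa'_def using admissible_warpD(2)[OF ad, of r]
    by (auto intro!: derivative_eq_intros)
  have dfb: "(fb h has_real_derivative fb' r) (at r)" if "r > 0" for r
    unfolding fb_def[abs_def] fb'_def using admissible_warpD(1)[OF ad, of r] admissible_warpD(7)[OF ad that]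
    by (auto intro!: derivative_eq_intros simp: power2_eq_square field_simps)
  have dinv: "((\<lambda>r. inverse r) has_real_derivative - (inverse r * inverse r)) (at r)" if "r > 0" for r :: real
    using that by (auto intro!: derivative_eq_intros simp: power2_eq_square)
  have dA0: "(A0 has_real_derivative A0' r) (at r)" if "r > 0" for r
    unfolding A0_def[abs_def] A0'_def
    by (rule DERIV_cong, (rule derivative_intros dw dfb dinv that)+) (simp add: algebra_simps)
  have dA1: "(A1 has_real_derivative A1' r) (at r)" if "r > 0" for r
    unfolding A1_def[abs_def] A1'_def
    by (rule DERIV_cong, (rule derivative_intros dw dfb dfa dinv that)+) (simp add: algebra_simps)
  have dA2: "(A2 has_real_derivative A2' r) (at r)" if "r > 0" for r
    unfolding A2_def[abs_def] A2'_def
    by (rule DERIV_cong, (rule derivative_intros dw that)+) (simp add: algebra_simps)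
  have dB0: "(B0 has_real_derivative B0' r) (at r)" if "r > 0" for r
    unfolding B0_def[abs_def] B0'_def
    by (rule DERIV_cong, (rule derivative_intros dw dfb that)+) (simp add: algebra_simps)
  have dB1: "(B1 has_real_derivative B1' r) (at r)" if "r > 0" for r
    unfolding B1_def[abs_def] B1'_def
    by (rule DERIV_cong, (rule derivative_intros dw that)+) (simp add: algebra_simps)
  define P' where "P' = dpolar A1 A2 A0' A1' A2'"
  define Q' where "Q' = dpolar B1 (\<lambda>_. 0) B0' B1' (\<lambda>_. 0)"
  have x0: "x \<noteq> 0" if "x \<in> N" for x using N that by auto
  have dP: "(P has_derivative P' x) (at x)" if "x \<in> N" for x
    unfolding P_def P'_def using x0[OF that] by (intro polar_has_derivative dA0 dA1 dA2) auto
  have dQ: "(Q has_derivative Q' x) (at x)" if "x \<in> N" for x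
    unfolding Q_def Q'_def using x0[OF that] by (intro polar_has_derivative dB0 dB1) auto
  have sP: "smooth_within N P" unfolding P_def A0_def[abs_def] A1_def[abs_def] A2_def[abs_def]
    by (intro smooth_within_polar N smooth_within_add smooth_within_mult smooth_within_minus smooth_within_const
        smooth_within_diff smooth_radial smooth_fa_fb open_greaterThan)
  have sQ: "smooth_within N Q" unfolding Q_def B0_def[abs_def] B1_def[abs_def]
    by (intro smooth_within_polar N smooth_within_mult smooth_within_const smooth_radial smooth_fa_fb open_greaterThan)
  have I: "(LINT x:{x \<in> N. q x < D}|lborel. j * (D - q x) ^ (j - 1) * (q' x x * P x - q' x e * Q x))
    = (LINT x:{x \<in> N. q x < D}|lborel. (D - q x) ^ j * (DIM('a) * P x + P' x x - Q' x e))"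
    by (rule sublevel_integration_by_parts[OF N(1) smooth_within_q[OF N] sP sQ K e j _ dP dQ])
      (use q_has_derivative x0 in auto)
  have e1: "q' x x * P x - q' x e * Q x = model_weight p x * DZ g h d (norm x) (ang x)" if "x \<in> N" for x
  proof -
    define r u where "r = norm x" and "u = ang x"
    have r: "r > 0" using x0[OF that] by (simp add: r_def)
    show ?thesis
      unfolding model_weight_w1[OF x0[OF that]] q'_simps[OF x0[OF that]] P_def Q_def polar_def DZ_def
        A0_def A1_def A2_def B0_def B1_def r_def[symmetric] u_def[symmetric]
      using r by (simp add: field_simps power2_eq_square)
  qed
  have e2: "DIM('a) * P x + P' x x - Q' x e = model_weight p x * DV g h d (norm x) (ang x)" if "x \<in> N" for x
  proof -
    define r u where "r = norm x" and "u = ang x"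
    have r: "r > 0" using x0[OF that] by (simp add: r_def)
    define H where "H = deriv p r / p r"
    show ?thesis
      unfolding model_weight_w1[OF x0[OF that]] P'_def Q'_def dpolar_radial[OF x0[OF that]] dpolar_e[OF x0[OF that]]
        P_def polar_def DV_def n_def[symmetric]
        A0_def A1_def A2_def B1_def A0'_def A1'_def A2'_def B0'_def B1'_def w1'_def fa'_def[symmetric]
        r_def[symmetric] u_def[symmetric] H_def[symmetric]
      using r by (simp add: field_simps power2_eq_square)
  qed
  have cong: "(LINT x:{x \<in> N. q x < D}|lborel. f x) = (LINT x:{x \<in> N. q x < D}|lborel. f' x)"
    if "\<And>x. x \<in> N \<Longrightarrow> f x = f' x" for f f' :: "'a \<Rightarrow> real"
    unfolding set_lebesgue_integral_def using that by (intro Bochner_Integration.integral_cong) (auto simp: indicator_def)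
  show ?thesis
    using I by (subst (asm) (1 2) cong) (auto simp: e1 e2 intro: cong)
qed

text \<open>The tangential part of the gradient of \<open>q\<close> has the factor
  \<open>p0 * p r\<close>, and the metric multiplies its square by \<open>(r / p r)\<^sup>2\<close>,
  so the warping function cancels except for \<open>p0\<close>.\<close>

lemma gnorm2_q:
  assumes x: "x \<noteq> 0" and D: "\<And>h. D \<bullet> h = q' x h"
  shows "gnorm2 p x D = GR (norm x) (ang x)"
proof -
  define r u where "r = norm x" and "u = ang x"
  have r: "r > 0" using x by (simp add: r_def)
  have pr: "p r > 0" using admissible_warpD(7)[OF ad r] .
  have a: "D \<bullet> x / r = qr r u" using r by (simp add: D q'_simps[OF x] r_def[symmetric] u_def[symmetric])
  have c: "x \<bullet> e = r * (1 - u)" using r by (simp add: u_def ang_def r_def)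
  \<comment> \<open>The Euclidean gradient of \<open>ang\<close>: orthogonal to \<open>x\<close>,
    with squared length \<open>(2 * u - u\<^sup>2) / r\<^sup>2\<close>.\<close>
  define T where "T = (1 / r) *\<^sub>R ((1 - u) *\<^sub>R ((1 / r) *\<^sub>R x) - e)"
  have Dv: "D = (qr r u / r) *\<^sub>R x + (p0 * p r) *\<^sub>R T"
  proof (rule vector_eq_ldot[THEN iffD1, rule_format])
    fix h
    have "h \<bullet> D = q' x h" using D[of h] by (simp add: inner_commute)
    also have "\<dots> = qr r u * ((x \<bullet> h) / r) + p0 * p r * dang x h"
      by (simp add: q'_def dpolar_def qr_def r_def u_def)
    also have "dang x h = T \<bullet> h"
      using r unfolding dang_def T_def r_def[symmetric] c
      by (simp add: inner_diff_left inner_commute[of e h] field_simps power3_eq_cube)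
    finally show "h \<bullet> D = h \<bullet> ((qr r u / r) *\<^sub>R x + (p0 * p r) *\<^sub>R T)"
      by (simp add: inner_add_right inner_commute[of h])
  qed
  have xx: "x \<bullet> x = r\<^sup>2" by (simp add: r_def power2_norm_eq_inner)
  have xT: "x \<bullet> T = 0" using r by (simp add: T_def inner_diff_right xx c power2_eq_square)
  have TT: "T \<bullet> T = (2 * u - u\<^sup>2) / r\<^sup>2"
    using r by (simp add: T_def inner_diff_left inner_diff_right xx c inner_commute[of e x] e_norm power2_eq_square)
      (simp add: field_simps)
  have "(norm D)\<^sup>2 = (qr r u)\<^sup>2 + (p0 * p r)\<^sup>2 * ((2 * u - u\<^sup>2) / r\<^sup>2)"
    unfolding power2_norm_eq_inner Dv using r
    by (simp add: inner_add_left inner_add_right xx xT inner_commute[of T x] TT)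
      (simp add: power2_eq_square)
  then show ?thesis
    using x r pr unfolding gnorm2_def Let_def r_def[symmetric] a GR_def u_def[symmetric]
    by (simp add: power_mult_distrib power_divide)
qed


text \<open>The radial and tangential sectional curvatures at the point.\<close>
definition Kr :: real where "Kr = - p2 / p0"
definition Kt :: real where "Kt = (1 - p1\<^sup>2) / p0\<^sup>2"

lemma scal_r0: "scal DIM('a) p r0 = (n - 1) * (2 * Kr + (n - 2) * Kt)"
  using p0_pos by (simp add: scal_def n_def[symmetric] Kr_def Kt_def p0_def[symmetric] p1_def[symmetric] p2_def[symmetric] field_simps)

text \<open>The quotient by \<open>(r - r0)\<^sup>2\<close> of the first order Taylor remainder of
  \<open>p\<close>, expanded about \<open>r\<close> and evaluated at \<open>r0\<close>; at
  \<open>r0\<close> it takes the limit value.\<close>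

definition kap :: "real \<Rightarrow> real" where
  "kap r = (if r = r0 then p2 / 2 else ((r - r0) * deriv p r + p0 - p r) / (r - r0)\<^sup>2)"

lemma kap_eq: "(r - r0) * deriv p r + p0 - p r = kap r * (r - r0)\<^sup>2"
  by (simp add: kap_def p0_def)

lemma kap_tendsto: "(kap \<longlongrightarrow> p2 / 2) (nhds r0)"
proof -
  have "((\<lambda>r. ((r - r0) * deriv p r + p0 - p r) / (r - r0)\<^sup>2) \<longlongrightarrow> p2 / 2) (at r0)"
  proof (rule lhopital)
    have c: "(p \<longlongrightarrow> p0) (at r0)" "(deriv p \<longlongrightarrow> p1) (at r0)"
      using DERIV_isCont[OF admissible_warpD(1)[OF ad, of r0]] DERIV_isCont[OF admissible_warpD(2)[OF ad, of r0]]
      by (simp_all add: isCont_def p0_def p1_def)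
    show "((\<lambda>r. (r - r0) * deriv p r + p0 - p r) \<longlongrightarrow> 0) (at r0)"
      by (rule tendsto_eq_rhs, (rule tendsto_intros c)+) simp
    show "((\<lambda>r. (r - r0)\<^sup>2) \<longlongrightarrow> 0) (at r0)"
      by (rule tendsto_eq_rhs, (rule tendsto_intros)+) simp
    show "\<forall>\<^sub>F r in at r0. (r - r0)\<^sup>2 \<noteq> 0" by (simp add: eventually_at_filter)
    show "\<forall>\<^sub>F r in at r0. 2 * (r - r0) \<noteq> 0" by (simp add: eventually_at_filter)
    show "\<forall>\<^sub>F r in at r0. ((\<lambda>r. (r - r0) * deriv p r + p0 - p r) has_real_derivative (r - r0) * deriv (deriv p) r) (at r)"
      using admissible_warpD(1,2)[OF ad] by (intro always_eventually allI) (auto intro!: derivative_eq_intros)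
    show "\<forall>\<^sub>F r in at r0. ((\<lambda>r. (r - r0)\<^sup>2) has_real_derivative 2 * (r - r0)) (at r)"
      by (intro always_eventually allI) (auto intro!: derivative_eq_intros)
    have "(deriv (deriv p) \<longlongrightarrow> p2) (at r0)"
      using DERIV_isCont[OF admissible_warpD(3)[OF ad, of r0]] by (simp add: isCont_def p2_def)
    then have "((\<lambda>r. deriv (deriv p) r / 2) \<longlongrightarrow> p2 / 2) (at r0)" by (intro tendsto_intros) auto
    moreover have "deriv (deriv p) r / 2 = (r - r0) * deriv (deriv p) r / (2 * (r - r0))" if "r \<noteq> r0" for r
      using that by (simp add: divide_simps)
    ultimately show "((\<lambda>r. (r - r0) * deriv (deriv p) r / (2 * (r - r0))) \<longlongrightarrow> p2 / 2) (at r0)"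
      by (elim Lim_transform_eventually) (simp add: eventually_at_filter)
  qed
  then have "(kap \<longlongrightarrow> p2 / 2) (at r0)"
    by (rule Lim_transform_eventually) (auto simp: kap_def eventually_at_filter)
  then show ?thesis by (simp add: tendsto_nhds_iff kap_def[of r0])
qed

section \<open>Second order expansions at the point\<close>

abbreviation F0 :: "(real \<times> real) filter" where "F0 \<equiv> nhds (r0, 0)"

lemma F0_tendsto:
  "((\<lambda>z. fst z) \<longlongrightarrow> r0) F0" "((\<lambda>z. snd z) \<longlongrightarrow> 0) F0"
  "((\<lambda>z. p (fst z)) \<longlongrightarrow> p0) F0" "((\<lambda>z. deriv p (fst z)) \<longlongrightarrow> p1) F0"
  "((\<lambda>z. deriv (deriv p) (fst z)) \<longlongrightarrow> p2) F0" "((\<lambda>z. kap (fst z)) \<longlongrightarrow> p2 / 2) F0"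
proof -
  show f: "((\<lambda>z. fst z) \<longlongrightarrow> r0) F0" using tendsto_fst[OF filterlim_ident, of "(r0, 0::real)"] by simp
  show "((\<lambda>z. snd z) \<longlongrightarrow> 0) F0" using tendsto_snd[OF filterlim_ident, of "(r0, 0::real)"] by simp
  show "((\<lambda>z. p (fst z)) \<longlongrightarrow> p0) F0" unfolding p0_def
    by (rule isCont_tendsto_compose[OF DERIV_isCont[OF admissible_warpD(1)[OF ad]] f])
  show "((\<lambda>z. deriv p (fst z)) \<longlongrightarrow> p1) F0" unfolding p1_def
    by (rule isCont_tendsto_compose[OF DERIV_isCont[OF admissible_warpD(2)[OF ad]] f])
  show "((\<lambda>z. deriv (deriv p) (fst z)) \<longlongrightarrow> p2) F0" unfolding p2_def
    by (rule isCont_tendsto_compose[OF DERIV_isCont[OF admissible_warpD(3)[OF ad]] f])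
  show "((\<lambda>z. kap (fst z)) \<longlongrightarrow> p2 / 2) F0" by (rule filterlim_compose[OF kap_tendsto f])
qed

text \<open>Both \<open>(r - r0)\<^sup>2\<close> and \<open>u\<close> have the order of
  \<open>q\<close>, so a combination of them with vanishing coefficients is a negligible
  error.\<close>

lemma eventually_small:
  assumes "(a \<longlongrightarrow> 0) F0" "(b \<longlongrightarrow> 0) F0" "\<eta> > 0"
  shows "\<forall>\<^sub>F z in F0. snd z \<ge> 0 \<longrightarrow> \<bar>a z * (fst z - r0)\<^sup>2 + b z * snd z\<bar> \<le> \<eta> * ((fst z - r0)\<^sup>2 + snd z)"
proof -
  have "\<forall>\<^sub>F z in F0. \<bar>a z\<bar> < \<eta>" "\<forall>\<^sub>F z in F0. \<bar>b z\<bar> < \<eta>"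
    using tendstoD[OF assms(1,3)] tendstoD[OF assms(2,3)] by (simp_all add: dist_real_def)
  then show ?thesis
  proof eventually_elim
    case (elim z)
    show ?case
    proof
      assume u: "snd z \<ge> 0"
      have "\<bar>a z * (fst z - r0)\<^sup>2 + b z * snd z\<bar> \<le> \<bar>a z\<bar> * (fst z - r0)\<^sup>2 + \<bar>b z\<bar> * snd z"
        using u abs_triangle_ineq[of "a z * (fst z - r0)\<^sup>2" "b z * snd z"] by (simp add: abs_mult)
      also have "\<dots> \<le> \<eta> * (fst z - r0)\<^sup>2 + \<eta> * snd z"
        using elim u by (intro add_mono mult_right_mono) auto
      finally show "\<bar>a z * (fst z - r0)\<^sup>2 + b z * snd z\<bar> \<le> \<eta> * ((fst z - r0)\<^sup>2 + snd z)" by (simp add: distrib_left)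
    qed
  qed
qed

definition qf :: "real \<Rightarrow> real \<Rightarrow> real" where "qf r u = (r - r0)\<^sup>2 / 2 + p0 * p r * u"

lemma q_qf: "q x = qf (norm x) (ang x)" by (simp add: q_def polar_def qf_def)

lemma qf_coercive:
  obtains C where "C > 0" "\<forall>\<^sub>F z in F0. snd z \<ge> 0 \<longrightarrow> (fst z - r0)\<^sup>2 + snd z \<le> C * qf (fst z) (snd z)"
proof -
  define C where "C = 2 + 2 / p0\<^sup>2"
  have C: "C > 0" using p0_pos by (simp add: C_def add_pos_nonneg)
  have "\<forall>\<^sub>F z in F0. p (fst z) > p0 / 2" using order_tendstoD(1)[OF F0_tendsto(3), of "p0 / 2"] p0_pos by simp
  then have "\<forall>\<^sub>F z in F0. snd z \<ge> 0 \<longrightarrow> (fst z - r0)\<^sup>2 + snd z \<le> C * qf (fst z) (snd z)"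
  proof (rule eventually_mono, intro impI)
    fix z :: "real \<times> real" assume z: "p (fst z) > p0 / 2" "snd z \<ge> 0"
    have "p0 * (p0 / 2) * snd z \<le> p0 * p (fst z) * snd z"
      using z p0_pos by (intro mult_right_mono mult_left_mono) auto
    then have q1: "(fst z - r0)\<^sup>2 / 2 + p0\<^sup>2 / 2 * snd z \<le> qf (fst z) (snd z)"
      by (simp add: qf_def power2_eq_square)
    have "(fst z - r0)\<^sup>2 + snd z \<le> C * ((fst z - r0)\<^sup>2 / 2 + p0\<^sup>2 / 2 * snd z)"
    proof -
      have "C * ((fst z - r0)\<^sup>2 / 2 + p0\<^sup>2 / 2 * snd z)
        = (fst z - r0)\<^sup>2 + snd z + (fst z - r0)\<^sup>2 / p0\<^sup>2 + p0\<^sup>2 * snd z"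
        using p0_pos by (simp add: C_def field_simps)
      then show ?thesis using z(2) by simp
    qed
    also have "\<dots> \<le> C * qf (fst z) (snd z)" using q1 C by (intro mult_left_mono) auto
    finally show "(fst z - r0)\<^sup>2 + snd z \<le> C * qf (fst z) (snd z)" .
  qed
  then show ?thesis using C that by blast
qed

text \<open>The two conditions match the coefficients of \<open>(r - r0)\<^sup>2\<close> and of
  \<open>u\<close> in the divergence with those of \<open>- \<kappa> * q\<close>, whose leading part
  is \<open>- \<kappa> * ((r - r0)\<^sup>2 / 2 + p0\<^sup>2 * u)\<close>.\<close>

lemma DV_expansion:
  assumes coef: "(n - 1) * (p2 / (2 * p0) + h) = - \<kappa> / 2"
    "p0 * p2 + 2 * g * p0\<^sup>2 + (n - 1) * (p1\<^sup>2 - 1 + d) + 2 * d = - \<kappa> * p0\<^sup>2" and \<eta>: "\<eta> > 0"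
  shows "\<forall>\<^sub>F z in F0. snd z \<ge> 0 \<longrightarrow> \<bar>DV g h d (fst z) (snd z) - (n - \<kappa> * qf (fst z) (snd z))\<bar> \<le> \<eta> * ((fst z - r0)\<^sup>2 + snd z)"
proof -
  define a where "a z = (n - 1) * (kap (fst z) / p (fst z) + h) + \<kappa> / 2" for z :: "real \<times> real"
  define b where "b z = (p0 * deriv (deriv p) (fst z) + 2 * g * p0\<^sup>2) + (n - 1) * (deriv p (fst z) / p (fst z)) * fa g (fst z)
      + d * (2 - snd z) + (n - 1) * (d - fb h (fst z) - d * snd z) + \<kappa> * p0 * p (fst z)" for z :: "real \<times> real"
  have a: "(a \<longlongrightarrow> 0) F0"
  proof (rule tendsto_eq_rhs)
    show "(a \<longlongrightarrow> (n - 1) * ((p2 / 2) / p0 + h) + \<kappa> / 2) F0"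
      unfolding a_def[abs_def] using p0_pos by (intro tendsto_intros F0_tendsto) auto
    show "(n - 1) * ((p2 / 2) / p0 + h) + \<kappa> / 2 = 0" using coef(1) by simp
  qed
  have b: "(b \<longlongrightarrow> 0) F0"
  proof (rule tendsto_eq_rhs)
    show "(b \<longlongrightarrow> (p0 * p2 + 2 * g * p0\<^sup>2) + (n - 1) * (p1 / p0) * (p0 * p1 + 2 * g * p0\<^sup>2 * (r0 - r0))
      + d * (2 - 0) + (n - 1) * (d - (p0 * inverse p0 + h * (r0 - r0)\<^sup>2) - d * 0) + \<kappa> * p0 * p0) F0"
      unfolding b_def[abs_def] fa_def fb_def using p0_pos by (intro tendsto_intros F0_tendsto) auto
    show "(p0 * p2 + 2 * g * p0\<^sup>2) + (n - 1) * (p1 / p0) * (p0 * p1 + 2 * g * p0\<^sup>2 * (r0 - r0))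
      + d * (2 - 0) + (n - 1) * (d - (p0 * inverse p0 + h * (r0 - r0)\<^sup>2) - d * 0) + \<kappa> * p0 * p0 = 0"
    proof -
      have "(n - 1) * (p1 / p0) * (p0 * p1 + 2 * g * p0\<^sup>2 * (r0 - r0)) = (n - 1) * p1\<^sup>2"
        using p0_pos by (simp add: power2_eq_square)
      then show ?thesis using coef(2) p0_pos by (simp only:) (simp add: power2_eq_square algebra_simps)
    qed
  qed
  have "\<forall>\<^sub>F z in F0. p (fst z) > 0" using order_tendstoD(1)[OF F0_tendsto(3) p0_pos] .
  with eventually_small[OF a b \<eta>] show ?thesis
  proof eventually_elim
    case (elim z)
    define r u where "r = fst z" and "u = snd z"
    have pr: "p r > 0" using elim by (simp add: r_def)
    define H I J where "H = deriv p r / p r" and "I = inverse (p r)" and "J = kap r / p r"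
    \<comment> \<open>The summand \<open>p0 * inverse (p r)\<close> of \<open>fb\<close> is there
      for this cancellation: no term linear in \<open>r - r0\<close> survives in the
      divergence.\<close>
    have k: "H * (r - r0) + p0 * I = 1 + J * (r - r0)\<^sup>2"
      unfolding H_def I_def J_def using pr kap_eq[of r] by (simp add: field_simps)
    have "DV g h d r u - (n - \<kappa> * qf r u) = a z * (r - r0)\<^sup>2 + b z * u
       + (n - 1) * (H * (r - r0) + p0 * I - (1 + J * (r - r0)\<^sup>2))"
      unfolding DV_def qf_def a_def b_def fb_def r_def[symmetric] u_def[symmetric]
        H_def[symmetric] I_def[symmetric] J_def[symmetric]
      by (simp add: field_simps power2_eq_square)
    then show ?case using elim k by (simp add: r_def u_def)
  qed
qed

text \<open>The parameters enter only through \<open>h + g\<close> and \<open>d\<close>. Opposite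
  \<open>g\<close> and \<open>h\<close> with \<open>d = 0\<close> thus change the divergence while
  the derivative of \<open>q\<close> along the field stays equal to the squared gradient to this
  order.\<close>

lemma DZ_expansion:
  assumes \<eta>: "\<eta> > 0"
  shows "\<forall>\<^sub>F z in F0. snd z \<ge> 0 \<longrightarrow>
    \<bar>DZ g h d (fst z) (snd z) - (GR (fst z) (snd z) + 2 * p0\<^sup>2 * snd z * ((h + g) * (fst z - r0)\<^sup>2 + d * snd z))\<bar>
      \<le> \<eta> * ((fst z - r0)\<^sup>2 + snd z)\<^sup>2"
proof -
  define a where "a z = p0 * p (fst z) * h * (2 - snd z) - 2 * p0\<^sup>2 * h" for z :: "real \<times> real"
  define b where "b z = 2 * g * p0 ^ 3 * deriv p (fst z) * (fst z - r0) + p0 * p (fst z) * d * (2 - snd z) - 2 * p0\<^sup>2 * d" for z :: "real \<times> real"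
  have a: "(a \<longlongrightarrow> 0) F0"
    unfolding a_def[abs_def] by (rule tendsto_eq_rhs, (rule tendsto_intros F0_tendsto)+) (simp add: power2_eq_square)
  have b: "(b \<longlongrightarrow> 0) F0"
    unfolding b_def[abs_def] by (rule tendsto_eq_rhs, (rule tendsto_intros F0_tendsto)+) (simp add: power2_eq_square)
  have "\<forall>\<^sub>F z in F0. p (fst z) > 0" using order_tendstoD(1)[OF F0_tendsto(3) p0_pos] .
  with eventually_small[OF a b \<eta>] show ?thesis
  proof eventually_elim
    case (elim z)
    define r u where "r = fst z" and "u = snd z"
    have pr: "p r > 0" using elim by (simp add: r_def)
    show ?case
    proof
      assume "snd z \<ge> 0"
      then have u: "u \<ge> 0" by (simp add: u_def)
      have i: "p r * inverse (p r) = 1" using pr by simp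
      have "DZ g h d r u - (GR r u + 2 * p0\<^sup>2 * u * ((h + g) * (r - r0)\<^sup>2 + d * u)) = u * (a z * (r - r0)\<^sup>2 + b z * u)
        + p0\<^sup>2 * (2 * u - u\<^sup>2) * (p r * inverse (p r) - 1)"
        unfolding DZ_def GR_def a_def b_def fa_def fb_def qr_def r_def[symmetric] u_def[symmetric]
        by (simp add: algebra_simps power2_eq_square power3_eq_cube)
      then have "\<bar>DZ g h d r u - (GR r u + 2 * p0\<^sup>2 * u * ((h + g) * (r - r0)\<^sup>2 + d * u))\<bar> = u * \<bar>a z * (r - r0)\<^sup>2 + b z * u\<bar>"
        using u by (simp add: i abs_mult)
      also have "\<dots> \<le> ((r - r0)\<^sup>2 + u) * (\<eta> * ((r - r0)\<^sup>2 + u))"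
        using elim u by (intro mult_mono) (auto simp: r_def u_def)
      finally show "\<bar>DZ g h d (fst z) (snd z) - (GR (fst z) (snd z) + 2 * p0\<^sup>2 * snd z * ((h + g) * (fst z - r0)\<^sup>2 + d * snd z))\<bar>
        \<le> \<eta> * ((fst z - r0)\<^sup>2 + snd z)\<^sup>2"
        by (simp add: r_def u_def power2_eq_square algebra_simps)
    qed
  qed
qed

text \<open>For the exact half squared distance the squared gradient would equal
  \<open>2 * q\<close>. The approximation \<open>q\<close> leaves a defect of order
  \<open>q\<^sup>2\<close> whose coefficients are the negative radial and tangential curvatures at
  the point, up to powers of \<open>p0\<close>.\<close>

lemma GR_expansion:
  assumes \<eta>: "\<eta> > 0"
  shows "\<forall>\<^sub>F z in F0. snd z \<ge> 0 \<longrightarrow>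
    \<bar>GR (fst z) (snd z) - (2 * qf (fst z) (snd z) + snd z * (p0 * p2 * (fst z - r0)\<^sup>2 + (p1\<^sup>2 - 1) * p0\<^sup>2 * snd z))\<bar>
      \<le> \<eta> * ((fst z - r0)\<^sup>2 + snd z)\<^sup>2"
proof -
  define a where "a z = 2 * p0 * kap (fst z) - p0 * p2" for z :: "real \<times> real"
  define b where "b z = ((deriv p (fst z))\<^sup>2 - p1\<^sup>2) * p0\<^sup>2" for z :: "real \<times> real"
  have a: "(a \<longlongrightarrow> 0) F0"
    unfolding a_def[abs_def] by (rule tendsto_eq_rhs, (rule tendsto_intros F0_tendsto)+) simp
  have b: "(b \<longlongrightarrow> 0) F0"
    unfolding b_def[abs_def] by (rule tendsto_eq_rhs, (rule tendsto_intros F0_tendsto)+) simp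
  from eventually_small[OF a b \<eta>] show ?thesis
  proof eventually_elim
    case (elim z)
    define r u where "r = fst z" and "u = snd z"
    show ?case
    proof
      assume "snd z \<ge> 0"
      then have u: "u \<ge> 0" by (simp add: u_def)
      have "GR r u - 2 * qf r u = 2 * p0 * u * ((r - r0) * deriv p r + p0 - p r) + ((deriv p r)\<^sup>2 - 1) * p0\<^sup>2 * u\<^sup>2"
        unfolding GR_def qf_def qr_def by (simp add: field_simps power2_eq_square)
      then have "GR r u - (2 * qf r u + u * (p0 * p2 * (r - r0)\<^sup>2 + (p1\<^sup>2 - 1) * p0\<^sup>2 * u)) = u * (a z * (r - r0)\<^sup>2 + b z * u)"
        unfolding kap_eq a_def b_def r_def[symmetric] u_def[symmetric]
        by (simp add: algebra_simps power2_eq_square)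
      then have "\<bar>GR r u - (2 * qf r u + u * (p0 * p2 * (r - r0)\<^sup>2 + (p1\<^sup>2 - 1) * p0\<^sup>2 * u))\<bar> = u * \<bar>a z * (r - r0)\<^sup>2 + b z * u\<bar>"
        using u by (simp add: abs_mult)
      also have "\<dots> \<le> ((r - r0)\<^sup>2 + u) * (\<eta> * ((r - r0)\<^sup>2 + u))"
        using elim u by (intro mult_mono) (auto simp: r_def u_def)
      finally show "\<bar>GR (fst z) (snd z) - (2 * qf (fst z) (snd z) + snd z * (p0 * p2 * (fst z - r0)\<^sup>2 + (p1\<^sup>2 - 1) * p0\<^sup>2 * snd z))\<bar>
        \<le> \<eta> * ((fst z - r0)\<^sup>2 + snd z)\<^sup>2"
        by (simp add: r_def u_def power2_eq_square algebra_simps)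
    qed
  qed
qed

text \<open>The divergence of the field is \<open>n - \<kappa> * q\<close> up to higher order terms: \<open>\<kappa>1\<close> for the field with
\<open>DZ \<approx> GR\<close> and \<open>\<kappa>2\<close> for the field with \<open>DZ \<approx> 2 * q\<close>.\<close>
definition \<kappa>1 :: real where "\<kappa>1 = (n - 1) * (2 * Kr + (n - 1) * Kt) / n"
definition \<kappa>2 :: real where "\<kappa>2 = (n - 1) * (Kr + (n - 3) / 2 * Kt) / n"

lemma \<kappa>_sum: "n * (\<kappa>1 + 2 * \<kappa>2) = 2 * scal DIM('a) p r0"
  using n_ge_2 by (simp add: \<kappa>1_def \<kappa>2_def scal_r0 field_simps)

text \<open>For the first field \<open>DZ \<approx> GR\<close> is obtained with
  \<open>h = - g\<close> and \<open>d = 0\<close>. For the second, \<open>h + g = Kr / 2\<close> and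
  \<open>d = Kt * p0\<^sup>2 / 2\<close> cancel the defect in \<open>GR_expansion\<close>. In both
  cases \<open>g\<close> and \<open>\<kappa>\<close> remain, and the two linear conditions of
  \<open>DV_expansion\<close> determine them; this is the origin of \<open>\<kappa>1\<close> and
  \<open>\<kappa>2\<close>.\<close>

lemma field_cases:
  obtains g1 h1 d1 g2 h2 d2 where
   "\<And>\<eta>. \<eta> > 0 \<Longrightarrow> \<forall>\<^sub>F z in F0. snd z \<ge> 0 \<longrightarrow>
      \<bar>DV g1 h1 d1 (fst z) (snd z) - (n - \<kappa>1 * qf (fst z) (snd z))\<bar> \<le> \<eta> * qf (fst z) (snd z) \<and>
      \<bar>DZ g1 h1 d1 (fst z) (snd z) - GR (fst z) (snd z)\<bar> \<le> \<eta> * (qf (fst z) (snd z))\<^sup>2 \<and>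
      \<bar>DV g2 h2 d2 (fst z) (snd z) - (n - \<kappa>2 * qf (fst z) (snd z))\<bar> \<le> \<eta> * qf (fst z) (snd z) \<and>
      \<bar>DZ g2 h2 d2 (fst z) (snd z) - 2 * qf (fst z) (snd z)\<bar> \<le> \<eta> * (qf (fst z) (snd z))\<^sup>2"
proof -
  have n: "n > 1" using n_ge_2 by simp
  have P2: "p2 = - Kr * p0" and P1: "p1\<^sup>2 = 1 - Kt * p0\<^sup>2" using p0_pos by (simp_all add: Kr_def Kt_def)
  define g1 where "g1 = \<kappa>1 / (2 * (n - 1)) - Kr / 2"
  define g2 where "g2 = \<kappa>2 / (2 * (n - 1))"
  define h2 where "h2 = Kr / 2 - g2"
  define d2 where "d2 = Kt * p0\<^sup>2 / 2"
  have c1: "(n - 1) * (p2 / (2 * p0) + (- g1)) = - \<kappa>1 / 2"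
    using n p0_pos by (simp add: P2 g1_def field_simps)
  have k1: "2 * g1 * (n - 1) = \<kappa>1 - Kr * (n - 1)" using n by (simp add: g1_def field_simps)
  have nk1: "n * \<kappa>1 = (n - 1) * (2 * Kr + (n - 1) * Kt)" using n by (simp add: \<kappa>1_def)
  have c2: "p0 * p2 + 2 * g1 * p0\<^sup>2 + (n - 1) * (p1\<^sup>2 - 1 + 0) + 2 * 0 = - \<kappa>1 * p0\<^sup>2"
  proof -
    have "(n - 1) * (- Kr + 2 * g1 - (n - 1) * Kt + \<kappa>1) = - Kr * (n - 1) + (\<kappa>1 - Kr * (n - 1)) - (n - 1) * (n - 1) * Kt + (n - 1) * \<kappa>1"
      unfolding k1[symmetric] by (simp add: algebra_simps)
    also have "\<dots> = n * \<kappa>1 - (n - 1) * (2 * Kr + (n - 1) * Kt)" by (simp add: algebra_simps)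
    finally have "- Kr + 2 * g1 - (n - 1) * Kt + \<kappa>1 = 0" using nk1 n by simp
    then have "(- Kr + 2 * g1 - (n - 1) * Kt + \<kappa>1) * p0\<^sup>2 = 0" by simp
    then show ?thesis unfolding P1 P2 by (simp add: algebra_simps power2_eq_square)
  qed
  have c3: "(n - 1) * (p2 / (2 * p0) + h2) = - \<kappa>2 / 2"
    using n p0_pos by (simp add: P2 h2_def g2_def field_simps)
  have k2: "2 * g2 * (n - 1) = \<kappa>2" using n by (simp add: g2_def field_simps)
  have nk2: "n * \<kappa>2 = (n - 1) * (Kr + (n - 3) / 2 * Kt)" using n by (simp add: \<kappa>2_def)
  have c4: "p0 * p2 + 2 * g2 * p0\<^sup>2 + (n - 1) * (p1\<^sup>2 - 1 + d2) + 2 * d2 = - \<kappa>2 * p0\<^sup>2"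
  proof -
    have "(n - 1) * (- Kr + 2 * g2 - (n - 3) / 2 * Kt + \<kappa>2) = \<kappa>2 + (n - 1) * \<kappa>2 - (n - 1) * (Kr + (n - 3) / 2 * Kt)"
      unfolding k2[symmetric] by (simp add: algebra_simps)
    also have "\<dots> = n * \<kappa>2 - (n - 1) * (Kr + (n - 3) / 2 * Kt)" by (simp add: algebra_simps)
    finally have "- Kr + 2 * g2 - (n - 3) / 2 * Kt + \<kappa>2 = 0" using nk2 n by simp
    then have "(- Kr + 2 * g2 - (n - 3) / 2 * Kt + \<kappa>2) * p0\<^sup>2 = 0" by simp
    then show ?thesis unfolding P1 P2 d2_def by (simp add: field_simps power2_eq_square)
  qed
  obtain C where C: "C > 0" "\<forall>\<^sub>F z in F0. snd z \<ge> 0 \<longrightarrow> (fst z - r0)\<^sup>2 + snd z \<le> C * qf (fst z) (snd z)"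
    using qf_coercive by blast
  show ?thesis
  proof (rule that[of g1 "- g1" 0 g2 h2 d2])
    fix \<eta> :: real assume \<eta>: "\<eta> > 0"
    \<comment> \<open>The constants convert \<open>(r - r0)\<^sup>2 + u\<close> and its square into
      \<open>q\<close> and its square; the 2 is there because the last estimate adds the errors of
      \<open>DZ\<close> and \<open>GR\<close>.\<close>
    define \<eta>' where "\<eta>' = min (\<eta> / C) (\<eta> / (2 * C\<^sup>2))"
    have \<eta>': "\<eta>' > 0" using \<eta> C by (simp add: \<eta>'_def)
    from DV_expansion[OF c1 c2 \<eta>'] DZ_expansion[OF \<eta>', of g1 "- g1" 0] DV_expansion[OF c3 c4 \<eta>']
      DZ_expansion[OF \<eta>', of g2 h2 d2] GR_expansion[OF \<eta>'] C(2)
    show "\<forall>\<^sub>F z in F0. snd z \<ge> 0 \<longrightarrow>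
      \<bar>DV g1 (- g1) 0 (fst z) (snd z) - (n - \<kappa>1 * qf (fst z) (snd z))\<bar> \<le> \<eta> * qf (fst z) (snd z) \<and>
      \<bar>DZ g1 (- g1) 0 (fst z) (snd z) - GR (fst z) (snd z)\<bar> \<le> \<eta> * (qf (fst z) (snd z))\<^sup>2 \<and>
      \<bar>DV g2 h2 d2 (fst z) (snd z) - (n - \<kappa>2 * qf (fst z) (snd z))\<bar> \<le> \<eta> * qf (fst z) (snd z) \<and>
      \<bar>DZ g2 h2 d2 (fst z) (snd z) - 2 * qf (fst z) (snd z)\<bar> \<le> \<eta> * (qf (fst z) (snd z))\<^sup>2"
    proof eventually_elim
      case (elim z)
      show ?case
      proof (rule impI)
        assume u0: "snd z \<ge> 0"
        define r u Nz where "r = fst z" and "u = snd z" and "Nz = (r - r0)\<^sup>2 + u"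
        have N0: "Nz \<ge> 0" using u0 by (simp add: Nz_def u_def)
        have NC: "Nz \<le> C * qf r u" using elim u0 by (simp add: Nz_def r_def u_def)
        have "\<eta>' * Nz \<le> (\<eta> / C) * (C * qf r u)"
          using NC N0 \<eta> C by (intro mult_mono) (auto simp: \<eta>'_def)
        then have s1: "\<eta>' * Nz \<le> \<eta> * qf r u" using C by simp
        have "\<eta>' * Nz\<^sup>2 \<le> (\<eta> / (2 * C\<^sup>2)) * (C * qf r u)\<^sup>2"
          using NC N0 \<eta> C by (intro mult_mono power_mono) (auto simp: \<eta>'_def)
        then have s2: "2 * (\<eta>' * Nz\<^sup>2) \<le> \<eta> * (qf r u)\<^sup>2" using C by (simp add: power_mult_distrib)
        have s3: "\<eta>' * Nz\<^sup>2 \<ge> 0" using \<eta>' by simp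
        have E: "2 * p0\<^sup>2 * u * ((h2 + g2) * (r - r0)\<^sup>2 + d2 * u) + u * (p0 * p2 * (r - r0)\<^sup>2 + (p1\<^sup>2 - 1) * p0\<^sup>2 * u) = 0"
          unfolding P1 P2 h2_def d2_def by (simp add: algebra_simps power2_eq_square)
        have e1: "\<bar>DV g1 (- g1) 0 r u - (n - \<kappa>1 * qf r u)\<bar> \<le> \<eta>' * Nz"
          "\<bar>DZ g1 (- g1) 0 r u - GR r u\<bar> \<le> \<eta>' * Nz\<^sup>2"
          "\<bar>DV g2 h2 d2 r u - (n - \<kappa>2 * qf r u)\<bar> \<le> \<eta>' * Nz"
          "\<bar>DZ g2 h2 d2 r u - (GR r u + 2 * p0\<^sup>2 * u * ((h2 + g2) * (r - r0)\<^sup>2 + d2 * u))\<bar> \<le> \<eta>' * Nz\<^sup>2"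
          "\<bar>GR r u - (2 * qf r u + u * (p0 * p2 * (r - r0)\<^sup>2 + (p1\<^sup>2 - 1) * p0\<^sup>2 * u))\<bar> \<le> \<eta>' * Nz\<^sup>2"
          using elim u0 by (simp_all add: r_def u_def Nz_def)
        have "\<bar>DZ g2 h2 d2 r u - 2 * qf r u\<bar> \<le> 2 * (\<eta>' * Nz\<^sup>2)" using e1(4,5) E by linarith
        then show "\<bar>DV g1 (- g1) 0 (fst z) (snd z) - (n - \<kappa>1 * qf (fst z) (snd z))\<bar> \<le> \<eta> * qf (fst z) (snd z) \<and>
          \<bar>DZ g1 (- g1) 0 (fst z) (snd z) - GR (fst z) (snd z)\<bar> \<le> \<eta> * (qf (fst z) (snd z))\<^sup>2 \<and>
          \<bar>DV g2 h2 d2 (fst z) (snd z) - (n - \<kappa>2 * qf (fst z) (snd z))\<bar> \<le> \<eta> * qf (fst z) (snd z) \<and>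
          \<bar>DZ g2 h2 d2 (fst z) (snd z) - 2 * qf (fst z) (snd z)\<bar> \<le> \<eta> * (qf (fst z) (snd z))\<^sup>2"
          unfolding r_def[symmetric] u_def[symmetric] using e1(1-3) s1 s2 s3 by linarith
      qed
    qed
  qed
qed

end

section \<open>Small sublevel sets\<close>

text \<open>Suited to functions whose backward increments alone are controlled. If the claim failed,
  tilting \<open>F\<close> by a small slope would give a first point where the final value is
  reached; all points to its left lie lower, contradicting the bound on left increments
  there.\<close>

lemma left_dini_nonincreasing:
  fixes F :: "real \<Rightarrow> real"
  assumes ab: "a < b" and c: "continuous_on {a..b} F"
    and d: "\<And>x \<epsilon>. a < x \<Longrightarrow> x \<le> b \<Longrightarrow> \<epsilon> > 0 \<Longrightarrow> \<forall>\<^sub>F y in at_left x. F x - F y \<le> \<epsilon> * (x - y)"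
  shows "F b \<le> F a"
proof -
  have "F b \<le> F a + \<epsilon> * (b - a)" if \<epsilon>: "\<epsilon> > 0" for \<epsilon>
  proof (rule ccontr)
    assume "\<not> F b \<le> F a + \<epsilon> * (b - a)"
    define G where "G y = F y - \<epsilon> * y" for y
    have Gab: "G a < G b" using \<open>\<not> F b \<le> F a + \<epsilon> * (b - a)\<close> by (simp add: G_def algebra_simps)
    have cG: "continuous_on {a..b} G" unfolding G_def by (intro continuous_intros c)
    define S where "S = {a..b} \<inter> G -` {G b..}"
    have "closed S" unfolding S_def by (rule continuous_closed_preimage[OF cG]) auto
    have "b \<in> S" using ab by (simp add: S_def)
    then have S: "S \<noteq> {}" "bdd_below S" by (auto simp: S_def intro!: bdd_belowI[of _ a])
    define x where "x = Inf S"
    have xS: "x \<in> S" unfolding x_def by (rule closed_contains_Inf[OF S \<open>closed S\<close>])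
    then have "x \<noteq> a" using Gab by (auto simp: S_def)
    then have x: "a < x" "x \<le> b" "G b \<le> G x" using xS by (auto simp: S_def)
    have "\<forall>\<^sub>F y in at_left x. y \<in> {a<..<x}" using x(1) by (rule eventually_at_left_real)
    moreover have "\<forall>\<^sub>F y in at_left x. F x - F y \<le> \<epsilon> * (x - y)" using d[OF x(1,2) \<epsilon>] .
    ultimately have "\<forall>\<^sub>F y in at_left x. False"
    proof eventually_elim
      case (elim y)
      have "y \<notin> S" using elim cInf_lower[OF _ S(2), of y] by (auto simp: x_def)
      then have "G y < G b" using elim x by (auto simp: S_def)
      then show False using elim x(3) by (simp add: G_def algebra_simps)
    qed
    then show False by simp
  qed
  moreover have "((\<lambda>\<epsilon>. F a + \<epsilon> * (b - a)) \<longlongrightarrow> F a + 0 * (b - a)) (at_right 0)" by (intro tendsto_intros)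
  moreover have "\<forall>\<^sub>F \<epsilon> in at_right (0::real). \<epsilon> > 0" by (simp add: eventually_at_filter)
  ultimately show ?thesis
    by (intro tendsto_lowerbound[of "\<lambda>\<epsilon>. F a + \<epsilon> * (b - a)" "F a" "at_right 0"])
      (auto elim!: eventually_mono)
qed

section \<open>Sublevel sets of \<open>q\<close> and weighted integrals over them\<close>

context off_pole
begin

definition x0 :: 'a where "x0 = r0 *\<^sub>R e"

lemma norm_x0: "norm x0 = r0" using r0 by (simp add: x0_def e_norm)

lemma ang_x0: "ang x0 = 0" using r0 by (simp add: ang_def norm_x0) (simp add: x0_def e_norm)

lemma dist_sq: "x \<noteq> 0 \<Longrightarrow> (norm (x - x0))\<^sup>2 = (norm x - r0)\<^sup>2 + 2 * norm x * r0 * ang x"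
proof -
  assume "x \<noteq> 0"
  then have c: "x \<bullet> e = norm x * (1 - ang x)" by (simp add: ang_def)
  have "(norm (x - x0))\<^sup>2 = x \<bullet> x - 2 * (r0 * (x \<bullet> e)) + r0\<^sup>2 * (e \<bullet> e)"
    unfolding power2_norm_eq_inner x0_def
    by (simp add: inner_diff_left inner_diff_right inner_commute[of e x] power2_eq_square algebra_simps)
  also have "\<dots> = (norm x)\<^sup>2 - 2 * (r0 * (norm x * (1 - ang x))) + r0\<^sup>2"
    by (simp add: power2_norm_eq_inner c e_norm)
  finally show ?thesis by (simp add: power2_eq_square algebra_simps)
qed

lemma coords_tendsto: "filterlim (\<lambda>x. (norm x, ang x)) F0 (nhds x0)"
proof -
  have x0: "x0 \<noteq> 0" using norm_x0 r0 by auto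
  have "isCont ang x0" using ang_has_derivative[OF x0] has_derivative_continuous by blast
  then have "(ang \<longlongrightarrow> 0) (nhds x0)" using ang_x0 by (simp add: isCont_def tendsto_nhds_iff)
  moreover have "(norm \<longlongrightarrow> r0) (nhds x0)" using tendsto_norm[OF filterlim_ident, of x0] norm_x0 by simp
  ultimately show ?thesis using tendsto_Pair by fastforce
qed

text \<open>Since \<open>ang\<close> is never negative, expansions valid for nonnegative second
  coordinate hold at every point near \<open>x0\<close>.\<close>

lemma near_x0:
  assumes "\<forall>\<^sub>F z in F0. snd z \<ge> 0 \<longrightarrow> P z"
  shows "\<exists>\<rho>>0. \<forall>x\<in>ball x0 \<rho>. P (norm x, ang x)"
proof -
  have "\<forall>\<^sub>F x in nhds x0. ang x \<ge> 0 \<longrightarrow> P (norm x, ang x)"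
    using filterlim_iff[THEN iffD1, OF coords_tendsto, rule_format, OF assms] by simp
  then show ?thesis using ang_bounds(1) by (auto simp: eventually_nhds_metric dist_commute)
qed

lemma coercive:
  obtains C \<rho> where "C > 0" "0 < \<rho>" "\<rho> < r0" "\<And>x. x \<in> ball x0 \<rho> \<Longrightarrow> (norm (x - x0))\<^sup>2 \<le> C * q x"
    "\<And>x. x \<in> ball x0 \<rho> \<Longrightarrow> 0 \<le> q x" "\<And>x. x \<in> ball x0 \<rho> \<Longrightarrow> x \<noteq> 0"
proof -
  obtain C where C: "C > 0" "\<forall>\<^sub>F z in F0. snd z \<ge> 0 \<longrightarrow> (fst z - r0)\<^sup>2 + snd z \<le> C * qf (fst z) (snd z)"
    using qf_coercive by blast
  obtain \<rho>1 where \<rho>1: "\<rho>1 > 0" "\<And>x. x \<in> ball x0 \<rho>1 \<Longrightarrow> (norm x - r0)\<^sup>2 + ang x \<le> C * q x"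
    using near_x0[OF C(2)] by (auto simp: q_qf)
  define \<rho> where "\<rho> = min \<rho>1 (r0 / 2)"
  define C' where "C' = (1 + 4 * r0\<^sup>2) * C"
  show ?thesis
  proof (rule that[of C' \<rho>])
    show "C' > 0" using C by (simp add: C'_def add_pos_nonneg)
    show "0 < \<rho>" "\<rho> < r0" using \<rho>1 r0 by (auto simp: \<rho>_def)
    fix x assume x: "x \<in> ball x0 \<rho>"
    then have d: "norm (x - x0) < r0 / 2" by (simp add: \<rho>_def dist_norm norm_minus_commute)
    have n1: "norm x \<le> norm x0 + norm (x - x0)" by (metis add.commute diff_add_cancel norm_triangle_ineq)
    have n2: "norm x0 \<le> norm x + norm (x - x0)" by (metis add.commute add_diff_cancel diff_add_cancel norm_minus_commute norm_triangle_ineq)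
    show x0: "x \<noteq> 0" using n2 d norm_x0 r0 by auto
    have k: "(norm x - r0)\<^sup>2 + ang x \<le> C * q x" using \<rho>1(2)[of x] x by (simp add: \<rho>_def)
    have s: "0 \<le> (norm x - r0)\<^sup>2 + ang x" using ang_bounds(1)[of x] by simp
    then show "0 \<le> q x" using k C by (metis mult_less_0_iff not_le order_trans zero_le_mult_iff less_le_not_le)
    have "norm x \<le> 2 * r0" using n1 d norm_x0 r0 by linarith
    then have "2 * norm x * r0 * ang x \<le> 2 * (2 * r0) * r0 * ang x"
      using r0 ang_bounds(1)[of x] by (intro mult_right_mono mult_left_mono) auto
    then have "(norm (x - x0))\<^sup>2 \<le> (norm x - r0)\<^sup>2 + 4 * r0\<^sup>2 * ang x"
      unfolding dist_sq[OF x0] by (simp add: power2_eq_square)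
    also have "\<dots> \<le> (1 + 4 * r0\<^sup>2) * ((norm x - r0)\<^sup>2 + ang x)"
      using ang_bounds(1)[of x] by (simp add: algebra_simps)
    also have "\<dots> \<le> C' * q x" unfolding C'_def mult.assoc using k by (intro mult_left_mono) auto
    finally show "(norm (x - x0))\<^sup>2 \<le> C' * q x" .
  qed
qed

text \<open>Choice turns the existential constants of \<open>coercive\<close> into constants of the
  locale, so that the neighbourhood and the integrals over sublevel sets can be defined
  once.\<close>

definition Cq :: real where "Cq = (SOME C. \<exists>\<rho>. C > 0 \<and> 0 < \<rho> \<and> \<rho> < r0 \<and>
  (\<forall>x\<in>ball x0 \<rho>. (norm (x - x0))\<^sup>2 \<le> C * q x \<and> 0 \<le> q x \<and> x \<noteq> 0))"
definition \<rho>q :: real where "\<rho>q = (SOME \<rho>. Cq > 0 \<and> 0 < \<rho> \<and> \<rho> < r0 \<and>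
  (\<forall>x\<in>ball x0 \<rho>. (norm (x - x0))\<^sup>2 \<le> Cq * q x \<and> 0 \<le> q x \<and> x \<noteq> 0))"
definition N :: "'a set" where "N = ball x0 \<rho>q"

lemma N_props:
  shows "Cq > 0" "0 < \<rho>q" "\<And>x. x \<in> N \<Longrightarrow> (norm (x - x0))\<^sup>2 \<le> Cq * q x" "\<And>x. x \<in> N \<Longrightarrow> 0 \<le> q x"
    "0 \<notin> N" "open N"
proof -
  have "\<exists>C \<rho>. C > 0 \<and> 0 < \<rho> \<and> \<rho> < r0 \<and> (\<forall>x\<in>ball x0 \<rho>. (norm (x - x0))\<^sup>2 \<le> C * q x \<and> 0 \<le> q x \<and> x \<noteq> 0)"
    using coercive by metis
  then have "\<exists>\<rho>. Cq > 0 \<and> 0 < \<rho> \<and> \<rho> < r0 \<and> (\<forall>x\<in>ball x0 \<rho>. (norm (x - x0))\<^sup>2 \<le> Cq * q x \<and> 0 \<le> q x \<and> x \<noteq> 0)"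
    unfolding Cq_def by (rule someI_ex)
  then have "Cq > 0 \<and> 0 < \<rho>q \<and> \<rho>q < r0 \<and> (\<forall>x\<in>ball x0 \<rho>q. (norm (x - x0))\<^sup>2 \<le> Cq * q x \<and> 0 \<le> q x \<and> x \<noteq> 0)"
    unfolding \<rho>q_def by (rule someI_ex)
  then show "Cq > 0" "0 < \<rho>q" "\<And>x. x \<in> N \<Longrightarrow> (norm (x - x0))\<^sup>2 \<le> Cq * q x" "\<And>x. x \<in> N \<Longrightarrow> 0 \<le> q x" "0 \<notin> N" "open N"
    by (auto simp: N_def)
qed

definition B :: "real \<Rightarrow> 'a set" where "B D = {x \<in> N. q x < D}"
text \<open>By coercivity the sublevel set at this height lies within distance
  \<open>\<rho>q / sqrt 2\<close> of \<open>x0\<close>, well inside \<open>N\<close>.\<close>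

definition D0 :: real where "D0 = \<rho>q\<^sup>2 / (2 * Cq)"

lemma D0_pos: "D0 > 0" using N_props(1,2) by (simp add: D0_def)

lemma continuous_q: "continuous_on N q"
  using smooth_within_continuous_on[OF smooth_within_q[OF N_props(6,5)]] .

lemma sublevel_in_ball: "x \<in> N \<Longrightarrow> q x \<le> D \<Longrightarrow> \<rho> > 0 \<Longrightarrow> Cq * D < \<rho>\<^sup>2 \<Longrightarrow> x \<in> ball x0 \<rho>"
proof -
  assume a: "x \<in> N" "q x \<le> D" "\<rho> > 0" "Cq * D < \<rho>\<^sup>2"
  have "(norm (x - x0))\<^sup>2 \<le> Cq * D" using N_props(3)[OF a(1)] a(2) N_props(1) by (meson less_imp_le mult_left_mono order_trans)
  then have "(norm (x - x0))\<^sup>2 < \<rho>\<^sup>2" using a(4) by simp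
  then have "norm (x - x0) < \<rho>" using a(3) by (simp add: power2_less_imp_less)
  then show ?thesis by (simp add: dist_norm norm_minus_commute)
qed

lemma compact_sublevel: "D \<le> D0 \<Longrightarrow> compact {x \<in> N. q x \<le> D}"
proof -
  assume D: "D \<le> D0"
  \<comment> \<open>The factor 3/4 lies strictly between \<open>1 / sqrt 2\<close> and 1.\<close>
  define \<rho> where "\<rho> = \<rho>q * (3/4)"
  have "Cq * D \<le> \<rho>q\<^sup>2 / 2" using mult_left_mono[OF D, of Cq] N_props(1) by (simp add: D0_def)
  then have "Cq * D < \<rho>\<^sup>2" using N_props(2) unfolding \<rho>_def by (simp add: power2_eq_square) (smt (verit) mult_pos_pos)
  moreover have "\<rho> > 0" using N_props(2) by (simp add: \<rho>_def)
  ultimately have sub: "{x \<in> N. q x \<le> D} \<subseteq> cball x0 \<rho>" using sublevel_in_ball[of _ D \<rho>] ball_subset_cball by blast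
  have sub2: "cball x0 \<rho> \<subseteq> N" using N_props(2) by (auto simp: N_def \<rho>_def)
  have "{x \<in> N. q x \<le> D} = cball x0 \<rho> \<inter> q -` {..D}" using sub sub2 by auto
  moreover have "closed (cball x0 \<rho> \<inter> q -` {..D})"
    by (rule continuous_closed_preimage[OF continuous_on_subset[OF continuous_q sub2]]) auto
  ultimately show ?thesis
    using compact_cball[of x0 \<rho>] by (metis compact_Int_closed Int_assoc inf.idem)
qed

lemma B_meas: "B D \<in> sets borel" "open (B D)"
proof -
  have "open (N \<inter> q -` {..<D})" by (rule continuous_open_preimage[OF continuous_q N_props(6)]) auto
  moreover have "B D = N \<inter> q -` {..<D}" by (auto simp: B_def)
  ultimately show "open (B D)" by simp
  then show "B D \<in> sets borel" by simp
qed

definition J :: "real \<Rightarrow> ('a \<Rightarrow> real) \<Rightarrow> real" where "J D f = (LINT x:B D|lborel. model_weight p x * f x)"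

lemma J_integrable:
  assumes "D \<le> D0" "continuous_on N f"
  shows "set_integrable lborel (B D) (\<lambda>x. model_weight p x * f x)"
proof (rule set_integrable_bounded_continuous[OF compact_sublevel[OF assms(1)]])
  show "continuous_on {x \<in> N. q x \<le> D} (\<lambda>x. model_weight p x * f x)"
    by (intro continuous_intros continuous_on_subset[OF continuous_model_weight[OF ad]] continuous_on_subset[OF assms(2)]) auto
qed (auto simp: B_def B_meas[unfolded B_def])

lemma J_add: "D \<le> D0 \<Longrightarrow> continuous_on N f \<Longrightarrow> continuous_on N g \<Longrightarrow> J D (\<lambda>x. f x + g x) = J D f + J D g"
  unfolding J_def distrib_left by (rule set_integral_add(2)) (auto intro: J_integrable)

lemma J_cmult: "J D (\<lambda>x. c * f x) = c * J D f"
  unfolding J_def by (simp add: mult.left_commute[of _ c])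

lemma J_mono:
  assumes "D \<le> D0" "continuous_on N f" "continuous_on N g" "\<And>x. x \<in> B D \<Longrightarrow> f x \<le> g x"
  shows "J D f \<le> J D g"
  unfolding J_def using model_weight_pos[OF ad] assms(4)
  by (intro set_integral_mono J_integrable assms(1-3) mult_left_mono) (auto intro: less_imp_le)

lemma J_abs_bound:
  assumes "D \<le> D0" "continuous_on N f" "continuous_on N g" "continuous_on N h" "\<And>x. x \<in> B D \<Longrightarrow> \<bar>f x - g x\<bar> \<le> h x"
  shows "\<bar>J D f - J D g\<bar> \<le> J D h"
proof -
  have "J D f \<le> J D (\<lambda>x. g x + h x)" "J D g \<le> J D (\<lambda>x. f x + h x)"
    by (intro J_mono assms(1-4) continuous_intros; use assms(5) in \<open>force simp: abs_le_iff\<close>)+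
  then show ?thesis using J_add[OF assms(1) assms(3,4)] J_add[OF assms(1) assms(2,4)] by linarith
qed

lemma J_ibp:
  assumes "D \<le> D0" "j \<ge> 1"
  shows "J D (\<lambda>x. real j * (D - q x) ^ (j - 1) * DZ g h d (norm x) (ang x)) = J D (\<lambda>x. (D - q x) ^ j * DV g h d (norm x) (ang x))"
  using field_integration_by_parts[OF N_props(6,5) compact_sublevel[OF assms(1)] assms(2), of g h d]
  unfolding J_def B_def by (simp add: mult.left_commute mult.commute)

lemma continuous_radial: "continuous_on N f" if "\<And>x. x \<in> N \<Longrightarrow> isCont f x" for f :: "'a \<Rightarrow> real"
  using that continuous_at_imp_continuous_on by blast

lemma isCont_coords:
  assumes "x \<in> N"
  shows "isCont ang x" "isCont norm x" "isCont (\<lambda>x. p (norm x)) x" "isCont (\<lambda>x. deriv p (norm x)) x"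
    "isCont (\<lambda>x. deriv (deriv p) (norm x)) x" "p (norm x) \<noteq> 0"
proof -
  have x: "x \<noteq> 0" using assms N_props(5) by auto
  show "isCont ang x" using ang_has_derivative[OF x] has_derivative_continuous by blast
  show n: "isCont norm x" by simp
  show "isCont (\<lambda>x. p (norm x)) x" "isCont (\<lambda>x. deriv p (norm x)) x" "isCont (\<lambda>x. deriv (deriv p) (norm x)) x"
    by (rule isCont_o2[OF n DERIV_isCont[OF admissible_warpD(1)[OF ad]]] isCont_o2[OF n DERIV_isCont[OF admissible_warpD(2)[OF ad]]]
      isCont_o2[OF n DERIV_isCont[OF admissible_warpD(3)[OF ad]]])+
  show "p (norm x) \<noteq> 0" using admissible_warpD(7)[OF ad, of "norm x"] x by simp
qed

lemma continuous_DZ: "continuous_on N (\<lambda>x. DZ g h d (norm x) (ang x))"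
  unfolding DZ_def qr_def fa_def fb_def
  by (rule continuous_radial) (intro continuous_intros isCont_coords; assumption)

lemma continuous_DV: "continuous_on N (\<lambda>x. DV g h d (norm x) (ang x))"
  unfolding DV_def fa_def fb_def
  by (rule continuous_radial) (intro continuous_intros isCont_coords; assumption)

lemma continuous_GR: "continuous_on N (\<lambda>x. GR (norm x) (ang x))"
  unfolding GR_def qr_def
  by (rule continuous_radial) (intro continuous_intros isCont_coords; assumption)

definition W :: "real \<Rightarrow> real" where "W D = J D (\<lambda>x. D - q x)"
definition m :: "real \<Rightarrow> real" where "m D = J D (\<lambda>x. 1)"
definition E :: "real \<Rightarrow> real" where "E D = J D (\<lambda>x. GR (norm x) (ang x))"

text \<open>Let \<open>M\<close> be the integral of \<open>(D - q) * q\<close>. With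
  \<open>j = 1\<close> the two fields give \<open>E = n * W - \<kappa>1 * M\<close> and
  \<open>2 * (D * m - W) = n * W - \<kappa>2 * M\<close> up to errors. With \<open>j = 2\<close> the
  second field gives \<open>4 * M = n * (D * W - M)\<close> to leading order, that is
  \<open>M = n / (n + 4) * D * W\<close>, whence the factor in the statement.\<close>

lemma sublevel_estimates:
  assumes \<epsilon>: "\<epsilon> > 0"
  shows "\<forall>\<^sub>F D in at_right 0. E D \<le> W D * (n - (\<kappa>1 * n / (n + 4) - \<epsilon>) * D)
    \<and> 2 * (D * m D - W D) \<le> W D * (n - (\<kappa>2 * n / (n + 4) - \<epsilon>) * D)
    \<and> 2 * (D * m D - W D) \<ge> W D * (n - \<epsilon>)"
proof -
  obtain g1 h1 d1 g2 h2 d2 where F: "\<And>\<eta>. \<eta> > 0 \<Longrightarrow> \<forall>\<^sub>F z in F0. snd z \<ge> 0 \<longrightarrow>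
      \<bar>DV g1 h1 d1 (fst z) (snd z) - (n - \<kappa>1 * qf (fst z) (snd z))\<bar> \<le> \<eta> * qf (fst z) (snd z) \<and>
      \<bar>DZ g1 h1 d1 (fst z) (snd z) - GR (fst z) (snd z)\<bar> \<le> \<eta> * (qf (fst z) (snd z))\<^sup>2 \<and>
      \<bar>DV g2 h2 d2 (fst z) (snd z) - (n - \<kappa>2 * qf (fst z) (snd z))\<bar> \<le> \<eta> * qf (fst z) (snd z) \<and>
      \<bar>DZ g2 h2 d2 (fst z) (snd z) - 2 * qf (fst z) (snd z)\<bar> \<le> \<eta> * (qf (fst z) (snd z))\<^sup>2"
    using field_cases by blast
  have n: "n \<ge> 2" using n_ge_2 .
  \<comment> \<open>Of the factor \<open>n + 2\<close>, one unit pays for the error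
    \<open>\<eta> * M\<close> and \<open>n + 1\<close> units for \<open>\<eta> * D * s / 2\<close>,
    by the bound \<open>sb\<close> below.\<close>
  define \<eta> where "\<eta> = min 1 (\<epsilon> / (2 * (n + 2)))"
  have \<eta>: "0 < \<eta>" "\<eta> \<le> 1" using \<epsilon> n by (auto simp: \<eta>_def)
  have "(n + 2) * \<eta> \<le> (n + 2) * (\<epsilon> / (2 * (n + 2)))" using n by (intro mult_left_mono) (auto simp: \<eta>_def)
  also have "\<dots> = \<epsilon> / 2" using n by (simp add: divide_simps)
  finally have \<eta>3: "(n + 2) * \<eta> \<le> \<epsilon> / 2" .
  obtain \<rho> where \<rho>: "\<rho> > 0" and near: "\<And>x. x \<in> ball x0 \<rho> \<Longrightarrow>
      \<bar>DV g1 h1 d1 (norm x) (ang x) - (n - \<kappa>1 * q x)\<bar> \<le> \<eta> * q x \<and>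
      \<bar>DZ g1 h1 d1 (norm x) (ang x) - GR (norm x) (ang x)\<bar> \<le> \<eta> * (q x)\<^sup>2 \<and>
      \<bar>DV g2 h2 d2 (norm x) (ang x) - (n - \<kappa>2 * q x)\<bar> \<le> \<eta> * q x \<and>
      \<bar>DZ g2 h2 d2 (norm x) (ang x) - 2 * q x\<bar> \<le> \<eta> * (q x)\<^sup>2"
    using near_x0[OF F[OF \<eta>(1)]] by (auto simp: q_qf)
  define C2 where "C2 = 3 + \<bar>\<kappa>2\<bar>"
  define C3 where "C3 = (\<bar>\<kappa>1\<bar> + \<bar>\<kappa>2\<bar>) * C2 + \<bar>\<kappa>2\<bar> + n + 3"
  have C: "C2 > 0" "C3 > 0" using n by (auto simp: C2_def C3_def intro!: add_nonneg_pos)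
  define Dm where "Dm = min (min D0 (\<rho>\<^sup>2 / (2 * Cq))) (min (1 / (\<bar>\<kappa>2\<bar> + 2)) (min (\<epsilon> / (2 * C3)) 1))"
  have Dm: "Dm > 0" using D0_pos \<rho> N_props(1) \<epsilon> C by (auto simp: Dm_def intro!: divide_pos_pos)
  have main: "E D \<le> W D * (n - (\<kappa>1 * n / (n + 4) - \<epsilon>) * D)
    \<and> 2 * (D * m D - W D) \<le> W D * (n - (\<kappa>2 * n / (n + 4) - \<epsilon>) * D)
    \<and> 2 * (D * m D - W D) \<ge> W D * (n - \<epsilon>)" if D: "0 < D" "D < Dm" for D
  proof -
    have DD0: "D \<le> D0" using D by (simp add: Dm_def)
    have inB: "x \<in> ball x0 \<rho>" "x \<in> N" "0 \<le> q x" "q x < D" if "x \<in> B D" for x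
    proof -
      have "D < \<rho>\<^sup>2 / (2 * Cq)" using D by (simp add: Dm_def)
      then have "Cq * D < \<rho>\<^sup>2 / 2" using N_props(1) by (simp add: field_simps)
      also have "\<dots> \<le> \<rho>\<^sup>2" by simp
      finally show "x \<in> ball x0 \<rho>" using that \<rho> sublevel_in_ball[of x D \<rho>] by (simp add: B_def)
      show "x \<in> N" "0 \<le> q x" "q x < D" using that N_props(4) by (auto simp: B_def)
    qed
    note cont = continuous_q continuous_DZ continuous_DV continuous_GR
    define s where "s = J D (\<lambda>x. 2 * q x)"
    define M where "M = J D (\<lambda>x. (D - q x) * q x)"
    define w where "w = W D"
    have q2: "J D (\<lambda>x. \<eta> * (q x)\<^sup>2) \<le> \<eta> * D * s / 2"
    proof -
      have "J D (\<lambda>x. \<eta> * (q x)\<^sup>2) \<le> J D (\<lambda>x. (\<eta> * D / 2) * (2 * q x))"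
      proof (intro J_mono DD0 continuous_intros cont)
        fix x assume x: "x \<in> B D"
        have "(q x)\<^sup>2 \<le> D * q x" using inB(3,4)[OF x] by (simp add: power2_eq_square mult_right_mono)
        then show "\<eta> * (q x)\<^sup>2 \<le> \<eta> * D / 2 * (2 * q x)" using \<eta>(1) by simp
      qed
      then show ?thesis by (simp add: J_cmult s_def)
    qed
    have M0: "0 \<le> M"
    proof -
      have "J D (\<lambda>x. 0) \<le> M" unfolding M_def
        by (intro J_mono DD0 continuous_intros cont) (simp add: inB(3,4) less_imp_le)
      then show ?thesis by (simp add: J_def)
    qed
    have s0: "0 \<le> s"
    proof -
      have "J D (\<lambda>x. 0) \<le> s" unfolding s_def by (intro J_mono DD0 continuous_intros cont) (use inB in auto)
      then show ?thesis by (simp add: J_def)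
    qed
    have MW: "M \<le> D * w"
    proof -
      have "M \<le> J D (\<lambda>x. D * (D - q x))" unfolding M_def
      proof (intro J_mono DD0 continuous_intros cont)
        fix x assume x: "x \<in> B D"
        show "(D - q x) * q x \<le> D * (D - q x)" using inB(3,4)[OF x] by (simp add: mult.commute mult_right_mono)
      qed
      then show ?thesis unfolding w_def W_def J_cmult .
    qed
    have w0: "0 \<le> w" using M0 MW D by (metis dual_order.trans mult_le_0_iff not_less order_less_imp_le zero_le_mult_iff)
    have dv: "\<bar>J D (\<lambda>x. (D - q x) * DV g h d (norm x) (ang x)) - (n * w - \<kappa> * M)\<bar> \<le> \<eta> * M"
      if near': "\<And>x. x \<in> B D \<Longrightarrow> \<bar>DV g h d (norm x) (ang x) - (n - \<kappa> * q x)\<bar> \<le> \<eta> * q x" for g h d \<kappa>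
    proof -
      have "J D (\<lambda>x. n * (D - q x) + (- \<kappa>) * ((D - q x) * q x)) = n * w - \<kappa> * M"
        unfolding w_def W_def M_def by (subst J_add[OF DD0]) (auto simp only: J_cmult intro!: continuous_intros cont)
      moreover have "\<bar>J D (\<lambda>x. (D - q x) * DV g h d (norm x) (ang x)) - J D (\<lambda>x. n * (D - q x) + (- \<kappa>) * ((D - q x) * q x))\<bar>
        \<le> J D (\<lambda>x. \<eta> * ((D - q x) * q x))"
      proof (intro J_abs_bound DD0 continuous_intros cont)
        fix x assume x: "x \<in> B D"
        have "\<bar>(D - q x) * DV g h d (norm x) (ang x) - (n * (D - q x) + - \<kappa> * ((D - q x) * q x))\<bar>
          = (D - q x) * \<bar>DV g h d (norm x) (ang x) - (n - \<kappa> * q x)\<bar>"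
        proof -
          have "(D - q x) * DV g h d (norm x) (ang x) - (n * (D - q x) + - \<kappa> * ((D - q x) * q x))
            = (D - q x) * (DV g h d (norm x) (ang x) - (n - \<kappa> * q x))" by (simp add: algebra_simps)
          then show ?thesis using inB(4)[OF x] by (simp add: abs_mult)
        qed
        also have "\<dots> \<le> (D - q x) * (\<eta> * q x)" using near'[OF x] inB(4)[OF x] by (intro mult_left_mono) auto
        finally show "\<bar>(D - q x) * DV g h d (norm x) (ang x) - (n * (D - q x) + - \<kappa> * ((D - q x) * q x))\<bar> \<le> \<eta> * ((D - q x) * q x)"
          by (simp add: mult.left_commute)
      qed
      ultimately show ?thesis unfolding M_def by (simp only: J_cmult)
    qed
    have eq1: "J D (\<lambda>x. DZ g h d (norm x) (ang x)) = J D (\<lambda>x. (D - q x) * DV g h d (norm x) (ang x))" for g h d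
      using J_ibp[OF DD0, of 1 g h d] by simp
    have zE: "\<bar>J D (\<lambda>x. DZ g1 h1 d1 (norm x) (ang x)) - E D\<bar> \<le> \<eta> * D * s / 2"
      using J_abs_bound[OF DD0 cont(2) cont(4), of "\<lambda>x. \<eta> * (q x)\<^sup>2" g1 h1 d1] near inB q2
      unfolding E_def by (force intro!: continuous_intros cont)
    have zs: "\<bar>J D (\<lambda>x. DZ g2 h2 d2 (norm x) (ang x)) - s\<bar> \<le> \<eta> * D * s / 2"
    proof -
      have "\<bar>J D (\<lambda>x. DZ g2 h2 d2 (norm x) (ang x)) - s\<bar> \<le> J D (\<lambda>x. \<eta> * (q x)\<^sup>2)" unfolding s_def
        by (intro J_abs_bound DD0 continuous_intros cont) (use near inB in blast)
      then show ?thesis using q2 by simp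
    qed
    have dv1: "\<bar>J D (\<lambda>x. (D - q x) * DV g1 h1 d1 (norm x) (ang x)) - (n * w - \<kappa>1 * M)\<bar> \<le> \<eta> * M"
      by (rule dv) (use near inB in blast)
    have dv2: "\<bar>J D (\<lambda>x. (D - q x) * DV g2 h2 d2 (norm x) (ang x)) - (n * w - \<kappa>2 * M)\<bar> \<le> \<eta> * M"
      by (rule dv) (use near inB in blast)
    have up1: "E D \<le> n * w - \<kappa>1 * M + \<eta> * M + \<eta> * D * s / 2" using zE dv1 eq1[of g1 h1 d1] by linarith
    have up2: "\<bar>s - (n * w - \<kappa>2 * M)\<bar> \<le> \<eta> * M + \<eta> * D * s / 2" using zs dv2 eq1[of g2 h2 d2] by linarith
    define X where "X = J D (\<lambda>x. (D - q x)\<^sup>2 * q x)"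
    have X: "0 \<le> X" "X \<le> D * M"
    proof -
      have "J D (\<lambda>x. 0) \<le> X" unfolding X_def
        by (intro J_mono DD0 continuous_intros cont) (use inB in \<open>auto intro!: mult_nonneg_nonneg\<close>)
      then show "0 \<le> X" by (simp add: J_def)
      have "X \<le> J D (\<lambda>x. D * ((D - q x) * q x))" unfolding X_def
      proof (intro J_mono DD0 continuous_intros cont)
        fix x assume x: "x \<in> B D"
        have "(D - q x) * ((D - q x) * q x) \<le> D * ((D - q x) * q x)"
          using inB(3,4)[OF x] by (intro mult_right_mono mult_nonneg_nonneg) auto
        then show "(D - q x)\<^sup>2 * q x \<le> D * ((D - q x) * q x)" by (simp add: power2_eq_square mult.assoc)
      qed
      then show "X \<le> D * M" unfolding M_def J_cmult .
    qed
    have W2: "J D (\<lambda>x. (D - q x)\<^sup>2) = D * w - M"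
    proof -
      have "J D (\<lambda>x. D * (D - q x) + (- 1) * ((D - q x) * q x)) = D * w - M"
        unfolding w_def W_def M_def by (subst J_add[OF DD0]) (auto simp only: J_cmult intro!: continuous_intros cont)
      moreover have "(\<lambda>x. D * (D - q x) + (- 1) * ((D - q x) * q x)) = (\<lambda>x. (D - q x)\<^sup>2)"
        by (auto simp: fun_eq_iff power2_eq_square algebra_simps)
      ultimately show ?thesis by simp
    qed
    have j2: "J D (\<lambda>x. 2 * (D - q x) * DZ g2 h2 d2 (norm x) (ang x)) = J D (\<lambda>x. (D - q x)\<^sup>2 * DV g2 h2 d2 (norm x) (ang x))"
      using J_ibp[OF DD0, of 2 g2 h2 d2] by simp
    have l2: "\<bar>J D (\<lambda>x. 2 * (D - q x) * DZ g2 h2 d2 (norm x) (ang x)) - 4 * M\<bar> \<le> 2 * \<eta> * D * M"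
    proof -
      have "\<bar>J D (\<lambda>x. 2 * (D - q x) * DZ g2 h2 d2 (norm x) (ang x)) - J D (\<lambda>x. 4 * ((D - q x) * q x))\<bar>
        \<le> J D (\<lambda>x. (2 * \<eta> * D) * ((D - q x) * q x))"
      proof (intro J_abs_bound DD0 continuous_intros cont)
        fix x assume x: "x \<in> B D"
        have d: "D - q x \<ge> 0" using inB(4)[OF x] by simp
        have "2 * (D - q x) * DZ g2 h2 d2 (norm x) (ang x) - 4 * ((D - q x) * q x)
          = 2 * (D - q x) * (DZ g2 h2 d2 (norm x) (ang x) - 2 * q x)" by (simp add: algebra_simps)
        then have "\<bar>2 * (D - q x) * DZ g2 h2 d2 (norm x) (ang x) - 4 * ((D - q x) * q x)\<bar>
          = 2 * (D - q x) * \<bar>DZ g2 h2 d2 (norm x) (ang x) - 2 * q x\<bar>" using d by (simp add: abs_mult)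
        also have "\<dots> \<le> 2 * (D - q x) * (\<eta> * (D * q x))"
        proof (intro mult_left_mono)
          have "(q x)\<^sup>2 \<le> D * q x" using inB(3,4)[OF x] by (simp add: power2_eq_square mult_right_mono)
          then have "\<eta> * (q x)\<^sup>2 \<le> \<eta> * (D * q x)" using \<eta>(1) by simp
          then show "\<bar>DZ g2 h2 d2 (norm x) (ang x) - 2 * q x\<bar> \<le> \<eta> * (D * q x)" using near[OF inB(1)[OF x]] by linarith
        qed (use d in simp)
        finally show "\<bar>2 * (D - q x) * DZ g2 h2 d2 (norm x) (ang x) - 4 * ((D - q x) * q x)\<bar> \<le> 2 * \<eta> * D * ((D - q x) * q x)"
          by (simp add: mult_ac)
      qed
      then show ?thesis unfolding M_def by (simp only: J_cmult)
    qed
    have r2: "\<bar>J D (\<lambda>x. (D - q x)\<^sup>2 * DV g2 h2 d2 (norm x) (ang x)) - (n * (D * w - M) - \<kappa>2 * X)\<bar> \<le> \<eta> * X"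
    proof -
      have "J D (\<lambda>x. n * (D - q x)\<^sup>2 + (- \<kappa>2) * ((D - q x)\<^sup>2 * q x)) = n * (D * w - M) - \<kappa>2 * X"
        unfolding W2[symmetric] X_def by (subst J_add[OF DD0]) (auto simp only: J_cmult intro!: continuous_intros cont)
      moreover have "\<bar>J D (\<lambda>x. (D - q x)\<^sup>2 * DV g2 h2 d2 (norm x) (ang x)) - J D (\<lambda>x. n * (D - q x)\<^sup>2 + (- \<kappa>2) * ((D - q x)\<^sup>2 * q x))\<bar>
        \<le> J D (\<lambda>x. \<eta> * ((D - q x)\<^sup>2 * q x))"
      proof (intro J_abs_bound DD0 continuous_intros cont)
        fix x assume x: "x \<in> B D"
        have "(D - q x)\<^sup>2 * DV g2 h2 d2 (norm x) (ang x) - (n * (D - q x)\<^sup>2 + - \<kappa>2 * ((D - q x)\<^sup>2 * q x))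
            = (D - q x)\<^sup>2 * (DV g2 h2 d2 (norm x) (ang x) - (n - \<kappa>2 * q x))" by (simp add: algebra_simps)
        then have "\<bar>(D - q x)\<^sup>2 * DV g2 h2 d2 (norm x) (ang x) - (n * (D - q x)\<^sup>2 + - \<kappa>2 * ((D - q x)\<^sup>2 * q x))\<bar>
            = (D - q x)\<^sup>2 * \<bar>DV g2 h2 d2 (norm x) (ang x) - (n - \<kappa>2 * q x)\<bar>" by (simp add: abs_mult)
        also have "\<dots> \<le> (D - q x)\<^sup>2 * (\<eta> * q x)" using near[OF inB(1)[OF x]] by (intro mult_left_mono) auto
        finally show "\<bar>(D - q x)\<^sup>2 * DV g2 h2 d2 (norm x) (ang x) - (n * (D - q x)\<^sup>2 + - \<kappa>2 * ((D - q x)\<^sup>2 * q x))\<bar> \<le> \<eta> * ((D - q x)\<^sup>2 * q x)"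
          by (simp add: mult.left_commute)
      qed
      ultimately show ?thesis unfolding X_def by (simp only: J_cmult)
    qed
    \<comment> \<open>The leading relation for \<open>M\<close>. Its errors carry an extra factor
      \<open>D\<close> because \<open>X \<le> D * M\<close>.\<close>
    have "\<bar>(n + 4) * M - n * D * w\<bar> \<le> C2 * D * M"
    proof -
      have "\<bar>4 * M - n * (D * w - M)\<bar> \<le> 2 * \<eta> * D * M + \<eta> * X + \<bar>\<kappa>2 * X\<bar>" using l2 r2 j2 by linarith
      also have "\<bar>\<kappa>2 * X\<bar> \<le> \<bar>\<kappa>2\<bar> * (D * M)" using X by (simp add: abs_mult mult_left_mono)
      also have "\<eta> * X \<le> 1 * (D * M)" using X \<eta> by (intro mult_mono) auto
      also have "2 * \<eta> * D * M \<le> 2 * (D * M)" using \<eta> D M0 by (simp add: mult_left_le_one_le mult.assoc)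
      finally show ?thesis by (simp add: C2_def algebra_simps)
    qed
    also have "C2 * D * M \<le> C2 * D * (D * w)" using MW C D by (intro mult_left_mono) auto
    finally have Mb: "\<bar>(n + 4) * M - n * D * w\<bar> \<le> C2 * D * D * w" by (simp add: mult.assoc)
    have Mb': "\<bar>M - n / (n + 4) * D * w\<bar> \<le> C2 * D * D * w"
    proof -
      have "(n + 4) * \<bar>M - n / (n + 4) * D * w\<bar> = \<bar>(n + 4) * (M - n / (n + 4) * D * w)\<bar>" using n by (simp add: abs_mult)
      also have "(n + 4) * (M - n / (n + 4) * D * w) = (n + 4) * M - n * D * w" using n by (simp add: right_diff_distrib)
      finally have "(n + 4) * \<bar>M - n / (n + 4) * D * w\<bar> \<le> C2 * D * D * w" using Mb by simp
      moreover have "1 * \<bar>M - n / (n + 4) * D * w\<bar> \<le> (n + 4) * \<bar>M - n / (n + 4) * D * w\<bar>"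
        using n by (intro mult_right_mono) auto
      ultimately show ?thesis by simp
    qed
    have D1: "D * (\<bar>\<kappa>2\<bar> + 2) \<le> 1" "D \<le> 1" "C3 * D \<le> \<epsilon> / 2"
    proof -
      have "D \<le> 1 / (\<bar>\<kappa>2\<bar> + 2)" "D \<le> \<epsilon> / (2 * C3)" using D by (auto simp: Dm_def)
      then show "D * (\<bar>\<kappa>2\<bar> + 2) \<le> 1" "C3 * D \<le> \<epsilon> / 2" using C by (auto simp: field_simps)
      show "D \<le> 1" using D by (simp add: Dm_def)
    qed
    \<comment> \<open>The error in \<open>up2\<close> contains \<open>s\<close> itself; as
      \<open>\<eta> * D \<le> 1\<close> it amounts to at most half of \<open>s\<close> and can be
      absorbed.\<close>
    have sb: "s / 2 \<le> (n + 1) * w"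
    proof -
      have "\<eta> * D \<le> 1 * 1" using \<eta> D D1 by (intro mult_mono) auto
      then have a: "\<eta> * D * s / 2 \<le> s / 2" using s0 mult_right_mono[of "\<eta> * D" 1 s] by simp
      have b: "\<eta> * M \<le> D * w" using \<eta> M0 MW by (meson mult_left_le_one_le order_trans less_imp_le)
      have "\<bar>\<kappa>2 * M\<bar> \<le> \<bar>\<kappa>2\<bar> * (D * w)" using M0 MW by (simp add: abs_mult mult_left_mono)
      then have "s - s / 2 \<le> n * w + (\<bar>\<kappa>2\<bar> * (D * w) + D * w)" using up2 a b by linarith
      moreover have "\<bar>\<kappa>2\<bar> * (D * w) + D * w \<le> (D * (\<bar>\<kappa>2\<bar> + 2)) * w" using w0 D by (simp add: algebra_simps)
      moreover have "(D * (\<bar>\<kappa>2\<bar> + 2)) * w \<le> 1 * w" using D1 w0 by (intro mult_right_mono) auto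
      ultimately have "s / 2 \<le> n * w + w" by linarith
      then show ?thesis by (simp add: algebra_simps)
    qed
    have err: "\<eta> * M + \<eta> * D * s / 2 \<le> (\<epsilon> / 2) * D * w"
    proof -
      have "\<eta> * M \<le> \<eta> * (D * w)" using MW \<eta> by (intro mult_left_mono) auto
      moreover have "\<eta> * D * s / 2 \<le> \<eta> * D * ((n + 1) * w)" using sb \<eta> D mult_left_mono[OF sb, of "\<eta> * D"] by simp
      ultimately have "\<eta> * M + \<eta> * D * s / 2 \<le> ((n + 2) * \<eta>) * (D * w)" by (simp add: algebra_simps)
      also have "\<dots> \<le> (\<epsilon> / 2) * (D * w)" using \<eta>3 D w0 by (intro mult_right_mono) auto
      finally show ?thesis by simp
    qed
    \<comment> \<open>The sign of \<open>\<kappa>\<close> is unknown, so \<open>M\<close> has to be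
      replaced by its leading value through the two-sided estimate \<open>Mb'\<close>.\<close>
    have kM: "- \<kappa> * M \<le> - (\<kappa> * n / (n + 4)) * D * w + (\<epsilon> / 2) * D * w" if "\<bar>\<kappa>\<bar> \<le> \<bar>\<kappa>1\<bar> + \<bar>\<kappa>2\<bar>" for \<kappa>
    proof -
      have "- \<kappa> * (M - n / (n + 4) * D * w) \<le> \<bar>\<kappa>\<bar> * \<bar>M - n / (n + 4) * D * w\<bar>"
        by (metis abs_ge_self abs_minus_cancel abs_mult)
      also have "\<dots> \<le> (\<bar>\<kappa>1\<bar> + \<bar>\<kappa>2\<bar>) * (C2 * D * D * w)" using Mb' that by (intro mult_mono) auto
      also have "\<dots> = ((\<bar>\<kappa>1\<bar> + \<bar>\<kappa>2\<bar>) * C2) * D * (D * w)" by (simp add: mult_ac)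
      also have "\<dots> \<le> C3 * D * (D * w)" using D w0 n by (intro mult_right_mono) (auto simp: C3_def)
      also have "\<dots> \<le> (\<epsilon> / 2) * (D * w)" using D1(3) D w0 by (intro mult_right_mono) auto
      finally show ?thesis by (simp add: algebra_simps)
    qed
    have sm: "s = 2 * (D * m D - w)"
    proof -
      have "J D (\<lambda>x. D * 1 + (- 1) * (D - q x)) = D * m D - w"
        unfolding w_def W_def m_def by (subst J_add[OF DD0]) (auto simp only: J_cmult intro!: continuous_intros cont)
      then have "J D (\<lambda>x. q x) = D * m D - w" by simp
      then show ?thesis unfolding s_def J_cmult by simp
    qed
    have ex: "w * (n - (c - \<epsilon>) * D) = n * w - c * D * w + 2 * (\<epsilon> / 2 * D * w)" for c
      by (simp add: algebra_simps)
    have "E D \<le> w * (n - (\<kappa>1 * n / (n + 4) - \<epsilon>) * D)"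
      unfolding ex using up1 err kM[of \<kappa>1] by linarith
    moreover have "s \<le> w * (n - (\<kappa>2 * n / (n + 4) - \<epsilon>) * D)"
      unfolding ex using up2 err kM[of \<kappa>2] by linarith
    moreover have "s \<ge> w * (n - \<epsilon>)"
    proof -
      have "\<kappa>2 * M \<le> \<bar>\<kappa>2\<bar> * (D * w)" using M0 MW by (meson abs_ge_self abs_ge_zero mult_mono)
      then have "s \<ge> n * w - \<bar>\<kappa>2\<bar> * (D * w) - (\<epsilon> / 2) * D * w" using up2 err by linarith
      moreover have "\<bar>\<kappa>2\<bar> * (D * w) \<le> (\<epsilon> / 2) * w"
      proof -
        have "\<bar>\<kappa>2\<bar> \<le> C3" using C n by (auto simp: C3_def intro!: add_nonneg_nonneg mult_nonneg_nonneg)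
        then have "\<bar>\<kappa>2\<bar> * (D * w) \<le> C3 * (D * w)" using D w0 by (intro mult_right_mono) auto
        also have "\<dots> \<le> (\<epsilon> / 2) * w" using D1(3) w0 mult_right_mono[of "C3 * D" "\<epsilon> / 2" w] by (simp add: mult.assoc)
        finally show ?thesis .
      qed
      moreover have "(\<epsilon> / 2) * D * w \<le> (\<epsilon> / 2) * 1 * w" using D1 \<epsilon> w0 D by (intro mult_right_mono mult_left_mono) auto
      ultimately show ?thesis by (simp add: algebra_simps)
    qed
    ultimately show ?thesis unfolding sm[symmetric] w_def[symmetric] by (simp add: sm w_def)
  qed
  show ?thesis unfolding eventually_at_right_field using Dm main by blast
qed

end

section \<open>Leading order of \<open>W\<close> as \<open>D\<close> tends to 0\<close>

lemma integral_lborel_affine_euclidean: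
  fixes c :: "'a::euclidean_space \<Rightarrow> real" and t and f :: "'a \<Rightarrow> real"
  defines "T x \<equiv> t + (\<Sum>j\<in>Basis. (c j * (x \<bullet> j)) *\<^sub>R j)"
  assumes c: "\<And>j. j \<in> Basis \<Longrightarrow> c j \<noteq> 0" and f: "f \<in> borel_measurable borel"
  shows "(\<integral>x. f x \<partial>lborel) = (\<Prod>j\<in>Basis. \<bar>c j\<bar>) * (\<integral>x. f (T x) \<partial>lborel)"
proof -
  have T [measurable]: "T \<in> borel \<rightarrow>\<^sub>M borel" by (simp add: T_def[abs_def])
  note [measurable] = f
  have eq: "lborel = density (distr lborel borel T) (\<lambda>_. ennreal (\<Prod>j\<in>Basis. \<bar>c j\<bar>))"
    unfolding T_def[abs_def] by (rule lborel_affine_euclidean[OF c])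
  have "(\<integral>x. f x \<partial>lborel) = (\<integral>x. f x \<partial>density (distr lborel borel T) (\<lambda>_. ennreal (\<Prod>j\<in>Basis. \<bar>c j\<bar>)))"
    by (rule arg_cong[of _ _ "\<lambda>M. integral\<^sup>L M f", OF eq])
  also have "\<dots> = (\<integral>x. (\<Prod>j\<in>Basis. \<bar>c j\<bar>) *\<^sub>R f x \<partial>distr lborel borel T)"
    by (intro integral_density) (auto intro!: AE_I2 prod_nonneg)
  also have "\<dots> = (\<Prod>j\<in>Basis. \<bar>c j\<bar>) * (\<integral>x. f x \<partial>distr lborel borel T)" by simp
  also have "(\<integral>x. f x \<partial>distr lborel borel T) = (\<integral>x. f (T x) \<partial>lborel)" by (intro integral_distr) auto
  finally show ?thesis .
qed

lemma integral_paraboloid: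
  assumes D: "D > 0" and a: "a > 0"
  defines "\<omega> \<equiv> measure lborel (ball (0::'a::euclidean_space) 1)" and "n \<equiv> real DIM('a)"
  shows "(\<integral>y. max 0 (D - a * ((norm (y::'a))\<^sup>2 / 2)) \<partial>lborel) = 2 / (n + 2) * D * \<omega> * sqrt (2 * D / a) ^ DIM('a)"
proof -
  define R where "R = sqrt (2 * D / a)"
  have R: "R > 0" "R\<^sup>2 = 2 * D / a" using D a by (auto simp: R_def)
  have n: "n > 0" by (simp add: n_def)
  have int: "set_integrable lborel (ball (0::'a) R) f" if "continuous_on UNIV f" for f :: "'a \<Rightarrow> real"
    by (rule set_integrable_bounded_continuous[of "cball 0 R"]) (auto intro: continuous_on_subset[OF that])
  have "max 0 (D - a * ((norm y)\<^sup>2 / 2)) = indicator (ball 0 R) y *\<^sub>R (D * 1 - a / 2 * (norm y)\<^sup>2)" for y :: 'a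
  proof (cases "norm y < R")
    case True
    then have "(norm y)\<^sup>2 < R\<^sup>2" by (intro power_strict_mono) auto
    then have "a * (norm y)\<^sup>2 < 2 * D" using a by (simp add: R field_simps)
    then show ?thesis using True by simp
  next
    case False
    then have "R\<^sup>2 \<le> (norm y)\<^sup>2" using R by (intro power_mono) auto
    then have "2 * D \<le> a * (norm y)\<^sup>2" using a by (simp add: R field_simps)
    then show ?thesis using False by simp
  qed
  then have "(\<integral>y. max 0 (D - a * ((norm (y::'a))\<^sup>2 / 2)) \<partial>lborel) = (LINT y:ball (0::'a) R|lborel. D * 1 - a / 2 * (norm y)\<^sup>2)"
    by (simp add: set_lebesgue_integral_def)
  also have "\<dots> = D * (LINT y:ball (0::'a) R|lborel. 1) - a / 2 * (LINT y:ball (0::'a) R|lborel. (norm y)\<^sup>2)"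
  proof -
    have "(LINT y:ball (0::'a) R|lborel. D * 1 - a / 2 * (norm y)\<^sup>2)
        = (LINT y:ball (0::'a) R|lborel. D * 1) - (LINT y:ball (0::'a) R|lborel. a / 2 * (norm y)\<^sup>2)"
      by (rule set_integral_diff) (auto intro!: int continuous_intros)
    then show ?thesis by (simp only: set_integral_mult_right)
  qed
  also have "\<dots> = D * (\<omega> * R ^ DIM('a)) - a / 2 * (n / (n + 2) * \<omega> * (R ^ DIM('a) * R\<^sup>2))"
    unfolding ball_moments(1,2)[OF R(1), where 'a='a, folded n_def \<omega>_def] by (simp add: power_add power2_eq_square[of R])
  also have "\<dots> = 2 / (n + 2) * D * \<omega> * R ^ DIM('a)"
  proof -
    have "a / 2 * (n / (n + 2) * \<omega> * (R ^ DIM('a) * R\<^sup>2)) = n / (n + 2) * (D * (\<omega> * R ^ DIM('a)))"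
      unfolding R(2) using a by simp
    then show ?thesis using n by (simp add: field_simps)
  qed
  finally show ?thesis by (simp add: R_def)
qed

context off_pole
begin

definition \<omega> :: real where "\<omega> = measure lborel (ball (0::'a) 1)"

lemma \<omega>_pos: "\<omega> > 0" unfolding \<omega>_def using content_ball_gt_0_iff[of "0::'a" 1] by simp

text \<open>The Euclidean quadratic form approximating \<open>q\<close> at \<open>x0\<close>.\<close>
definition qE :: "'a \<Rightarrow> real" where
  "qE x = ((x - x0) \<bullet> e)\<^sup>2 / 2 + p0\<^sup>2 / (2 * r0\<^sup>2) * ((norm (x - x0))\<^sup>2 - ((x - x0) \<bullet> e)\<^sup>2)"

lemma e_inner_le: "((x::'a) \<bullet> e)\<^sup>2 \<le> (norm x)\<^sup>2"
  using Cauchy_Schwarz_ineq2[of x e] by (simp add: e_norm abs_le_square_iff[symmetric])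

lemma qE_coercive:
  obtains c where "c > 0" "\<And>x. c * (norm (x - x0))\<^sup>2 \<le> qE x"
proof -
  define c where "c = min (1/2) (p0\<^sup>2 / (2 * r0\<^sup>2))"
  have c: "c > 0" using p0_pos r0 by (simp add: c_def)
  have "c * (norm (x - x0))\<^sup>2 \<le> qE x" for x
  proof -
    have "c * (norm (x - x0))\<^sup>2 = c * ((x - x0) \<bullet> e)\<^sup>2 + c * ((norm (x - x0))\<^sup>2 - ((x - x0) \<bullet> e)\<^sup>2)" by (simp add: algebra_simps)
    also have "\<dots> \<le> 1/2 * ((x - x0) \<bullet> e)\<^sup>2 + p0\<^sup>2 / (2 * r0\<^sup>2) * ((norm (x - x0))\<^sup>2 - ((x - x0) \<bullet> e)\<^sup>2)"
      using e_inner_le[of "x - x0"] by (intro add_mono mult_right_mono) (auto simp: c_def)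
    finally show ?thesis by (simp add: qE_def)
  qed
  then show ?thesis using c that by blast
qed

text \<open>With \<open>t = norm x - r0\<close>, the law of cosines gives exactly \<open>q x =
  t\<^sup>2 / 2 + A' x * ((norm (x - x0))\<^sup>2 - t\<^sup>2)\<close>. Two things remain:
  \<open>A'\<close> is continuous at \<open>x0\<close>, and \<open>t\<close> agrees with
  \<open>(x - x0) \<bullet> e\<close> to first order because the latter is the derivative of the
  norm.\<close>

lemma q_qE:
  assumes \<eta>: "\<eta> > 0"
  obtains \<rho> where "\<rho> > 0" "\<And>x. x \<in> ball x0 \<rho> \<Longrightarrow> \<bar>q x - qE x\<bar> \<le> \<eta> * (norm (x - x0))\<^sup>2"
proof -
  have x00: "x0 \<noteq> 0" using norm_x0 r0 by auto
  define A where "A = p0\<^sup>2 / (2 * r0\<^sup>2)"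
  define A' where "A' x = p0 * p (norm x) / (2 * norm x * r0)" for x :: 'a
  define k where "k = 2 * \<bar>1/2 - A\<bar> + 1"
  have k: "k > 0" by (simp add: k_def add_nonneg_pos)
  have "isCont A' x0" unfolding A'_def
    using x00 r0 isCont_o2[of x0 norm p] DERIV_isCont[OF admissible_warpD(1)[OF ad]] by (intro continuous_intros) auto
  moreover have "A' x0 = A" by (simp add: A'_def A_def norm_x0 p0_def power2_eq_square)
  ultimately have "\<forall>\<^sub>F x in nhds x0. \<bar>A' x - A\<bar> < \<eta> / k"
    using \<eta> k tendstoD[of A' A "nhds x0" "\<eta> / k"] by (auto simp: isCont_def tendsto_nhds_iff dist_real_def)
  then obtain \<rho>1 where \<rho>1: "\<rho>1 > 0" "\<And>x. x \<in> ball x0 \<rho>1 \<Longrightarrow> \<bar>A' x - A\<bar> < \<eta> / k"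
    by (auto simp: eventually_nhds_metric dist_commute)
  have "(norm has_derivative (\<lambda>h. (x0 \<bullet> h) / norm x0)) (at x0)" by (rule norm_has_derivative[OF x00])
  then obtain \<rho>2 where \<rho>2: "\<rho>2 > 0" "\<And>x. norm (x - x0) < \<rho>2 \<Longrightarrow> norm (norm x - norm x0 - (x0 \<bullet> (x - x0)) / norm x0) \<le> \<eta> / k * norm (x - x0)"
    using \<eta> k unfolding has_derivative_at_alt by (metis divide_pos_pos)
  show ?thesis
  proof (rule that[of "min \<rho>1 (min \<rho>2 r0)"])
    show "0 < min \<rho>1 (min \<rho>2 r0)" using \<rho>1 \<rho>2 r0 by simp
    fix x assume x: "x \<in> ball x0 (min \<rho>1 (min \<rho>2 r0))"
    define y where "y = norm (x - x0)"
    define y1 where "y1 = (x - x0) \<bullet> e"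
    define t where "t = norm x - r0"
    have yr: "y < r0" "y < \<rho>2" using x by (auto simp: y_def dist_norm norm_minus_commute)
    have n2: "\<bar>t\<bar> \<le> y" using norm_triangle_ineq3[of x x0] by (simp add: t_def y_def norm_x0)
    have xne: "x \<noteq> 0" using n2 yr r0 by (auto simp: t_def)
    have nx: "norm x > 0" using xne by simp
    have "(x0 \<bullet> (x - x0)) / norm x0 = y1" using r0 by (simp add: norm_x0 y1_def) (simp add: x0_def inner_commute)
    then have ty: "\<bar>t - y1\<bar> \<le> \<eta> / k * y" using \<rho>2(2)[of x] yr(2) by (simp add: y_def t_def norm_x0)
    have y1: "\<bar>y1\<bar> \<le> y" using Cauchy_Schwarz_ineq2[of "x - x0" e] by (simp add: y1_def y_def e_norm)
    have u: "ang x = (y\<^sup>2 - t\<^sup>2) / (2 * norm x * r0)" using dist_sq[OF xne] nx r0 by (simp add: y_def t_def)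
    have "q x = t\<^sup>2 / 2 + A' x * (y\<^sup>2 - t\<^sup>2)" unfolding q_qf qf_def u A'_def t_def[symmetric] by simp
    then have "q x - qE x = (t - y1) * (t + y1) * (1/2 - A) + (A' x - A) * (y\<^sup>2 - t\<^sup>2)"
      unfolding qE_def y1_def[symmetric] y_def[symmetric] A_def[symmetric] by (simp add: field_simps power2_eq_square)
    then have "\<bar>q x - qE x\<bar> \<le> \<bar>t - y1\<bar> * \<bar>t + y1\<bar> * \<bar>1/2 - A\<bar> + \<bar>A' x - A\<bar> * \<bar>y\<^sup>2 - t\<^sup>2\<bar>"
      using abs_triangle_ineq[of "(t - y1) * (t + y1) * (1/2 - A)" "(A' x - A) * (y\<^sup>2 - t\<^sup>2)"] by (simp add: abs_mult)
    also have "\<dots> \<le> (\<eta> / k * y) * (2 * y) * \<bar>1/2 - A\<bar> + \<eta> / k * y\<^sup>2"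
    proof (intro add_mono mult_mono mult_right_mono)
      show "\<bar>t + y1\<bar> \<le> 2 * y" using n2 y1 by linarith
      have "t\<^sup>2 \<le> y\<^sup>2" using n2 by (simp add: abs_le_square_iff[symmetric])
      then show "\<bar>y\<^sup>2 - t\<^sup>2\<bar> \<le> y\<^sup>2" by simp
      show "\<bar>A' x - A\<bar> \<le> \<eta> / k" using \<rho>1(2)[of x] x by simp
    qed (use ty \<eta> k in \<open>auto simp: y_def\<close>)
    also have "\<dots> = \<eta> / k * y\<^sup>2 * k"
    proof -
      have "(c * y) * (2 * y) * Z + c * y\<^sup>2 = c * y\<^sup>2 * (2 * Z + 1)" for c Z :: real
        by (simp add: power2_eq_square algebra_simps)
      then show ?thesis by (simp only: k_def)
    qed
    also have "\<dots> = \<eta> * y\<^sup>2" using k by simp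
    finally show "\<bar>q x - qE x\<bar> \<le> \<eta> * (norm (x - x0))\<^sup>2" by (simp add: y_def)
  qed
qed

text \<open>The value of \<open>W\<close> in flat space with \<open>q\<close> half the squared
  norm.\<close>

definition K :: "real \<Rightarrow> real" where "K D = 2 / (n + 2) * D * \<omega> * sqrt (2 * D) ^ DIM('a)"

text \<open>Stretching the directions orthogonal to \<open>e\<close> by \<open>r0 / p0\<close> turns
  \<open>qE\<close> into half the squared norm; the Jacobian cancels the weight of the model measure
  at \<open>x0\<close>.\<close>

lemma integral_qE:
  assumes "D > 0" "a > 0"
  shows "(p0 / r0) ^ (DIM('a) - 1) * (\<integral>x. max 0 (D - a * qE x) \<partial>lborel) = K D / sqrt a ^ DIM('a)"
proof -
  define c where "c j = (if j = e then 1 else r0 / p0)" for j :: 'a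
  have c0: "c j \<noteq> 0" if "j \<in> Basis" for j using r0 p0_pos by (simp add: c_def)
  define T where "T x = x0 + (\<Sum>j\<in>Basis. (c j * (x \<bullet> j)) *\<^sub>R j)" for x
  have pr: "(\<Prod>j\<in>Basis. \<bar>c j\<bar>) = (r0 / p0) ^ (DIM('a) - 1)"
  proof -
    have "(\<Prod>j\<in>Basis. \<bar>c j\<bar>) = \<bar>c e\<bar> * (\<Prod>j\<in>Basis - {e}. \<bar>c j\<bar>)" using e by (intro prod.remove) auto
    also have "(\<Prod>j\<in>Basis - {e}. \<bar>c j\<bar>) = (\<Prod>j\<in>Basis - {e}. r0 / p0)"
      using r0 p0_pos by (intro prod.cong) (auto simp: c_def)
    finally show ?thesis using e by (simp add: c_def card_Diff_singleton)
  qed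
  have qT: "qE (T y) = (norm y)\<^sup>2 / 2" for y
  proof -
    have i: "(T y - x0) \<bullet> j = c j * (y \<bullet> j)" if "j \<in> Basis" for j
      using that by (simp add: T_def inner_sum_left_Basis)
    have nsq: "(norm z)\<^sup>2 = (\<Sum>j\<in>Basis. (z \<bullet> j)\<^sup>2)" for z :: 'a
      unfolding power2_norm_eq_inner by (subst euclidean_inner) (simp add: power2_eq_square)
    have "(norm (T y - x0))\<^sup>2 = (\<Sum>j\<in>Basis. (c j * (y \<bullet> j))\<^sup>2)"
      unfolding nsq by (intro sum.cong) (auto simp: i)
    also have "\<dots> = (y \<bullet> e)\<^sup>2 + (\<Sum>j\<in>Basis - {e}. (c j * (y \<bullet> j))\<^sup>2)"
      using e by (subst sum.remove[of Basis e]) (auto simp: c_def)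
    also have "(\<Sum>j\<in>Basis - {e}. (c j * (y \<bullet> j))\<^sup>2) = (r0 / p0)\<^sup>2 * (\<Sum>j\<in>Basis - {e}. (y \<bullet> j)\<^sup>2)"
      unfolding sum_distrib_left by (intro sum.cong) (auto simp: c_def power_mult_distrib power_divide)
    also have "(\<Sum>j\<in>Basis - {e}. (y \<bullet> j)\<^sup>2) = (norm y)\<^sup>2 - (y \<bullet> e)\<^sup>2"
      unfolding nsq using e by (subst sum.remove[of Basis e]) auto
    finally have "(norm (T y - x0))\<^sup>2 - (y \<bullet> e)\<^sup>2 = (r0 / p0)\<^sup>2 * ((norm y)\<^sup>2 - (y \<bullet> e)\<^sup>2)" by simp
    then show ?thesis unfolding qE_def i[OF e] using r0 p0_pos by (simp add: c_def) (simp add: field_simps power2_eq_square)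
  qed
  have m: "(\<lambda>x. max 0 (D - a * qE x)) \<in> borel_measurable borel"
    unfolding qE_def by measurable
  have "(\<integral>x. max 0 (D - a * qE x) \<partial>lborel) = (r0 / p0) ^ (DIM('a) - 1) * (\<integral>y. max 0 (D - a * ((norm (y::'a))\<^sup>2 / 2)) \<partial>lborel)"
    unfolding pr[symmetric] qT[symmetric] T_def by (rule integral_lborel_affine_euclidean[OF c0 m])
  also have "\<dots> = (r0 / p0) ^ (DIM('a) - 1) * (2 / (n + 2) * D * \<omega> * sqrt (2 * D / a) ^ DIM('a))"
    using integral_paraboloid[OF assms, where 'a='a] by (simp add: n_def \<omega>_def)
  also have "2 / (n + 2) * D * \<omega> * sqrt (2 * D / a) ^ DIM('a) = K D / sqrt a ^ DIM('a)"
    by (simp add: K_def real_sqrt_divide power_divide)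
  finally show ?thesis using r0 p0_pos by (simp add: power_divide)
qed

lemma W_integral: "W D = (\<integral>x. indicator (B D) x * (model_weight p x * (D - q x)) \<partial>lborel)"
  by (simp add: W_def J_def set_lebesgue_integral_def)

text \<open>Near \<open>x0\<close> both \<open>q\<close> and the weight are within factors
  \<open>1 - \<eta>\<close> and \<open>1 + \<eta>\<close> of \<open>qE\<close> and of the weight at
  \<open>x0\<close>, and scaling the form by \<open>a\<close> divides the integral by
  \<open>sqrt a ^ DIM('a)\<close>.\<close>

lemma W_sandwich:
  assumes \<eta>: "0 < \<eta>" "\<eta> < 1"
  shows "\<forall>\<^sub>F D in at_right 0. (1 - \<eta>) / sqrt (1 + \<eta>) ^ DIM('a) * K D \<le> W D \<and> W D \<le> (1 + \<eta>) / sqrt (1 - \<eta>) ^ DIM('a) * K D"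
proof -
  define w0 where "w0 = (p0 / r0) ^ (DIM('a) - 1)"
  have w0: "w0 > 0" using p0_pos r0 by (simp add: w0_def)
  obtain c where c: "c > 0" "\<And>x. c * (norm (x - x0))\<^sup>2 \<le> qE x" using qE_coercive by blast
  obtain \<rho>1 where \<rho>1: "\<rho>1 > 0" "\<And>x. x \<in> ball x0 \<rho>1 \<Longrightarrow> \<bar>q x - qE x\<bar> \<le> (\<eta> * c) * (norm (x - x0))\<^sup>2"
    using q_qE[of "\<eta> * c"] \<eta> c by auto
  have x00: "x0 \<noteq> 0" using norm_x0 r0 by auto
  have "model_weight p x0 = w0" using x00 by (simp add: model_weight_def norm_x0 w0_def p0_def)
  moreover have "isCont (model_weight p) x0"
    using continuous_model_weight[OF ad, where 'a='a] by (simp add: continuous_on_eq_continuous_at)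
  ultimately have "(model_weight p \<longlongrightarrow> w0) (nhds x0)" by (simp add: isCont_def tendsto_nhds_iff)
  then have "\<forall>\<^sub>F x in nhds x0. \<bar>model_weight p x - w0\<bar> < \<eta> * w0"
    using tendstoD[of _ w0 "nhds x0" "\<eta> * w0"] \<eta> w0 by (simp add: dist_real_def)
  then obtain \<rho>2 where \<rho>2: "\<rho>2 > 0" "\<And>x. x \<in> ball x0 \<rho>2 \<Longrightarrow> \<bar>model_weight p x - w0\<bar> < \<eta> * w0"
    by (auto simp: eventually_nhds_metric dist_commute)
  define \<rho> where "\<rho> = min (min \<rho>1 \<rho>2) \<rho>q"
  have \<rho>: "\<rho> > 0" using \<rho>1 \<rho>2 N_props(2) by (simp add: \<rho>_def)
  have near: "(1 - \<eta>) * qE x \<le> q x" "q x \<le> (1 + \<eta>) * qE x" "(1 - \<eta>) * w0 \<le> model_weight p x" "model_weight p x \<le> (1 + \<eta>) * w0" "x \<in> N"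
    if x: "x \<in> ball x0 \<rho>" for x
  proof -
    have "\<bar>q x - qE x\<bar> \<le> \<eta> * (c * (norm (x - x0))\<^sup>2)" using \<rho>1(2)[of x] x by (simp add: \<rho>_def mult.assoc)
    also have "\<dots> \<le> \<eta> * qE x" using c(2)[of x] \<eta> by (intro mult_left_mono) auto
    finally show "(1 - \<eta>) * qE x \<le> q x" "q x \<le> (1 + \<eta>) * qE x" by (auto simp: algebra_simps abs_le_iff)
    have "\<bar>model_weight p x - w0\<bar> < \<eta> * w0" using \<rho>2(2)[of x] x by (simp add: \<rho>_def)
    then show "(1 - \<eta>) * w0 \<le> model_weight p x" "model_weight p x \<le> (1 + \<eta>) * w0" by (auto simp: algebra_simps abs_less_iff)
    show "x \<in> N" using x by (simp add: N_def \<rho>_def)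
  qed
  \<comment> \<open>The second entry keeps \<open>B D\<close> and the third the support of the lower
    comparison function inside the ball where the estimates in \<open>near\<close> hold.\<close>
  define Dm where "Dm = min D0 (min (\<rho>\<^sup>2 / (2 * Cq)) (c * \<rho>\<^sup>2))"
  have Dm: "Dm > 0" using D0_pos \<rho> c N_props(1) by (simp add: Dm_def)
  have main: "(1 - \<eta>) / sqrt (1 + \<eta>) ^ DIM('a) * K D \<le> W D \<and> W D \<le> (1 + \<eta>) / sqrt (1 - \<eta>) ^ DIM('a) * K D"
    if D: "0 < D" "D < Dm" for D
  proof -
    have DD0: "D \<le> D0" using D by (simp add: Dm_def)
    have inB: "x \<in> ball x0 \<rho>" "x \<in> N" "q x < D" if "x \<in> B D" for x
    proof -
      have "D < \<rho>\<^sup>2 / (2 * Cq)" using D by (simp add: Dm_def)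
      then have "Cq * D < \<rho>\<^sup>2 / 2" using N_props(1) by (simp add: field_simps)
      also have "\<dots> \<le> \<rho>\<^sup>2" by simp
      finally show "x \<in> ball x0 \<rho>" using that \<rho> sublevel_in_ball[of x D \<rho>] by (simp add: B_def)
      show "x \<in> N" "q x < D" using that by (auto simp: B_def)
    qed
    have iW: "integrable lborel (\<lambda>x. indicator (B D) x * (model_weight p x * (D - q x)))"
      using J_integrable[OF DD0 continuous_on_diff[OF continuous_on_const continuous_q]]
      by (simp add: set_integrable_def)
    have iE: "integrable lborel (\<lambda>x. max 0 (D - a * qE x))" if a: "a > 0" for a
    proof (rule integrable_compact_support[of "cball x0 (sqrt (D / (a * c)))"])
      show "continuous_on UNIV (\<lambda>x. max 0 (D - a * qE x))" unfolding qE_def using r0 by (intro continuous_intros) auto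
      fix x assume "x \<notin> cball x0 (sqrt (D / (a * c)))"
      then have "sqrt (D / (a * c)) < norm (x - x0)" by (simp add: dist_norm norm_minus_commute)
      then have "(sqrt (D / (a * c)))\<^sup>2 < (norm (x - x0))\<^sup>2" by (intro power_strict_mono) (use a c D in auto)
      then have "D < a * (c * (norm (x - x0))\<^sup>2)" using a c D by (simp add: field_simps)
      also have "\<dots> \<le> a * qE x" using c(2)[of x] a by (intro mult_left_mono) auto
      finally show "max 0 (D - a * qE x) = 0" by simp
    qed simp
    have "W D \<le> (\<integral>x. (1 + \<eta>) * w0 * max 0 (D - (1 - \<eta>) * qE x) \<partial>lborel)"
      unfolding W_integral
    proof (rule integral_mono[OF iW])
      show "integrable lborel (\<lambda>x. (1 + \<eta>) * w0 * max 0 (D - (1 - \<eta>) * qE x))"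
        using iE[of "1 - \<eta>"] \<eta> by (intro integrable_mult_right) auto
      fix x
      show "indicator (B D) x * (model_weight p x * (D - q x)) \<le> (1 + \<eta>) * w0 * max 0 (D - (1 - \<eta>) * qE x)"
      proof (cases "x \<in> B D")
        case True
        then have "model_weight p x * (D - q x) \<le> ((1 + \<eta>) * w0) * max 0 (D - (1 - \<eta>) * qE x)"
          using near[OF inB(1)[OF True]] inB(3)[OF True] \<eta> w0 by (intro mult_mono) auto
        then show ?thesis using True by simp
      next
        case False
        then show ?thesis using \<eta> w0 by (auto intro!: mult_nonneg_nonneg)
      qed
    qed
    also have "\<dots> = (1 + \<eta>) * (w0 * (\<integral>x. max 0 (D - (1 - \<eta>) * qE x) \<partial>lborel))" by simp
    also have "w0 * (\<integral>x. max 0 (D - (1 - \<eta>) * qE x) \<partial>lborel) = K D / sqrt (1 - \<eta>) ^ DIM('a)"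
      unfolding w0_def using \<eta> by (intro integral_qE D(1)) simp
    also have "(1 + \<eta>) * (K D / sqrt (1 - \<eta>) ^ DIM('a)) = (1 + \<eta>) / sqrt (1 - \<eta>) ^ DIM('a) * K D" by simp
    finally have up: "W D \<le> (1 + \<eta>) / sqrt (1 - \<eta>) ^ DIM('a) * K D" .
    have "(\<integral>x. (1 - \<eta>) * w0 * max 0 (D - (1 + \<eta>) * qE x) \<partial>lborel) \<le> W D"
      unfolding W_integral
    proof (rule integral_mono[OF _ iW])
      show "integrable lborel (\<lambda>x. (1 - \<eta>) * w0 * max 0 (D - (1 + \<eta>) * qE x))"
        using iE[of "1 + \<eta>"] \<eta> by (intro integrable_mult_right) auto
      fix x
      show "(1 - \<eta>) * w0 * max 0 (D - (1 + \<eta>) * qE x) \<le> indicator (B D) x * (model_weight p x * (D - q x))"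
      proof (cases "(1 + \<eta>) * qE x < D")
        case True
        have qE0: "0 \<le> qE x" using c(1) c(2)[of x] by (meson less_imp_le mult_nonneg_nonneg order_trans zero_le_power2)
        have "c * (norm (x - x0))\<^sup>2 \<le> qE x" using c(2) .
        also have "\<dots> \<le> (1 + \<eta>) * qE x" using qE0 \<eta> by (simp add: algebra_simps)
        also have "\<dots> < c * \<rho>\<^sup>2" using True D by (simp add: Dm_def)
        finally have "(norm (x - x0))\<^sup>2 < \<rho>\<^sup>2" using c by simp
        then have x: "x \<in> ball x0 \<rho>" using \<rho> by (simp add: dist_norm norm_minus_commute power2_less_imp_less)
        have xB: "x \<in> B D" using near(2,5)[OF x] True by (simp add: B_def)
        have "(1 - \<eta>) * w0 * (D - (1 + \<eta>) * qE x) \<le> model_weight p x * (D - q x)"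
          using near[OF x] True \<eta> w0 less_imp_le[OF model_weight_pos[OF ad, of x]] by (intro mult_mono) auto
        then show ?thesis using xB True by simp
      next
        case False
        then show ?thesis
          using less_imp_le[OF model_weight_pos[OF ad, of x]] by (cases "x \<in> B D") (auto dest: inB(3))
      qed
    qed
    moreover have "(\<integral>x. (1 - \<eta>) * w0 * max 0 (D - (1 + \<eta>) * qE x) \<partial>lborel) = (1 - \<eta>) / sqrt (1 + \<eta>) ^ DIM('a) * K D"
    proof -
      have "(\<integral>x. (1 - \<eta>) * w0 * max 0 (D - (1 + \<eta>) * qE x) \<partial>lborel) = (1 - \<eta>) * (w0 * (\<integral>x. max 0 (D - (1 + \<eta>) * qE x) \<partial>lborel))" by simp
      also have "w0 * (\<integral>x. max 0 (D - (1 + \<eta>) * qE x) \<partial>lborel) = K D / sqrt (1 + \<eta>) ^ DIM('a)"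
        unfolding w0_def using \<eta> by (intro integral_qE D(1)) simp
      finally show ?thesis by simp
    qed
    ultimately show ?thesis using up by simp
  qed
  show ?thesis unfolding eventually_at_right_field using Dm main by blast
qed

lemma K_pos: "D > 0 \<Longrightarrow> K D > 0" using \<omega>_pos n_ge_2 by (simp add: K_def)

text \<open>This is the initial condition for the differential inequality in
  \<open>ln_W_upper\<close>. It must be exact to leading order, since the comparison concerns the
  next one.\<close>

lemma W_asymptotic: "((\<lambda>D. W D / K D) \<longlongrightarrow> 1) (at_right 0)"
proof (rule order_tendstoI)
  have pos: "\<forall>\<^sub>F D in at_right (0::real). D > 0" by (simp add: eventually_at_filter)
  have small: "\<forall>\<^sub>F \<eta> in at_right (0::real). \<eta> \<in> {0<..<1}" by (rule eventually_at_right_real) simp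
  {
    fix a :: real assume "a < 1"
    have "((\<lambda>\<eta>. (1 - \<eta>) / sqrt (1 + \<eta>) ^ DIM('a)) \<longlongrightarrow> (1 - 0) / sqrt (1 + 0) ^ DIM('a)) (at_right 0)"
      by (intro tendsto_intros) auto
    then have "\<forall>\<^sub>F \<eta> in at_right 0. a < (1 - \<eta>) / sqrt (1 + \<eta>) ^ DIM('a)"
      using \<open>a < 1\<close> by (intro order_tendstoD(1)) auto
    then have "\<forall>\<^sub>F \<eta> in at_right 0. a < (1 - \<eta>) / sqrt (1 + \<eta>) ^ DIM('a) \<and> \<eta> \<in> {0<..<1}"
      using small by eventually_elim auto
    then obtain \<eta> where \<eta>: "a < (1 - \<eta>) / sqrt (1 + \<eta>) ^ DIM('a)" "0 < \<eta>" "\<eta> < 1"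
      using eventually_happens'[OF trivial_limit_at_right_real] by fastforce
    from W_sandwich[OF \<eta>(2,3)] pos show "\<forall>\<^sub>F D in at_right 0. a < W D / K D"
    proof eventually_elim
      case (elim D)
      then have "(1 - \<eta>) / sqrt (1 + \<eta>) ^ DIM('a) \<le> W D / K D" using K_pos[of D] by (simp add: pos_le_divide_eq)
      then show ?case using \<eta>(1) by simp
    qed
  }
  {
    fix a :: real assume "1 < a"
    have "((\<lambda>\<eta>. (1 + \<eta>) / sqrt (1 - \<eta>) ^ DIM('a)) \<longlongrightarrow> (1 + 0) / sqrt (1 - 0) ^ DIM('a)) (at_right 0)"
      by (intro tendsto_intros) auto
    then have "\<forall>\<^sub>F \<eta> in at_right 0. (1 + \<eta>) / sqrt (1 - \<eta>) ^ DIM('a) < a"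
      using \<open>1 < a\<close> by (intro order_tendstoD(2)) auto
    then have "\<forall>\<^sub>F \<eta> in at_right 0. (1 + \<eta>) / sqrt (1 - \<eta>) ^ DIM('a) < a \<and> \<eta> \<in> {0<..<1}"
      using small by eventually_elim auto
    then obtain \<eta> where \<eta>: "(1 + \<eta>) / sqrt (1 - \<eta>) ^ DIM('a) < a" "0 < \<eta>" "\<eta> < 1"
      using eventually_happens'[OF trivial_limit_at_right_real] by fastforce
    from W_sandwich[OF \<eta>(2,3)] pos show "\<forall>\<^sub>F D in at_right 0. W D / K D < a"
    proof eventually_elim
      case (elim D)
      then have "W D / K D \<le> (1 + \<eta>) / sqrt (1 - \<eta>) ^ DIM('a)" using K_pos[of D] by (simp add: pos_divide_le_eq)
      then show ?case using \<eta>(1) by simp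
    qed
  }
qed


section \<open>Growth of the torsion functional\<close>

lemma integrable_W: "D \<le> D0 \<Longrightarrow> integrable lborel (\<lambda>x. indicator (B D) x * (model_weight p x * (D - q x)))"
  using J_integrable[OF _ continuous_on_diff[OF continuous_on_const continuous_q]]
  by (simp add: set_integrable_def)

lemma integrable_m: "D \<le> D0 \<Longrightarrow> integrable lborel (\<lambda>x. indicator (B D) x * model_weight p x)"
  using J_integrable[of D "\<lambda>_. 1"] by (simp add: set_integrable_def)

lemma m_integral: "m D = (\<integral>x. indicator (B D) x * model_weight p x \<partial>lborel)"
  by (simp add: m_def J_def set_lebesgue_integral_def)

text \<open>The part of \<open>W' = m\<close> that can be read off pointwise: when the level rises
  from \<open>D'\<close> to \<open>D\<close>, the positive part of level minus \<open>q\<close>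
  grows by at most \<open>D - D'\<close>, and only on \<open>B D\<close>.\<close>

lemma W_increment:
  assumes "D' \<le> D" "D \<le> D0"
  shows "W D' \<le> W D" "W D - W D' \<le> m D * (D - D')" "m D' \<le> m D" "0 \<le> m D"
proof -
  have w: "0 \<le> model_weight p x" for x :: 'a using model_weight_pos[OF ad, of x] by simp
  have D': "D' \<le> D0" using assms by simp
  show "W D' \<le> W D" unfolding W_integral
    by (rule integral_mono[OF integrable_W[OF D'] integrable_W[OF assms(2)]])
      (use assms(1) w in \<open>auto simp: indicator_def B_def intro!: mult_left_mono mult_nonneg_nonneg\<close>)
  show "m D' \<le> m D" unfolding m_integral
    by (rule integral_mono[OF integrable_m[OF D'] integrable_m[OF assms(2)]])
      (use assms(1) w in \<open>auto simp: indicator_def B_def\<close>)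
  show "0 \<le> m D" unfolding m_integral by (intro integral_nonneg_AE AE_I2) (simp add: w)
  have "W D - W D' = (\<integral>x. indicator (B D) x * (model_weight p x * (D - q x)) - indicator (B D') x * (model_weight p x * (D' - q x)) \<partial>lborel)"
    unfolding W_integral by (simp add: integrable_W D' assms(2))
  also have "\<dots> \<le> (\<integral>x. (D - D') * (indicator (B D) x * model_weight p x) \<partial>lborel)"
  proof (rule integral_mono)
    show "integrable lborel (\<lambda>x. indicator (B D) x * (model_weight p x * (D - q x)) - indicator (B D') x * (model_weight p x * (D' - q x)))"
      by (simp add: integrable_W D' assms(2))
    show "integrable lborel (\<lambda>x. (D - D') * (indicator (B D) x * model_weight p x))"
      using integrable_m[OF assms(2)] by simp
    fix x :: 'a
    show "indicator (B D) x * (model_weight p x * (D - q x)) - indicator (B D') x * (model_weight p x * (D' - q x))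
      \<le> (D - D') * (indicator (B D) x * model_weight p x)"
    proof (cases "x \<in> B D")
      case True
      show ?thesis
      proof (cases "x \<in> B D'")
        case True then show ?thesis using \<open>x \<in> B D\<close> by (simp add: algebra_simps)
      next
        case False
        then have "D - q x \<le> D - D'" using \<open>x \<in> B D\<close> by (simp add: B_def)
        then have "model_weight p x * (D - q x) \<le> model_weight p x * (D - D')" using w by (rule mult_left_mono)
        then show ?thesis using False \<open>x \<in> B D\<close> by (simp add: mult.commute)
      qed
    next
      case False
      then have "x \<notin> B D'" using assms(1) by (auto simp: B_def)
      then show ?thesis using False by simp
    qed
  qed
  also have "\<dots> = m D * (D - D')" by (simp add: m_integral)
  finally show "W D - W D' \<le> m D * (D - D')" .
qed

lemma eventually_pos: "\<forall>\<^sub>F D in at_right (0::real). 0 < D" by (simp add: eventually_at_filter)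

lemma eventually_less: "a > 0 \<Longrightarrow> \<forall>\<^sub>F D in at_right (0::real). D < a"
  unfolding eventually_at_right_field by (intro exI[of _ a]) auto

lemma W_pos: assumes "0 < D" "D \<le> D0" shows "W D > 0"
proof -
  have "\<forall>\<^sub>F D in at_right 0. W D / K D > 0" using order_tendstoD(1)[OF W_asymptotic, of 0] by simp
  then have "\<forall>\<^sub>F D' in at_right 0. W D' > 0 \<and> D' < D" using eventually_pos eventually_less[OF assms(1)]
  proof eventually_elim
    case (elim D') then show ?case using K_pos[of D'] by (simp add: zero_less_divide_iff)
  qed
  then obtain D' where "W D' > 0" "D' < D" using eventually_happens'[OF trivial_limit_at_right_real] by blast
  then show ?thesis using W_increment(1)[of D' D] assms by simp
qed

lemma m_pos: assumes "0 < D" "D \<le> D0" shows "m D > 0"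
proof -
  have "W D \<le> D * m D"
  proof -
    have "W D \<le> (\<integral>x. D * (indicator (B D) x * model_weight p x) \<partial>lborel)" unfolding W_integral
    proof (rule integral_mono[OF integrable_W[OF assms(2)]])
      show "integrable lborel (\<lambda>x. D * (indicator (B D) x * model_weight p x))" using integrable_m[OF assms(2)] by simp
      fix x :: 'a
      have "model_weight p x * (D - q x) \<le> model_weight p x * D" if "x \<in> B D"
        using that N_props(4)[of x] model_weight_pos[OF ad, of x] by (intro mult_left_mono) (auto simp: B_def)
      then show "indicator (B D) x * (model_weight p x * (D - q x)) \<le> D * (indicator (B D) x * model_weight p x)"
        by (cases "x \<in> B D") (auto simp: mult.commute)
    qed
    then show ?thesis by (simp add: m_integral)
  qed
  then have "0 < D * m D" using W_pos[OF assms] by simp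
  then show ?thesis using assms by (simp add: zero_less_mult_iff)
qed

definition Lc :: real where "Lc = ln (2 / (n + 2)) + ln \<omega> + n / 2 * ln 2"

lemma ln_K: "D > 0 \<Longrightarrow> ln (K D) = Lc + (n + 2) / 2 * ln D"
proof -
  assume D: "D > 0"
  have n: "n > 0" using n_ge_2 by simp
  have "ln (K D) = ln (2 / (n + 2)) + ln D + ln \<omega> + ln (sqrt (2 * D) ^ DIM('a))"
  proof -
    have lm: "ln (c * D * \<omega> * s) = ln c + ln D + ln \<omega> + ln s" if "c > 0" "s > 0" for c s
      using that D \<omega>_pos by (simp add: ln_mult)
    show ?thesis unfolding K_def by (rule lm) (use D n in auto)
  qed
  also have "ln (sqrt (2 * D) ^ DIM('a)) = n * (ln (2 * D) / 2)"
    using D by (simp add: ln_realpow ln_sqrt n_def)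
  also have "ln (2 * D) = ln 2 + ln D" using D by (simp add: ln_mult)
  finally show ?thesis by (simp add: Lc_def field_simps)
qed

text \<open>The second estimate of \<open>sublevel_estimates\<close> says that the logarithmic
  derivative of \<open>W\<close> is at most \<open>h\<close>, which is the derivative of
  \<open>H\<close>. So \<open>ln (W D) - H D\<close> is nonincreasing, and its limit at 0 is
  \<open>Lc\<close> by \<open>W_asymptotic\<close>.\<close>

lemma ln_W_upper:
  assumes \<epsilon>: "\<epsilon> > 0"
  shows "\<forall>\<^sub>F D in at_right 0. ln (W D) \<le> ln (K D) - (\<kappa>2 * n / (n + 4) - \<epsilon>) * D / 2"
proof -
  define \<beta> where "\<beta> = \<kappa>2 * n / (n + 4) - \<epsilon>"
  have "\<forall>\<^sub>F D in at_right 0. 2 * (D * m D - W D) \<le> W D * (n - \<beta> * D)"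
    using sublevel_estimates[OF \<epsilon>] unfolding \<beta>_def by eventually_elim blast
  then obtain D2 where D2: "D2 > 0" "\<And>D. 0 < D \<Longrightarrow> D < D2 \<Longrightarrow> 2 * (D * m D - W D) \<le> W D * (n - \<beta> * D)"
    unfolding eventually_at_right_field by auto
  define D1 where "D1 = min D2 D0"
  define h where "h D = (n + 2) / (2 * D) - \<beta> / 2" for D
  define H where "H D = (n + 2) / 2 * ln D - \<beta> * D / 2" for D
  have mh: "m D \<le> W D * h D" if "0 < D" "D < D1" for D
    using D2(2)[of D] that by (simp add: D1_def h_def field_simps)
  have dH: "(H has_real_derivative h D) (at D)" if "D > 0" for D
    unfolding H_def[abs_def] h_def using that by (auto intro!: derivative_eq_intros simp: divide_simps)
  have Fmono: "ln (W b) - H b \<le> ln (W a) - H a" if ab: "0 < a" "a < b" "b < D1" for a b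
  proof (rule left_dini_nonincreasing[OF ab(2)])
    have bD0: "b \<le> D0" using ab by (simp add: D1_def)
    have Wp: "W x > 0" if "x \<in> {a..b}" for x using that ab bD0 W_pos[of x] by simp
    have lip: "\<bar>W x - W y\<bar> \<le> m D0 * \<bar>x - y\<bar>" if "x \<in> {a..b}" "y \<in> {a..b}" for x y
    proof -
      have *: "\<bar>W x - W y\<bar> \<le> m D0 * \<bar>x - y\<bar>" if "y \<le> x" "x \<le> b" for x y
      proof -
        have x: "x \<le> D0" using that bD0 by simp
        have "W x - W y \<le> m x * (x - y)" using W_increment(2)[OF that(1) x] .
        also have "\<dots> \<le> m D0 * (x - y)" using W_increment(3)[OF x, of] that by (intro mult_right_mono) auto
        finally show ?thesis using W_increment(1)[OF that(1) x] that by simp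
      qed
      show ?thesis using *[of x y] *[of y x] that by (cases "x \<le> y") (auto simp: abs_minus_commute)
    qed
    have cW: "continuous_on {a..b} W"
    proof (rule lipschitz_on_continuous_on)
      show "(m D0)-lipschitz_on {a..b} W"
        using lip W_increment(4)[of D0 D0] by (intro lipschitz_onI) (auto simp: dist_real_def)
    qed
    have cH: "continuous_on {a..b} H"
      by (intro continuous_at_imp_continuous_on ballI DERIV_isCont[OF dH]) (use ab in auto)
    show "continuous_on {a..b} (\<lambda>x. ln (W x) - H x)"
      by (intro continuous_intros cW cH) (use Wp in fastforce)
    fix x \<epsilon>' :: real assume x: "a < x" "x \<le> b" and \<epsilon>': "\<epsilon>' > 0"
    have x0: "x > 0" "x < D1" "x \<le> D0" using x ab bD0 by auto
    have inl: "\<forall>\<^sub>F y in at_left x. y \<in> {a<..<x}" using x(1) by (rule eventually_at_left_real)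
    have Wl: "(W \<longlongrightarrow> W x) (at_left x)"
    proof -
      have "(W \<longlongrightarrow> W x) (at x within {a..b})" using cW x by (auto simp: continuous_on_def)
      then have "(W \<longlongrightarrow> W x) (at x within {a..x})" by (rule tendsto_within_subset) (use x in auto)
      moreover have "at x within {a..x} = at_left x" using x(1) by (rule at_within_Icc_at_left)
      ultimately show ?thesis by simp
    qed
    have "((\<lambda>y. W x / W y * h x) \<longlongrightarrow> W x / W x * h x) (at_left x)"
      using Wp[of x] x by (intro tendsto_intros Wl) auto
    then have e1: "\<forall>\<^sub>F y in at_left x. W x / W y * h x < h x + \<epsilon>' / 2"
      using Wp[of x] x \<epsilon>' by (intro order_tendstoD(2)) auto
    have "((\<lambda>y. (H y - H x) / (y - x)) \<longlongrightarrow> h x) (at x)"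
      using dH[OF x0(1)] by (simp add: has_field_derivative_iff)
    then have "((\<lambda>y. (H y - H x) / (y - x)) \<longlongrightarrow> h x) (at_left x)"
      by (rule tendsto_mono[OF at_le, rotated]) simp
    then have e2: "\<forall>\<^sub>F y in at_left x. (H y - H x) / (y - x) > h x - \<epsilon>' / 2"
      using \<epsilon>' by (intro order_tendstoD(1)) auto
    from inl e1 e2 show "\<forall>\<^sub>F y in at_left x. ln (W x) - H x - (ln (W y) - H y) \<le> \<epsilon>' * (x - y)"
    proof eventually_elim
      case (elim y)
      have y: "a < y" "y < x" using elim by auto
      have Wy: "W y > 0" "W x > 0" using Wp[of y] Wp[of x] y x by auto
      have "ln (W x) - ln (W y) = ln (W x / W y)" using Wy by (simp add: ln_div)
      also have "\<dots> \<le> W x / W y - 1" using Wy by (intro ln_le_minus_one) simp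
      also have "\<dots> = (W x - W y) / W y" using Wy by (simp add: diff_divide_distrib)
      also have "\<dots> \<le> (m x * (x - y)) / W y" using W_increment(2)[of y x] y x0 Wy by (intro divide_right_mono) auto
      also have "\<dots> \<le> (W x * h x * (x - y)) / W y" using mh[OF x0(1,2)] y Wy by (intro divide_right_mono mult_right_mono) auto
      also have "\<dots> = (W x / W y * h x) * (x - y)" by simp
      also have "\<dots> \<le> (h x + \<epsilon>' / 2) * (x - y)" using elim y by (intro mult_right_mono) auto
      finally have 1: "ln (W x) - ln (W y) \<le> (h x + \<epsilon>' / 2) * (x - y)" .
      have "(H x - H y) = (H y - H x) / (y - x) * (x - y)" using y by (simp add: field_simps)
      also have "\<dots> \<ge> (h x - \<epsilon>' / 2) * (x - y)" using elim y by (intro mult_right_mono) auto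
      finally have 2: "H x - H y \<ge> (h x - \<epsilon>' / 2) * (x - y)" .
      have "(h x + \<epsilon>' / 2) * (x - y) - (h x - \<epsilon>' / 2) * (x - y) = \<epsilon>' * (x - y)" by (simp add: field_simps)
      then show ?case using 1 2 by linarith
    qed
  qed
  \<comment> \<open>Both \<open>ln (W a)\<close> and \<open>H a\<close> diverge at 0; the terms
    \<open>(n + 2) / 2 * ln a\<close> cancel against \<open>ln (K a)\<close>.\<close>
  have lim: "((\<lambda>a. ln (W a) - H a) \<longlongrightarrow> Lc) (at_right 0)"
  proof -
    have "((\<lambda>a. ln (W a / K a) + Lc + \<beta> * a / 2) \<longlongrightarrow> ln 1 + Lc + \<beta> * 0 / 2) (at_right 0)"
      by (intro tendsto_intros W_asymptotic) auto
    then have "((\<lambda>a. ln (W a / K a) + Lc + \<beta> * a / 2) \<longlongrightarrow> Lc) (at_right 0)" by simp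
    moreover have "\<forall>\<^sub>F a in at_right 0. ln (W a / K a) + Lc + \<beta> * a / 2 = ln (W a) - H a"
      using eventually_pos eventually_less[OF D0_pos]
    proof eventually_elim
      case (elim a)
      have "W a > 0" "K a > 0" using W_pos[of a] K_pos[of a] elim by auto
      then have "ln (W a / K a) = ln (W a) - ln (K a)" by (simp add: ln_div)
      then show ?case using ln_K[of a] elim by (simp add: H_def)
    qed
    ultimately show ?thesis by (rule Lim_transform_eventually)
  qed
  have D1: "D1 > 0" using D2 D0_pos by (simp add: D1_def)
  from eventually_pos eventually_less[OF D1] show ?thesis
  proof eventually_elim
    case (elim D)
    have "\<forall>\<^sub>F a in at_right 0. ln (W D) - H D \<le> ln (W a) - H a"
      using eventually_pos eventually_less[OF elim(1)] by eventually_elim (use Fmono elim in auto)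
    then have "ln (W D) - H D \<le> Lc" by (rule tendsto_lowerbound[OF lim]) simp
    then show ?case using ln_K[OF elim(1)] by (simp add: H_def \<beta>_def)
  qed
qed

section \<open>Testing the inequality with the sublevel function\<close>

lemma gnorm2_scaleR: "gnorm2 p x (s *\<^sub>R D) = s\<^sup>2 * gnorm2 p x D"
  by (simp add: gnorm2_def Let_def power_mult_distrib power_divide algebra_simps diff_divide_distrib)

text \<open>The positive part of \<open>D - q\<close> is not smooth, so the assumption is applied to
  its smoothed version. There the slope of the profile is at most 1 and the support stays in
  \<open>B D\<close>, so energy and volume are bounded by \<open>E D\<close> and \<open>m D\<close>
  for every \<open>k\<close>, while the integrals converge to \<open>W D\<close>.\<close>

lemma polya_szego_sublevel:
  assumes D: "0 < D" "D \<le> D0" and T: "T \<ge> 0"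
    and PS: "\<And>v :: 'a \<Rightarrow> real. test_fun v \<Longrightarrow> (\<And>x. v x \<ge> 0) \<Longrightarrow> energy p (egrad v) < \<infinity> \<Longrightarrow>
      emeasure (model_vol p) {x. v x \<noteq> 0} \<le> ennreal (m D) \<Longrightarrow>
      (\<integral>\<^sup>+x. ennreal (v x) \<partial>model_vol p)\<^sup>2 \<le> energy p (egrad v) * ennreal T"
  shows "(W D)\<^sup>2 \<le> E D * T"
proof -
  let ?w = "model_weight p :: 'a \<Rightarrow> real"
  define \<delta> where "\<delta> k = inverse (real (Suc k))" for k
  have \<delta>: "\<And>k. \<delta> k > 0" "\<delta> \<longlonglongrightarrow> 0"
    unfolding \<delta>_def using LIMSEQ_inverse_real_of_nat by auto
  define v where "v k x = (if x \<in> N then profile (\<delta> k) 1 (D - q x) * 1 else 0)" for k and x :: 'a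
  have w0: "0 \<le> ?w x" for x using model_weight_pos[OF ad, of x] by simp
  have xN: "x \<noteq> 0" if "x \<in> N" for x using that N_props(5) by auto
  have Bm: "B D \<in> sets lebesgue" using B_meas(1)[of D] by simp
  have GR0: "0 \<le> GR (norm x) (ang x)" for x :: 'a
  proof -
    have "0 \<le> ang x * (2 - ang x)" using ang_bounds[of x] by (intro mult_nonneg_nonneg) auto
    then have "0 \<le> 2 * ang x - (ang x)\<^sup>2" by (simp add: power2_eq_square algebra_simps)
    then show ?thesis unfolding GR_def by (intro add_nonneg_nonneg mult_nonneg_nonneg) auto
  qed
  have indm: "(\<lambda>x. indicator (B D) x * f x) \<in> borel_measurable borel" if "continuous_on N f" for f :: "'a \<Rightarrow> real"
  proof -
    have "continuous_on (B D) f" using that continuous_on_subset by (fastforce simp: B_def)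
    from borel_measurable_continuous_on_indicator[OF B_meas(1) this] show ?thesis by simp
  qed
  have nnJ: "(\<integral>\<^sup>+x. ennreal (indicator (B D) x * (?w x * f x)) \<partial>lborel) = ennreal (J D f)"
    if "continuous_on N f" "\<And>x. x \<in> B D \<Longrightarrow> f x \<ge> 0" for f
  proof -
    have "integrable lborel (\<lambda>x. indicator (B D) x * (?w x * f x))"
      using J_integrable[OF D(2) that(1)] by (simp add: set_integrable_def)
    then show ?thesis unfolding J_def set_lebesgue_integral_def
      by (subst nn_integral_eq_integral) (use that(2) w0 in \<open>auto simp: indicator_def\<close>)
  qed
  have main: "(\<integral>\<^sup>+x. ennreal (v k x) \<partial>model_vol p)\<^sup>2 \<le> ennreal (E D) * ennreal T" for k
  proof -
    have q2: "\<forall>x\<in>N. (q has_derivative q' x) (at x)" using q_has_derivative xN by blast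
    have P2: "\<forall>x\<in>N. ((\<lambda>_. 1::real) has_derivative (\<lambda>_. 0)) (at x)" by simp
    note cut = sublevel_cutoff[OF N_props(6) smooth_within_q[OF N_props(6,5)] smooth_within_const[OF N_props(6)]
        compact_sublevel[OF D(2)] \<delta>(1)[of k] q2 P2, where j = 1, folded v_def]
    have vz: "v k x = 0" if "x \<notin> B D" for x
      using that profile_nonpos(1)[of "D - q x"] by (auto simp: v_def B_def)
    have sub: "{x. v k x \<noteq> 0} \<subseteq> {x \<in> N. q x \<le> D}" using vz by (force simp: B_def)
    have tv: "test_fun (v k)"
      unfolding test_fun_def using cut(1) bounded_subset[OF compact_imp_bounded[OF compact_sublevel[OF D(2)]] sub]
      by (simp add: compact_closure v_def[abs_def])
    have v0: "v k x \<ge> 0" for x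
      using profile_bounds(1)[OF \<delta>(1)[of k], of "D - q x" 1] profile_nonpos(1)[of "D - q x" "\<delta> k" 1]
      by (cases "D - q x > 0") (auto simp: v_def)
    have gn: "gnorm2 p x (egrad (v k) x) \<le> indicator (B D) x * GR (norm x) (ang x)" for x
    proof (cases "x \<in> B D")
      case True
      then have x: "x \<in> N" "D - q x > 0" by (auto simp: B_def)
      have dq: "q differentiable at x" using q2 x(1) differentiable_def by blast
      have fq: "frechet_derivative q (at x) = q' x" using frechet_derivative_at[OF bspec[OF q2 x(1)]] by simp
      have dv: "(v k has_derivative (\<lambda>h. - profile' (\<delta> k) 1 (D - q x) * q' x h)) (at x)"
        using cut(3)[of x] True by (simp add: v_def[abs_def] B_def)
      have ev: "egrad (v k) x = (- profile' (\<delta> k) 1 (D - q x)) *\<^sub>R egrad q x"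
      proof (rule vector_eq_rdot[THEN iffD1, rule_format])
        fix h
        have "egrad (v k) x \<bullet> h = - profile' (\<delta> k) 1 (D - q x) * q' x h"
          using egrad_inner[of "v k" x h] dv frechet_derivative_at[OF dv] differentiable_def by metis
        also have "\<dots> = ((- profile' (\<delta> k) 1 (D - q x)) *\<^sub>R egrad q x) \<bullet> h"
          using egrad_inner[OF dq, of h] fq by simp
        finally show "egrad (v k) x \<bullet> h = ((- profile' (\<delta> k) 1 (D - q x)) *\<^sub>R egrad q x) \<bullet> h" .
      qed
      have "gnorm2 p x (egrad q x) = GR (norm x) (ang x)"
        by (rule gnorm2_q[OF xN[OF x(1)]]) (simp add: egrad_inner[OF dq] fq)
      then have "gnorm2 p x (egrad (v k) x) = (profile' (\<delta> k) 1 (D - q x))\<^sup>2 * GR (norm x) (ang x)"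
        unfolding ev gnorm2_scaleR by simp
      also have "\<dots> \<le> 1 * GR (norm x) (ang x)"
      proof (rule mult_right_mono[OF _ GR0])
        show "(profile' (\<delta> k) 1 (D - q x))\<^sup>2 \<le> 1"
          using profile_bounds(3,4)[OF \<delta>(1)[of k] x(2), of 1] by (simp add: power_le_one)
      qed
      finally show ?thesis using True by simp
    next
      case False
      have "(v k has_derivative (\<lambda>h. 0)) (at x)"
        using cut(3)[of x] False by (simp add: v_def[abs_def] B_def)
      then have "egrad (v k) x \<bullet> h = 0" for h
        using egrad_inner[of "v k" x h] frechet_derivative_at differentiable_def by metis
      then have "egrad (v k) x = 0" by (metis inner_eq_zero_iff)
      then show ?thesis using False by (simp add: gnorm2_def Let_def)
    qed
    have En: "energy p (egrad (v k)) \<le> ennreal (E D)"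
    proof -
      have "energy p (egrad (v k)) \<le> (\<integral>\<^sup>+x. ennreal (indicator (B D) x * GR (norm x) (ang x)) \<partial>model_vol p)"
        unfolding energy_def by (intro nn_integral_mono ennreal_leI gn)
      also have "\<dots> = (\<integral>\<^sup>+x. ennreal (?w x) * ennreal (indicator (B D) x * GR (norm x) (ang x)) \<partial>lebesgue)"
        by (rule nn_integral_model_vol[OF ad]) (intro measurable_compose[OF _ measurable_ennreal] borel_lebesgue_measurable indm continuous_GR)
      also have "\<dots> = (\<integral>\<^sup>+x. ennreal (indicator (B D) x * (?w x * GR (norm x) (ang x))) \<partial>lborel)"
        unfolding nn_integral_completion by (intro nn_integral_cong) (auto simp: indicator_def ennreal_mult' w0)
      also have "\<dots> = ennreal (E D)" unfolding E_def by (rule nnJ[OF continuous_GR GR0])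
      finally show ?thesis .
    qed
    have vol: "emeasure (model_vol p) {x. v k x \<noteq> 0} \<le> ennreal (m D)"
    proof -
      have "{x. v k x \<noteq> 0} \<subseteq> B D" using vz by blast
      then have "emeasure (model_vol p) {x. v k x \<noteq> 0} \<le> emeasure (model_vol p) (B D)" using Bm by (intro emeasure_mono) auto
      also have "\<dots> = (\<integral>\<^sup>+x. ennreal (?w x) * indicator (B D) x \<partial>lebesgue)"
        unfolding model_vol_def using model_weight_measurable(3)[OF ad] Bm by (intro emeasure_density) auto
      also have "\<dots> = (\<integral>\<^sup>+x. ennreal (indicator (B D) x * (?w x * 1)) \<partial>lborel)"
        unfolding nn_integral_completion by (intro nn_integral_cong) (auto simp: indicator_def)
      also have "\<dots> = ennreal (m D)" unfolding m_def by (rule nnJ) auto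
      finally show ?thesis .
    qed
    have "(\<integral>\<^sup>+x. ennreal (v k x) \<partial>model_vol p)\<^sup>2 \<le> energy p (egrad (v k)) * ennreal T"
      using PS[OF tv v0 _ vol] En by (metis ennreal_less_top infinity_ennreal_def order_le_less_trans)
    also have "\<dots> \<le> ennreal (E D) * ennreal T" using En by (rule mult_right_mono) simp
    finally show ?thesis .
  qed
  have lim: "(\<lambda>k. \<integral>\<^sup>+x. ennreal (v k x) \<partial>model_vol p) \<longlonglongrightarrow> ennreal (W D)"
  proof -
    define f where "f k x = indicator (B D) x * (?w x * profile (\<delta> k) 1 (D - q x))" for k x
    have cp: "continuous_on N (\<lambda>x. profile (\<delta> k) 1 (D - q x))" for k
    proof -
      have "continuous_on UNIV (profile (\<delta> k) 1)" using smooth_within_continuous_on[OF smooth_within_profile[OF \<delta>(1)]] .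
      then show ?thesis by (rule continuous_on_compose2) (auto intro!: continuous_on_diff continuous_q)
    qed
    have cw: "continuous_on N ?w" using continuous_model_weight[OF ad] continuous_on_subset by blast
    have vf: "(\<integral>\<^sup>+x. ennreal (v k x) \<partial>model_vol p) = (\<integral>\<^sup>+x. ennreal (f k x) \<partial>lborel)" for k
    proof -
      have vi: "v k = (\<lambda>x. indicator (B D) x * profile (\<delta> k) 1 (D - q x))"
        using profile_nonpos(1) by (auto simp: fun_eq_iff v_def B_def indicator_def)
      have "(\<integral>\<^sup>+x. ennreal (v k x) \<partial>model_vol p) = (\<integral>\<^sup>+x. ennreal (?w x) * ennreal (v k x) \<partial>lebesgue)"
        unfolding vi by (rule nn_integral_model_vol[OF ad]) (intro measurable_compose[OF _ measurable_ennreal] borel_lebesgue_measurable indm cp)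
      also have "\<dots> = (\<integral>\<^sup>+x. ennreal (f k x) \<partial>lborel)"
        unfolding nn_integral_completion vi f_def by (intro nn_integral_cong) (auto simp: indicator_def ennreal_mult' w0)
      finally show ?thesis .
    qed
    have "(\<lambda>k. \<integral>\<^sup>+x. ennreal (f k x) \<partial>lborel) \<longlonglongrightarrow> (\<integral>\<^sup>+x. ennreal (indicator (B D) x * (?w x * (D - q x))) \<partial>lborel)"
    proof (rule nn_integral_dominated_convergence[where w = "\<lambda>x. ennreal (indicator (B D) x * (?w x * (D - q x)))"])
      show "(\<lambda>x. ennreal (f k x)) \<in> borel_measurable lborel" for k
        using indm[OF continuous_on_mult[OF cw cp], of k] unfolding f_def by measurable
      show "(\<lambda>x. ennreal (indicator (B D) x * (?w x * (D - q x)))) \<in> borel_measurable lborel"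
        using indm[OF continuous_on_mult[OF cw continuous_on_diff[OF continuous_on_const continuous_q]], of D] by measurable
      then show "(\<lambda>x. ennreal (indicator (B D) x * (?w x * (D - q x)))) \<in> borel_measurable lborel" .
      show "(\<integral>\<^sup>+x. ennreal (indicator (B D) x * (?w x * (D - q x))) \<partial>lborel) < \<infinity>"
        by (subst nnJ) (auto intro!: continuous_on_diff continuous_q simp: B_def)
      show "AE x in lborel. ennreal (f k x) \<le> ennreal (indicator (B D) x * (?w x * (D - q x)))" for k
      proof (intro AE_I2 ennreal_leI)
        fix x :: 'a
        show "f k x \<le> indicator (B D) x * (?w x * (D - q x))"
        proof (cases "x \<in> B D")
          case True
          then have "D - q x > 0" by (simp add: B_def)
          from profile_bounds(2)[OF \<delta>(1)[of k] this, of 1] show ?thesis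
            using True w0[of x] by (simp add: f_def mult_left_mono)
        qed (simp add: f_def)
      qed
      show "AE x in lborel. (\<lambda>k. ennreal (f k x)) \<longlonglongrightarrow> ennreal (indicator (B D) x * (?w x * (D - q x)))"
      proof (intro AE_I2 tendsto_ennrealI)
        fix x :: 'a
        show "(\<lambda>k. f k x) \<longlonglongrightarrow> indicator (B D) x * (?w x * (D - q x))"
        proof (cases "x \<in> B D")
          case True
          then have "D - q x > 0" by (simp add: B_def)
          from profile_tendsto(1)[OF \<delta> this, of 1] show ?thesis
            unfolding f_def by (intro tendsto_intros) simp
        qed (simp add: f_def)
      qed
    qed
    also have "(\<integral>\<^sup>+x. ennreal (indicator (B D) x * (?w x * (D - q x))) \<partial>lborel) = ennreal (W D)"
      unfolding W_def by (rule nnJ) (auto intro!: continuous_on_diff continuous_q simp: B_def)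
    finally show ?thesis by (simp add: vf)
  qed
  have "(\<lambda>k. (\<integral>\<^sup>+x. ennreal (v k x) \<partial>model_vol p) * (\<integral>\<^sup>+x. ennreal (v k x) \<partial>model_vol p)) \<longlonglongrightarrow> ennreal (W D) * ennreal (W D)"
    by (rule tendsto_mult_ennreal[OF lim lim]) auto
  then have "ennreal (W D) * ennreal (W D) \<le> ennreal (E D) * ennreal T"
    by (rule LIMSEQ_le_const2) (use main in \<open>auto simp: power2_eq_square\<close>)
  moreover have "W D > 0" using W_pos[OF D] .
  moreover have "E D \<ge> 0"
  proof -
    have "J D (\<lambda>x. 0) \<le> E D" unfolding E_def by (intro J_mono D(2) continuous_GR continuous_on_const GR0)
    then show ?thesis by (simp add: J_def)
  qed
  ultimately show ?thesis using T by (simp add: ennreal_mult[symmetric] power2_eq_square)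
qed

end

section \<open>Comparison\<close>

lemma ln_one_plus_bounds:
  fixes z :: real assumes "\<bar>z\<bar> \<le> 1/2"
  shows "z - 2 * z\<^sup>2 \<le> ln (1 + z)" "ln (1 + z) \<le> z"
proof -
  show "z - 2 * z\<^sup>2 \<le> ln (1 + z)"
  proof (cases "z \<ge> 0")
    case True
    then have "z - z\<^sup>2 \<le> ln (1 + z)" using assms by (intro ln_one_plus_pos_lower_bound) auto
    moreover have "0 \<le> z\<^sup>2" by simp
    ultimately show ?thesis by linarith
  next
    case False
    then have "- (- z) - 2 * (- z)\<^sup>2 \<le> ln (1 - (- z))" using assms by (intro ln_one_minus_pos_lower_bound) auto
    then show ?thesis by simp
  qed
  show "ln (1 + z) \<le> z" using assms by (intro ln_add_one_self_le_self2) auto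
qed

context off_pole
begin

text \<open>The bound on \<open>2 * (D * m D - W D)\<close> makes \<open>m D\<close> at most a
  multiple of \<open>W D / D\<close>, and \<open>W\<close> is comparable to \<open>K\<close>, which
  carries a factor \<open>D\<close> in front of a power of \<open>sqrt D\<close>.\<close>

lemma m_tendsto_0: "(m \<longlongrightarrow> 0) (at_right 0)"
proof (rule tendsto_sandwich[OF _ _ tendsto_const])
  have n: "n \<ge> 2" using n_ge_2 .
  define \<beta> where "\<beta> = \<kappa>2 * n / (n + 4) - 1"
  have "\<forall>\<^sub>F D in at_right 0. W D / K D < 2" using order_tendstoD(2)[OF W_asymptotic, of 2] by simp
  moreover have "\<forall>\<^sub>F D in at_right (0::real). D < 1 / (\<bar>\<beta>\<bar> + 1)" by (rule eventually_less) simp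
  ultimately show "\<forall>\<^sub>F D in at_right 0. m D \<le> 2 * (n + 3) * (2 / (n + 2) * \<omega> * sqrt (2 * D) ^ DIM('a))"
    using sublevel_estimates[OF zero_less_one] eventually_pos eventually_less[OF D0_pos]
  proof eventually_elim
    case (elim D)
    have W: "W D > 0" "W D \<le> 2 * K D" using W_pos[of D] K_pos[of D] elim by (auto simp: divide_less_eq)
    have "\<bar>\<beta>\<bar> * D \<le> 1" using elim by (simp add: field_simps)
    then have "- (\<beta> * D) \<le> 1" using elim by (metis abs_ge_minus_self abs_mult abs_of_pos order_trans)
    then have "n - \<beta> * D \<le> n + 1" by simp
    then have "W D * (n - \<beta> * D) \<le> W D * (n + 1)" using W by (intro mult_left_mono) auto
    then have "2 * (D * m D) \<le> W D * (n + 3)" using elim by (simp add: \<beta>_def algebra_simps)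
    moreover have "0 < W D * (n + 3)" using W n by simp
    ultimately have "D * m D \<le> W D * (n + 3)" by linarith
    also have "\<dots> \<le> 2 * K D * (n + 3)" using W n by (intro mult_right_mono) auto
    also have "\<dots> = D * (2 * (n + 3) * (2 / (n + 2) * \<omega> * sqrt (2 * D) ^ DIM('a)))" by (simp add: K_def)
    finally have "D * m D \<le> D * (2 * (n + 3) * (2 / (n + 2) * \<omega> * sqrt (2 * D) ^ DIM('a)))" .
    then show ?case by (rule mult_left_le_imp_le) (use elim in simp)
  qed
  show "\<forall>\<^sub>F D in at_right 0. 0 \<le> m D" using eventually_pos eventually_less[OF D0_pos]
    by eventually_elim (use m_pos less_imp_le in auto)
  have "((\<lambda>D. 2 * (n + 3) * (2 / (n + 2) * \<omega> * sqrt (2 * D) ^ DIM('a))) \<longlongrightarrow> 2 * (n + 3) * (2 / (n + 2) * \<omega> * sqrt (2 * 0) ^ DIM('a))) (at_right 0)"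
    by (intro tendsto_intros)
  then show "((\<lambda>D. 2 * (n + 3) * (2 / (n + 2) * \<omega> * sqrt (2 * D) ^ DIM('a))) \<longlongrightarrow> 0) (at_right 0)" by (simp add: zero_power)
qed

text \<open>The logarithm of \<open>W^2 \<le> E * T\<close> contains \<open>ln R\<close>, which the
  ball volume trades for \<open>ln (m D)\<close>, then for \<open>ln (W D)\<close>, then for
  \<open>ln (K D)\<close>. The leading terms cancel and, up to multiples of \<open>\<eta>\<close>,
  \<open>(\<beta>1 + 2 * \<beta>2) * D \<le> n * (\<tau> - b) * R\<^sup>2\<close> remains;
  \<open>\<beta>2\<close> counts twice because it enters both through \<open>m\<close> and through
  \<open>W\<close>. Since \<open>n * (\<tau> - b)\<close> is \<open>S0 / (n + 4)\<close> and
  \<open>R\<^sup>2\<close> is \<open>2 * D\<close> in the same sense, the curvature at the point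
  would be at most \<open>S0\<close>.\<close>

lemma not_polya_szego:
  assumes S0: "(scal DIM('a) p \<longlongrightarrow> S0) (at_right 0)" and S: "scal DIM('a) p r0 > S0"
  shows "\<not> polya_szego p TYPE('a)"
proof
  assume PS: "polya_szego p TYPE('a)"
  have n: "n \<ge> 2" using n_ge_2 .
  define b where "b = (real DIM('a) - 1) * deriv (deriv (deriv p)) 0 / 6"
  have S0b: "S0 = - 6 * n * b" using scal_limit[OF ad S0] by (simp add: b_def n_def)
  define \<Delta> where "\<Delta> = scal DIM('a) p r0 - S0"
  have \<Delta>: "\<Delta> > 0" using S by (simp add: \<Delta>_def)
  \<comment> \<open>The three summands are the coefficients of \<open>\<eta> * D\<close> in the
    final inequalities \<open>f1\<close>, \<open>f2\<close> and \<open>f3\<close>.\<close>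
  define C where "C = 3 * (n + 4) + 12 * \<bar>S0\<bar> + 36 * n * (n + 4)"
  have C: "C > 0" using n by (simp add: C_def add_pos_nonneg)
  define \<eta> where "\<eta> = min (1/3) (\<Delta> / C)"
  have \<eta>: "\<eta> > 0" "\<eta> \<le> 1/3" "C * \<eta> \<le> \<Delta>" using \<Delta> C by (auto simp: \<eta>_def min_def field_simps)
  define \<beta>1 \<beta>2 where "\<beta>1 = \<kappa>1 * n / (n + 4)" and "\<beta>2 = \<kappa>2 * n / (n + 4)"
  have \<beta>: "(n + 4) * (\<beta>1 + 2 * \<beta>2) = 2 * scal DIM('a) p r0"
  proof -
    have "(n + 4) * \<beta>1 = \<kappa>1 * n" "(n + 4) * \<beta>2 = \<kappa>2 * n" using n by (simp_all add: \<beta>1_def \<beta>2_def)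
    then have "(n + 4) * (\<beta>1 + 2 * \<beta>2) = n * (\<kappa>1 + 2 * \<kappa>2)" by (simp add: algebra_simps)
    then show ?thesis using \<kappa>_sum by simp
  qed
  obtain \<rho> where \<rho>: "\<rho> > 0"
    and V1: "\<And>R. 0 < R \<Longrightarrow> R < \<rho> \<Longrightarrow> ball_vol p TYPE('a) R \<ge> \<omega> * R ^ DIM('a) * (1 + (b - \<eta>) * n / (n + 2) * R\<^sup>2)"
    and V2: "\<And>R. 0 < R \<Longrightarrow> R < \<rho> \<Longrightarrow> ball_vol p TYPE('a) R \<le> \<omega> * R ^ DIM('a) * (1 + (b + \<eta>) * n / (n + 2) * R\<^sup>2)"
    and PS1: "\<And>R (v :: 'a \<Rightarrow> real). 0 < R \<Longrightarrow> R < \<rho> \<Longrightarrow> test_fun v \<Longrightarrow> (\<And>x. v x \<ge> 0) \<Longrightarrow> energy p (egrad v) < \<infinity> \<Longrightarrow>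
      emeasure (model_vol p) {x. v x \<noteq> 0} \<le> ennreal (ball_vol p TYPE('a) R) \<Longrightarrow>
      (\<integral>\<^sup>+x. ennreal (v x) \<partial>model_vol p)\<^sup>2 \<le> energy p (egrad v) *
        ennreal (\<omega> / n * R ^ (DIM('a) + 2) * (1 / (n + 2) + (b * (n - 2) / (n + 2) + 4 * \<eta>) / (n + 4) * R\<^sup>2))"
    using polya_szego_small_balls[OF ad PS \<eta>(1)] unfolding b_def n_def \<omega>_def by blast
  \<comment> \<open>The coefficient of \<open>R\<^sup>2\<close> in the torsion bound relative to its
    flat value.\<close>
  define \<tau> where "\<tau> = (n + 2) * ((b * (n - 2) / (n + 2) + 4 * \<eta>) / (n + 4))"
  have T_eq: "\<omega> / n * R ^ (DIM('a) + 2) * (1 / (n + 2) + (b * (n - 2) / (n + 2) + 4 * \<eta>) / (n + 4) * R\<^sup>2)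
      = \<omega> / (n * (n + 2)) * R ^ (DIM('a) + 2) * (1 + \<tau> * R\<^sup>2)" for R
  proof -
    have "1 / (n + 2) + (b * (n - 2) / (n + 2) + 4 * \<eta>) / (n + 4) * R\<^sup>2 = (1 + \<tau> * R\<^sup>2) / (n + 2)"
      using n by (simp add: \<tau>_def add_divide_distrib)
    then show ?thesis by simp
  qed
  define Cb where "Cb = \<bar>b\<bar> + \<bar>\<tau>\<bar> + 3"
  have Cb: "Cb \<ge> 3" by (simp add: Cb_def)
  \<comment> \<open>Up to this radius \<open>2 * Cb\<^sup>2 * R\<^sup>2 \<le> \<eta>\<close>, so
    every relative correction is below 1/2 and the squares of the corrections are below
    \<open>\<eta> * R\<^sup>2\<close>.\<close>
  define R1 where "R1 = min (\<rho> / 2) (sqrt (\<eta> / (2 * Cb\<^sup>2)))"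
  have R1: "R1 > 0" "R1 < \<rho>" using \<rho> \<eta> Cb by (auto simp: R1_def)
  have R1sq: "2 * Cb\<^sup>2 * R\<^sup>2 \<le> \<eta>" if "0 \<le> R" "R \<le> R1" for R
  proof -
    have "R\<^sup>2 \<le> (sqrt (\<eta> / (2 * Cb\<^sup>2)))\<^sup>2" using that by (intro power_mono) (auto simp: R1_def)
    also have "\<dots> = \<eta> / (2 * Cb\<^sup>2)" using \<eta> by simp
    finally show ?thesis using Cb by (simp add: field_simps)
  qed
  let ?V = "ball_vol p TYPE('a)"
  have zb: "\<bar>c * x\<^sup>2\<bar> \<le> Cb * x\<^sup>2" if "\<bar>c\<bar> \<le> Cb" for c x using that by (simp add: abs_mult mult_right_mono)
  have VR1: "?V R1 > 0"
  proof -
    have "\<bar>(b - \<eta>) * n / (n + 2)\<bar> \<le> Cb"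
    proof -
      have "\<bar>(b - \<eta>) * n / (n + 2)\<bar> = \<bar>b - \<eta>\<bar> * (n / (n + 2))" using n by (simp add: abs_mult)
      also have "\<dots> \<le> \<bar>b - \<eta>\<bar> * 1" using n by (intro mult_left_mono) auto
      also have "\<dots> \<le> Cb" using \<eta> by (simp add: Cb_def)
      finally show ?thesis .
    qed
    then have "\<bar>(b - \<eta>) * n / (n + 2) * R1\<^sup>2\<bar> \<le> Cb * R1\<^sup>2" by (rule zb)
    also have "\<dots> \<le> Cb\<^sup>2 * R1\<^sup>2" using Cb by (intro mult_right_mono) (auto simp: power2_eq_square)
    also have "\<dots> < 1" using R1sq[of R1] R1 \<eta> by simp
    finally have "1 + (b - \<eta>) * n / (n + 2) * R1\<^sup>2 > 0" by linarith
    then have "0 < \<omega> * R1 ^ DIM('a) * (1 + (b - \<eta>) * n / (n + 2) * R1\<^sup>2)" using \<omega>_pos R1 by simp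
    then show ?thesis using V1[OF R1] by linarith
  qed
  have ln1: "\<forall>\<^sub>F D in at_right 0. \<bar>ln (W D / K D)\<bar> < \<eta>"
  proof -
    have "((\<lambda>D. ln (W D / K D)) \<longlongrightarrow> ln 1) (at_right 0)" by (intro tendsto_intros W_asymptotic) simp
    from tendstoD[OF this \<eta>(1)] show ?thesis by (simp add: dist_real_def)
  qed
  have "\<eta> / (\<bar>\<beta>1\<bar> + \<bar>\<beta>2\<bar> + 1) > 0" using \<eta>(1) by (simp add: add_nonneg_pos)
  note ev = eventually_less[OF this]
  have "\<forall>\<^sub>F D in at_right 0. 0 < D \<and> D < D0 \<and> D < \<eta> / (\<bar>\<beta>1\<bar> + \<bar>\<beta>2\<bar> + 1) \<and> \<bar>ln (W D / K D)\<bar> < \<eta> \<and> m D < ?V R1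
      \<and> E D \<le> W D * (n - (\<beta>1 - \<eta>) * D) \<and> 2 * (D * m D - W D) \<le> W D * (n - (\<beta>2 - \<eta>) * D) \<and> 2 * (D * m D - W D) \<ge> W D * (n - \<eta>)
      \<and> ln (W D) \<le> ln (K D) - (\<beta>2 - \<eta>) * D / 2"
    using eventually_pos eventually_less[OF D0_pos] ev ln1
      order_tendstoD(2)[OF m_tendsto_0 VR1] sublevel_estimates[OF \<eta>(1)] ln_W_upper[OF \<eta>(1)]
    unfolding \<beta>1_def \<beta>2_def by eventually_elim auto
  then obtain D where D: "0 < D" "D < D0" "D < \<eta> / (\<bar>\<beta>1\<bar> + \<bar>\<beta>2\<bar> + 1)" and lnWK: "\<bar>ln (W D / K D)\<bar> < \<eta>" and mV: "m D < ?V R1"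
    and e1: "E D \<le> W D * (n - (\<beta>1 - \<eta>) * D)" and e2: "2 * (D * m D - W D) \<le> W D * (n - (\<beta>2 - \<eta>) * D)"
    and e3: "2 * (D * m D - W D) \<ge> W D * (n - \<eta>)" and e4: "ln (W D) \<le> ln (K D) - (\<beta>2 - \<eta>) * D / 2"
    using eventually_happens'[OF trivial_limit_at_right_real] by blast
  have W: "W D > 0" using W_pos D by simp
  have m: "m D > 0" using m_pos D by simp
  have V0: "?V 0 = 0" by (simp add: ball_vol_def)
  \<comment> \<open>The ball about the pole with exactly the volume \<open>m D\<close>, available by
    the intermediate value theorem since \<open>m D\<close> lies between the volumes for radius 0
    and \<open>R1\<close>.\<close>
  have "\<exists>R. 0 \<le> R \<and> R \<le> R1 \<and> ?V R = m D"
    using mV m R1(1) V0 continuous_on_subset[OF ball_vol_continuous[OF ad, where 'a='a]] by (intro IVT') auto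
  then obtain R where R: "0 \<le> R" "R \<le> R1" "?V R = m D" by blast
  have R0: "R > 0" using R V0 m by (cases "R = 0") auto
  have R\<rho>: "R < \<rho>" using R R1 by simp
  have sm: "2 * Cb\<^sup>2 * R\<^sup>2 \<le> \<eta>" using R1sq[OF R(1,2)] .
  have sm1: "Cb * R\<^sup>2 \<le> \<eta> / 2"
  proof -
    have "Cb * R\<^sup>2 \<le> Cb\<^sup>2 * R\<^sup>2" using Cb by (intro mult_right_mono) (auto simp: power2_eq_square)
    then show ?thesis using sm by simp
  qed
  have frac: "\<bar>c * n / (n + 2)\<bar> \<le> \<bar>c\<bar>" for c
  proof -
    have "\<bar>c * n / (n + 2)\<bar> = \<bar>c\<bar> * (n / (n + 2))" using n by (simp add: abs_mult)
    also have "\<dots> \<le> \<bar>c\<bar> * 1" using n by (intro mult_left_mono) auto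
    finally show ?thesis by simp
  qed
  have cm: "\<bar>(b - \<eta>) * n / (n + 2)\<bar> \<le> Cb" "\<bar>(b + \<eta>) * n / (n + 2)\<bar> \<le> Cb" "\<bar>(b - 2 * \<eta>) * n / (n + 2)\<bar> \<le> Cb" "\<bar>\<tau>\<bar> \<le> Cb"
  proof -
    have "\<bar>b - \<eta>\<bar> \<le> Cb" "\<bar>b + \<eta>\<bar> \<le> Cb" "\<bar>b - 2 * \<eta>\<bar> \<le> Cb" using \<eta> unfolding Cb_def by linarith+
    then show "\<bar>(b - \<eta>) * n / (n + 2)\<bar> \<le> Cb" "\<bar>(b + \<eta>) * n / (n + 2)\<bar> \<le> Cb" "\<bar>(b - 2 * \<eta>) * n / (n + 2)\<bar> \<le> Cb"
      using order_trans[OF frac] by blast+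
    show "\<bar>\<tau>\<bar> \<le> Cb" by (simp add: Cb_def)
  qed
  define T where "T = \<omega> / (n * (n + 2)) * R ^ (DIM('a) + 2) * (1 + \<tau> * R\<^sup>2)"
  have t1: "\<bar>\<tau> * R\<^sup>2\<bar> \<le> 1/2" using zb[OF cm(4), of R] sm1 \<eta> by linarith
  have T0: "T > 0" unfolding T_def using \<omega>_pos n R0 t1 by (intro mult_pos_pos divide_pos_pos) (auto simp: abs_le_iff)
  have PSW: "(W D)\<^sup>2 \<le> E D * T"
  proof (rule polya_szego_sublevel[OF D(1) less_imp_le[OF D(2)] less_imp_le[OF T0]])
    fix v :: "'a \<Rightarrow> real"
    assume "test_fun v" "\<And>x. v x \<ge> 0" "energy p (egrad v) < \<infinity>" "emeasure (model_vol p) {x. v x \<noteq> 0} \<le> ennreal (m D)"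
    from PS1[OF R0 R\<rho> this[folded R(3)]] show "(\<integral>\<^sup>+x. ennreal (v x) \<partial>model_vol p)\<^sup>2 \<le> energy p (egrad v) * ennreal T"
      unfolding T_eq T_def .
  qed
  have "0 < E D * T" using PSW W by (meson less_le_trans zero_less_power)
  then have E0: "E D > 0" using T0 by (simp add: zero_less_mult_iff)
  \<comment> \<open>With all logarithms named, eliminating the unknowns becomes linear
    arithmetic.\<close>
  define lw where "lw = ln (W D)"
  define lR where "lR = ln R"
  define lD where "lD = ln D"
  define lm where "lm = ln (m D)"
  define lo where "lo = ln \<omega>"
  define l2 where "l2 = ln (2::real)"
  define ln2 where "ln2 = ln (n + 2)"
  have a1: "2 * lw \<le> ln (E D) + ln T"
  proof -
    have "ln ((W D)\<^sup>2) \<le> ln (E D * T)" using PSW W E0 T0 by simp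
    then show ?thesis using W E0 T0 by (simp add: ln_realpow ln_mult lw_def)
  qed
  have Dsmall: "D * (\<bar>\<beta>1\<bar> + \<bar>\<beta>2\<bar> + 1) \<le> \<eta>" using D(3) by (simp add: field_simps)
  have dsm: "\<bar>c - \<eta>\<bar> * D \<le> \<eta>" if "\<bar>c\<bar> \<le> \<bar>\<beta>1\<bar> + \<bar>\<beta>2\<bar>" for c
  proof -
    have "\<bar>c - \<eta>\<bar> * D \<le> (\<bar>\<beta>1\<bar> + \<bar>\<beta>2\<bar> + 1) * D" using that \<eta> D by (intro mult_right_mono) auto
    then show ?thesis using Dsmall by (simp add: mult.commute)
  qed
  have a2: "ln (E D) \<le> lw + ln n - (\<beta>1 - \<eta>) * D / n"
  proof -
    define y where "y = (\<beta>1 - \<eta>) * D / n"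
    have "\<bar>y\<bar> \<le> 1/2"
    proof -
      have "\<bar>y\<bar> = \<bar>\<beta>1 - \<eta>\<bar> * D / n" using n D by (simp add: y_def abs_mult)
      also have "\<dots> \<le> \<eta> / n" using dsm[of \<beta>1] n by (intro divide_right_mono) auto
      also have "\<dots> \<le> 1/2" using n \<eta> by (simp add: divide_le_eq)
      finally show ?thesis .
    qed
    then have l: "ln (1 + (- y)) \<le> - y" "1 + (- y) > 0" using ln_one_plus_bounds(2)[of "- y"] by auto
    have "n - (\<beta>1 - \<eta>) * D = n * (1 + (- y))" using n by (simp add: y_def field_simps)
    then have "E D \<le> W D * (n * (1 + (- y)))" using e1 by simp
    then have "ln (E D) \<le> ln (W D * (n * (1 + (- y))))" using E0 W n l by (subst ln_le_cancel_iff) auto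
    also have "\<dots> = lw + ln n + ln (1 + (- y))" using W n l by (simp add: ln_mult lw_def)
    finally show ?thesis using l(1) by (simp add: y_def)
  qed
  have a3: "lm \<le> lw - lD + ln2 - l2 - (\<beta>2 - \<eta>) * D / (n + 2)"
  proof -
    define y where "y = (\<beta>2 - \<eta>) * D / (n + 2)"
    have "\<bar>y\<bar> \<le> 1/2"
    proof -
      have "\<bar>y\<bar> = \<bar>\<beta>2 - \<eta>\<bar> * D / (n + 2)" using n D by (simp add: y_def abs_mult)
      also have "\<dots> \<le> \<eta> / (n + 2)" using dsm[of \<beta>2] n by (intro divide_right_mono) auto
      also have "\<dots> \<le> 1/2" using n \<eta> by (simp add: divide_le_eq)
      finally show ?thesis .
    qed
    then have l: "ln (1 + (- y)) \<le> - y" "1 + (- y) > 0" using ln_one_plus_bounds(2)[of "- y"] by auto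
    have "(\<beta>2 - \<eta>) * D = (n + 2) * y" using n by (simp add: y_def)
    then have "2 * (D * m D) \<le> W D * ((n + 2) * (1 + (- y)))" using e2 by (simp add: algebra_simps)
    then have "ln (2 * (D * m D)) \<le> ln (W D * ((n + 2) * (1 + (- y))))" using D m W n l by (subst ln_le_cancel_iff) auto
    moreover have "ln (2 * (D * m D)) = l2 + lD + lm" using D m by (simp add: ln_mult l2_def lD_def lm_def)
    moreover have "ln (W D * ((n + 2) * (1 + (- y)))) = lw + ln2 + ln (1 + (- y))" using W n l by (simp add: ln_mult lw_def ln2_def)
    ultimately show ?thesis using l(1) by (simp add: y_def)
  qed
  have a3': "lm \<le> lw - lD + ln2 - l2 + \<eta>"
  proof -
    have "- ((\<beta>2 - \<eta>) * D / (n + 2)) \<le> \<bar>\<beta>2 - \<eta>\<bar> * D / (n + 2)"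
      using divide_right_mono[OF mult_right_mono[of "- (\<beta>2 - \<eta>)" "\<bar>\<beta>2 - \<eta>\<bar>" D], of "n + 2"] n D by (simp del: minus_diff_eq)
    also have "\<dots> \<le> \<eta> / (n + 2)" using dsm[of \<beta>2] n by (intro divide_right_mono) auto
    also have "\<dots> \<le> \<eta>" using n \<eta> by (simp add: divide_le_eq)
    finally show ?thesis using a3 by linarith
  qed
  have a4: "lm \<ge> lw - lD + ln2 - l2 - \<eta>"
  proof -
    define y where "y = \<eta> / (n + 2)"
    have y: "0 \<le> y" "y \<le> \<eta> / 4" using n \<eta> divide_left_mono[of 4 "n + 2" \<eta>] by (simp_all add: y_def)
    have y2: "\<bar>- y\<bar> \<le> 1/2" using y \<eta> by simp
    have "y\<^sup>2 \<le> y * 1" unfolding power2_eq_square using y \<eta> by (intro mult_left_mono) auto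
    then have l: "- \<eta> \<le> ln (1 + (- y))" using ln_one_plus_bounds(1)[OF y2] y \<eta> by simp
    have l0: "1 + (- y) > 0" using y2 by auto
    have "\<eta> = (n + 2) * y" using n by (simp add: y_def)
    then have "W D * ((n + 2) * (1 + (- y))) \<le> 2 * (D * m D)" using e3 by (simp add: algebra_simps)
    then have "ln (W D * ((n + 2) * (1 + (- y)))) \<le> ln (2 * (D * m D))" using D m W n l0 by (subst ln_le_cancel_iff) auto
    moreover have "ln (2 * (D * m D)) = l2 + lD + lm" using D m by (simp add: ln_mult l2_def lD_def lm_def)
    moreover have "ln (W D * ((n + 2) * (1 + (- y)))) = lw + ln2 + ln (1 + (- y))" using W n l0 by (simp add: ln_mult lw_def ln2_def)
    ultimately show ?thesis using l by linarith
  qed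
  have lnV: "ln (\<omega> * R ^ DIM('a) * (1 + z)) = lo + n * lR + ln (1 + z)" if "\<bar>z\<bar> \<le> 1/2" for z
  proof -
    have "1 + z > 0" using that by auto
    then show ?thesis using \<omega>_pos R0 by (simp add: ln_mult ln_realpow lo_def lR_def n_def)
  qed
  have a5: "lm \<ge> lo + n * lR + (b - 2 * \<eta>) * n / (n + 2) * R\<^sup>2"
  proof -
    define z where "z = (b - \<eta>) * n / (n + 2) * R\<^sup>2"
    have zC: "\<bar>z\<bar> \<le> Cb * R\<^sup>2" unfolding z_def by (rule zb[OF cm(1)])
    have z2: "\<bar>z\<bar> \<le> 1/2" using zC sm1 \<eta> by linarith
    \<comment> \<open>The loss in the lower bound for \<open>ln (1 + z)\<close> has to be a small
      multiple of \<open>R\<^sup>2\<close>, not merely small, since it competes with curvature terms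
      of that size.\<close>
    have zz: "2 * z\<^sup>2 \<le> \<eta> * (n / (n + 2)) * R\<^sup>2"
    proof -
      have "\<bar>z\<bar> = (n / (n + 2)) * (\<bar>b - \<eta>\<bar> * R\<^sup>2)" using n by (simp add: z_def abs_mult)
      also have "\<dots> \<le> (n / (n + 2)) * (Cb * R\<^sup>2)" using n \<eta> by (intro mult_left_mono mult_right_mono) (auto simp: Cb_def)
      finally have z1: "\<bar>z\<bar> \<le> (n / (n + 2)) * (Cb * R\<^sup>2)" .
      have "z\<^sup>2 = \<bar>z\<bar> * \<bar>z\<bar>" by (simp add: power2_eq_square)
      also have "\<dots> \<le> ((n / (n + 2)) * (Cb * R\<^sup>2)) * (Cb * R\<^sup>2)" using z1 zC n Cb by (intro mult_mono) auto
      finally have "2 * z\<^sup>2 \<le> 2 * (((n / (n + 2)) * (Cb * R\<^sup>2)) * (Cb * R\<^sup>2))" by (rule mult_left_mono) simp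
      also have "\<dots> = (n / (n + 2)) * R\<^sup>2 * (2 * Cb\<^sup>2 * R\<^sup>2)" by (simp only: power2_eq_square mult_ac)
      also have "\<dots> \<le> (n / (n + 2)) * R\<^sup>2 * \<eta>" using sm n by (intro mult_left_mono) auto
      finally show ?thesis by (simp add: mult_ac)
    qed
    have "ln (\<omega> * R ^ DIM('a) * (1 + z)) \<le> lm"
    proof -
      have "1 + z > 0" using z2 by auto
      then have "0 < \<omega> * R ^ DIM('a) * (1 + z)" using \<omega>_pos R0 by simp
      then show ?thesis unfolding lm_def using V1[OF R0 R\<rho>] m by (subst ln_le_cancel_iff) (auto simp: R(3) z_def)
    qed
    then have "lo + n * lR + ln (1 + z) \<le> lm" by (simp only: lnV[OF z2])
    moreover have "z - 2 * z\<^sup>2 \<le> ln (1 + z)" using ln_one_plus_bounds(1)[OF z2] .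
    moreover have "z - \<eta> * (n / (n + 2)) * R\<^sup>2 = (b - 2 * \<eta>) * n / (n + 2) * R\<^sup>2"
      by (simp add: z_def algebra_simps diff_divide_distrib)
    ultimately show ?thesis using zz by linarith
  qed
  have a6: "lm \<le> lo + n * lR + \<eta>"
  proof -
    define z where "z = (b + \<eta>) * n / (n + 2) * R\<^sup>2"
    have zC: "\<bar>z\<bar> \<le> Cb * R\<^sup>2" unfolding z_def by (rule zb[OF cm(2)])
    have z2: "\<bar>z\<bar> \<le> 1/2" using zC sm1 \<eta> by linarith
    have "lm \<le> ln (\<omega> * R ^ DIM('a) * (1 + z))"
    proof -
      have "m D \<le> \<omega> * R ^ DIM('a) * (1 + z)" using V2[OF R0 R\<rho>] by (simp add: R(3) z_def)
      then show ?thesis unfolding lm_def using m by (subst ln_le_cancel_iff) auto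
    qed
    then have "lm \<le> lo + n * lR + ln (1 + z)" by (simp only: lnV[OF z2])
    then show ?thesis using ln_one_plus_bounds(2)[OF z2] zC sm1 \<eta> by linarith
  qed
  have a5': "lm \<ge> lo + n * lR - \<eta>" using a5 zb[OF cm(3), of R] sm1 \<eta> by linarith
  have lK: "ln (K D) = l2 - ln2 + lo + n / 2 * l2 + (n + 2) / 2 * lD"
    using ln_K[OF D(1)] n by (simp add: Lc_def ln_div l2_def ln2_def lo_def lD_def)
  have a7: "\<bar>lw - ln (K D)\<bar> < \<eta>" using lnWK W K_pos[OF D(1)] by (simp add: ln_div lw_def)
  have a8: "lw \<le> ln (K D) - (\<beta>2 - \<eta>) * D / 2" using e4 by (simp add: lw_def)
  have a9: "ln T \<le> lo - ln n - ln2 + (n + 2) * lR + \<tau> * R\<^sup>2"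
  proof -
    have t0: "1 + \<tau> * R\<^sup>2 > 0" using t1 by (auto simp: abs_le_iff)
    have c0: "\<omega> / (n * (n + 2)) > 0" "R ^ (DIM('a) + 2) > 0" using \<omega>_pos n R0 by auto
    have "ln T = ln (\<omega> / (n * (n + 2))) + ln (R ^ (DIM('a) + 2)) + ln (1 + \<tau> * R\<^sup>2)"
    proof -
      have "ln (x * y * z) = ln x + ln y + ln z" if "x > 0" "y > 0" "z > 0" for x y z :: real
        using that by (simp add: ln_mult)
      from this[OF c0 t0] show ?thesis unfolding T_def .
    qed
    also have "ln (\<omega> / (n * (n + 2))) = lo - ln n - ln2" using \<omega>_pos n by (simp add: ln_div ln_mult lo_def ln2_def)
    also have "ln (R ^ (DIM('a) + 2)) = (n + 2) * lR" using ln_realpow[of R "DIM('a) + 2"] by (simp only: lR_def n_def of_nat_add of_nat_numeral)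
    finally show ?thesis using ln_one_plus_bounds(2)[OF t1] by simp
  qed
  \<comment> \<open>Leading order only: \<open>a3'\<close> and \<open>a4\<close> tie
    \<open>m\<close> to \<open>W / D\<close>, \<open>a5'\<close> and \<open>a6\<close> tie it to
    \<open>R ^ DIM('a)\<close>, and \<open>a7\<close> ties \<open>W\<close> to \<open>K\<close>,
    each with error \<open>\<eta>\<close>. Together they force \<open>R\<^sup>2\<close> to be
    \<open>2 * D\<close> up to a factor close to 1.\<close>
  have ratio: "\<bar>2 * lR - (l2 + lD)\<bar> \<le> 3 * \<eta>"
  proof -
    have "\<bar>n * lR - n / 2 * (l2 + lD)\<bar> \<le> 3 * \<eta>"
    proof -
      have k: "ln (K D) - lD + ln2 - l2 = lo + n / 2 * (l2 + lD)" unfolding lK by (simp add: field_simps)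
      show ?thesis using a3' a4 a5' a6 a7 k by linarith
    qed
    moreover have "n * lR - n / 2 * (l2 + lD) = n / 2 * (2 * lR - (l2 + lD))" by (simp add: algebra_simps)
    ultimately have u: "n / 2 * \<bar>2 * lR - (l2 + lD)\<bar> \<le> 3 * \<eta>" using n by (simp add: abs_mult)
    have "1 * \<bar>2 * lR - (l2 + lD)\<bar> \<le> n / 2 * \<bar>2 * lR - (l2 + lD)\<bar>" using n by (intro mult_right_mono) auto
    from order_trans[OF this u] show ?thesis by (simp only: mult_1)
  qed
  have Rsq: "R\<^sup>2 = 2 * D * exp (2 * lR - (l2 + lD))"
  proof -
    have "exp (2 * lR - (l2 + lD)) = exp (2 * lR) / exp (l2 + lD)" by (rule exp_diff)
    also have "exp (2 * lR) = R\<^sup>2" using R0 by (simp add: lR_def exp_double)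
    also have "exp (l2 + lD) = 2 * D" using D by (simp add: exp_add l2_def lD_def)
    finally show ?thesis using D by simp
  qed
  have R2: "R\<^sup>2 \<le> 2 * D * (1 + 6 * \<eta>)" "R\<^sup>2 \<ge> 2 * D * (1 - 6 * \<eta>)"
  proof -
    have "exp (2 * lR - (l2 + lD)) \<le> exp (3 * \<eta>)" using ratio by simp
    also have "\<dots> \<le> 1 + 3 * \<eta> + (3 * \<eta>)\<^sup>2" using \<eta> by (intro exp_bound) auto
    also have "(3 * \<eta>)\<^sup>2 \<le> 3 * \<eta>" using \<eta> by (simp add: power2_eq_square)
    finally have "exp (2 * lR - (l2 + lD)) \<le> 1 + 6 * \<eta>" by simp
    then show "R\<^sup>2 \<le> 2 * D * (1 + 6 * \<eta>)" unfolding Rsq using D by (intro mult_left_mono) auto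
    have "1 + (2 * lR - (l2 + lD)) \<le> exp (2 * lR - (l2 + lD))" by (rule exp_ge_add_one_self)
    then have "1 - 6 * \<eta> \<le> exp (2 * lR - (l2 + lD))" using ratio \<eta> by linarith
    then show "R\<^sup>2 \<ge> 2 * D * (1 - 6 * \<eta>)" unfolding Rsq using D by (intro mult_left_mono) auto
  qed
  \<comment> \<open>The elimination: \<open>k1\<close> is the torsion inequality multiplied by
    \<open>n\<close>, \<open>k2\<close> replaces \<open>lR\<close> by \<open>lm\<close>,
    \<open>k3\<close> replaces \<open>lm\<close> by \<open>lw\<close>, and the surplus
    \<open>2 * lw\<close> is bounded by \<open>k4\<close>.\<close>
  have key: "0 \<le> - (\<beta>1 - \<eta>) * D - 2 * ((\<beta>2 - \<eta>) * D) + (n * \<tau> - (b - 2 * \<eta>) * n) * R\<^sup>2"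
  proof -
    have "lw \<le> - ((\<beta>1 - \<eta>) * D / n) + lo - ln2 + (n + 2) * lR + \<tau> * R\<^sup>2" using a1 a2 a9 by linarith
    then have "n * lw \<le> n * (- ((\<beta>1 - \<eta>) * D / n) + lo - ln2 + (n + 2) * lR + \<tau> * R\<^sup>2)" using n by (intro mult_left_mono) auto
    also have "\<dots> = - ((\<beta>1 - \<eta>) * D) + n * lo - n * ln2 + (n + 2) * (n * lR) + n * \<tau> * R\<^sup>2"
    proof -
      have "n * (- y + lo - ln2 + (n + 2) * lR + \<tau> * R\<^sup>2) = - (n * y) + n * lo - n * ln2 + (n + 2) * (n * lR) + n * \<tau> * R\<^sup>2" for y
        by (simp add: algebra_simps)
      moreover have "n * ((\<beta>1 - \<eta>) * D / n) = (\<beta>1 - \<eta>) * D" using n by simp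
      ultimately show ?thesis by (simp only:)
    qed
    finally have k1: "n * lw \<le> - ((\<beta>1 - \<eta>) * D) + n * lo - n * ln2 + (n + 2) * (n * lR) + n * \<tau> * R\<^sup>2" .
    have "n * lR \<le> lm - lo - (b - 2 * \<eta>) * n / (n + 2) * R\<^sup>2" using a5 by linarith
    then have "(n + 2) * (n * lR) \<le> (n + 2) * (lm - lo - (b - 2 * \<eta>) * n / (n + 2) * R\<^sup>2)" using n by (intro mult_left_mono) auto
    also have "\<dots> = (n + 2) * lm - (n + 2) * lo - (b - 2 * \<eta>) * n * R\<^sup>2"
    proof -
      have "(n + 2) * ((b - 2 * \<eta>) * n / (n + 2) * R\<^sup>2) = (b - 2 * \<eta>) * n * R\<^sup>2" using n by simp
      then show ?thesis by (simp only: right_diff_distrib)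
    qed
    finally have k2: "(n + 2) * (n * lR) \<le> (n + 2) * lm - (n + 2) * lo - (b - 2 * \<eta>) * n * R\<^sup>2" .
    have "(n + 2) * lm \<le> (n + 2) * (lw - lD + ln2 - l2 - (\<beta>2 - \<eta>) * D / (n + 2))" using a3 n by (intro mult_left_mono) auto
    also have "\<dots> = (n + 2) * (lw - lD + ln2 - l2) - (\<beta>2 - \<eta>) * D"
    proof -
      have "(n + 2) * ((\<beta>2 - \<eta>) * D / (n + 2)) = (\<beta>2 - \<eta>) * D" using n by simp
      then show ?thesis by (simp only: right_diff_distrib)
    qed
    finally have k3: "(n + 2) * lm \<le> (n + 2) * (lw - lD + ln2 - l2) - (\<beta>2 - \<eta>) * D" .
    have k4: "2 * lw \<le> 2 * l2 - 2 * ln2 + 2 * lo + n * l2 + (n + 2) * lD - (\<beta>2 - \<eta>) * D"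
    proof -
      have "2 * (l2 - ln2 + lo + n / 2 * l2 + (n + 2) / 2 * lD) = 2 * l2 - 2 * ln2 + 2 * lo + n * l2 + (n + 2) * lD"
        by (simp add: field_simps)
      then show ?thesis using a8 unfolding lK by linarith
    qed
    have "n * lw \<le> - ((\<beta>1 - \<eta>) * D) + n * lo - n * ln2 + ((n + 2) * (lw - lD + ln2 - l2) - (\<beta>2 - \<eta>) * D) - (n + 2) * lo - (b - 2 * \<eta>) * n * R\<^sup>2 + n * \<tau> * R\<^sup>2"
      using k1 k2 k3 by linarith
    also have "\<dots> = n * lw + (2 * lw - (2 * l2 - 2 * ln2 + 2 * lo + n * l2 + (n + 2) * lD)) - (\<beta>1 - \<eta>) * D - (\<beta>2 - \<eta>) * D + (n * \<tau> - (b - 2 * \<eta>) * n) * R\<^sup>2"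
      by (simp add: algebra_simps)
    finally show ?thesis using k4 by linarith
  qed
  \<comment> \<open>Without \<open>\<eta>\<close> the coefficient is
    \<open>n * b * ((n - 2) / (n + 4) - 1) = - 6 * n * b / (n + 4)\<close>, and
    \<open>- 6 * n * b\<close> is the curvature at the pole.\<close>
  have fin: "(n * \<tau> - (b - 2 * \<eta>) * n) * R\<^sup>2 \<le> (S0 / (n + 4) + 6 * n * \<eta>) * R\<^sup>2"
  proof (rule mult_right_mono)
    have tau: "\<tau> = (b * (n - 2) + 4 * \<eta> * (n + 2)) / (n + 4)"
    proof -
      have "(n + 2) * (y + 4 * \<eta>) = (n + 2) * y + 4 * \<eta> * (n + 2)" for y by (simp add: algebra_simps)
      moreover have "(n + 2) * (b * (n - 2) / (n + 2)) = b * (n - 2)" using n by simp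
      ultimately show ?thesis unfolding \<tau>_def times_divide_eq_right by (simp only: times_divide_eq_right)
    qed
    have "(n + 4) * (n * \<tau> - (b - 2 * \<eta>) * n) = n * (b * (n - 2) + 4 * \<eta> * (n + 2)) - (n + 4) * ((b - 2 * \<eta>) * n)"
      unfolding tau using n by (simp add: right_diff_distrib)
    also have "\<dots> = S0 + n * \<eta> * (4 * (n + 2) + 2 * (n + 4))" unfolding S0b by (simp add: algebra_simps)
    also have "\<dots> \<le> S0 + n * \<eta> * (6 * (n + 4))" using n \<eta> by (intro add_left_mono mult_left_mono) auto
    also have "\<dots> = (n + 4) * (S0 / (n + 4) + 6 * n * \<eta>)"
    proof -
      have "(n + 4) * (y + 6 * n * \<eta>) = (n + 4) * y + n * \<eta> * (6 * (n + 4))" for y by (simp add: algebra_simps)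
      moreover have "(n + 4) * (S0 / (n + 4)) = S0" using n by simp
      ultimately show ?thesis by (simp only:)
    qed
    finally show "n * \<tau> - (b - 2 * \<eta>) * n \<le> S0 / (n + 4) + 6 * n * \<eta>" using n by simp
  qed simp
  have "(\<beta>1 + 2 * \<beta>2) * D - 3 * \<eta> * D \<le> (S0 / (n + 4) + 6 * n * \<eta>) * R\<^sup>2" using key fin by (simp add: algebra_simps)
  then have "(n + 4) * ((\<beta>1 + 2 * \<beta>2) * D - 3 * \<eta> * D) \<le> (n + 4) * ((S0 / (n + 4) + 6 * n * \<eta>) * R\<^sup>2)"
    using n by (intro mult_left_mono) auto
  also have "(n + 4) * ((S0 / (n + 4) + 6 * n * \<eta>) * R\<^sup>2) = S0 * R\<^sup>2 + 6 * n * (n + 4) * \<eta> * R\<^sup>2" using n by (simp add: field_simps)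
  also have "(n + 4) * ((\<beta>1 + 2 * \<beta>2) * D - 3 * \<eta> * D) = 2 * scal DIM('a) p r0 * D - 3 * (n + 4) * \<eta> * D"
    unfolding \<beta>[symmetric] by (simp add: algebra_simps)
  finally have f1: "2 * scal DIM('a) p r0 * D - 3 * (n + 4) * \<eta> * D \<le> S0 * R\<^sup>2 + 6 * n * (n + 4) * \<eta> * R\<^sup>2" .
  have f2: "S0 * R\<^sup>2 \<le> 2 * S0 * D + 12 * \<bar>S0\<bar> * \<eta> * D"
  proof -
    have "\<bar>R\<^sup>2 - 2 * D\<bar> \<le> 12 * \<eta> * D" using R2 by (simp add: algebra_simps abs_le_iff)
    then have "\<bar>S0\<bar> * \<bar>R\<^sup>2 - 2 * D\<bar> \<le> \<bar>S0\<bar> * (12 * \<eta> * D)" by (intro mult_left_mono) auto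
    moreover have "S0 * (R\<^sup>2 - 2 * D) \<le> \<bar>S0\<bar> * \<bar>R\<^sup>2 - 2 * D\<bar>" by (metis abs_ge_self abs_mult)
    ultimately show ?thesis by (simp add: algebra_simps)
  qed
  have f3: "6 * n * (n + 4) * \<eta> * R\<^sup>2 \<le> 36 * n * (n + 4) * \<eta> * D"
  proof -
    have "2 * D * (1 + 6 * \<eta>) \<le> 2 * D * 3" using \<eta> D by (intro mult_left_mono) auto
    then have "R\<^sup>2 \<le> 6 * D" using R2(1) by simp
    from mult_left_mono[OF this, of "6 * n * (n + 4) * \<eta>"] show ?thesis using n \<eta> by (simp add: mult_ac)
  qed
  have "2 * \<Delta> * D \<le> C * \<eta> * D" using f1 f2 f3 by (simp add: C_def \<Delta>_def algebra_simps)
  then have "2 * \<Delta> \<le> C * \<eta>" using D by simp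
  then show False using \<eta>(3) \<Delta> by simp
qed

end

theorem mainTheorem5:
  fixes \<psi> :: "real \<Rightarrow> real" and S0 r0 :: real
  assumes "admissible_warp \<psi>"
    and "(scal DIM('a::euclidean_space) \<psi> \<longlongrightarrow> S0) (at_right 0)"
    and "r0 > 0"
    and "scal DIM('a) \<psi> r0 > S0"
  shows "\<not> polya_szego \<psi> TYPE('a)"
proof (cases "DIM('a) \<ge> 2")
  case True
  obtain e :: 'a where "e \<in> Basis" using nonempty_Basis by blast
  then interpret off_pole \<psi> r0 e using assms(1,3) True by unfold_locales
  show ?thesis by (rule not_polya_szego[OF assms(2,4)])
next
  case False
  \<comment> \<open>In dimension one the factor \<open>n - 1\<close> makes the scalar curvature
    vanish identically, so the assumed strict inequality is impossible.\<close>
  then have "DIM('a) = 1" using DIM_positive[where 'a='a] by linarith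
  then have "scal DIM('a) \<psi> = (\<lambda>_. 0)" by (simp add: scal_def fun_eq_iff)
  moreover from this have "S0 = 0" using assms(2) by (simp add: tendsto_const_iff)
  ultimately show ?thesis using assms(4) by simp
qed

end
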